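(* (Type $D(m,N-m)$.) Assume $N\ge3$ and $2\le m\le N-1$. Let $\chi$ be a bi-homomorphism on $\Pi$, write $q_{ij}=\chi(\alpha_i,\alpha_j)$, and let $\hat q\in\mathbb{K}^\times_\infty$ be such that $\hat q^2=q_{NN}$. Assume: $q_{ii}=\hat q^{-2}$ for $1\le i<N-m$; $q_{N-m,N-m}=-1$; $q_{ii}=\hat q^2$ for $N-m<i\le N$; for $1\le i\le N-2$, $q_{i,i+1}q_{i+1,i}=\hat q^{2}$ if $i+1\le N-m$ and $q_{i,i+1}q_{i+1,i}=\hat q^{-2}$ if $i+1>N-m$; $q_{N-2,N}q_{N,N-2}=\hat q^{-2}$; $q_{N-1,N}q_{N,N-1}=1$; and $q_{ij}q_{ji}=1$ for all other pairs $i\ne j$. Let $\Lambda\in\mathrm{Ch}(U^0(\chi))$, $\lambda_i:=\Lambda(K_{\alpha_i}L_{-\alpha_i})$, and $$\tilde g(\Lambda):=\Big(\prod_{i=N-m}^{N-2}\lambda_i\Big)^2\lambda_{N-1}\lambda_N.$$ Then $\dim\mathcal{L}_\chi(\Lambda)<\infty$ if and only if the following four conditions all hold: (i) for every $i\in I\setminus\{N-m\}$ there is an integer $r_i\ge0$ with $\lambda_i=q_{ii}^{r_i}$; (ii) $\tilde g(\Lambda)=\hat q^{-4x}$ for some $x\in\mathbb{Z}_{\ge0}$; (iii) if $\tilde g(\Lambda)=\hat q^{-4y}$ for some integer $y$ with $0\le y\le m-2$, then $\prod_{i=N-m}^{N-m+y}\lambda_i=\hat q^{-2y}$ and $\lambda_j=1$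 for all $j$ with $N-m+y+1\le j\le N$; (iv) if $\tilde g(\Lambda)=\hat q^{-4(m-1)}$, then $\prod_{i=N-m}^{N-1}\lambda_i=\hat q^{-2(m-1)}$.
   Context: $\mathbb{K}$ is a field of characteristic $0$, $\mathbb{K}^\times=\mathbb{K}\setminus\{0\}$, and $\mathbb{K}^\times_\infty$ is the set of elements of $\mathbb{K}^\times$ that are not roots of unity. $N\ge1$ is an integer, $I=\{1,\dots,N\}$, $\Pi=\{\alpha_i\mid i\in I\}$, $\mathbb{Z}\Pi=\bigoplus_{i\in I}\mathbb{Z}\alpha_i$ (free $\mathbb{Z}$-module), $\mathbb{Z}_{\ge0}\Pi=\bigoplus_{i\in I}\mathbb{Z}_{\ge0}\alpha_i$. A bi-homomorphism on $\Pi$ is a map $\chi:\mathbb{Z}\Pi\times\mathbb{Z}\Pi\to\mathbb{K}^\times$ with $\chi(\alpha,\beta+\gamma)=\chi(\alpha,\beta)\chi(\alpha,\gamma)$ and $\chi(\alpha+\beta,\gamma)=\chi(\alpha,\gamma)\chi(\beta,\gamma)$. Generalized quantum group $U(\chi)$: $\tilde U=\tilde U(\chi)$ is the unital associative $\mathbb{K}$-algebra with generators $\tilde K_\alpha,\tilde L_\alpha$ ($\alpha\in\mathbb{Z}\Pi$), $\tilde E_i,\tilde F_i$ ($i\in I$) and relations $\tilde K_0=\tilde L_0=1$, $\tilde K_\alpha\tilde K_\beta=\tilde K_{\alpha+\beta}$, $\tilde L_\alpha\tilde L_\beta=\tilde L_{\alpha+\beta}$, $\tilde K_\alpha\tilde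 L_\beta=\tilde L_\beta\tilde K_\alpha$, $\tilde K_\alpha\tilde E_i=\chi(\alpha,\alpha_i)\tilde E_i\tilde K_\alpha$, $\tilde L_\alpha\tilde E_i=\chi(-\alpha_i,\alpha)\tilde E_i\tilde L_\alpha$, $\tilde K_\alpha\tilde F_i=\chi(\alpha,-\alpha_i)\tilde F_i\tilde K_\alpha$, $\tilde L_\alpha\tilde F_i=\chi(\alpha_i,\alpha)\tilde F_i\tilde L_\alpha$, $\tilde E_i\tilde F_j-\tilde F_j\tilde E_i=\delta_{ij}(-\tilde K_{\alpha_i}+\tilde L_{\alpha_i})$. It is $\mathbb{Z}\Pi$-graded with $\tilde K_\alpha,\tilde L_\alpha$ in degree $0$, $\tilde E_i$ in degree $\alpha_i$, $\tilde F_i$ in degree $-\alpha_i$. $\tilde U^0,\tilde U^+,\tilde U^-$ are the unital subalgebras generated by the $\tilde K_\alpha,\tilde L_\alpha$, by the $\tilde E_i$, and by the $\tilde F_i$. Define subspaces $\tilde{\mathcal I}^-_{-\alpha}\subseteq\tilde U^-_{-\alpha}$ ($\alpha\in\mathbb{Z}_{\ge0}\Pi$) inductively: $\tilde{\mathcal I}^-_0=0$ and, for $\alpha\ne0$, $\tilde{\mathcal I}^-_{-\alpha}$ is the set of $Y\in\tilde U^-_{-\alpha}$ with $[\tilde E_i,Y]\in\tilde{\mathcal I}^-_{-\alpha+\alpha_i}\tilde K_{\alpha_i}+\tilde{\mathcal I}^-_{-\alpha+\alpha_i}\tilde L_{\alpha_i}$ for all $i$ with $\alpha-\alpha_i\in\mathbb{Z}_{\ge0}\Pi$.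 Put $\tilde{\mathcal I}^-=\bigoplus_\alpha\tilde{\mathcal I}^-_{-\alpha}$ and $\tilde{\mathcal J}^-=\mathrm{Span}_{\mathbb{K}}(\tilde{\mathcal I}^-\tilde U^0\tilde U^+)$ (an ideal). Let $\tilde\Omega$ be the algebra automorphism of $\tilde U$ with $\tilde K_\alpha\mapsto\tilde K_{-\alpha}$, $\tilde L_\alpha\mapsto\tilde L_{-\alpha}$, $\tilde E_i\mapsto\tilde F_i\tilde L_{-\alpha_i}$, $\tilde F_i\mapsto\tilde K_{-\alpha_i}\tilde E_i$. Then $U(\chi)=\tilde U/(\tilde{\mathcal J}^-+\tilde\Omega(\tilde{\mathcal J}^-))$. Images of generators are written $K_\alpha,L_\alpha,E_i,F_i$; $U^0(\chi),U^\pm(\chi)$ are the images of $\tilde U^0,\tilde U^\pm$. Multiplication $U^-\otimes U^0\otimes U^+\to U$ is a linear isomorphism and the $K_\alpha L_\beta$ form a basis of $U^0$. Highest weight modules: $\mathrm{Ch}(U^0(\chi))$ is the set of unital $\mathbb{K}$-algebra homomorphisms $U^0(\chi)\to\mathbb{K}$. For $\Lambda\in\mathrm{Ch}(U^0(\chi))$, $\mathcal{M}_\chi(\Lambda)$ is the Verma module: generated by $\tilde v_\Lambda\neq0$ with $Z\tilde v_\Lambda=\Lambda(Z)\tilde v_\Lambda$ ($Z\in U^0$), $E_i\tilde v_\Lambda=0$ ($i\in I$), and $U^-\to\mathcal{M}_\chi(\Lambda)$, $Y\mapsto Y\tilde v_\Lambda$ bijective; it is graded by $\mathcal{M}_\chi(\Lambda)_\alpha=U^-_\alpha\tilde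 v_\Lambda$. $\mathcal{L}_\chi(\Lambda)$ is the quotient of $\mathcal{M}_\chi(\Lambda)$ by its maximal proper $\mathbb{Z}\Pi$-graded submodule. *)

theory Defs
  imports
    "HOL.Hull"
    "HOL-Library.Poly_Mapping"
    "HOL-Algebra.Ideal"
    "HOL-Algebra.QuotRing"
    "HOL-Algebra.Subrings"
    "HOL-Algebra.Module"
    "HOL-Algebra.Algebraic_Closure_Type"
begin

section \<open>Algebras and modules over a field\<close>

text \<open>
  The base field is a type \<open>'k\<close>.  A (noncommutative, unital) algebra over it is a
  record of type \<open>('k, 'a) module\<close>, used with both its ring fields and its scalar
  multiplication.  A left module over an algebra with elements of type \<open>'u\<close> is a record of type
  \<open>('u, 'm) module\<close>, of which the fields \<open>mult\<close> and \<open>one\<close> are irrelevant.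
  The library locale \<^locale>\<open>module\<close> asks for a commutative ring of scalars, hence
  the noncommutative version below.
\<close>

abbreviation scalars :: "'k::field ring"
  where "scalars \<equiv> ring_of_type_algebra"

definition linear_span :: "('k::field, 'a) module \<Rightarrow> 'a set \<Rightarrow> 'a set"
  where "linear_span V S = (\<lambda>W. submodule W scalars V) hull S"

definition finite_dimensional :: "('k::field, 'a) module \<Rightarrow> bool"
  where "finite_dimensional V \<longleftrightarrow>
    (\<exists>B. finite B \<and> B \<subseteq> carrier V \<and> linear_span V B = carrier V)"

definition generated_subalgebra :: "('k::field, 'a) module \<Rightarrow> 'a set \<Rightarrow> 'a set"
  where "generated_subalgebra A S = (\<lambda>B. subring B A \<and> submodule B scalars A) hull S"

text \<open>
  The quotient of an algebra by an ideal, and also of a left module by a submodule: it is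
  \<^const>\<open>FactRing\<close> together with the induced scalar multiplication.
\<close>

definition quotient :: "('r, 'a) module \<Rightarrow> 'a set \<Rightarrow> ('r, 'a set) module"  (infixl \<open>'/'/\<^sub>m\<close> 65)
  where "A //\<^sub>m I =
    \<lparr>carrier = carrier (A Quot I), monoid.mult = monoid.mult (A Quot I), one = one (A Quot I),
     zero = zero (A Quot I), add = add (A Quot I),
     module.smult = (\<lambda>c C. \<Union>x\<in>C. I +>\<^bsub>A\<^esub> (c \<odot>\<^bsub>A\<^esub> x))\<rparr>"

locale left_module = A?: ring A + M?: abelian_group M
  for A :: "('u, 'b) ring_scheme" (structure) and M :: "('u, 'm) module" (structure) +
  assumes smult_closed: "\<lbrakk>a \<in> carrier A; x \<in> carrier M\<rbrakk> \<Longrightarrow> a \<odot>\<^bsub>M\<^esub> x \<in> carrier M"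
    and smult_l_distr: "\<lbrakk>a \<in> carrier A; b \<in> carrier A; x \<in> carrier M\<rbrakk> \<Longrightarrow>
      (a \<oplus>\<^bsub>A\<^esub> b) \<odot>\<^bsub>M\<^esub> x = a \<odot>\<^bsub>M\<^esub> x \<oplus>\<^bsub>M\<^esub> b \<odot>\<^bsub>M\<^esub> x"
    and smult_r_distr: "\<lbrakk>a \<in> carrier A; x \<in> carrier M; y \<in> carrier M\<rbrakk> \<Longrightarrow>
      a \<odot>\<^bsub>M\<^esub> (x \<oplus>\<^bsub>M\<^esub> y) = a \<odot>\<^bsub>M\<^esub> x \<oplus>\<^bsub>M\<^esub> a \<odot>\<^bsub>M\<^esub> y"
    and smult_assoc: "\<lbrakk>a \<in> carrier A; b \<in> carrier A; x \<in> carrier M\<rbrakk> \<Longrightarrow>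
      (a \<otimes>\<^bsub>A\<^esub> b) \<odot>\<^bsub>M\<^esub> x = a \<odot>\<^bsub>M\<^esub> (b \<odot>\<^bsub>M\<^esub> x)"
    and smult_one: "x \<in> carrier M \<Longrightarrow> \<one>\<^bsub>A\<^esub> \<odot>\<^bsub>M\<^esub> x = x"

definition restrict_scalars :: "('k, 'u) module \<Rightarrow> ('u, 'm) module \<Rightarrow> ('k, 'm) module"
  where "restrict_scalars A M =
    \<lparr>carrier = carrier M, monoid.mult = monoid.mult M, one = one M, zero = zero M, add = add M,
     module.smult = (\<lambda>c x. (c \<odot>\<^bsub>A\<^esub> \<one>\<^bsub>A\<^esub>) \<odot>\<^bsub>M\<^esub> x)\<rparr>"


section \<open>Free algebras\<close>

text \<open>
  Words form a monoid under concatenation, written additively so that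
  \<open>'g fword \<Rightarrow>\<^sub>0 'k\<close>, with the convolution product of the library, is the monoid
  algebra of the free monoid.
\<close>

datatype 'g fword = FWord (letters: "'g list")

instantiation fword :: (type) monoid_add
begin

definition zero_fword :: "'a fword" where "0 = FWord []"

definition plus_fword :: "'a fword \<Rightarrow> 'a fword \<Rightarrow> 'a fword"
  where "v + w = FWord (letters v @ letters w)"

instance
  by standard (simp_all add: zero_fword_def plus_fword_def)

end

definition free_algebra :: "'g set \<Rightarrow> ('k::field, 'g fword \<Rightarrow>\<^sub>0 'k) module"
  where "free_algebra G =
    \<lparr>carrier = {p. \<forall>w \<in> Poly_Mapping.keys p. set (letters w) \<subseteq> G},
     monoid.mult = (*), one = 1, zero = 0, add = (+),
     module.smult = (\<lambda>c p. Poly_Mapping.single 0 c * p)\<rparr>"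

lemma ring_free_algebra: "ring (free_algebra G :: ('k::field, 'g fword \<Rightarrow>\<^sub>0 'k) module)"
proof -
  let ?C = "{p :: 'g fword \<Rightarrow>\<^sub>0 'k. \<forall>w \<in> Poly_Mapping.keys p. set (letters w) \<subseteq> G}"
  have add: "p + q \<in> ?C" if "p \<in> ?C" "q \<in> ?C" for p q
    using that keys_add[of p q] by blast
  have mult: "p * q \<in> ?C" if "p \<in> ?C" "q \<in> ?C" for p q
  proof (intro CollectI ballI)
    fix w assume "w \<in> Poly_Mapping.keys (p * q)"
    then obtain u u' where "w = u + u'" "u \<in> Poly_Mapping.keys p" "u' \<in> Poly_Mapping.keys q"
      using keys_mult[of p q] by blast
    with that show "set (letters w) \<subseteq> G"
      by (auto simp: plus_fword_def)
  qed
  have neg: "- p \<in> ?C" if "p \<in> ?C" for p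
    using that by (simp add: keys_def)
  have one: "1 \<in> ?C"
    by (simp flip: single_one add: zero_fword_def)
  have zero: "0 \<in> ?C"
    by simp
  have carrier: "carrier (free_algebra G) = ?C"
    by (simp add: free_algebra_def)
  show ?thesis
  proof (intro ringI abelian_groupI monoidI, goal_cases)
    case (6 x)
    then show ?case
      using neg[of x] unfolding carrier by (intro bexI[of _ "- x"]) (simp_all add: free_algebra_def)
  qed (use add mult one zero in \<open>simp_all add: free_algebra_def ac_simps distrib_left distrib_right del: mem_Collect_eq\<close>)
qed


section \<open>The root lattice\<close>

text \<open>
  The lattice \<open>\<int>\<Pi>\<close> is the set of finitely supported integer functions on \<open>nat\<close> with support
  in \<open>{1..N}\<close>.
\<close>

type_synonym weight = "nat \<Rightarrow>\<^sub>0 int"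

definition root_lattice :: "nat \<Rightarrow> weight set"
  where "root_lattice N = {a. Poly_Mapping.keys a \<subseteq> {1..N}}"

definition positive_cone :: "nat \<Rightarrow> weight set"
  where "positive_cone N = {a \<in> root_lattice N. \<forall>i. 0 \<le> Poly_Mapping.lookup a i}"

definition simple_root :: "nat \<Rightarrow> weight"  (\<open>\<alpha>\<^sub>s\<close>)
  where "\<alpha>\<^sub>s i = Poly_Mapping.single i 1"

definition bihomomorphism :: "nat \<Rightarrow> (weight \<Rightarrow> weight \<Rightarrow> 'k::field) \<Rightarrow> bool"
  where "bihomomorphism N \<chi> \<longleftrightarrow>
    (\<forall>a\<in>root_lattice N. \<forall>b\<in>root_lattice N. \<chi> a b \<noteq> 0) \<and>
    (\<forall>a\<in>root_lattice N. \<forall>b\<in>root_lattice N. \<forall>c\<in>root_lattice N.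
       \<chi> a (b + c) = \<chi> a b * \<chi> a c \<and> \<chi> (a + b) c = \<chi> a c * \<chi> b c)"


section \<open>The algebra \<open>\<tilde>U(\<chi>)\<close>\<close>

datatype generator = GenK weight | GenL weight | GenE nat | GenF nat

definition generators :: "nat \<Rightarrow> generator set"
  where "generators N = GenK ` root_lattice N \<union> GenL ` root_lattice N
    \<union> GenE ` {1..N} \<union> GenF ` {1..N}"

type_synonym 'k free = "generator fword \<Rightarrow>\<^sub>0 'k"

definition monomial :: "generator list \<Rightarrow> 'k::field free"
  where "monomial gs = Poly_Mapping.single (FWord gs) 1"

definition const :: "'k \<Rightarrow> 'k::field free"
  where "const c = Poly_Mapping.single 0 c"

text \<open>Each defining relation \<open>lhs = rhs\<close> is encoded as the element \<open>lhs - rhs\<close>.\<close>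

definition relators :: "nat \<Rightarrow> (weight \<Rightarrow> weight \<Rightarrow> 'k::field) \<Rightarrow> 'k free set"
  where "relators N \<chi> =
    (let K = (\<lambda>a. monomial [GenK a]); L = (\<lambda>a. monomial [GenL a]);
         E = (\<lambda>i. monomial [GenE i]); F = (\<lambda>i. monomial [GenF i])
     in {K 0 - 1, L 0 - 1}
      \<union> {K a * K b - K (a + b) | a b. a \<in> root_lattice N \<and> b \<in> root_lattice N}
      \<union> {L a * L b - L (a + b) | a b. a \<in> root_lattice N \<and> b \<in> root_lattice N}
      \<union> {K a * L b - L b * K a | a b. a \<in> root_lattice N \<and> b \<in> root_lattice N}
      \<union> {K a * E i - const (\<chi> a (\<alpha>\<^sub>s i)) * E i * K a | a i. a \<in> root_lattice N \<and> i \<in> {1..N}}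
      \<union> {L a * E i - const (\<chi> (- \<alpha>\<^sub>s i) a) * E i * L a | a i. a \<in> root_lattice N \<and> i \<in> {1..N}}
      \<union> {K a * F i - const (\<chi> a (- \<alpha>\<^sub>s i)) * F i * K a | a i. a \<in> root_lattice N \<and> i \<in> {1..N}}
      \<union> {L a * F i - const (\<chi> (\<alpha>\<^sub>s i) a) * F i * L a | a i. a \<in> root_lattice N \<and> i \<in> {1..N}}
      \<union> {E i * F j - F j * E i - (if i = j then - K (\<alpha>\<^sub>s i) + L (\<alpha>\<^sub>s i) else 0)
          | i j. i \<in> {1..N} \<and> j \<in> {1..N}})"

definition relation_ideal :: "nat \<Rightarrow> (weight \<Rightarrow> weight \<Rightarrow> 'k::field) \<Rightarrow> 'k free set"
  where "relation_ideal N \<chi> =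
    Idl\<^bsub>free_algebra (generators N) :: ('k, 'k free) module\<^esub> (relators N \<chi>)"

type_synonym 'k tilde = "'k free set"

definition Utilde :: "nat \<Rightarrow> (weight \<Rightarrow> weight \<Rightarrow> 'k::field) \<Rightarrow> ('k, 'k tilde) module"
  where "Utilde N \<chi> = free_algebra (generators N) //\<^sub>m relation_ideal N \<chi>"

definition tilde_class :: "nat \<Rightarrow> (weight \<Rightarrow> weight \<Rightarrow> 'k::field) \<Rightarrow> generator list \<Rightarrow> 'k tilde"
  where "tilde_class N \<chi> gs =
    relation_ideal N \<chi> +>\<^bsub>free_algebra (generators N) :: ('k, 'k free) module\<^esub> monomial gs"

definition tK :: "nat \<Rightarrow> (weight \<Rightarrow> weight \<Rightarrow> 'k::field) \<Rightarrow> weight \<Rightarrow> 'k tilde"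
  where "tK N \<chi> a = tilde_class N \<chi> [GenK a]"

definition tL :: "nat \<Rightarrow> (weight \<Rightarrow> weight \<Rightarrow> 'k::field) \<Rightarrow> weight \<Rightarrow> 'k tilde"
  where "tL N \<chi> a = tilde_class N \<chi> [GenL a]"

definition tE :: "nat \<Rightarrow> (weight \<Rightarrow> weight \<Rightarrow> 'k::field) \<Rightarrow> nat \<Rightarrow> 'k tilde"
  where "tE N \<chi> i = tilde_class N \<chi> [GenE i]"

definition tF :: "nat \<Rightarrow> (weight \<Rightarrow> weight \<Rightarrow> 'k::field) \<Rightarrow> nat \<Rightarrow> 'k tilde"
  where "tF N \<chi> i = tilde_class N \<chi> [GenF i]"

primrec generator_degree :: "generator \<Rightarrow> weight"
  where
    "generator_degree (GenK a) = 0"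
  | "generator_degree (GenL a) = 0"
  | "generator_degree (GenE i) = \<alpha>\<^sub>s i"
  | "generator_degree (GenF i) = - \<alpha>\<^sub>s i"

definition Utilde_degree :: "nat \<Rightarrow> (weight \<Rightarrow> weight \<Rightarrow> 'k::field) \<Rightarrow> weight \<Rightarrow> 'k tilde set"
  where "Utilde_degree N \<chi> b = linear_span (Utilde N \<chi>)
    {tilde_class N \<chi> gs | gs. set gs \<subseteq> generators N \<and> sum_list (map generator_degree gs) = b}"

definition Utilde_zero :: "nat \<Rightarrow> (weight \<Rightarrow> weight \<Rightarrow> 'k::field) \<Rightarrow> 'k tilde set"
  where "Utilde_zero N \<chi> = generated_subalgebra (Utilde N \<chi>)
    (tK N \<chi> ` root_lattice N \<union> tL N \<chi> ` root_lattice N)"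

definition Utilde_plus :: "nat \<Rightarrow> (weight \<Rightarrow> weight \<Rightarrow> 'k::field) \<Rightarrow> 'k tilde set"
  where "Utilde_plus N \<chi> = generated_subalgebra (Utilde N \<chi>) (tE N \<chi> ` {1..N})"

definition Utilde_minus :: "nat \<Rightarrow> (weight \<Rightarrow> weight \<Rightarrow> 'k::field) \<Rightarrow> 'k tilde set"
  where "Utilde_minus N \<chi> = generated_subalgebra (Utilde N \<chi>) (tF N \<chi> ` {1..N})"

text \<open>
  \<open>I_minus N \<chi> a Y\<close> says that \<open>Y\<close> lies in the component of degree \<open>- a\<close>.  The recursion is
  well-founded (each step lowers the height of \<open>a\<close> by one), so the least fixed point taken by
  the command is the only solution of the recursive description.
\<close>

inductive I_minus :: "nat \<Rightarrow> (weight \<Rightarrow> weight \<Rightarrow> 'k::field) \<Rightarrow> weight \<Rightarrow> 'k tilde \<Rightarrow> bool"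
  for N \<chi> where
    zero: "I_minus N \<chi> 0 \<zero>\<^bsub>Utilde N \<chi>\<^esub>"
  | step: "\<lbrakk>a \<in> positive_cone N; a \<noteq> 0; Y \<in> Utilde_minus N \<chi> \<inter> Utilde_degree N \<chi> (- a);
      \<forall>i. i \<in> {1..N} \<and> a - \<alpha>\<^sub>s i \<in> positive_cone N \<longrightarrow>
        (\<exists>Z Z'. I_minus N \<chi> (a - \<alpha>\<^sub>s i) Z \<and> I_minus N \<chi> (a - \<alpha>\<^sub>s i) Z' \<and>
          tE N \<chi> i \<otimes>\<^bsub>Utilde N \<chi>\<^esub> Y \<ominus>\<^bsub>Utilde N \<chi>\<^esub> Y \<otimes>\<^bsub>Utilde N \<chi>\<^esub> tE N \<chi> i =
          Z \<otimes>\<^bsub>Utilde N \<chi>\<^esub> tK N \<chi> (\<alpha>\<^sub>s i) \<oplus>\<^bsub>Utilde N \<chi>\<^esub> Z' \<otimes>\<^bsub>Utilde N \<chi>\<^esub> tL N \<chi> (\<alpha>\<^sub>s i))\<rbrakk>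
      \<Longrightarrow> I_minus N \<chi> a Y"

definition I_minus_sum :: "nat \<Rightarrow> (weight \<Rightarrow> weight \<Rightarrow> 'k::field) \<Rightarrow> 'k tilde set"
  where "I_minus_sum N \<chi> = linear_span (Utilde N \<chi>) {Y. \<exists>a \<in> positive_cone N. I_minus N \<chi> a Y}"

definition J_minus :: "nat \<Rightarrow> (weight \<Rightarrow> weight \<Rightarrow> 'k::field) \<Rightarrow> 'k tilde set"
  where "J_minus N \<chi> = linear_span (Utilde N \<chi>)
    {Y \<otimes>\<^bsub>Utilde N \<chi>\<^esub> Z \<otimes>\<^bsub>Utilde N \<chi>\<^esub> W | Y Z W.
      Y \<in> I_minus_sum N \<chi> \<and> Z \<in> Utilde_zero N \<chi> \<and> W \<in> Utilde_plus N \<chi>}"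

text \<open>
  The automorphism is determined by its values on generators only on the carrier; its values
  elsewhere are never used.
\<close>

definition Omega_tilde :: "nat \<Rightarrow> (weight \<Rightarrow> weight \<Rightarrow> 'k::field) \<Rightarrow> 'k tilde \<Rightarrow> 'k tilde"
  where "Omega_tilde N \<chi> = (SOME h.
    h \<in> ring_iso (Utilde N \<chi>) (Utilde N \<chi>) \<and>
    (\<forall>c. \<forall>x \<in> carrier (Utilde N \<chi>). h (c \<odot>\<^bsub>Utilde N \<chi>\<^esub> x) = c \<odot>\<^bsub>Utilde N \<chi>\<^esub> h x) \<and>
    (\<forall>a \<in> root_lattice N. h (tK N \<chi> a) = tK N \<chi> (- a) \<and> h (tL N \<chi> a) = tL N \<chi> (- a)) \<and>
    (\<forall>i \<in> {1..N}. h (tE N \<chi> i) = tF N \<chi> i \<otimes>\<^bsub>Utilde N \<chi>\<^esub> tL N \<chi> (- \<alpha>\<^sub>s i) \<and>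
                  h (tF N \<chi> i) = tK N \<chi> (- \<alpha>\<^sub>s i) \<otimes>\<^bsub>Utilde N \<chi>\<^esub> tE N \<chi> i))"


section \<open>The generalized quantum group \<open>U(\<chi>)\<close>\<close>

definition J_total :: "nat \<Rightarrow> (weight \<Rightarrow> weight \<Rightarrow> 'k::field) \<Rightarrow> 'k tilde set"
  where "J_total N \<chi> = J_minus N \<chi> <+>\<^bsub>Utilde N \<chi>\<^esub> Omega_tilde N \<chi> ` J_minus N \<chi>"

type_synonym 'k qgroup = "'k tilde set"

definition U :: "nat \<Rightarrow> (weight \<Rightarrow> weight \<Rightarrow> 'k::field) \<Rightarrow> ('k, 'k qgroup) module"
  where "U N \<chi> = Utilde N \<chi> //\<^sub>m J_total N \<chi>"

definition proj :: "nat \<Rightarrow> (weight \<Rightarrow> weight \<Rightarrow> 'k::field) \<Rightarrow> 'k tilde \<Rightarrow> 'k qgroup"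
  where "proj N \<chi> x = J_total N \<chi> +>\<^bsub>Utilde N \<chi>\<^esub> x"

definition UK :: "nat \<Rightarrow> (weight \<Rightarrow> weight \<Rightarrow> 'k::field) \<Rightarrow> weight \<Rightarrow> 'k qgroup"
  where "UK N \<chi> a = proj N \<chi> (tK N \<chi> a)"

definition UL :: "nat \<Rightarrow> (weight \<Rightarrow> weight \<Rightarrow> 'k::field) \<Rightarrow> weight \<Rightarrow> 'k qgroup"
  where "UL N \<chi> a = proj N \<chi> (tL N \<chi> a)"

definition UE :: "nat \<Rightarrow> (weight \<Rightarrow> weight \<Rightarrow> 'k::field) \<Rightarrow> nat \<Rightarrow> 'k qgroup"
  where "UE N \<chi> i = proj N \<chi> (tE N \<chi> i)"

definition U_zero :: "nat \<Rightarrow> (weight \<Rightarrow> weight \<Rightarrow> 'k::field) \<Rightarrow> 'k qgroup set"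
  where "U_zero N \<chi> = proj N \<chi> ` Utilde_zero N \<chi>"

definition U_minus :: "nat \<Rightarrow> (weight \<Rightarrow> weight \<Rightarrow> 'k::field) \<Rightarrow> 'k qgroup set"
  where "U_minus N \<chi> = proj N \<chi> ` Utilde_minus N \<chi>"

definition U_degree :: "nat \<Rightarrow> (weight \<Rightarrow> weight \<Rightarrow> 'k::field) \<Rightarrow> weight \<Rightarrow> 'k qgroup set"
  where "U_degree N \<chi> b = proj N \<chi> ` Utilde_degree N \<chi> b"


section \<open>Highest weight modules\<close>

definition Ch_U_zero :: "nat \<Rightarrow> (weight \<Rightarrow> weight \<Rightarrow> 'k::field) \<Rightarrow> ('k qgroup \<Rightarrow> 'k) set"
  where "Ch_U_zero N \<chi> =
    {\<Lambda> \<in> ring_hom (U N \<chi>\<lparr>carrier := U_zero N \<chi>\<rparr>) scalars.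
       \<forall>c. \<forall>Z \<in> U_zero N \<chi>. \<Lambda> (c \<odot>\<^bsub>U N \<chi>\<^esub> Z) = c * \<Lambda> Z}"

definition verma_module ::
    "nat \<Rightarrow> (weight \<Rightarrow> weight \<Rightarrow> 'k::field) \<Rightarrow> ('k qgroup \<Rightarrow> 'k) \<Rightarrow> ('k qgroup, 'm) module \<Rightarrow> 'm \<Rightarrow> bool"
  where "verma_module N \<chi> \<Lambda> M v \<longleftrightarrow>
    left_module (U N \<chi>) M \<and> v \<in> carrier M \<and> v \<noteq> \<zero>\<^bsub>M\<^esub> \<and>
    carrier M = (\<lambda>u. u \<odot>\<^bsub>M\<^esub> v) ` carrier (U N \<chi>) \<and>
    (\<forall>Z \<in> U_zero N \<chi>. Z \<odot>\<^bsub>M\<^esub> v = \<Lambda> Z \<odot>\<^bsub>restrict_scalars (U N \<chi>) M\<^esub> v) \<and>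
    (\<forall>i \<in> {1..N}. UE N \<chi> i \<odot>\<^bsub>M\<^esub> v = \<zero>\<^bsub>M\<^esub>) \<and>
    bij_betw (\<lambda>Y. Y \<odot>\<^bsub>M\<^esub> v) (U_minus N \<chi>) (carrier M)"

definition verma_degree ::
    "nat \<Rightarrow> (weight \<Rightarrow> weight \<Rightarrow> 'k::field) \<Rightarrow> ('k qgroup, 'm) module \<Rightarrow> 'm \<Rightarrow> weight \<Rightarrow> 'm set"
  where "verma_degree N \<chi> M v a = (\<lambda>Y. Y \<odot>\<^bsub>M\<^esub> v) ` (U_minus N \<chi> \<inter> U_degree N \<chi> a)"

definition graded_submodule ::
    "nat \<Rightarrow> (weight \<Rightarrow> weight \<Rightarrow> 'k::field) \<Rightarrow> ('k qgroup, 'm) module \<Rightarrow> 'm \<Rightarrow> 'm set \<Rightarrow> bool"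
  where "graded_submodule N \<chi> M v S \<longleftrightarrow>
    submodule S (U N \<chi>) M \<and>
    S = linear_span (restrict_scalars (U N \<chi>) M)
          (\<Union>a \<in> root_lattice N. S \<inter> verma_degree N \<chi> M v a)"

definition maximal_graded_submodule ::
    "nat \<Rightarrow> (weight \<Rightarrow> weight \<Rightarrow> 'k::field) \<Rightarrow> ('k qgroup, 'm) module \<Rightarrow> 'm \<Rightarrow> 'm set"
  where "maximal_graded_submodule N \<chi> M v =
    (GREATEST S. graded_submodule N \<chi> M v S \<and> S \<noteq> carrier M)"

text \<open>
  The module \<open>\<L>\<^sub>\<chi>(\<Lambda>)\<close>, where \<open>M\<close> is the Verma module with highest weight vector \<open>v\<close>;
  the character \<open>\<Lambda>\<close> enters only through \<open>M\<close> and \<open>v\<close>.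
\<close>

definition simple_quotient ::
    "nat \<Rightarrow> (weight \<Rightarrow> weight \<Rightarrow> 'k::field) \<Rightarrow> ('k qgroup, 'm) module \<Rightarrow> 'm \<Rightarrow> ('k qgroup, 'm set) module"
  where "simple_quotient N \<chi> M v = M //\<^sub>m maximal_graded_submodule N \<chi> M v"


section \<open>Elements of infinite multiplicative order\<close>

definition K_times_infty :: "'k::field set"
  where "K_times_infty = {q. q \<noteq> 0 \<and> (\<forall>n::nat. 1 \<le> n \<longrightarrow> q ^ n \<noteq> 1)}"

end

theory Submission
  imports Defs "HOL-Library.Function_Algebras"
begin

text \<open>
  The irreducible module is realized by functions on words, where only weight spaces and the action of \<open>E\<^sub>i\<close>,
  \<open>F\<^sub>i\<close> on them matter.  Its set of weights is stable under the reflection at an even simple root if the highest weight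
  is integrable there, and integrability is necessary for finiteness; for the given simple roots this is condition
  (i).  The even root \<open>2 \<epsilon>\<^sub>n\<close>, where \<open>n = N - m\<close>, is not simple, but a chain of \<open>m\<close> odd reflections makes it
  so; each of them replaces the highest weight vector \<open>v\<close> by \<open>F\<^sub>\<beta> v\<close>, unless this vanishes.  Integrability at
  \<open>2 \<epsilon>\<^sub>n\<close> then says that \<open>g qh\<^bsup>4z\<^esup>\<close> is a nonnegative power of \<open>qh\<^bsup>-4\<^esup>\<close>, with \<open>z\<close> the number of
  steps at which the vector changes, and given (i) this is equivalent to (ii), (iii) and (iv).  Conversely,
  integrability at all these roots makes the set of weights stable under enough swaps and sign changes of
  coordinates to be bounded.
\<close>

section \<open>Highest weight systems and odd reflections\<close>

text \<open>The arithmetic behind (ii) to (iv): step t of the chain reflects at eps_n - eps_(n+t+1)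
  and leaves the vector in place exactly if lam_n ... lam_(n+t) = qh^(-2z), with z the number of
  moves so far. While all steps move, z = t; so the first standstill occurs at the least s with
  lam_n ... lam_(n+s) = qh^(-2s). By (i) the later lam_j are nonnegative powers of qh^2. If s <= m -
  2, then g is qh^(-4s) times a nonnegative power of qh, whereas integrability at 2 eps_n asks for
  qh^(-4(k+z)) with k >= 0 and z >= s. Hence all later lam_j are 1, the vector never moves again and
  g = qh^(-4s), which is the situation of (iii). A first standstill at the last step corresponds to
  (iv); without any, z = m and g = qh^(-4x) with x >= m.

  The link with U(chi) is a pairing: the E_i along a word take a homogeneous combination of F-words
  of the same content to a multiple of the highest weight vector, and the combinations for which all
  these multiples vanish make up the maximal submodule. The torus separates weights because qh is
  not a root of unity, so every submodule splits into homogeneous parts.\<close>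

definition reflect_root :: "('g::ab_group_add \<Rightarrow> 'g \<Rightarrow> 'k::field) \<Rightarrow> 'i \<Rightarrow> ('i \<Rightarrow> 'g) \<Rightarrow> 'i \<Rightarrow> 'g"
  where "reflect_root \<chi> p \<alpha> j =
    (if j = p then - \<alpha> p else if \<chi> (\<alpha> p) (\<alpha> j) * \<chi> (\<alpha> j) (\<alpha> p) = 1 then \<alpha> j else \<alpha> j + \<alpha> p)"

text \<open>The scalar attached to a root is multiplicative in the root, because \<open>K\<close>
  and \<open>L\<close> are: a sum of roots becomes a product of scalars and
  \<open>- \<alpha> p\<close> an inverse.\<close>

definition reflect_lam :: "('g::ab_group_add \<Rightarrow> 'g \<Rightarrow> 'k::field) \<Rightarrow> 'i \<Rightarrow> ('i \<Rightarrow> 'g) \<Rightarrow> ('i \<Rightarrow> 'k) \<Rightarrow> 'i \<Rightarrow> 'k"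
  where "reflect_lam \<chi> p \<alpha> lam j =
    (if j = p then inverse (lam p) else if \<chi> (\<alpha> p) (\<alpha> j) * \<chi> (\<alpha> j) (\<alpha> p) = 1 then lam j else lam j * lam p)"

primrec rep :: "nat \<Rightarrow> 'g::ab_group_add \<Rightarrow> 'g"
  where "rep 0 a = 0" | "rep (Suc k) a = rep k a + a"

lemma rep_add: "rep (h + k) a = rep h a + rep k a"
  by (induction h) (simp_all add: algebra_simps)

text \<open>
  An irreducible highest weight module over \<open>U(\<chi>)\<close>, seen only through its weight spaces and the action
  of the root vectors on them: \<open>b i\<close> and \<open>lam i\<close> are the scalars by which \<open>L\<^bsub>\<alpha>\<^sub>i\<^esub>\<close> and
  \<open>K\<^bsub>\<alpha>\<^sub>i\<^esub> L\<^bsub>-\<alpha>\<^sub>i\<^esub>\<close> act in weight \<open>0\<close>.  The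
  operators take the weight as an argument because an odd reflection multiplies some of them by characters of the
  torus; in return the new root vectors satisfy the same relations, so no other form of the algebra is needed.
\<close>

locale qsys = vector_space scale
  for scale :: "'k::field \<Rightarrow> 'v::ab_group_add \<Rightarrow> 'v" (infixr \<open>*s\<close> 75) +
  fixes \<chi> :: "'g::ab_group_add \<Rightarrow> 'g \<Rightarrow> 'k"
    and I :: "'i set" and \<alpha> :: "'i \<Rightarrow> 'g" and lam b :: "'i \<Rightarrow> 'k"
    and E F :: "'i \<Rightarrow> 'g \<Rightarrow> 'v \<Rightarrow> 'v"
    and L :: "'g \<Rightarrow> 'v set" and \<mu>\<^sub>0 :: 'g and v :: 'v
  assumes chi_add_left: "\<chi> (r + s) t = \<chi> r t * \<chi> s t"
    and chi_add_right: "\<chi> r (s + t) = \<chi> r s * \<chi> r t"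
    and chi_nonzero: "\<chi> r s \<noteq> 0"
    and height_ex: "\<exists>h::'g \<Rightarrow> int. (\<forall>x y. h (x + y) = h x + h y) \<and> (\<forall>i\<in>I. h (\<alpha> i) > 0)"
    and lam_nonzero: "i \<in> I \<Longrightarrow> lam i \<noteq> 0"
    and b_nonzero: "i \<in> I \<Longrightarrow> b i \<noteq> 0"
    and subspace_L: "subspace (L \<mu>)"
    and E_in: "\<lbrakk>i \<in> I; x \<in> L \<mu>\<rbrakk> \<Longrightarrow> E i \<mu> x \<in> L (\<mu> + \<alpha> i)"
    and F_in: "\<lbrakk>i \<in> I; x \<in> L \<mu>\<rbrakk> \<Longrightarrow> F i \<mu> x \<in> L (\<mu> - \<alpha> i)"
    and E_add: "\<lbrakk>i \<in> I; x \<in> L \<mu>; y \<in> L \<mu>\<rbrakk> \<Longrightarrow> E i \<mu> (x + y) = E i \<mu> x + E i \<mu> y"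
    and F_add: "\<lbrakk>i \<in> I; x \<in> L \<mu>; y \<in> L \<mu>\<rbrakk> \<Longrightarrow> F i \<mu> (x + y) = F i \<mu> x + F i \<mu> y"
    and E_scale: "\<lbrakk>i \<in> I; x \<in> L \<mu>\<rbrakk> \<Longrightarrow> E i \<mu> (c *s x) = c *s E i \<mu> x"
    and F_scale: "\<lbrakk>i \<in> I; x \<in> L \<mu>\<rbrakk> \<Longrightarrow> F i \<mu> (c *s x) = c *s F i \<mu> x"
    and E_F: "\<lbrakk>i \<in> I; j \<in> I; x \<in> L \<mu>\<rbrakk> \<Longrightarrow> E i (\<mu> - \<alpha> j) (F j \<mu> x) =
      F j (\<mu> + \<alpha> i) (E i \<mu> x)
      + (if i = j then (b i * (inverse (\<chi> \<mu> (\<alpha> i)) - lam i * \<chi> (\<alpha> i) \<mu>)) *s x else 0)"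
    and v_in: "v \<in> L \<mu>\<^sub>0" and v_nonzero: "v \<noteq> 0"
    and E_v: "i \<in> I \<Longrightarrow> E i \<mu>\<^sub>0 v = 0"
    and irreducible: "\<lbrakk>\<And>\<mu>. subspace (S \<mu>) \<and> S \<mu> \<subseteq> L \<mu>;
      \<And>i \<mu> x. \<lbrakk>i \<in> I; x \<in> S \<mu>\<rbrakk> \<Longrightarrow> E i \<mu> x \<in> S (\<mu> + \<alpha> i);
      \<And>i \<mu> x. \<lbrakk>i \<in> I; x \<in> S \<mu>\<rbrakk> \<Longrightarrow> F i \<mu> x \<in> S (\<mu> - \<alpha> i);
      y \<in> S \<nu>; y \<noteq> 0\<rbrakk> \<Longrightarrow> L \<mu> \<subseteq> S \<mu>"
begin

definition d :: "'i \<Rightarrow> 'i \<Rightarrow> 'g \<Rightarrow> 'k"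
  where "d i j \<mu> = (if i = j then b i * (inverse (\<chi> \<mu> (\<alpha> i)) - lam i * \<chi> (\<alpha> i) \<mu>) else 0)"

text \<open>The scalar of K L^(-1) for the root i on the weight space. The bracket of
  \<open>E i\<close> and \<open>F i\<close> vanishes there exactly if it is 1, and its place among
  the powers of \<open>\<chi> (\<alpha> i) (\<alpha> i)\<close> governs the string of weights
  through it.\<close>

definition \<kappa> :: "'i \<Rightarrow> 'g \<Rightarrow> 'k"
  where "\<kappa> i \<mu> = lam i * \<chi> (\<alpha> i) \<mu> * \<chi> \<mu> (\<alpha> i)"

lemma chi_zero [simp]: "\<chi> 0 x = 1" "\<chi> x 0 = 1"
  using chi_add_left[of 0 0 x] chi_add_right[of x 0 0] chi_nonzero[of 0 x] chi_nonzero[of x 0]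
  by simp_all

lemma chi_minus_left: "\<chi> (- x) y = inverse (\<chi> x y)"
  using chi_add_left[of x "- x" y] chi_nonzero by (simp add: field_simps)

lemma chi_minus_right: "\<chi> x (- y) = inverse (\<chi> x y)"
  using chi_add_right[of x y "- y"] chi_nonzero by (simp add: field_simps)

lemma chi_diff_left: "\<chi> (x - y) z = \<chi> x z / \<chi> y z"
  using chi_add_left[of x "- y" z] by (simp add: chi_minus_left field_simps)

lemma chi_diff_right: "\<chi> x (y - z) = \<chi> x y / \<chi> x z"
  using chi_add_right[of x y "- z"] by (simp add: chi_minus_right field_simps)

lemmas chi_simps = chi_add_left chi_add_right chi_minus_left chi_minus_right chi_diff_left chi_diff_right

definition height :: "'g \<Rightarrow> int"
  where "height = (SOME h. (\<forall>x y. h (x + y) = h x + h y) \<and> (\<forall>i\<in>I. h (\<alpha> i) > 0))"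

lemma height_add: "height (x + y) = height x + height y"
  and height_pos: "i \<in> I \<Longrightarrow> height (\<alpha> i) > 0"
  using someI_ex[OF height_ex] unfolding height_def by blast+

lemma height_diff: "height (x - y) = height x - height y"
  using height_add[of "x - y" y] by simp

lemma zero_in [simp]: "0 \<in> L \<mu>"
  and add_in: "\<lbrakk>x \<in> L \<mu>; y \<in> L \<mu>\<rbrakk> \<Longrightarrow> x + y \<in> L \<mu>"
  and scale_in: "x \<in> L \<mu> \<Longrightarrow> a *s x \<in> L \<mu>"
  and diff_in: "\<lbrakk>x \<in> L \<mu>; y \<in> L \<mu>\<rbrakk> \<Longrightarrow> x - y \<in> L \<mu>"
  using subspace_L by (auto simp: subspace_0 subspace_add subspace_scale subspace_diff)

lemma E_zero [simp]: "i \<in> I \<Longrightarrow> E i \<mu> 0 = 0"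
  using E_add[of i 0 \<mu> 0] by simp

lemma F_zero [simp]: "i \<in> I \<Longrightarrow> F i \<mu> 0 = 0"
  using F_add[of i 0 \<mu> 0] by simp

lemma E_diff: "\<lbrakk>i \<in> I; x \<in> L \<mu>; y \<in> L \<mu>\<rbrakk> \<Longrightarrow> E i \<mu> (x - y) = E i \<mu> x - E i \<mu> y"
  using E_add[of i "x - y" \<mu> y] diff_in by (simp add: algebra_simps)

lemma F_diff: "\<lbrakk>i \<in> I; x \<in> L \<mu>; y \<in> L \<mu>\<rbrakk> \<Longrightarrow> F i \<mu> (x - y) = F i \<mu> x - F i \<mu> y"
  using F_add[of i "x - y" \<mu> y] diff_in by (simp add: algebra_simps)

lemmas weight_simps = diff_diff_eq diff_add_eq add_diff_eq add.commute add.left_commute add.assoc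

lemma E_F': "\<lbrakk>i \<in> I; j \<in> I; x \<in> L \<mu>\<rbrakk> \<Longrightarrow>
    E i (\<mu> - \<alpha> j) (F j \<mu> x) = F j (\<mu> + \<alpha> i) (E i \<mu> x) + d i j \<mu> *s x"
  using E_F[of i j x \<mu>] by (simp add: d_def)

lemma FF_in:
  assumes "i \<in> I" "j \<in> I" "x \<in> L \<mu>"
  shows "F i (\<mu> - \<alpha> j) (F j \<mu> x) \<in> L (\<mu> - \<alpha> j - \<alpha> i)"
  by (intro F_in assms)

lemma FFF_in:
  assumes "i \<in> I" "j \<in> I" "l \<in> I" "x \<in> L \<mu>"
  shows "F i (\<mu> - \<alpha> l - \<alpha> j) (F j (\<mu> - \<alpha> l) (F l \<mu> x)) \<in> L (\<mu> - \<alpha> l - \<alpha> j - \<alpha> i)"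
  by (intro F_in assms)

lemma E_FF:
  assumes "i \<in> I" "j \<in> I" "k \<in> I" "x \<in> L \<mu>"
  shows "E k (\<mu> - \<alpha> j - \<alpha> i) (F i (\<mu> - \<alpha> j) (F j \<mu> x)) =
    F i (\<mu> + \<alpha> k - \<alpha> j) (F j (\<mu> + \<alpha> k) (E k \<mu> x)) + d k j \<mu> *s F i \<mu> x + d k i (\<mu> - \<alpha> j) *s F j \<mu> x"
proof -
  have w: "\<mu> - \<alpha> j + \<alpha> k = \<mu> + \<alpha> k - \<alpha> j" by (simp add: weight_simps)
  have "F i (\<mu> + \<alpha> k - \<alpha> j) (F j (\<mu> + \<alpha> k) (E k \<mu> x) + d k j \<mu> *s x) =
      F i (\<mu> + \<alpha> k - \<alpha> j) (F j (\<mu> + \<alpha> k) (E k \<mu> x)) + d k j \<mu> *s F i \<mu> x"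
    using assms F_in[OF assms(2) E_in[OF assms(3,4)]]
    by (cases "k = j") (auto simp: d_def F_add F_scale scale_in)
  then show ?thesis
    by (simp add: E_F'[OF assms(3,1) F_in[OF assms(2,4)]] E_F'[OF assms(3,2,4)] w)
qed

lemma E_FFF:
  assumes "i \<in> I" "j \<in> I" "l \<in> I" "k \<in> I" "x \<in> L \<mu>"
  shows "E k (\<mu> - \<alpha> l - \<alpha> j - \<alpha> i) (F i (\<mu> - \<alpha> l - \<alpha> j) (F j (\<mu> - \<alpha> l) (F l \<mu> x))) =
    F i (\<mu> + \<alpha> k - \<alpha> l - \<alpha> j) (F j (\<mu> + \<alpha> k - \<alpha> l) (F l (\<mu> + \<alpha> k) (E k \<mu> x)))
    + d k l \<mu> *s F i (\<mu> - \<alpha> j) (F j \<mu> x) + d k j (\<mu> - \<alpha> l) *s F i (\<mu> - \<alpha> l) (F l \<mu> x)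
    + d k i (\<mu> - \<alpha> l - \<alpha> j) *s F j (\<mu> - \<alpha> l) (F l \<mu> x)"
proof -
  have w: "\<mu> - \<alpha> l + \<alpha> k = \<mu> + \<alpha> k - \<alpha> l" "\<mu> - \<alpha> l - \<alpha> j + \<alpha> k = \<mu> + \<alpha> k - \<alpha> l - \<alpha> j"
    by (simp_all add: weight_simps)
  have Ein: "E k \<mu> x \<in> L (\<mu> + \<alpha> k)" using assms by (intro E_in)
  have "F i (\<mu> + \<alpha> k - \<alpha> l - \<alpha> j) (F j (\<mu> + \<alpha> k - \<alpha> l) (F l (\<mu> + \<alpha> k) (E k \<mu> x)) + d k l \<mu> *s F j \<mu> x + d k j (\<mu> - \<alpha> l) *s F l \<mu> x) =
      F i (\<mu> + \<alpha> k - \<alpha> l - \<alpha> j) (F j (\<mu> + \<alpha> k - \<alpha> l) (F l (\<mu> + \<alpha> k) (E k \<mu> x)))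
      + d k l \<mu> *s F i (\<mu> - \<alpha> j) (F j \<mu> x) + d k j (\<mu> - \<alpha> l) *s F i (\<mu> - \<alpha> l) (F l \<mu> x)"
    using assms FF_in[OF assms(2,3) Ein] F_in[OF assms(2,5)] F_in[OF assms(3,5)]
    by (cases "k = j"; cases "k = l") (auto simp: d_def F_add F_scale scale_in add_in)
  then show ?thesis
    by (simp add: E_F'[OF assms(4,1) FF_in[OF assms(2,3,5)]] E_FF[OF assms(2,3,4,5)] w)
qed

section \<open>Singular vectors and what they generate\<close>

inductive generated :: "'g \<Rightarrow> 'v \<Rightarrow> 'g \<Rightarrow> 'v \<Rightarrow> bool" for \<nu> y where
    base: "generated \<nu> y \<nu> y"
  | zero: "generated \<nu> y \<mu> 0"
  | add: "\<lbrakk>generated \<nu> y \<mu> x; generated \<nu> y \<mu> x'\<rbrakk> \<Longrightarrow> generated \<nu> y \<mu> (x + x')"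
  | scale: "generated \<nu> y \<mu> x \<Longrightarrow> generated \<nu> y \<mu> (a *s x)"
  | step: "\<lbrakk>generated \<nu> y \<mu> x; i \<in> I; \<mu>' = \<mu> - \<alpha> i\<rbrakk> \<Longrightarrow> generated \<nu> y \<mu>' (F i \<mu> x)"

lemma generated_in_L:
  assumes "y \<in> L \<nu>" "generated \<nu> y \<mu> x"
  shows "x \<in> L \<mu>"
  using assms(2) by induction (auto intro: assms(1) add_in scale_in F_in)

text \<open>Moving \<open>E j\<close> past \<open>F i\<close> leaves at most a scalar multiple of a
  shorter product, and in the end \<open>E j\<close> meets the singular vector. So lowering
  operators alone already produce a stable family.\<close>

lemma generated_E:
  assumes "y \<in> L \<nu>" "\<And>i. i \<in> I \<Longrightarrow> E i \<nu> y = 0" "generated \<nu> y \<mu> x" "j \<in> I"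
  shows "generated \<nu> y (\<mu> + \<alpha> j) (E j \<mu> x)"
  using assms(3)
proof induction
  case base
  then show ?case using assms by (simp add: generated.zero)
next
  case (zero \<mu>)
  then show ?case using assms by (simp add: generated.zero)
next
  case (add \<mu> x x')
  then show ?case
    using generated_in_L[OF assms(1)] assms(4) by (simp add: E_add generated.add)
next
  case (scale \<mu> x a)
  then show ?case
    using generated_in_L[OF assms(1)] assms(4) by (simp add: E_scale generated.scale)
next
  case (step \<mu> x i \<mu>')
  then have x: "x \<in> L \<mu>" using generated_in_L[OF assms(1)] by blast
  have 1: "generated \<nu> y (\<mu>' + \<alpha> j) (F i (\<mu> + \<alpha> j) (E j \<mu> x))"
    by (rule generated.step[OF step.IH step.hyps(2)]) (simp add: step.hyps)
  show ?case
    unfolding step.hyps(3) E_F'[OF assms(4) step.hyps(2) x]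
    using 1 step.hyps by (cases "j = i") (auto simp: d_def intro!: generated.add generated.zero generated.scale)
qed

lemma singular_generates:
  assumes "y \<in> L \<nu>" "y \<noteq> 0" "\<And>i. i \<in> I \<Longrightarrow> E i \<nu> y = 0" "x \<in> L \<mu>"
  shows "generated \<nu> y \<mu> x"
proof -
  have "L \<mu> \<subseteq> {x. generated \<nu> y \<mu> x}"
  proof (rule irreducible[of "\<lambda>\<mu>. {x. generated \<nu> y \<mu> x}" y \<nu>])
    show "subspace {x. generated \<nu> y \<mu> x} \<and> {x. generated \<nu> y \<mu> x} \<subseteq> L \<mu>" for \<mu>
      unfolding subspace_def using generated_in_L[OF assms(1)]
      by (auto intro: generated.intros)
  qed (use assms generated_E in \<open>auto intro: generated.intros\<close>)
  with assms(4) show ?thesis by blast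
qed

lemma generated_height:
  assumes "generated \<nu> y \<mu> x" "x \<noteq> 0"
  shows "height \<mu> \<le> height \<nu>"
  using assms
proof induction
  case (add \<mu> x x')
  then show ?case by (cases "x = 0") auto
next
  case (step \<mu> x i \<mu>')
  then show ?case using height_pos[of i] by (cases "x = 0") (auto simp: height_diff)
qed auto

lemma height_le: "\<lbrakk>x \<in> L \<mu>; x \<noteq> 0\<rbrakk> \<Longrightarrow> height \<mu> \<le> height \<mu>\<^sub>0"
  using generated_height singular_generates[OF v_in v_nonzero E_v] by blast

text \<open>Both \<open>y\<close> and \<open>v\<close> generate everything by lowering, so neither
  lies below the other. A vector killed by all \<open>E i\<close> but of smaller height must
  therefore be zero; the vanishing arguments below rest on this.\<close>

lemma singular_height:
  assumes "y \<in> L \<nu>" "y \<noteq> 0" "\<And>i. i \<in> I \<Longrightarrow> E i \<nu> y = 0"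
  shows "height \<nu> = height \<mu>\<^sub>0"
  using height_le[OF assms(1,2)] generated_height[OF singular_generates[OF assms v_in] v_nonzero]
  by simp

section \<open>Relations among the root vectors, deduced from irreducibility\<close>

text \<open>
  If \<open>T \<mu> x \<noteq> 0\<close> with \<open>\<mu>\<close> as high as possible, then \<open>T \<mu> x\<close> is annihilated by all \<open>E k\<close>, but it lies below
  the highest weight.
\<close>

lemma lowering_zero:
  assumes "height \<beta> > 0"
    and "\<And>\<mu> x. x \<in> L \<mu> \<Longrightarrow> T \<mu> x \<in> L (\<mu> - \<beta>)" and "\<And>\<mu>. T \<mu> 0 = 0"
    and "\<And>k \<mu> x. \<lbrakk>k \<in> I; x \<in> L \<mu>\<rbrakk> \<Longrightarrow> \<exists>d. E k (\<mu> - \<beta>) (T \<mu> x) = d *s T (\<mu> + \<alpha> k) (E k \<mu> x)"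
    and "x \<in> L \<mu>"
  shows "T \<mu> x = 0"
  using assms(5)
proof (induction "nat (height \<mu>\<^sub>0 - height \<mu>)" arbitrary: \<mu> x rule: less_induct)
  case less
  show ?case
  proof (cases "x = 0")
    case False
    have sing: "E k (\<mu> - \<beta>) (T \<mu> x) = 0" if "k \<in> I" for k
    proof -
      have "T (\<mu> + \<alpha> k) (E k \<mu> x) = 0"
      proof (cases "E k \<mu> x = 0")
        case nz: False
        have in_L: "E k \<mu> x \<in> L (\<mu> + \<alpha> k)" using less.prems that by (rule E_in[rotated])
        show ?thesis
          by (rule less.hyps[OF _ in_L])
            (use height_le[OF in_L nz] height_pos[OF that] height_add[of \<mu> "\<alpha> k"] in linarith)
      qed (use assms(3) in simp)
      then show ?thesis using assms(4)[OF that less.prems] by auto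
    qed
    show ?thesis
    proof (rule ccontr)
      assume "T \<mu> x \<noteq> 0"
      from singular_height[OF assms(2)[OF less.prems] this sing]
      show False using height_le[OF less.prems False] assms(1) by (simp add: height_diff)
    qed
  qed (use assms(3) in simp)
qed

text \<open>\<open>T\<close> passes every \<open>F k\<close> up to a scalar, so it vanishes on all
  that is generated from \<open>v\<close> as soon as it kills \<open>v\<close>; and \<open>T\<close>
  applied to \<open>v\<close> would lie above the highest weight.\<close>

lemma raising_zero:
  assumes "height \<beta> > 0"
    and "\<And>\<mu> x. x \<in> L \<mu> \<Longrightarrow> T \<mu> x \<in> L (\<mu> + \<beta>)"
    and "\<And>\<mu> x y. \<lbrakk>x \<in> L \<mu>; y \<in> L \<mu>\<rbrakk> \<Longrightarrow> T \<mu> (x + y) = T \<mu> x + T \<mu> y"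
    and "\<And>\<mu> x a. x \<in> L \<mu> \<Longrightarrow> T \<mu> (a *s x) = a *s T \<mu> x"
    and "\<And>k \<mu> x. \<lbrakk>k \<in> I; x \<in> L \<mu>\<rbrakk> \<Longrightarrow> \<exists>d. T (\<mu> - \<alpha> k) (F k \<mu> x) = d *s F k (\<mu> + \<beta>) (T \<mu> x)"
    and "x \<in> L \<mu>"
  shows "T \<mu> x = 0"
proof -
  have T0: "T \<mu> 0 = 0" for \<mu> using assms(3)[of 0 \<mu> 0] by simp
  have "generated \<mu>\<^sub>0 v \<mu> x" by (rule singular_generates[OF v_in v_nonzero E_v assms(6)])
  then show ?thesis
  proof induction
    case base
    show ?case
    proof (rule ccontr)
      assume "T \<mu>\<^sub>0 v \<noteq> 0"
      from height_le[OF assms(2)[OF v_in] this] assms(1) show False by (simp add: height_add)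
    qed
  next
    case (add \<mu> x x')
    then show ?case using assms(3) generated_in_L[OF v_in] by force
  next
    case (scale \<mu> x a)
    then show ?case using assms(4) generated_in_L[OF v_in] by force
  next
    case (step \<mu> x i \<mu>')
    then show ?case using assms(5)[OF step.hyps(2)] generated_in_L[OF v_in] by fastforce
  qed (rule T0)
qed

text \<open>The q-commutator \<open>T\<close> commutes with every \<open>E k\<close>: the two
  scalars that the brackets contribute differ by the factor \<open>A\<close> and cancel. Then
  \<open>lowering_zero\<close> applies.\<close>

lemma F_F_commute:
  assumes "i \<in> I" "j \<in> I" "i \<noteq> j" "\<chi> (\<alpha> i) (\<alpha> j) * \<chi> (\<alpha> j) (\<alpha> i) = 1" "x \<in> L \<mu>"
  shows "F i (\<mu> - \<alpha> j) (F j \<mu> x) = \<chi> (\<alpha> j) (\<alpha> i) *s F j (\<mu> - \<alpha> i) (F i \<mu> x)"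
proof -
  define A where "A = \<chi> (\<alpha> j) (\<alpha> i)"
  have A: "\<chi> (\<alpha> i) (\<alpha> j) = inverse A" "A \<noteq> 0"
    using assms(4) chi_nonzero by (auto simp: A_def field_simps)
  define T where "T \<mu> x = F i (\<mu> - \<alpha> j) (F j \<mu> x) - A *s F j (\<mu> - \<alpha> i) (F i \<mu> x)" for \<mu> x
  have w: "\<mu> - \<alpha> i - \<alpha> j = \<mu> - \<alpha> j - \<alpha> i" for \<mu> by (simp add: weight_simps)
  have "T \<mu> x = 0"
  proof (rule lowering_zero[OF _ _ _ _ assms(5), where \<beta> = "\<alpha> j + \<alpha> i"]; (unfold diff_diff_eq[symmetric])?)
    show "height (\<alpha> j + \<alpha> i) > 0" using height_pos assms by (simp add: height_add add_pos_pos)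
    show "T \<mu> x \<in> L (\<mu> - \<alpha> j - \<alpha> i)" if "x \<in> L \<mu>" for \<mu> x
      unfolding T_def using FF_in[of i j x \<mu>] FF_in[of j i x \<mu>] that assms
      by (auto intro!: diff_in scale_in simp: w)
    show "T \<mu> 0 = 0" for \<mu> using assms by (simp add: T_def)
    fix k \<mu> x assume k: "k \<in> I" and x: "x \<in> L \<mu>"
    note i = assms(1) and j = assms(2)
    have d: "d k j \<mu> = A * d k j (\<mu> - \<alpha> i)" "d k i (\<mu> - \<alpha> j) = A * d k i \<mu>"
      using A(2) chi_nonzero by (auto simp: d_def chi_simps A_def[symmetric] A(1) field_simps)
    have "E k (\<mu> - \<alpha> j - \<alpha> i) (T \<mu> x) = T (\<mu> + \<alpha> k) (E k \<mu> x)"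
      unfolding T_def using FF_in[OF i j x] FF_in[OF j i x] k E_FF[OF i j k x] E_FF[OF j i k x]
      by (simp add: w E_diff E_scale scale_in d scale_right_distrib)
    then show "\<exists>d. E k (\<mu> - \<alpha> j - \<alpha> i) (T \<mu> x) = d *s T (\<mu> + \<alpha> k) (E k \<mu> x)"
      by (intro exI[of _ 1]) simp
  qed
  then show ?thesis by (simp add: T_def A_def)
qed

text \<open>Lowering the weight by \<open>\<alpha> i\<close> multiplies both terms of
  \<open>d i i\<close> by -1, so the two scalars that \<open>E i\<close> leaves on the square of
  \<open>F i\<close> cancel.\<close>

lemma F_F_zero:
  assumes "i \<in> I" "\<chi> (\<alpha> i) (\<alpha> i) = - 1" "x \<in> L \<mu>"
  shows "F i (\<mu> - \<alpha> i) (F i \<mu> x) = 0"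
proof (rule lowering_zero[OF _ _ _ _ assms(3), where \<beta> = "\<alpha> i + \<alpha> i" and T = "\<lambda>\<mu> x. F i (\<mu> - \<alpha> i) (F i \<mu> x)"];
    (unfold diff_diff_eq[symmetric])?)
  show "height (\<alpha> i + \<alpha> i) > 0" using height_pos assms by (simp add: height_add)
  show "F i (\<mu> - \<alpha> i) (F i \<mu> x) \<in> L (\<mu> - \<alpha> i - \<alpha> i)" if "x \<in> L \<mu>" for \<mu> x
    using FF_in[of i i x \<mu>] that assms by auto
  fix k \<mu> x assume k: "k \<in> I" and x: "x \<in> L \<mu>"
  have "d k i (\<mu> - \<alpha> i) = - d k i \<mu>"
    using assms(2) by (auto simp: d_def chi_simps algebra_simps)
  then show "\<exists>d. E k (\<mu> - \<alpha> i - \<alpha> i) (F i (\<mu> - \<alpha> i) (F i \<mu> x)) =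
      d *s F i (\<mu> + \<alpha> k - \<alpha> i) (F i (\<mu> + \<alpha> k) (E k \<mu> x))"
    by (intro exI[of _ 1]) (simp add: E_FF[OF assms(1,1) k x])
qed (use assms in simp)

text \<open>The q-Serre relation for Cartan integer -1. Its coefficients are hidden behind an
  existential because only its shape is used later: \<open>F j\<close> moves to the left past at
  least one \<open>F i\<close>, which is what local nilpotence of \<open>F i\<close>
  requires.\<close>

lemma F_serre:
  assumes "i \<in> I" "j \<in> I" "i \<noteq> j" "\<chi> (\<alpha> i) (\<alpha> i) * (\<chi> (\<alpha> i) (\<alpha> j) * \<chi> (\<alpha> j) (\<alpha> i)) = 1" "x \<in> L \<mu>"
  shows "\<exists>r s. F i (\<mu> - \<alpha> j - \<alpha> i) (F i (\<mu> - \<alpha> j) (F j \<mu> x)) =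
    r *s F i (\<mu> - \<alpha> i - \<alpha> j) (F j (\<mu> - \<alpha> i) (F i \<mu> x)) + s *s F j (\<mu> - \<alpha> i - \<alpha> i) (F i (\<mu> - \<alpha> i) (F i \<mu> x))"
proof -
  define A where "A = \<chi> (\<alpha> j) (\<alpha> i)"
  define B where "B = \<chi> (\<alpha> i) (\<alpha> j)"
  have AB: "A \<noteq> 0" "B \<noteq> 0" using chi_nonzero by (auto simp: A_def B_def)
  have q: "\<chi> (\<alpha> i) (\<alpha> i) = inverse (A * B)"
    using assms(4) AB by (simp add: A_def[symmetric] B_def[symmetric] field_simps)
  \<comment> \<open>With q = \<open>inverse (A * B)\<close>, the value of \<open>\<chi>\<close> at
    the root i, these are the usual Serre coefficients (1 + q) A and q A^2.\<close>
  define r where "r = A + inverse B"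
  define s where "s = A / B"
  define T where "T \<mu> x = F i (\<mu> - \<alpha> j - \<alpha> i) (F i (\<mu> - \<alpha> j) (F j \<mu> x))
    - r *s F i (\<mu> - \<alpha> i - \<alpha> j) (F j (\<mu> - \<alpha> i) (F i \<mu> x))
    + s *s F j (\<mu> - \<alpha> i - \<alpha> i) (F i (\<mu> - \<alpha> i) (F i \<mu> x))" for \<mu> x
  have w: "\<mu> - \<alpha> i - \<alpha> j = \<mu> - \<alpha> j - \<alpha> i" for \<mu> by (simp add: weight_simps)
  have "T \<mu> x = 0"
  proof (rule lowering_zero[OF _ _ _ _ assms(5), where \<beta> = "\<alpha> j + \<alpha> i + \<alpha> i"]; (unfold diff_diff_eq[symmetric])?)
    show "height (\<alpha> j + \<alpha> i + \<alpha> i) > 0" using height_pos assms by (simp add: height_add add_pos_pos)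
    note i = assms(1) and j = assms(2)
    show "T \<mu> x \<in> L (\<mu> - \<alpha> j - \<alpha> i - \<alpha> i)" if "x \<in> L \<mu>" for \<mu> x
      unfolding T_def using FFF_in[OF i i j that] FFF_in[OF i j i that] FFF_in[OF j i i that]
      by (auto intro!: diff_in add_in scale_in simp: w)
    show "T \<mu> 0 = 0" for \<mu> using assms by (simp add: T_def)
    fix k \<mu> x assume k: "k \<in> I" and x: "x \<in> L \<mu>"
    \<comment> \<open>\<open>E k\<close> removes one of the three factors; these are the total
      coefficients of the three products of two root vectors that remain.\<close>
    have d1: "d k j \<mu> - r * d k j (\<mu> - \<alpha> i) + s * d k j (\<mu> - \<alpha> i - \<alpha> i) = 0"
      using AB chi_nonzero
      by (auto simp: d_def chi_simps A_def[symmetric] B_def[symmetric] r_def s_def field_simps)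
    have d2: "d k i (\<mu> - \<alpha> j) + d k i (\<mu> - \<alpha> j - \<alpha> i) - r * d k i \<mu> = 0"
      using AB chi_nonzero
      by (auto simp: d_def chi_simps A_def[symmetric] B_def[symmetric] q r_def s_def field_simps)
    have d3: "s * d k i \<mu> + s * d k i (\<mu> - \<alpha> i) - r * d k i (\<mu> - \<alpha> j - \<alpha> i) = 0"
      using AB chi_nonzero
      by (auto simp: d_def chi_simps A_def[symmetric] B_def[symmetric] q r_def s_def field_simps)
    have "E k (\<mu> - \<alpha> j - \<alpha> i - \<alpha> i) (T \<mu> x) - T (\<mu> + \<alpha> k) (E k \<mu> x) =
       (d k j \<mu> - r * d k j (\<mu> - \<alpha> i) + s * d k j (\<mu> - \<alpha> i - \<alpha> i)) *s F i (\<mu> - \<alpha> i) (F i \<mu> x)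
       + (d k i (\<mu> - \<alpha> j) + d k i (\<mu> - \<alpha> j - \<alpha> i) - r * d k i \<mu>) *s F i (\<mu> - \<alpha> j) (F j \<mu> x)
       + (s * d k i \<mu> + s * d k i (\<mu> - \<alpha> i) - r * d k i (\<mu> - \<alpha> j - \<alpha> i)) *s F j (\<mu> - \<alpha> i) (F i \<mu> x)"
      unfolding T_def
      using FFF_in[OF i i j x] FFF_in[OF i j i x] FFF_in[OF j i i x] k
        E_FFF[OF i i j k x] E_FFF[OF i j i k x] E_FFF[OF j i i k x]
      by (simp add: w E_diff E_add E_scale scale_in diff_in add_in algebra_simps del: diff_diff_eq diff_diff_add)
    then show "\<exists>d. E k (\<mu> - \<alpha> j - \<alpha> i - \<alpha> i) (T \<mu> x) = d *s T (\<mu> + \<alpha> k) (E k \<mu> x)"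
      unfolding d1 d2 d3 by (intro exI[of _ 1]) simp
  qed
  then show ?thesis
    by (intro exI[of _ r] exI[of _ "- s"]) (simp add: T_def algebra_simps)
qed

lemma EE_in:
  assumes "i \<in> I" "j \<in> I" "x \<in> L \<mu>"
  shows "E i (\<mu> + \<alpha> j) (E j \<mu> x) \<in> L (\<mu> + \<alpha> j + \<alpha> i)"
  by (intro E_in assms)

lemma EE_F:
  assumes "i \<in> I" "j \<in> I" "k \<in> I" "x \<in> L \<mu>"
  shows "E i (\<mu> - \<alpha> k + \<alpha> j) (E j (\<mu> - \<alpha> k) (F k \<mu> x)) =
    F k (\<mu> + \<alpha> j + \<alpha> i) (E i (\<mu> + \<alpha> j) (E j \<mu> x)) + d j k \<mu> *s E i \<mu> x + d i k (\<mu> + \<alpha> j) *s E j \<mu> x"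
proof -
  have w: "\<mu> - \<alpha> k + \<alpha> j = \<mu> + \<alpha> j - \<alpha> k" by (simp add: weight_simps)
  have "E i (\<mu> + \<alpha> j - \<alpha> k) (F k (\<mu> + \<alpha> j) (E j \<mu> x) + d j k \<mu> *s x) =
      E i (\<mu> + \<alpha> j - \<alpha> k) (F k (\<mu> + \<alpha> j) (E j \<mu> x)) + d j k \<mu> *s E i \<mu> x"
    using assms F_in[OF assms(3) E_in[OF assms(2,4)]]
    by (cases "j = k") (auto simp: d_def E_add E_scale scale_in)
  then show ?thesis
    by (simp add: E_F'[OF assms(1,3) E_in[OF assms(2,4)]] E_F'[OF assms(2,3,4)] w)
qed

lemma E_E_commute:
  assumes "i \<in> I" "j \<in> I" "i \<noteq> j" "\<chi> (\<alpha> i) (\<alpha> j) * \<chi> (\<alpha> j) (\<alpha> i) = 1" "x \<in> L \<mu>"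
  shows "E i (\<mu> + \<alpha> j) (E j \<mu> x) = \<chi> (\<alpha> i) (\<alpha> j) *s E j (\<mu> + \<alpha> i) (E i \<mu> x)"
proof -
  define A where "A = \<chi> (\<alpha> i) (\<alpha> j)"
  have A: "\<chi> (\<alpha> j) (\<alpha> i) = inverse A" "A \<noteq> 0"
    using assms(4) chi_nonzero by (auto simp: A_def field_simps)
  define T where "T \<mu> x = E i (\<mu> + \<alpha> j) (E j \<mu> x) - A *s E j (\<mu> + \<alpha> i) (E i \<mu> x)" for \<mu> x
  have w: "\<mu> + \<alpha> i + \<alpha> j = \<mu> + \<alpha> j + \<alpha> i" "\<mu> - y + z = \<mu> + z - y" for \<mu> y z by (simp_all add: weight_simps)
  note i = assms(1) and j = assms(2)
  have "T \<mu> x = 0"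
  proof (rule raising_zero[OF _ _ _ _ _ assms(5), where \<beta> = "\<alpha> j + \<alpha> i"]; (unfold add.assoc[symmetric])?)
    show "height (\<alpha> j + \<alpha> i) > 0" using height_pos assms by (simp add: height_add add_pos_pos)
    show "T \<mu> x \<in> L (\<mu> + \<alpha> j + \<alpha> i)" if "x \<in> L \<mu>" for \<mu> x
      unfolding T_def using EE_in[OF i j that] EE_in[OF j i that]
      by (auto intro!: diff_in scale_in simp: w)
    show "T \<mu> (x + y) = T \<mu> x + T \<mu> y" if "x \<in> L \<mu>" "y \<in> L \<mu>" for \<mu> x y
      unfolding T_def using that i j E_in by (simp add: E_add algebra_simps)
    show "T \<mu> (a *s x) = a *s T \<mu> x" if "x \<in> L \<mu>" for \<mu> x a
      unfolding T_def using that i j E_in by (simp add: E_scale algebra_simps)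
    fix k \<mu> x assume k: "k \<in> I" and x: "x \<in> L \<mu>"
    have "d j j \<mu> = A * d j j (\<mu> + \<alpha> i)" "d i i (\<mu> + \<alpha> j) = A * d i i \<mu>"
      using A(2) chi_nonzero by (simp_all add: d_def chi_simps A_def[symmetric] A(1) field_simps)
    then have d: "d j k \<mu> = A * d j k (\<mu> + \<alpha> i)" "d i k (\<mu> + \<alpha> j) = A * d i k \<mu>"
      by (cases "k = j"; cases "k = i"; simp add: d_def)+
    have "T (\<mu> - \<alpha> k) (F k \<mu> x) = F k (\<mu> + \<alpha> j + \<alpha> i) (T \<mu> x)"
      unfolding T_def EE_F[OF i j k x] EE_F[OF j i k x]
      using EE_in[OF i j x] EE_in[OF j i x] k
      by (simp add: w(1) F_diff F_scale scale_in d scale_right_distrib)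
    then show "\<exists>d. T (\<mu> - \<alpha> k) (F k \<mu> x) = d *s F k (\<mu> + \<alpha> j + \<alpha> i) (T \<mu> x)"
      by (intro exI[of _ 1]) simp
  qed
  then show ?thesis by (simp add: T_def A_def)
qed

lemma E_E_zero:
  assumes "i \<in> I" "\<chi> (\<alpha> i) (\<alpha> i) = - 1" "x \<in> L \<mu>"
  shows "E i (\<mu> + \<alpha> i) (E i \<mu> x) = 0"
proof (rule raising_zero[OF _ _ _ _ _ assms(3), where \<beta> = "\<alpha> i + \<alpha> i" and T = "\<lambda>\<mu> x. E i (\<mu> + \<alpha> i) (E i \<mu> x)"];
    (unfold add.assoc[symmetric])?)
  show "height (\<alpha> i + \<alpha> i) > 0" using height_pos assms by (simp add: height_add)
  show "E i (\<mu> + \<alpha> i) (E i \<mu> x) \<in> L (\<mu> + \<alpha> i + \<alpha> i)" if "x \<in> L \<mu>" for \<mu> x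
    using EE_in[of i i x \<mu>] that assms by auto
  fix k \<mu> x assume k: "k \<in> I" and x: "x \<in> L \<mu>"
  have "d i k (\<mu> + \<alpha> i) = - d i k \<mu>"
    using assms(2) by (auto simp: d_def chi_simps algebra_simps)
  then show "\<exists>d. E i (\<mu> - \<alpha> k + \<alpha> i) (E i (\<mu> - \<alpha> k) (F k \<mu> x)) =
      d *s F k (\<mu> + \<alpha> i + \<alpha> i) (E i (\<mu> + \<alpha> i) (E i \<mu> x))"
    by (intro exI[of _ 1]) (simp add: EE_F[OF assms(1,1) k x])
qed (use assms E_in in \<open>auto simp: E_add E_scale\<close>)

section \<open>Odd reflection at a root where \<chi> takes the value -1\<close>

context
  fixes p
  assumes p: "p \<in> I" and pp: "\<chi> (\<alpha> p) (\<alpha> p) = - 1"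
begin

text \<open>
  The new root vectors are the \<open>q\<close>-commutators with the odd root vectors \<open>E p\<close> and \<open>F p\<close>.
\<close>

definition E\<^sub>2 :: "'i \<Rightarrow> 'g \<Rightarrow> 'v \<Rightarrow> 'v"
  where "E\<^sub>2 j \<mu> x = E p (\<mu> + \<alpha> j) (E j \<mu> x) - \<chi> (\<alpha> p) (\<alpha> j) *s E j (\<mu> + \<alpha> p) (E p \<mu> x)"

definition F\<^sub>2 :: "'i \<Rightarrow> 'g \<Rightarrow> 'v \<Rightarrow> 'v"
  where "F\<^sub>2 j \<mu> x = F p (\<mu> - \<alpha> j) (F j \<mu> x) - \<chi> (\<alpha> j) (\<alpha> p) *s F j (\<mu> - \<alpha> p) (F p \<mu> x)"

lemma w2: "\<mu> + \<alpha> p + \<alpha> j = \<mu> + \<alpha> j + \<alpha> p" "\<mu> - \<alpha> p - \<alpha> j = \<mu> - \<alpha> j - \<alpha> p" "\<mu> - y + z = \<mu> + z - y"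
  by (simp_all add: weight_simps)

lemma E2_in: "\<lbrakk>j \<in> I; x \<in> L \<mu>\<rbrakk> \<Longrightarrow> E\<^sub>2 j \<mu> x \<in> L (\<mu> + \<alpha> j + \<alpha> p)"
  and F2_in: "\<lbrakk>j \<in> I; x \<in> L \<mu>\<rbrakk> \<Longrightarrow> F\<^sub>2 j \<mu> x \<in> L (\<mu> - \<alpha> j - \<alpha> p)"
  unfolding E\<^sub>2_def F\<^sub>2_def using EE_in[OF p, of j x \<mu>] EE_in[OF _ p, of j x \<mu>] FF_in[OF p, of j x \<mu>] FF_in[OF _ p, of j x \<mu>]
  by (auto intro!: diff_in scale_in simp: w2)

lemma E2_add: "\<lbrakk>j \<in> I; x \<in> L \<mu>; y \<in> L \<mu>\<rbrakk> \<Longrightarrow> E\<^sub>2 j \<mu> (x + y) = E\<^sub>2 j \<mu> x + E\<^sub>2 j \<mu> y"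
  and F2_add: "\<lbrakk>j \<in> I; x \<in> L \<mu>; y \<in> L \<mu>\<rbrakk> \<Longrightarrow> F\<^sub>2 j \<mu> (x + y) = F\<^sub>2 j \<mu> x + F\<^sub>2 j \<mu> y"
  unfolding E\<^sub>2_def F\<^sub>2_def using E_in F_in p by (simp_all add: E_add F_add algebra_simps)

lemma E2_scale: "\<lbrakk>j \<in> I; x \<in> L \<mu>\<rbrakk> \<Longrightarrow> E\<^sub>2 j \<mu> (a *s x) = a *s E\<^sub>2 j \<mu> x"
  and F2_scale: "\<lbrakk>j \<in> I; x \<in> L \<mu>\<rbrakk> \<Longrightarrow> F\<^sub>2 j \<mu> (a *s x) = a *s F\<^sub>2 j \<mu> x"
  unfolding E\<^sub>2_def F\<^sub>2_def using E_in F_in p by (simp_all add: E_scale F_scale algebra_simps)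

text \<open>Structure constants of the new root vectors: the bracket of \<open>E p\<close> with
  \<open>F\<^sub>2 j\<close> is \<open>e j\<close> times \<open>F j\<close>, that of
  \<open>E j\<close> with \<open>F\<^sub>2 k\<close> is \<open>f j k\<close> times
  \<open>F p\<close>. The factors in brackets vanish exactly for roots not adjacent to
  \<open>p\<close>; for adjacent ones this makes the old root vectors recoverable.\<close>

definition e :: "'i \<Rightarrow> 'g \<Rightarrow> 'k"
  where "e j \<mu> = b p * lam p * \<chi> (\<alpha> p) \<mu> * (\<chi> (\<alpha> j) (\<alpha> p) - inverse (\<chi> (\<alpha> p) (\<alpha> j)))"

definition f :: "'i \<Rightarrow> 'i \<Rightarrow> 'g \<Rightarrow> 'k"
  where "f j k \<mu> = (if j = k then b j * inverse (\<chi> \<mu> (\<alpha> j)) * (1 - \<chi> (\<alpha> p) (\<alpha> j) * \<chi> (\<alpha> j) (\<alpha> p)) else 0)"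

lemma Ep_F2:
  assumes k: "k \<in> I" "k \<noteq> p" and x: "x \<in> L \<mu>"
  shows "E p (\<mu> - \<alpha> k - \<alpha> p) (F\<^sub>2 k \<mu> x) = F\<^sub>2 k (\<mu> + \<alpha> p) (E p \<mu> x) + e k \<mu> *s F k \<mu> x"
proof -
  have d: "d p k \<nu> = 0" "d p p (\<mu> - \<alpha> k) - \<chi> (\<alpha> k) (\<alpha> p) * d p p \<mu> = e k \<mu>" for \<nu>
    using k chi_nonzero by (auto simp: d_def e_def chi_simps field_simps)
  show ?thesis
    unfolding F\<^sub>2_def d(2)[symmetric]
    using FF_in[OF p k(1) x] FF_in[OF k(1) p x] p E_FF[OF p k(1) p x] E_FF[OF k(1) p p x]
    by (simp add: w2(2) E_diff E_scale scale_in d(1) algebra_simps del: diff_diff_eq diff_diff_add)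
qed

lemma E_F2:
  assumes j: "j \<in> I" "j \<noteq> p" and k: "k \<in> I" and x: "x \<in> L \<mu>"
  shows "E j (\<mu> - \<alpha> k - \<alpha> p) (F\<^sub>2 k \<mu> x) = F\<^sub>2 k (\<mu> + \<alpha> j) (E j \<mu> x) + f j k \<mu> *s F p \<mu> x"
proof -
  have d: "d j p \<nu> = 0" "d j k \<mu> - \<chi> (\<alpha> k) (\<alpha> p) * d j k (\<mu> - \<alpha> p) = f j k \<mu>" for \<nu>
    using j chi_nonzero by (auto simp: d_def f_def chi_simps field_simps)
  show ?thesis
    unfolding F\<^sub>2_def d(2)[symmetric]
    using FF_in[OF p k x] FF_in[OF k p x] j E_FF[OF p k j(1) x] E_FF[OF k p j(1) x]
    by (simp add: w2(2) E_diff E_scale scale_in d(1) algebra_simps del: diff_diff_eq diff_diff_add)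
qed

lemma E2_Fp:
  assumes j: "j \<in> I" "j \<noteq> p" and x: "x \<in> L \<mu>"
  shows "E\<^sub>2 j (\<mu> - \<alpha> p) (F p \<mu> x) = F p (\<mu> + \<alpha> j + \<alpha> p) (E\<^sub>2 j \<mu> x)
    + (b p * inverse (\<chi> \<mu> (\<alpha> p)) * (inverse (\<chi> (\<alpha> j) (\<alpha> p)) - \<chi> (\<alpha> p) (\<alpha> j))) *s E j \<mu> x"
proof -
  have d: "d j p \<nu> = 0" "d p p (\<mu> + \<alpha> j) - \<chi> (\<alpha> p) (\<alpha> j) * d p p \<mu> =
      b p * inverse (\<chi> \<mu> (\<alpha> p)) * (inverse (\<chi> (\<alpha> j) (\<alpha> p)) - \<chi> (\<alpha> p) (\<alpha> j))" for \<nu>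
    using j chi_nonzero by (auto simp: d_def chi_simps field_simps)
  show ?thesis
    unfolding E\<^sub>2_def d(2)[symmetric] EE_F[OF p j(1) p x] EE_F[OF j(1) p p x]
    using EE_in[OF p j(1) x] EE_in[OF j(1) p x] p
    by (simp add: w2(1) F_diff F_scale scale_in d(1) algebra_simps del: diff_diff_eq diff_diff_add)
qed

lemma E2_F:
  assumes j: "j \<in> I" and k: "k \<in> I" "k \<noteq> j" "k \<noteq> p" and x: "x \<in> L \<mu>"
  shows "E\<^sub>2 j (\<mu> - \<alpha> k) (F k \<mu> x) = F k (\<mu> + \<alpha> j + \<alpha> p) (E\<^sub>2 j \<mu> x)"
proof -
  have d: "d j k \<nu> = 0" "d p k \<nu> = 0" for \<nu>
    using k by (auto simp: d_def)
  show ?thesis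
    unfolding E\<^sub>2_def EE_F[OF p j k(1) x] EE_F[OF j p k(1) x]
    using EE_in[OF p j x] EE_in[OF j p x] k(1)
    by (simp add: w2(1) F_diff F_scale scale_in d algebra_simps del: diff_diff_eq diff_diff_add)
qed

text \<open>The brackets with the two factors of \<open>E\<^sub>2 j\<close> leave terms ending in
  \<open>E j\<close> or \<open>E p\<close>. These cancel, since a shift of the weight by
  \<open>\<alpha> j\<close> multiplies \<open>e k\<close> by
  \<open>\<chi> (\<alpha> p) (\<alpha> j)\<close> and a shift by \<open>\<alpha> p\<close> divides
  \<open>f j k\<close> by it. Only a scalar survives.\<close>

lemma E2_F2:
  assumes j: "j \<in> I" "j \<noteq> p" and k: "k \<in> I" "k \<noteq> p" and x: "x \<in> L \<mu>"
  shows "E\<^sub>2 j (\<mu> - \<alpha> k - \<alpha> p) (F\<^sub>2 k \<mu> x) = F\<^sub>2 k (\<mu> + \<alpha> j + \<alpha> p) (E\<^sub>2 j \<mu> x)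
    + (f j k \<mu> * d p p \<mu> - \<chi> (\<alpha> p) (\<alpha> j) * e k \<mu> * d j k \<mu>) *s x"
proof -
  let ?s = "\<chi> (\<alpha> p) (\<alpha> j)"
  have w: "\<mu> + \<alpha> p + \<alpha> j = \<mu> + \<alpha> j + \<alpha> p" "\<mu> + \<alpha> j - \<alpha> k - \<alpha> p = \<mu> - \<alpha> k - \<alpha> p + \<alpha> j"
     "\<mu> - \<alpha> k - \<alpha> p + \<alpha> p = \<mu> - \<alpha> k" "\<mu> + \<alpha> p - \<alpha> k - \<alpha> p = \<mu> - \<alpha> k"
    by (simp_all add: weight_simps)
  have e: "e k (\<mu> + \<alpha> j) = ?s * e k \<mu>"
    by (simp add: e_def chi_simps)
  have f: "f j k \<mu> = ?s * f j k (\<mu> + \<alpha> p)"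
    using chi_nonzero by (simp add: f_def chi_simps)
  have Ex: "E j \<mu> x \<in> L (\<mu> + \<alpha> j)" "E p \<mu> x \<in> L (\<mu> + \<alpha> p)" using E_in j p x by blast+
  have 1: "E p (\<mu> - \<alpha> k - \<alpha> p + \<alpha> j) (F\<^sub>2 k (\<mu> + \<alpha> j) (E j \<mu> x) + f j k \<mu> *s F p \<mu> x) =
      F\<^sub>2 k (\<mu> + \<alpha> j + \<alpha> p) (E p (\<mu> + \<alpha> j) (E j \<mu> x)) + e k (\<mu> + \<alpha> j) *s F k (\<mu> + \<alpha> j) (E j \<mu> x)
      + f j k \<mu> *s (F p (\<mu> + \<alpha> p) (E p \<mu> x) + d p p \<mu> *s x)"
  proof -
    have 11: "E p (\<mu> - \<alpha> k - \<alpha> p + \<alpha> j) (F\<^sub>2 k (\<mu> + \<alpha> j) (E j \<mu> x)) =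
      F\<^sub>2 k (\<mu> + \<alpha> j + \<alpha> p) (E p (\<mu> + \<alpha> j) (E j \<mu> x)) + e k (\<mu> + \<alpha> j) *s F k (\<mu> + \<alpha> j) (E j \<mu> x)"
      using Ep_F2[OF k Ex(1)] unfolding w .
    have 12: "F\<^sub>2 k (\<mu> + \<alpha> j) (E j \<mu> x) \<in> L (\<mu> - \<alpha> k - \<alpha> p + \<alpha> j)"
      using F2_in[OF k(1) Ex(1)] unfolding w .
    show ?thesis
    \<comment> \<open>Additivity of \<open>E p\<close> requires both summands to lie in one weight
      space, which is so for \<open>j = k\<close>; otherwise \<open>f j k\<close> is zero.\<close>
    proof (cases "j = k")
      case True
      have w': "\<mu> - \<alpha> k - \<alpha> p + \<alpha> j = \<mu> - \<alpha> p" by (simp add: True weight_simps)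
      show ?thesis
        using 12 unfolding 11[symmetric] E_F'[OF p p x, symmetric] w'
        using F_in[OF p x] p by (simp add: E_add E_scale scale_in)
    next
      case False
      then show ?thesis using 11 by (simp add: f_def)
    qed
  qed
  have 2: "E j (\<mu> - \<alpha> k) (F\<^sub>2 k (\<mu> + \<alpha> p) (E p \<mu> x) + e k \<mu> *s F k \<mu> x) =
      F\<^sub>2 k (\<mu> + \<alpha> j + \<alpha> p) (E j (\<mu> + \<alpha> p) (E p \<mu> x)) + f j k (\<mu> + \<alpha> p) *s F p (\<mu> + \<alpha> p) (E p \<mu> x)
      + e k \<mu> *s (F k (\<mu> + \<alpha> j) (E j \<mu> x) + d j k \<mu> *s x)"
    using E_F2[OF j k(1) Ex(2)] F2_in[OF k(1) Ex(2)] F_in[OF k(1) x] j(1)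
    unfolding w E_F'[OF j(1) k(1) x, symmetric] by (simp add: E_add E_scale scale_in)
  have 3: "F\<^sub>2 k (\<mu> + \<alpha> j + \<alpha> p) (E\<^sub>2 j \<mu> x) = F\<^sub>2 k (\<mu> + \<alpha> j + \<alpha> p) (E p (\<mu> + \<alpha> j) (E j \<mu> x))
      - ?s *s F\<^sub>2 k (\<mu> + \<alpha> j + \<alpha> p) (E j (\<mu> + \<alpha> p) (E p \<mu> x))"
    using F2_add[OF k(1) E2_in[OF j(1) x] scale_in[OF EE_in[OF j(1) p x, unfolded w], of ?s]]
      F2_scale[OF k(1) EE_in[OF j(1) p x, unfolded w], of ?s]
    by (simp add: E\<^sub>2_def algebra_simps)
  show ?thesis
    unfolding 3 unfolding E\<^sub>2_def E_F2[OF j k(1) x] Ep_F2[OF k x] w 1 2 unfolding e f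
    by (simp add: algebra_simps)
qed

abbreviation adj :: "'i \<Rightarrow> bool"
  where "adj j \<equiv> \<chi> (\<alpha> p) (\<alpha> j) * \<chi> (\<alpha> j) (\<alpha> p) \<noteq> 1"

text \<open>\<open>F p\<close> merely q-commutes with the other new lowering operators. The factor
  \<open>\<chi> \<mu> (\<alpha> p)\<close> turns this into genuine commutation, as the bracket
  relation of \<open>qsys\<close> demands of a raising operator; the factor in \<open>F' p\<close>
  does the same for \<open>E p\<close>.\<close>

definition E' :: "'i \<Rightarrow> 'g \<Rightarrow> 'v \<Rightarrow> 'v"
  where "E' j \<mu> x = (if j = p then \<chi> \<mu> (\<alpha> p) *s F p \<mu> x else if adj j then E\<^sub>2 j \<mu> x else E j \<mu> x)"

definition F' :: "'i \<Rightarrow> 'g \<Rightarrow> 'v \<Rightarrow> 'v"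
  where "F' j \<mu> x = (if j = p then inverse (\<chi> (\<alpha> p) \<mu>) *s E p \<mu> x else if adj j then F\<^sub>2 j \<mu> x else F j \<mu> x)"

text \<open>Read off from the bracket of \<open>E' j\<close> with \<open>F' j\<close>. At
  \<open>p\<close> the roles of \<open>E\<close> and \<open>F\<close> are exchanged, which swaps the
  two terms of the bracket and brings in the factor \<open>- lam p\<close>.\<close>

definition b' :: "'i \<Rightarrow> 'k"
  where "b' j = (if j = p then - lam p * b p
     else if adj j then b p * b j * (1 - \<chi> (\<alpha> p) (\<alpha> j) * \<chi> (\<alpha> j) (\<alpha> p)) else b j)"

text \<open>If exactly one index is \<open>p\<close>, the claim is a q-commutation: for a neighbour
  of \<open>p\<close> it follows from the vanishing squares of \<open>E p\<close> and
  \<open>F p\<close>, otherwise from \<open>F_F_commute\<close> and \<open>E_E_commute\<close>. If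
  both are \<open>p\<close>, it is the old bracket up to the twist; the other cases are the bracket
  formulas above.\<close>

lemma E'_F':
  assumes j: "j \<in> I" and k: "k \<in> I" and x: "x \<in> L \<mu>"
  shows "E' j (\<mu> - reflect_root \<chi> p \<alpha> k) (F' k \<mu> x) = F' k (\<mu> + reflect_root \<chi> p \<alpha> j) (E' j \<mu> x)
    + (if j = k then (b' j * (inverse (\<chi> \<mu> (reflect_root \<chi> p \<alpha> j))
        - reflect_lam \<chi> p \<alpha> lam j * \<chi> (reflect_root \<chi> p \<alpha> j) \<mu>)) *s x else 0)"
proof -
  have Fp: "F p \<mu> x \<in> L (\<mu> - \<alpha> p)" and Ep: "E p \<mu> x \<in> L (\<mu> + \<alpha> p)"
    and Fk: "F k \<mu> x \<in> L (\<mu> - \<alpha> k)" and Ej: "E j \<mu> x \<in> L (\<mu> + \<alpha> j)"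
    using p j k x by (auto intro: E_in F_in)
  have pFF: "F p (\<mu> - \<alpha> k - \<alpha> p) (F\<^sub>2 k \<mu> x) = - \<chi> (\<alpha> k) (\<alpha> p) *s F p (\<mu> - \<alpha> p - \<alpha> k) (F k (\<mu> - \<alpha> p) (F p \<mu> x))"
    using FF_in[OF p k x] FF_in[OF k p x] p F_F_zero[OF p pp Fk]
    by (simp add: F\<^sub>2_def w2(2) F_diff F_scale scale_in)
  have F2F: "F\<^sub>2 k (\<mu> - \<alpha> p) (F p \<mu> x) = F p (\<mu> - \<alpha> p - \<alpha> k) (F k (\<mu> - \<alpha> p) (F p \<mu> x))"
    using F_F_zero[OF p pp x] k by (simp add: F\<^sub>2_def)
  have EEp: "E\<^sub>2 j (\<mu> + \<alpha> p) (E p \<mu> x) = E p (\<mu> + \<alpha> p + \<alpha> j) (E j (\<mu> + \<alpha> p) (E p \<mu> x))"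
    using E_E_zero[OF p pp x] j by (simp add: E\<^sub>2_def)
  have pEE: "E p (\<mu> + \<alpha> j + \<alpha> p) (E\<^sub>2 j \<mu> x) = - \<chi> (\<alpha> p) (\<alpha> j) *s E p (\<mu> + \<alpha> p + \<alpha> j) (E j (\<mu> + \<alpha> p) (E p \<mu> x))"
    using EE_in[OF p j x] EE_in[OF j p x] p E_E_zero[OF p pp Ej]
    by (simp add: E\<^sub>2_def w2(1) E_diff E_scale scale_in)
  consider (pp) "j = p" "k = p" | (pa) "j = p" "k \<noteq> p" "adj k" | (pn) "j = p" "k \<noteq> p" "\<not> adj k"
    | (ap) "j \<noteq> p" "adj j" "k = p" | (np) "j \<noteq> p" "\<not> adj j" "k = p"
    | (aa) "j \<noteq> p" "adj j" "k \<noteq> p" "adj k" | (an) "j \<noteq> p" "adj j" "k \<noteq> p" "\<not> adj k"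
    | (na) "j \<noteq> p" "\<not> adj j" "k \<noteq> p" "adj k" | (nn) "j \<noteq> p" "\<not> adj j" "k \<noteq> p" "\<not> adj k"
    by blast
  then show ?thesis
  proof cases
    case pp
    let ?r = "\<chi> \<mu> (\<alpha> p) * inverse (\<chi> (\<alpha> p) \<mu>)"
    have r: "\<chi> (\<mu> + \<alpha> p) (\<alpha> p) * inverse (\<chi> (\<alpha> p) \<mu>) = - ?r"
        "inverse (\<chi> (\<alpha> p) (\<mu> - \<alpha> p)) * \<chi> \<mu> (\<alpha> p) = - ?r"
      using \<open>\<chi> (\<alpha> p) (\<alpha> p) = - 1\<close> chi_nonzero by (simp_all add: chi_simps field_simps)
    have "E p (\<mu> - \<alpha> p) (F p \<mu> x) = F p (\<mu> + \<alpha> p) (E p \<mu> x) + d p p \<mu> *s x"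
      by (rule E_F'[OF p p x])
    moreover have "b' p * (inverse (\<chi> \<mu> (- \<alpha> p)) - inverse (lam p) * \<chi> (- \<alpha> p) \<mu>) = ?r * d p p \<mu>"
      using chi_nonzero lam_nonzero[OF p] by (simp add: b'_def d_def chi_simps field_simps)
    ultimately show ?thesis
      using Fp Ep p unfolding pp
      by (simp add: E'_def F'_def reflect_root_def reflect_lam_def E_scale F_scale r)
        (simp add: algebra_simps)
  next
    case pa
    have "\<chi> (\<mu> - (\<alpha> k + \<alpha> p)) (\<alpha> p) * \<chi> (\<alpha> k) (\<alpha> p) = - \<chi> \<mu> (\<alpha> p)"
      using \<open>\<chi> (\<alpha> p) (\<alpha> p) = - 1\<close> chi_nonzero by (simp add: chi_simps)
    with pa show ?thesis
      using pFF F2F F2_scale[OF k Fp] by (simp add: E'_def F'_def reflect_root_def diff_diff_eq)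
  next
    case pn
    have "\<chi> (\<mu> - \<alpha> k) (\<alpha> p) * \<chi> (\<alpha> k) (\<alpha> p) = \<chi> \<mu> (\<alpha> p)"
      using chi_nonzero by (simp add: chi_simps)
    with pn show ?thesis
      using F_F_commute[OF p k _ _ x] F_scale[OF k Fp] by (simp add: E'_def F'_def reflect_root_def)
  next
    case ap
    have "inverse (\<chi> (\<alpha> p) (\<mu> + (\<alpha> j + \<alpha> p))) * \<chi> (\<alpha> p) (\<alpha> j) = - inverse (\<chi> (\<alpha> p) \<mu>)"
      using \<open>\<chi> (\<alpha> p) (\<alpha> p) = - 1\<close> chi_nonzero by (simp add: chi_simps)
    with ap show ?thesis
      using pEE EEp E2_scale[OF j Ep] by (simp add: E'_def F'_def reflect_root_def add.assoc)
  next
    case np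
    have "inverse (\<chi> (\<alpha> p) (\<mu> + \<alpha> j)) * \<chi> (\<alpha> p) (\<alpha> j) = inverse (\<chi> (\<alpha> p) \<mu>)"
      using chi_nonzero by (simp add: chi_simps)
    with np show ?thesis
      using E_E_commute[OF p j _ _ x] E_scale[OF j Ep] by (simp add: E'_def F'_def reflect_root_def)
  next
    case aa
    have "f j j \<mu> * d p p \<mu> - \<chi> (\<alpha> p) (\<alpha> j) * e j \<mu> * d j j \<mu> =
        b' j * (inverse (\<chi> \<mu> (\<alpha> j + \<alpha> p)) - lam j * lam p * \<chi> (\<alpha> j + \<alpha> p) \<mu>)"
      using aa chi_nonzero by (simp add: f_def e_def d_def b'_def chi_simps field_simps)
    moreover have "f j k \<mu> * d p p \<mu> - \<chi> (\<alpha> p) (\<alpha> j) * e k \<mu> * d j k \<mu> = 0" if "j \<noteq> k"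
      using that by (simp add: f_def d_def)
    ultimately show ?thesis
      using aa E2_F2[OF j _ k _ x]
      by (cases "j = k") (simp_all add: E'_def F'_def reflect_root_def reflect_lam_def diff_diff_eq add.assoc)
  next
    case an
    then show ?thesis
      using E2_F[OF j k _ _ x] by (auto simp add: E'_def F'_def reflect_root_def reflect_lam_def add.assoc)
  next
    case na
    then show ?thesis
      using E_F2[OF j _ k x] by (auto simp add: f_def E'_def F'_def reflect_root_def reflect_lam_def diff_diff_eq)
  next
    case nn
    then show ?thesis
      using E_F'[OF j k x] by (auto simp add: d_def b'_def E'_def F'_def reflect_root_def reflect_lam_def diff_diff_eq)
  qed
qed

text \<open>The weight spaces stay the same and only the notion of a highest vector changes.
  \<open>F p \<mu>\<^sub>0 v\<close> vanishes exactly if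
  \<open>\<kappa> p \<mu>\<^sub>0 = 1\<close>; otherwise the new raising operators kill it, as
  \<open>F p\<close> squares to zero and every other \<open>E i\<close> commutes with
  \<open>F p\<close>. The assumption provides a height for the new simple roots.\<close>

theorem odd_reflection:
  assumes "\<exists>h::'g \<Rightarrow> int. (\<forall>x y. h (x + y) = h x + h y) \<and> (\<forall>i\<in>I. h (reflect_root \<chi> p \<alpha> i) > 0)"
  shows "\<exists>b E F v. qsys scale \<chi> I (reflect_root \<chi> p \<alpha>) (reflect_lam \<chi> p \<alpha> lam) b E F L
    (if \<kappa> p \<mu>\<^sub>0 = 1 then \<mu>\<^sub>0 else \<mu>\<^sub>0 - \<alpha> p) v"
proof -
  have d0: "d p p \<mu>\<^sub>0 = 0 \<longleftrightarrow> \<kappa> p \<mu>\<^sub>0 = 1"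
    using chi_nonzero b_nonzero[OF p] by (simp add: d_def \<kappa>_def field_simps)
  have Fv_in: "F p \<mu>\<^sub>0 v \<in> L (\<mu>\<^sub>0 - \<alpha> p)" by (rule F_in[OF p v_in])
  have E_Fv: "E i (\<mu>\<^sub>0 - \<alpha> p) (F p \<mu>\<^sub>0 v) = d i p \<mu>\<^sub>0 *s v" if "i \<in> I" for i
    using E_F'[OF that p v_in] E_v[OF that] p by simp
  have Fv_zero: "F p \<mu>\<^sub>0 v = 0" if "\<kappa> p \<mu>\<^sub>0 = 1"
  proof (rule ccontr)
    assume nz: "F p \<mu>\<^sub>0 v \<noteq> 0"
    have "E i (\<mu>\<^sub>0 - \<alpha> p) (F p \<mu>\<^sub>0 v) = 0" if "i \<in> I" for i
      using E_Fv[OF that] \<open>\<kappa> p \<mu>\<^sub>0 = 1\<close> d0 by (cases "i = p") (auto simp: d_def)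
    from singular_height[OF Fv_in nz this] show False using height_pos[OF p] by (simp add: height_diff)
  qed
  define \<mu>' where "\<mu>' = (if \<kappa> p \<mu>\<^sub>0 = 1 then \<mu>\<^sub>0 else \<mu>\<^sub>0 - \<alpha> p)"
  define v' where "v' = (if \<kappa> p \<mu>\<^sub>0 = 1 then v else F p \<mu>\<^sub>0 v)"
  let ?\<alpha> = "reflect_root \<chi> p \<alpha>"
  have "qsys scale \<chi> I ?\<alpha> (reflect_lam \<chi> p \<alpha> lam) b' E' F' L \<mu>' v'"
  proof unfold_locales
    fix i \<mu> x assume i: "i \<in> I" and x: "x \<in> L \<mu>"
    show "E' i \<mu> x \<in> L (\<mu> + ?\<alpha> i)"
      using E_in[OF i x] F_in[OF p x] E2_in[OF i x]
      by (simp add: E'_def reflect_root_def scale_in add.assoc)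
    show "F' i \<mu> x \<in> L (\<mu> - ?\<alpha> i)"
      using F_in[OF i x] E_in[OF p x] F2_in[OF i x]
      by (simp add: F'_def reflect_root_def scale_in diff_diff_eq)
    show "E' i \<mu> (a *s x) = a *s E' i \<mu> x" for a
      using E_scale[OF i x] F_scale[OF p x] E2_scale[OF i x] by (simp add: E'_def mult.commute)
    show "F' i \<mu> (a *s x) = a *s F' i \<mu> x" for a
      using F_scale[OF i x] E_scale[OF p x] F2_scale[OF i x] by (simp add: F'_def mult.commute)
    fix y assume y: "y \<in> L \<mu>"
    show "E' i \<mu> (x + y) = E' i \<mu> x + E' i \<mu> y"
      using E_add[OF i x y] F_add[OF p x y] E2_add[OF i x y] by (simp add: E'_def algebra_simps)
    show "F' i \<mu> (x + y) = F' i \<mu> x + F' i \<mu> y"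
      using F_add[OF i x y] E_add[OF p x y] F2_add[OF i x y] by (simp add: F'_def algebra_simps)
  next
    show "v' \<in> L \<mu>'" using v_in Fv_in by (simp add: v'_def \<mu>'_def)
    show "v' \<noteq> 0"
    proof
      assume "v' = 0"
      with v_nonzero have "\<kappa> p \<mu>\<^sub>0 \<noteq> 1" "F p \<mu>\<^sub>0 v = 0" by (auto simp: v'_def split: if_splits)
      with E_Fv[OF p] d0 v_nonzero p show False by auto
    qed
    fix i assume i: "i \<in> I"
    show "E' i \<mu>' v' = 0"
    proof (cases "\<kappa> p \<mu>\<^sub>0 = 1")
      case True
      then show ?thesis
        using E_v i p by (simp add: E'_def \<mu>'_def v'_def E\<^sub>2_def Fv_zero)
    next
      case False
      have "d i p \<mu>\<^sub>0 = 0" if "i \<noteq> p"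
        using that by (simp add: d_def)
      moreover have "E i \<mu>\<^sub>0 (d p p \<mu>\<^sub>0 *s v) = 0"
        using E_scale[OF i v_in] E_v[OF i] by simp
      ultimately show ?thesis
        using False F_F_zero[OF p pp v_in] i p
        by (simp add: E'_def \<mu>'_def v'_def E\<^sub>2_def E_Fv)
    qed
  next
    fix S y \<nu> \<mu>
    assume S: "\<And>\<mu>. subspace (S \<mu>) \<and> S \<mu> \<subseteq> L \<mu>"
      and SE: "\<And>i \<mu> x. \<lbrakk>i \<in> I; x \<in> S \<mu>\<rbrakk> \<Longrightarrow> E' i \<mu> x \<in> S (\<mu> + ?\<alpha> i)"
      and SF: "\<And>i \<mu> x. \<lbrakk>i \<in> I; x \<in> S \<mu>\<rbrakk> \<Longrightarrow> F' i \<mu> x \<in> S (\<mu> - ?\<alpha> i)"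
      and y: "y \<in> S \<nu>" "y \<noteq> 0"
    have Sscale: "a *s x \<in> S \<mu>" if "x \<in> S \<mu>" for a x \<mu>
      using S that by (blast intro: subspace_scale)
    have Sdiff: "x - y \<in> S \<mu>" if "x \<in> S \<mu>" "y \<in> S \<mu>" for x y \<mu>
      using S that by (blast intro: subspace_diff)
    \<comment> \<open>Stability under the new root vectors implies stability under the old ones:
      \<open>E p\<close> and \<open>F p\<close> are recovered up to a nonzero scalar, and for a
      neighbour \<open>i\<close> of \<open>p\<close> the brackets of the new vectors with
      \<open>F p\<close> and \<open>E p\<close> return nonzero multiples of \<open>E i\<close> and
      \<open>F i\<close>.\<close>
    have Ep_S: "E p \<mu> x \<in> S (\<mu> + \<alpha> p)" if "x \<in> S \<mu>" for \<mu> x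
      using Sscale[OF SF[OF p that], of "\<chi> (\<alpha> p) \<mu>"] chi_nonzero by (simp add: F'_def reflect_root_def)
    have Fp_S: "F p \<mu> x \<in> S (\<mu> - \<alpha> p)" if "x \<in> S \<mu>" for \<mu> x
      using Sscale[OF SE[OF p that], of "inverse (\<chi> \<mu> (\<alpha> p))"] chi_nonzero by (simp add: E'_def reflect_root_def)
    have E_S: "E i \<mu> x \<in> S (\<mu> + \<alpha> i)" and F_S: "F i \<mu> x \<in> S (\<mu> - \<alpha> i)" if i: "i \<in> I" and x: "x \<in> S \<mu>" for i \<mu> x
    proof -
      have xL: "x \<in> L \<mu>" using S x by blast
      show "E i \<mu> x \<in> S (\<mu> + \<alpha> i)"
      proof (cases "i = p \<or> \<not> adj i")
        case True
        then show ?thesis using Ep_S[OF x] SE[OF i x] by (auto simp: E'_def reflect_root_def split: if_splits)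
      next
        case False
        define k where "k = b p * inverse (\<chi> \<mu> (\<alpha> p)) * (inverse (\<chi> (\<alpha> i) (\<alpha> p)) - \<chi> (\<alpha> p) (\<alpha> i))"
        have k: "k \<noteq> 0" using False chi_nonzero b_nonzero[OF p] by (auto simp: k_def field_simps)
        have "E\<^sub>2 i (\<mu> - \<alpha> p) (F p \<mu> x) - F p (\<mu> + (\<alpha> i + \<alpha> p)) (E\<^sub>2 i \<mu> x) \<in> S (\<mu> + \<alpha> i)"
          using SE[OF i Fp_S[OF x]] Fp_S[OF SE[OF i x]] False
          by (intro Sdiff) (simp_all add: E'_def reflect_root_def algebra_simps)
        from Sscale[OF this, of "inverse k"] E2_Fp[OF i _ xL, folded k_def] False k
        show ?thesis by (simp add: add.assoc)
      qed
      show "F i \<mu> x \<in> S (\<mu> - \<alpha> i)"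
      proof (cases "i = p \<or> \<not> adj i")
        case True
        then show ?thesis using Fp_S[OF x] SF[OF i x] by (auto simp: F'_def reflect_root_def split: if_splits)
      next
        case False
        have k: "e i \<mu> \<noteq> 0" using False chi_nonzero b_nonzero[OF p] lam_nonzero[OF p] by (auto simp: e_def field_simps)
        have "E p (\<mu> - \<alpha> i - \<alpha> p) (F\<^sub>2 i \<mu> x) - F\<^sub>2 i (\<mu> + \<alpha> p) (E p \<mu> x) \<in> S (\<mu> - \<alpha> i)"
          using Ep_S[OF SF[OF i x]] SF[OF i Ep_S[OF x]] False
          by (intro Sdiff) (simp_all add: F'_def reflect_root_def algebra_simps)
        from Sscale[OF this, of "inverse (e i \<mu>)"] Ep_F2[OF i _ xL] False k
        show ?thesis by simp
      qed
    qed
    show "L \<mu> \<subseteq> S \<mu>" by (rule irreducible[OF S E_S F_S y])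
  next
    show "reflect_lam \<chi> p \<alpha> lam i \<noteq> 0" if "i \<in> I" for i
      using that lam_nonzero p by (simp add: reflect_lam_def)
    show "b' i \<noteq> 0" if "i \<in> I" for i
      using that lam_nonzero b_nonzero p by (simp add: b'_def)
  qed (use assms E'_F' in \<open>auto simp: chi_add_left chi_add_right chi_nonzero subspace_L\<close>)
  then show ?thesis unfolding \<mu>'_def by blast
qed

end

section \<open>Strings of weights along a single root, and integrability\<close>

lemma chi_rep: "\<chi> (rep k x) y = \<chi> x y ^ k" "\<chi> x (rep k y) = \<chi> x y ^ k"
  by (induction k) (simp_all add: chi_simps)

lemma height_rep: "height (rep k x) = int k * height x"
  using height_diff[of 0 0] by (induction k) (simp_all add: height_add algebra_simps)

primrec Fpow :: "'i \<Rightarrow> nat \<Rightarrow> 'g \<Rightarrow> 'v \<Rightarrow> 'v"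
  where "Fpow i 0 \<mu> x = x" | "Fpow i (Suc k) \<mu> x = Fpow i k (\<mu> - \<alpha> i) (F i \<mu> x)"

primrec Epow :: "'i \<Rightarrow> nat \<Rightarrow> 'g \<Rightarrow> 'v \<Rightarrow> 'v"
  where "Epow i 0 \<mu> x = x" | "Epow i (Suc k) \<mu> x = E i (\<mu> + rep k (\<alpha> i)) (Epow i k \<mu> x)"

lemma Fpow_Suc: "Fpow i (Suc k) \<mu> x = F i (\<mu> - rep k (\<alpha> i)) (Fpow i k \<mu> x)"
proof (induction k arbitrary: \<mu> x)
  case (Suc k)
  have "Fpow i (Suc (Suc k)) \<mu> x = Fpow i (Suc k) (\<mu> - \<alpha> i) (F i \<mu> x)"
    by (rule Fpow.simps)
  also have "\<dots> = F i (\<mu> - \<alpha> i - rep k (\<alpha> i)) (Fpow i (Suc k) \<mu> x)"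
    unfolding Suc[of "\<mu> - \<alpha> i"] Fpow.simps(2)[of i k \<mu>] ..
  finally show ?case by (simp add: diff_diff_eq add.commute)
qed simp

context
  fixes i
  assumes i: "i \<in> I" and not_root: "\<And>n. \<chi> (\<alpha> i) (\<alpha> i) ^ Suc n \<noteq> 1"
begin

abbreviation qi :: 'k
  where "qi \<equiv> \<chi> (\<alpha> i) (\<alpha> i)"

lemma Fpow_in: "x \<in> L \<mu> \<Longrightarrow> Fpow i k \<mu> x \<in> L (\<mu> - rep k (\<alpha> i))"
proof (induction k arbitrary: \<mu> x)
  case (Suc k)
  from Suc.IH[OF F_in[OF i Suc.prems]] show ?case by (simp add: diff_diff_eq add.commute)
qed simp

lemma Epow_in: "x \<in> L \<mu> \<Longrightarrow> Epow i k \<mu> x \<in> L (\<mu> + rep k (\<alpha> i))"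
  by (induction k) (auto simp: add.assoc[symmetric] intro: E_in[OF i])

lemma Fpow_zero [simp]: "Fpow i k \<mu> 0 = 0"
  by (induction k arbitrary: \<mu>) (simp_all add: i)

lemma Fpow_add: "\<lbrakk>x \<in> L \<mu>; y \<in> L \<mu>\<rbrakk> \<Longrightarrow> Fpow i k \<mu> (x + y) = Fpow i k \<mu> x + Fpow i k \<mu> y"
  by (induction k arbitrary: \<mu> x y) (simp_all add: F_add[OF i] F_in[OF i])

lemma Fpow_scale: "x \<in> L \<mu> \<Longrightarrow> Fpow i k \<mu> (a *s x) = a *s Fpow i k \<mu> x"
  by (induction k arbitrary: \<mu> x) (simp_all add: F_scale[OF i] F_in[OF i])

lemma Fpow_zero_mono: "\<lbrakk>Fpow i k \<mu> x = 0; k \<le> l\<rbrakk> \<Longrightarrow> Fpow i l \<mu> x = 0"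
proof (induction l)
  case (Suc l)
  then show ?case by (cases "k = Suc l") (auto simp: Fpow_Suc i simp del: Fpow.simps)
qed simp

text \<open>The sum is the scalar left when \<open>E i\<close> meets a power of \<open>F i\<close>
  on a singular vector. Both terms of \<open>d i i\<close> run through geometric progressions;
  clearing the denominator 1 - q leaves a q-number, nonzero away from roots of unity, times a factor
  that vanishes exactly if \<open>\<kappa> i \<mu> = qi ^ n\<close>.\<close>

lemma sum_d_down: "(1 - qi) * (\<Sum>l<Suc n. d i i (\<mu> - rep l (\<alpha> i))) =
    b i * (1 - qi ^ Suc n) * (inverse (\<chi> \<mu> (\<alpha> i)) - lam i * \<chi> (\<alpha> i) \<mu> / qi ^ n)"
proof (induction n)
  case (Suc n)
  have eq: "d i i (\<mu> - rep (Suc n) (\<alpha> i)) = b i * (inverse (\<chi> \<mu> (\<alpha> i)) * qi ^ Suc n - lam i * \<chi> (\<alpha> i) \<mu> / qi ^ Suc n)"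
    by (simp add: d_def chi_simps chi_rep field_simps del: rep.simps power_Suc)
  show ?case
    unfolding sum.lessThan_Suc[of _ "Suc n"] distrib_left Suc eq
    using chi_nonzero by (simp add: field_simps)
qed (simp add: d_def)

lemma sum_d_up: "(1 - qi) * (\<Sum>l<Suc n. d i i (\<mu> + rep l (\<alpha> i))) =
    b i * (1 - qi ^ Suc n) * (inverse (\<chi> \<mu> (\<alpha> i)) / qi ^ n - lam i * \<chi> (\<alpha> i) \<mu>)"
proof (induction n)
  case (Suc n)
  have eq: "d i i (\<mu> + rep (Suc n) (\<alpha> i)) = b i * (inverse (\<chi> \<mu> (\<alpha> i)) / qi ^ Suc n - lam i * \<chi> (\<alpha> i) \<mu> * qi ^ Suc n)"
    by (simp add: d_def chi_simps chi_rep field_simps del: rep.simps power_Suc)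
  show ?case
    unfolding sum.lessThan_Suc[of _ "Suc n"] distrib_left Suc eq
    using chi_nonzero by (simp add: field_simps)
qed (simp add: d_def)

lemma sum_d_down_zero: "(\<Sum>l<Suc n. d i i (\<mu> - rep l (\<alpha> i))) = 0 \<longleftrightarrow> \<kappa> i \<mu> = qi ^ n"
proof -
  have "(\<Sum>l<Suc n. d i i (\<mu> - rep l (\<alpha> i))) = 0 \<longleftrightarrow> (1 - qi) * (\<Sum>l<Suc n. d i i (\<mu> - rep l (\<alpha> i))) = 0"
    using not_root[of 0] by simp
  also have "\<dots> \<longleftrightarrow> inverse (\<chi> \<mu> (\<alpha> i)) - lam i * \<chi> (\<alpha> i) \<mu> / qi ^ n = 0"
    unfolding sum_d_down using not_root[of n] b_nonzero[OF i] by simp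
  also have "\<dots> \<longleftrightarrow> \<kappa> i \<mu> = qi ^ n"
    using chi_nonzero by (auto simp: \<kappa>_def field_simps)
  finally show ?thesis .
qed

lemma sum_d_up_zero: "(\<Sum>l<Suc n. d i i (\<mu> + rep l (\<alpha> i))) = 0 \<longleftrightarrow> \<kappa> i \<mu> * qi ^ n = 1"
proof -
  have "(\<Sum>l<Suc n. d i i (\<mu> + rep l (\<alpha> i))) = 0 \<longleftrightarrow> (1 - qi) * (\<Sum>l<Suc n. d i i (\<mu> + rep l (\<alpha> i))) = 0"
    using not_root[of 0] by simp
  also have "\<dots> \<longleftrightarrow> inverse (\<chi> \<mu> (\<alpha> i)) / qi ^ n - lam i * \<chi> (\<alpha> i) \<mu> = 0"
    unfolding sum_d_up using not_root[of n] b_nonzero[OF i] by simp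
  also have "\<dots> \<longleftrightarrow> \<kappa> i \<mu> * qi ^ n = 1"
    using chi_nonzero by (auto simp: \<kappa>_def field_simps)
  finally show ?thesis .
qed

lemma E_Fpow:
  assumes y: "y \<in> L \<mu>" "E i \<mu> y = 0"
  shows "E i (\<mu> - rep (Suc n) (\<alpha> i)) (Fpow i (Suc n) \<mu> y) = (\<Sum>l<Suc n. d i i (\<mu> - rep l (\<alpha> i))) *s Fpow i n \<mu> y"
proof (induction n)
  case 0
  then show ?case using E_F'[OF i i y(1)] y(2) i by simp
next
  case (Suc n)
  let ?\<nu> = "\<mu> - rep (Suc n) (\<alpha> i)"
  have w: "\<mu> - rep (Suc (Suc n)) (\<alpha> i) = ?\<nu> - \<alpha> i" "?\<nu> + \<alpha> i = \<mu> - rep n (\<alpha> i)"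
    by (simp_all add: weight_simps)
  have "E i (\<mu> - rep (Suc (Suc n)) (\<alpha> i)) (Fpow i (Suc (Suc n)) \<mu> y) =
      F i (\<mu> - rep n (\<alpha> i)) (E i ?\<nu> (Fpow i (Suc n) \<mu> y)) + d i i ?\<nu> *s Fpow i (Suc n) \<mu> y"
    unfolding Fpow_Suc[of i "Suc n"] w(1) E_F'[OF i i Fpow_in[OF y(1)]] w(2) ..
  also have "F i (\<mu> - rep n (\<alpha> i)) (E i ?\<nu> (Fpow i (Suc n) \<mu> y)) =
      (\<Sum>l<Suc n. d i i (\<mu> - rep l (\<alpha> i))) *s Fpow i (Suc n) \<mu> y"
    unfolding Suc unfolding F_scale[OF i Fpow_in[OF y(1)]] unfolding Fpow_Suc[of i n] ..
  finally show ?case by (simp add: scale_left_distrib del: Fpow.simps rep.simps)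
qed

lemma F_Epow:
  assumes y: "y \<in> L \<mu>" "F i \<mu> y = 0"
  shows "F i (\<mu> + rep (Suc n) (\<alpha> i)) (Epow i (Suc n) \<mu> y) = - (\<Sum>l<Suc n. d i i (\<mu> + rep l (\<alpha> i))) *s Epow i n \<mu> y"
proof (induction n)
  case 0
  then show ?case using E_F'[OF i i y(1)] y(2) i by (simp add: add_eq_0_iff2)
next
  case (Suc n)
  let ?\<nu> = "\<mu> + rep (Suc n) (\<alpha> i)"
  have w: "\<mu> + rep (Suc (Suc n)) (\<alpha> i) = ?\<nu> + \<alpha> i" "?\<nu> - \<alpha> i = \<mu> + rep n (\<alpha> i)"
    by (simp_all add: weight_simps)
  have "F i (\<mu> + rep (Suc (Suc n)) (\<alpha> i)) (Epow i (Suc (Suc n)) \<mu> y) =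
      E i (\<mu> + rep n (\<alpha> i)) (F i ?\<nu> (Epow i (Suc n) \<mu> y)) - d i i ?\<nu> *s Epow i (Suc n) \<mu> y"
    using E_F'[OF i i Epow_in[OF y(1), of "Suc n"]]
    unfolding Epow.simps(2)[of i "Suc n"] w by simp
  also have "E i (\<mu> + rep n (\<alpha> i)) (F i ?\<nu> (Epow i (Suc n) \<mu> y)) =
      - (\<Sum>l<Suc n. d i i (\<mu> + rep l (\<alpha> i))) *s Epow i (Suc n) \<mu> y"
    unfolding Suc unfolding E_scale[OF i Epow_in[OF y(1)]] unfolding Epow.simps(2)[of i n] ..
  finally show ?case by (simp add: scale_left_distrib scale_left_diff_distrib del: Epow.simps rep.simps)
qed

text \<open>\<open>E i\<close> takes each power back to a multiple of the previous one, and the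
  multiple is nonzero because \<open>qi ^ h\<close> differs from all smaller powers.\<close>

lemma Fpow_nonzero:
  assumes y: "y \<in> L \<mu>" "E i \<mu> y = 0" "y \<noteq> 0" and "\<kappa> i \<mu> = qi ^ h" "k \<le> h"
  shows "Fpow i k \<mu> y \<noteq> 0"
  using assms(5)
proof (induction k)
  case (Suc k)
  have "qi ^ h \<noteq> qi ^ k"
  proof
    assume "qi ^ h = qi ^ k"
    moreover have "qi ^ h = qi ^ k * qi ^ Suc (h - Suc k)"
      using Suc.prems by (simp add: power_add[symmetric] del: power_Suc)
    ultimately show False using not_root chi_nonzero by (simp del: power_Suc)
  qed
  then have "(\<Sum>l<Suc k. d i i (\<mu> - rep l (\<alpha> i))) \<noteq> 0"
    unfolding sum_d_down_zero assms(4) .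
  then have "(\<Sum>l<Suc k. d i i (\<mu> - rep l (\<alpha> i))) *s Fpow i k \<mu> y \<noteq> 0"
    using Suc by simp
  then show ?case
    unfolding E_Fpow[OF y(1,2), of k, symmetric] using i by (metis E_zero)
qed (use y in simp)

lemma Epow_nonzero:
  assumes y: "y \<in> L \<mu>" "F i \<mu> y = 0" "y \<noteq> 0" and "\<kappa> i \<mu> * qi ^ h = 1" "k \<le> h"
  shows "Epow i k \<mu> y \<noteq> 0"
  using assms(5)
proof (induction k)
  case (Suc k)
  have "\<kappa> i \<mu> * qi ^ k \<noteq> 1"
  proof
    assume "\<kappa> i \<mu> * qi ^ k = 1"
    moreover have "qi ^ h = qi ^ k * qi ^ Suc (h - Suc k)"
      using Suc.prems by (simp add: power_add[symmetric] del: power_Suc)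
    ultimately have "qi ^ Suc (h - Suc k) = 1"
      using assms(4) by (simp add: mult.assoc[symmetric] del: power_Suc)
    then show False using not_root by blast
  qed
  then have "(\<Sum>l<Suc k. d i i (\<mu> + rep l (\<alpha> i))) \<noteq> 0"
    unfolding sum_d_up_zero .
  then have "- (\<Sum>l<Suc k. d i i (\<mu> + rep l (\<alpha> i))) *s Epow i k \<mu> y \<noteq> 0"
    using Suc by (simp del: sum.lessThan_Suc)
  then show ?case
    unfolding F_Epow[OF y(1,2), of k, symmetric] using i by (metis F_zero)
qed (use y in simp)

lemma \<kappa>_shift: "\<kappa> i (\<mu> + rep k (\<alpha> i)) = \<kappa> i \<mu> * qi ^ (2 * k)"
    "\<kappa> i (\<mu> - rep k (\<alpha> i)) * qi ^ (2 * k) = \<kappa> i \<mu>"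
  unfolding mult_2 power_add using chi_nonzero by (simp_all add: \<kappa>_def chi_simps chi_rep field_simps)

text \<open>The weights \<open>\<mu>\<^sub>0 - rep k (\<alpha> i)\<close> are distinct, so some
  power of \<open>F i\<close> kills \<open>v\<close>. Applying \<open>E i\<close> to the first
  vanishing power shows that the scalar of \<open>sum_d_down\<close> is zero.\<close>

theorem finite_weights_power:
  assumes "finite {\<mu>. L \<mu> \<noteq> {0}}"
  shows "\<exists>n. \<kappa> i \<mu>\<^sub>0 = qi ^ n"
proof -
  have inj: "inj (\<lambda>k. \<mu>\<^sub>0 - rep k (\<alpha> i))"
  proof (rule injI)
    fix k l assume "\<mu>\<^sub>0 - rep k (\<alpha> i) = \<mu>\<^sub>0 - rep l (\<alpha> i)"
    then have "rep k (\<alpha> i) = rep l (\<alpha> i)" by simp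
    then have "int k * height (\<alpha> i) = int l * height (\<alpha> i)"
      by (metis height_rep)
    then show "k = l" using height_pos[OF i] by simp
  qed
  have "\<exists>k. Fpow i k \<mu>\<^sub>0 v = 0"
  proof (rule ccontr)
    assume "\<nexists>k. Fpow i k \<mu>\<^sub>0 v = 0"
    then have "range (\<lambda>k. \<mu>\<^sub>0 - rep k (\<alpha> i)) \<subseteq> {\<mu>. L \<mu> \<noteq> {0}}"
      using Fpow_in[OF v_in] by fastforce
    then show False using assms inj finite_subset finite_imageD[of _ UNIV] infinite_UNIV_nat by metis
  qed
  then obtain k where k: "Fpow i k \<mu>\<^sub>0 v = 0" "\<And>l. l < k \<Longrightarrow> Fpow i l \<mu>\<^sub>0 v \<noteq> 0"
    using exists_least_iff[of "\<lambda>k. Fpow i k \<mu>\<^sub>0 v = 0"] by blast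
  then obtain n where n: "k = Suc n" using v_nonzero by (cases k) auto
  have "(\<Sum>l<Suc n. d i i (\<mu>\<^sub>0 - rep l (\<alpha> i))) *s Fpow i n \<mu>\<^sub>0 v = 0"
    using E_Fpow[OF v_in E_v[OF i], of n] k(1) i unfolding n by (simp del: Fpow.simps)
  then have "(\<Sum>l<Suc n. d i i (\<mu>\<^sub>0 - rep l (\<alpha> i))) = 0"
    using k(2)[of n] n by simp
  then show ?thesis unfolding sum_d_down_zero by blast
qed

text \<open>Raising \<open>x\<close> by \<open>E i\<close> ends at some \<open>n\<close>, since
  heights are bounded. At the top of the string \<open>\<kappa>\<close> is
  \<open>qi ^ (h + 2 * n)\<close>, so \<open>F i\<close> can be applied up to h + 2n times without
  reaching zero; h + n applications arrive at the reflected weight.\<close>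

lemma reflection_weight_down:
  assumes x: "x \<in> L \<mu>" "x \<noteq> 0" and h: "\<kappa> i \<mu> = qi ^ h"
  shows "L (\<mu> - rep h (\<alpha> i)) \<noteq> {0}"
proof -
  have "Epow i k \<mu> x = 0" if "int k > height \<mu>\<^sub>0 - height \<mu>" for k
  proof (rule ccontr)
    assume "Epow i k \<mu> x \<noteq> 0"
    from height_le[OF Epow_in[OF x(1)] this] have "int k * height (\<alpha> i) \<le> height \<mu>\<^sub>0 - height \<mu>"
      by (simp add: height_add height_rep)
    moreover have "int k * 1 \<le> int k * height (\<alpha> i)"
      using height_pos[OF i] by (intro mult_left_mono) auto
    ultimately show False using that by simp
  qed
  then have "Epow i (nat (height \<mu>\<^sub>0 - height \<mu> + 1)) \<mu> x = 0" by simp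
  then have "\<exists>k. Epow i k \<mu> x = 0" ..
  then obtain k where k: "Epow i k \<mu> x = 0" "\<And>l. l < k \<Longrightarrow> Epow i l \<mu> x \<noteq> 0"
    using exists_least_iff[of "\<lambda>k. Epow i k \<mu> x = 0"] by blast
  then obtain n where n: "k = Suc n" using x by (cases k) auto
  let ?y = "Epow i n \<mu> x" and ?\<nu> = "\<mu> + rep n (\<alpha> i)"
  have y: "?y \<in> L ?\<nu>" "E i ?\<nu> ?y = 0" "?y \<noteq> 0"
    using Epow_in[OF x(1)] k n by auto
  have "\<kappa> i ?\<nu> = qi ^ (h + 2 * n)"
    unfolding \<kappa>_shift h by (simp add: power_add)
  from Fpow_nonzero[OF y this, of "h + n"] Fpow_in[OF y(1), of "h + n"]
  have "L (?\<nu> - rep (h + n) (\<alpha> i)) \<noteq> {0}" by auto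
  moreover have "?\<nu> - rep (h + n) (\<alpha> i) = \<mu> - rep h (\<alpha> i)" by (simp add: rep_add algebra_simps)
  ultimately show ?thesis by simp
qed

text \<open>Going up needs a lower end of each string, hence local nilpotence of \<open>F i\<close>.
  The Cartan integers 0 and -1 allowed here are those for which commutation or the Serre relation
  above is available.\<close>

context
  fixes r
  assumes integrable: "\<kappa> i \<mu>\<^sub>0 = qi ^ r"
    and cartan: "\<And>j. \<lbrakk>j \<in> I; j \<noteq> i\<rbrakk> \<Longrightarrow> \<chi> (\<alpha> i) (\<alpha> j) * \<chi> (\<alpha> j) (\<alpha> i) = 1 \<or>
      qi * (\<chi> (\<alpha> i) (\<alpha> j) * \<chi> (\<alpha> j) (\<alpha> i)) = 1"
begin

text \<open>This vector is singular: the scalar for \<open>E i\<close> vanishes by integrability,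
  and the other \<open>E j\<close> commute with \<open>F i\<close>. Being lower than the highest
  weight it must be zero.\<close>

lemma Fpow_v: "Fpow i (Suc r) \<mu>\<^sub>0 v = 0"
proof (rule ccontr)
  assume nz: "Fpow i (Suc r) \<mu>\<^sub>0 v \<noteq> 0"
  have "E j (\<mu>\<^sub>0 - rep n (\<alpha> i)) (Fpow i n \<mu>\<^sub>0 v) = 0" if "j \<in> I" "j \<noteq> i" for j n
  proof (induction n)
    case (Suc n)
    have w: "\<mu>\<^sub>0 - rep (Suc n) (\<alpha> i) = \<mu>\<^sub>0 - rep n (\<alpha> i) - \<alpha> i" by (simp add: weight_simps)
    show ?case
      unfolding w Fpow_Suc E_F'[OF that(1) i Fpow_in[OF v_in]] Suc using that i by (simp add: d_def)
  qed (use that E_v in simp)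
  moreover have "E i (\<mu>\<^sub>0 - rep (Suc r) (\<alpha> i)) (Fpow i (Suc r) \<mu>\<^sub>0 v) = 0"
    using sum_d_down_zero[of \<mu>\<^sub>0 r] E_Fpow[OF v_in E_v[OF i], of r] integrable by (simp del: Fpow.simps)
  ultimately have "E j (\<mu>\<^sub>0 - rep (Suc r) (\<alpha> i)) (Fpow i (Suc r) \<mu>\<^sub>0 v) = 0" if "j \<in> I" for j
    using that by (cases "j = i") (auto simp del: Fpow.simps rep.simps)
  from singular_height[OF Fpow_in[OF v_in] nz this] height_pos[OF i]
  show False by (simp add: height_diff height_rep del: rep.simps)
qed

text \<open>Applying \<open>F j\<close> costs one more power of \<open>F i\<close>. The relations
  rewrite the product so that \<open>F j\<close> acts on \<open>F i x\<close> or on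
  \<open>F i (F i x)\<close>, which are killed by one or two powers fewer; this is what the
  induction is on.\<close>

lemma Fpow_F:
  assumes j: "j \<in> I" "j \<noteq> i"
  shows "\<lbrakk>x \<in> L \<mu>; Fpow i k \<mu> x = 0\<rbrakk> \<Longrightarrow> Fpow i (Suc k) (\<mu> - \<alpha> j) (F j \<mu> x) = 0"
proof (induction k arbitrary: \<mu> x rule: less_induct)
  case (less k)
  note x = less.prems(1)
  show ?case
  proof (cases "\<chi> (\<alpha> i) (\<alpha> j) * \<chi> (\<alpha> j) (\<alpha> i) = 1")
    case True
    have comm: "F i (\<mu> - \<alpha> j) (F j \<mu> x) = \<chi> (\<alpha> j) (\<alpha> i) *s F j (\<mu> - \<alpha> i) (F i \<mu> x)"
      using F_F_commute[OF i j(1) _ True x] j by simp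
    have w: "\<mu> - \<alpha> j - \<alpha> i = \<mu> - \<alpha> i - \<alpha> j" by (simp add: weight_simps)
    have Fx: "F i \<mu> x \<in> L (\<mu> - \<alpha> i)" "F j (\<mu> - \<alpha> i) (F i \<mu> x) \<in> L (\<mu> - \<alpha> i - \<alpha> j)"
      using F_in i j(1) x by blast+
    have "Fpow i k (\<mu> - \<alpha> i - \<alpha> j) (F j (\<mu> - \<alpha> i) (F i \<mu> x)) = 0"
    proof (cases k)
      case 0
      then show ?thesis using less.prems i j by simp
    next
      case (Suc k')
      have "Fpow i k' (\<mu> - \<alpha> i) (F i \<mu> x) = 0" using less.prems(2) Suc by simp
      from less.IH[OF _ Fx(1) this] show ?thesis using Suc by simp
    qed
    then show ?thesis
      using Fpow_scale[OF Fx(2)] by (simp add: comm w)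
  next
    case False
    with cartan[OF j] obtain r s where serre: "F i (\<mu> - \<alpha> j - \<alpha> i) (F i (\<mu> - \<alpha> j) (F j \<mu> x)) =
        r *s F i (\<mu> - \<alpha> i - \<alpha> j) (F j (\<mu> - \<alpha> i) (F i \<mu> x)) + s *s F j (\<mu> - \<alpha> i - \<alpha> i) (F i (\<mu> - \<alpha> i) (F i \<mu> x))"
      using F_serre[OF i j(1) _ _ x] j(2) by blast
    show ?thesis
    proof (cases k)
      case 0
      then show ?thesis using less.prems i j by simp
    next
      case (Suc k')
      have w: "\<mu> - \<alpha> j - \<alpha> i - \<alpha> i = \<mu> - \<alpha> i - \<alpha> i - \<alpha> j" "\<mu> - \<alpha> i - \<alpha> j - \<alpha> i = \<mu> - \<alpha> i - \<alpha> i - \<alpha> j"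
        by (simp_all add: weight_simps)
      have in1: "F i (\<mu> - \<alpha> i - \<alpha> j) (F j (\<mu> - \<alpha> i) (F i \<mu> x)) \<in> L (\<mu> - \<alpha> i - \<alpha> i - \<alpha> j)"
        using FFF_in[OF i j(1) i x] unfolding w .
      have in2: "F j (\<mu> - \<alpha> i - \<alpha> i) (F i (\<mu> - \<alpha> i) (F i \<mu> x)) \<in> L (\<mu> - \<alpha> i - \<alpha> i - \<alpha> j)"
        using FFF_in[OF j(1) i i x] .
      have 1: "Fpow i k' (\<mu> - \<alpha> i) (F i \<mu> x) = 0" using less.prems(2) Suc by simp
      have 2: "Fpow i (Suc k') (\<mu> - \<alpha> i - \<alpha> j) (F j (\<mu> - \<alpha> i) (F i \<mu> x)) = 0"
        by (rule less.IH[OF _ F_in[OF i x] 1]) (simp add: Suc)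
      have 3: "Fpow i k' (\<mu> - \<alpha> i - \<alpha> i - \<alpha> j) (F j (\<mu> - \<alpha> i - \<alpha> i) (F i (\<mu> - \<alpha> i) (F i \<mu> x))) = 0"
      proof (cases k')
        case 0
        then show ?thesis using 1 i j by simp
      next
        case (Suc k'')
        have "Fpow i k'' (\<mu> - \<alpha> i - \<alpha> i) (F i (\<mu> - \<alpha> i) (F i \<mu> x)) = 0" using 1 Suc by simp
        from less.IH[OF _ FF_in[OF i i x] this] show ?thesis using Suc \<open>k = Suc k'\<close> by simp
      qed
      show ?thesis
        using 2 3 Fpow_scale[OF in1] Fpow_scale[OF in2] Fpow_add[OF scale_in[OF in1] scale_in[OF in2]]
        unfolding Suc by (simp add: serre w)
    qed
  qed
qed

lemma F_locally_nilpotent: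
  assumes "x \<in> L \<mu>"
  shows "\<exists>k. Fpow i k \<mu> x = 0"
proof -
  have "generated \<mu>\<^sub>0 v \<mu> x" by (rule singular_generates[OF v_in v_nonzero E_v assms])
  then show ?thesis
  proof induction
    case base
    then show ?case using Fpow_v by blast
  next
    case (zero \<mu>)
    then show ?case by simp
  next
    case (add \<mu> x x')
    then obtain k l where "Fpow i k \<mu> x = 0" "Fpow i l \<mu> x' = 0" by blast
    then have "Fpow i (max k l) \<mu> x = 0" "Fpow i (max k l) \<mu> x' = 0"
      by (auto intro: Fpow_zero_mono)
    then show ?case using add Fpow_add generated_in_L[OF v_in] by (metis add.right_neutral)
  next
    case (scale \<mu> x a)
    then show ?case using Fpow_scale generated_in_L[OF v_in] by (metis scale_zero_right)
  next
    case (step \<mu> x j \<mu>')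
    then obtain k where k: "Fpow i k \<mu> x = 0" by blast
    have x: "x \<in> L \<mu>" using step generated_in_L[OF v_in] by blast
    show ?case
    proof (cases "j = i")
      case True
      have "Fpow i (Suc k) \<mu> x = 0" using Fpow_zero_mono[OF k] by (meson le_SucI order_refl)
      then show ?thesis using step True by auto
    next
      case False
      then show ?thesis using Fpow_F[OF step.hyps(2) _ x k] step.hyps by blast
    qed
  qed
qed

text \<open>The mirror image of \<open>reflection_weight_down\<close>: local nilpotence gives a
  bottom of the string, n steps below, and h + n applications of \<open>E i\<close> lead from there
  to the reflected weight.\<close>

lemma reflection_weight_up:
  assumes x: "x \<in> L \<mu>" "x \<noteq> 0" and h: "\<kappa> i \<mu> * qi ^ h = 1"
  shows "L (\<mu> + rep h (\<alpha> i)) \<noteq> {0}"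
proof -
  obtain k where k: "Fpow i k \<mu> x = 0" "\<And>l. l < k \<Longrightarrow> Fpow i l \<mu> x \<noteq> 0"
    using exists_least_iff[of "\<lambda>k. Fpow i k \<mu> x = 0"] F_locally_nilpotent[OF x(1)] by blast
  then obtain n where n: "k = Suc n" using x by (cases k) auto
  let ?y = "Fpow i n \<mu> x" and ?\<nu> = "\<mu> - rep n (\<alpha> i)"
  have y: "?y \<in> L ?\<nu>" "F i ?\<nu> ?y = 0" "?y \<noteq> 0"
    using Fpow_in[OF x(1)] k n by (auto simp: Fpow_Suc simp del: Fpow.simps)
  have "\<kappa> i ?\<nu> * qi ^ (h + 2 * n) = 1"
    using \<kappa>_shift(2)[of \<mu> n] h by (simp add: power_add mult_ac)
  from Epow_nonzero[OF y this, of "h + n"] Epow_in[OF y(1), of "h + n"]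
  have "L (?\<nu> + rep (h + n) (\<alpha> i)) \<noteq> {0}" by auto
  moreover have "?\<nu> + rep (h + n) (\<alpha> i) = \<mu> + rep h (\<alpha> i)" by (simp add: rep_add algebra_simps)
  ultimately show ?thesis by simp
qed

end

end

end

section \<open>The root lattice of type D(m, n)\<close>

text \<open>
  The coordinates of \<open>a\<close> when \<open>\<alpha>\<^sub>k = \<epsilon>\<^sub>k - \<epsilon>\<^bsub>k+1\<^esub>\<close> for \<open>k < N\<close> and \<open>\<alpha>\<^sub>N = \<epsilon>\<^bsub>N-1\<^esub> + \<epsilon>\<^sub>N\<close>; on the
  root lattice \<open>lookup a 0 = 0\<close>, which makes the truncated \<open>k - 1\<close> harmless.
\<close>

definition crd :: "nat \<Rightarrow> weight \<Rightarrow> nat \<Rightarrow> int"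
  where "crd N a k = (Poly_Mapping.lookup a k + (if k + 1 = N then Poly_Mapping.lookup a N else 0))
    - Poly_Mapping.lookup a (k - 1)"

lemma crd_add: "crd N (a + b) k = crd N a k + crd N b k"
  and crd_minus: "crd N (- a) k = - crd N a k"
  and crd_diff: "crd N (a - b) k = crd N a k - crd N b k"
  and crd_zero [simp]: "crd N 0 k = 0"
  by (simp_all add: crd_def lookup_add lookup_minus)

lemma crd_rep: "crd N (rep h a) k = int h * crd N a k"
  by (induction h) (simp_all add: crd_add algebra_simps)

lemma lookup_simple_root: "Poly_Mapping.lookup (\<alpha>\<^sub>s i) k = (if k = i then 1 else 0)"
  by (simp add: simple_root_def)

lemma crd_simple_root:
  assumes "1 \<le> i" "i < N" "1 \<le> k" "k \<le> N"
  shows "crd N (\<alpha>\<^sub>s i) k = (if k = i then 1 else if k = i + 1 then -1 else 0)"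
  using assms by (auto simp: crd_def lookup_simple_root)

lemma crd_simple_root_last:
  assumes "2 \<le> N" "1 \<le> k" "k \<le> N"
  shows "crd N (\<alpha>\<^sub>s N) k = (if k + 1 = N \<or> k = N then 1 else 0)"
  using assms by (auto simp: crd_def lookup_simple_root)

lemma simple_root_in: "i \<in> {1..N} \<Longrightarrow> \<alpha>\<^sub>s i \<in> root_lattice N"
  by (auto simp: root_lattice_def simple_root_def)

lemma root_lattice_zero [simp]: "0 \<in> root_lattice N"
  and root_lattice_add: "\<lbrakk>a \<in> root_lattice N; b \<in> root_lattice N\<rbrakk> \<Longrightarrow> a + b \<in> root_lattice N"
  and root_lattice_minus: "a \<in> root_lattice N \<Longrightarrow> - a \<in> root_lattice N"
  and root_lattice_diff: "\<lbrakk>a \<in> root_lattice N; b \<in> root_lattice N\<rbrakk> \<Longrightarrow> a - b \<in> root_lattice N"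
  using keys_add[of a b] keys_diff[of a b] by (auto simp: root_lattice_def)

lemma root_lattice_induct [consumes 1, case_names zero simple diff]:
  assumes "a \<in> root_lattice N" "P 0" "\<And>i. i \<in> {1..N} \<Longrightarrow> P (\<alpha>\<^sub>s i)"
    and "\<And>a b. \<lbrakk>a \<in> root_lattice N; b \<in> root_lattice N; P a; P b\<rbrakk> \<Longrightarrow> P (a - b)"
  shows "P a"
proof -
  have "a \<in> root_lattice N \<and> P a"
  proof (rule frag_induction[of a "{1..N}" "\<lambda>a. a \<in> root_lattice N \<and> P a"])
    show "Poly_Mapping.keys a \<subseteq> {1..N}" using assms(1) by (simp add: root_lattice_def)
    show "frag_of i \<in> root_lattice N \<and> P (frag_of i)" if "i \<in> {1..N}" for i
      using assms(3)[OF that] simple_root_in[OF that] by (simp add: simple_root_def)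
  qed (use assms(2,4) root_lattice_diff in auto)
  then show ?thesis ..
qed

text \<open>Partial sums of the coordinates give the coefficients up to N - 2; the fork leaves the
  sum and the difference of the last two.\<close>

lemma crd_zero_imp:
  assumes "N \<ge> 2" "a \<in> root_lattice N" "\<And>k. k \<in> {1..N} \<Longrightarrow> crd N a k = 0"
  shows "a = 0"
proof -
  let ?c = "Poly_Mapping.lookup a"
  have out: "?c k = 0" if "k \<notin> {1..N}" for k
    using assms(2) that by (auto simp: root_lattice_def in_keys_iff)
  have c0: "?c k = 0" if "k + 1 < N" for k
    using that
  proof (induction k)
    case 0
    then show ?case using out by simp
  next
    case (Suc k)
    then show ?case using assms(3)[of "Suc k"] by (simp add: crd_def)
  qed
  have "?c (N - 1) + ?c N = 0" "?c N - ?c (N - 1) = 0"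
  proof -
    have "?c (N - 2) = 0" using c0 assms(1) by simp
    then show "?c (N - 1) + ?c N = 0" "?c N - ?c (N - 1) = 0"
      using assms(3)[of "N - 1"] assms(3)[of N] assms(1) by (simp_all add: crd_def numeral_2_eq_2)
  qed
  then have "?c (N - 1) = 0" "?c N = 0" by linarith+
  have "?c k = 0" for k
  proof -
    consider "k + 1 < N" | "k = N - 1" | "k = N" | "k > N" using assms(1) by linarith
    then show ?thesis using c0 out \<open>?c (N - 1) = 0\<close> \<open>?c N = 0\<close> by cases auto
  qed
  then show ?thesis by (simp add: poly_mapping_eq_iff fun_eq_iff)
qed

text \<open>Here \<open>n\<close> is the position N - m of the odd simple root. Multiplicativity is
  asked for on all weights, so that \<open>\<chi>\<close> fits \<open>qsys\<close>; it will be
  instantiated with a truncated bihomomorphism.\<close>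

locale type_D =
  fixes N m n :: nat and \<chi> :: "weight \<Rightarrow> weight \<Rightarrow> 'k::field" and qh :: 'k
  assumes m_ge: "2 \<le> m" and n_ge: "1 \<le> n" and N_eq: "N = n + m"
    and chi_add_left: "\<chi> (r + s) t = \<chi> r t * \<chi> s t"
    and chi_add_right: "\<chi> r (s + t) = \<chi> r s * \<chi> r t"
    and chi_nonzero: "\<chi> r s \<noteq> 0"
    and qh: "qh \<in> K_times_infty"
    and q_low: "\<lbrakk>1 \<le> i; i < n\<rbrakk> \<Longrightarrow> \<chi> (\<alpha>\<^sub>s i) (\<alpha>\<^sub>s i) = qh powi (-2)"
    and q_odd: "\<chi> (\<alpha>\<^sub>s n) (\<alpha>\<^sub>s n) = -1"
    and q_high: "\<lbrakk>n < i; i \<le> N\<rbrakk> \<Longrightarrow> \<chi> (\<alpha>\<^sub>s i) (\<alpha>\<^sub>s i) = qh ^ 2"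
    and q_next: "\<lbrakk>1 \<le> i; i \<le> N - 2\<rbrakk> \<Longrightarrow> \<chi> (\<alpha>\<^sub>s i) (\<alpha>\<^sub>s (i + 1)) * \<chi> (\<alpha>\<^sub>s (i + 1)) (\<alpha>\<^sub>s i) =
      (if i + 1 \<le> n then qh ^ 2 else qh powi (-2))"
    and q_fork: "\<chi> (\<alpha>\<^sub>s (N - 2)) (\<alpha>\<^sub>s N) * \<chi> (\<alpha>\<^sub>s N) (\<alpha>\<^sub>s (N - 2)) = qh powi (-2)"
    and q_ends: "\<chi> (\<alpha>\<^sub>s (N - 1)) (\<alpha>\<^sub>s N) * \<chi> (\<alpha>\<^sub>s N) (\<alpha>\<^sub>s (N - 1)) = 1"
    and q_far: "\<lbrakk>1 \<le> i; i < j; j \<le> N; j \<noteq> i + 1; (i, j) \<noteq> (N - 2, N)\<rbrakk> \<Longrightarrow>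
      \<chi> (\<alpha>\<^sub>s i) (\<alpha>\<^sub>s j) * \<chi> (\<alpha>\<^sub>s j) (\<alpha>\<^sub>s i) = 1"
begin

lemma N_ge: "n + 2 \<le> N"
  using m_ge N_eq by simp

lemma qh_nonzero [simp]: "qh \<noteq> 0"
  using qh by (simp add: K_times_infty_def)

lemma qh_powi_eq_1: "qh powi k = 1 \<longleftrightarrow> k = 0"
proof
  assume eq: "qh powi k = 1"
  show "k = 0"
  proof (rule ccontr)
    assume "k \<noteq> 0"
    then have "nat \<bar>k\<bar> \<ge> 1" by simp
    moreover have "qh ^ nat \<bar>k\<bar> = 1"
      using eq by (cases "k \<ge> 0") (auto simp: power_int_def field_simps split: if_splits)
    ultimately show False using qh by (auto simp: K_times_infty_def)
  qed
qed simp

lemma qh_powi_inject: "qh powi k = qh powi l \<longleftrightarrow> k = l"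
proof -
  have "qh powi k = qh powi l \<longleftrightarrow> qh powi (k - l) = 1"
    by (simp add: power_int_diff)
  then show ?thesis by (simp add: qh_powi_eq_1)
qed

text \<open>The signature of the invariant form of osp(2m|2n): the symplectic directions eps_1, ...,
  eps_n have norm -1, the orthogonal ones norm 1.\<close>

definition sgn_e :: "nat \<Rightarrow> int"
  where "sgn_e k = (if k \<le> n then -1 else 1)"

definition form :: "weight \<Rightarrow> weight \<Rightarrow> int"
  where "form a b = (\<Sum>k=1..N. sgn_e k * crd N a k * crd N b k)"

lemma form_simps: "form (a - b) c = form a c - form b c" "form c (a - b) = form c a - form c b"
  "form (a + b) c = form a c + form b c" "form c (a + b) = form c a + form c b"
  "form (- a) c = - form a c" "form c (- a) = - form c a"
  "form 0 c = 0" "form c 0 = 0"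
  by (simp_all add: form_def crd_add crd_diff crd_minus algebra_simps sum_subtractf sum.distrib sum_negf)

lemma form_commute: "form a b = form b a"
  by (simp add: form_def mult_ac)

lemma form_simple:
  assumes "1 \<le> i" "i < N"
  shows "form (\<alpha>\<^sub>s i) b = sgn_e i * crd N b i - sgn_e (i + 1) * crd N b (i + 1)"
proof -
  have "form (\<alpha>\<^sub>s i) b = (\<Sum>k=1..N. (if k = i then sgn_e i * crd N b i else 0) +
      (if k = i + 1 then - (sgn_e (i + 1) * crd N b (i + 1)) else 0))"
    unfolding form_def by (rule sum.cong) (use assms in \<open>auto simp: crd_simple_root\<close>)
  also have "\<dots> = sgn_e i * crd N b i - sgn_e (i + 1) * crd N b (i + 1)"
    using assms by (simp add: sum.distrib)
  finally show ?thesis .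
qed

lemma form_last: "form (\<alpha>\<^sub>s N) b = crd N b (N - 1) + crd N b N"
proof -
  have "form (\<alpha>\<^sub>s N) b = (\<Sum>k=1..N. (if k = N - 1 then crd N b (N - 1) else 0) + (if k = N then crd N b N else 0))"
    unfolding form_def
    by (rule sum.cong) (use N_ge n_ge in \<open>auto simp: crd_simple_root_last sgn_e_def\<close>)
  also have "\<dots> = crd N b (N - 1) + crd N b N"
    using N_ge n_ge by (simp add: sum.distrib)
  finally show ?thesis .
qed

text \<open>The hypotheses fix \<open>\<chi>\<close> only on the diagonal and in this symmetrized
  form; adjacency, Cartan integers and \<open>\<kappa>\<close> depend on nothing else.\<close>

definition tc :: "weight \<Rightarrow> weight \<Rightarrow> 'k"
  where "tc a b = \<chi> a b * \<chi> b a"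

lemma chi_zero [simp]: "\<chi> 0 x = 1" "\<chi> x 0 = 1"
  using chi_add_left[of 0 0 x] chi_add_right[of x 0 0] chi_nonzero[of 0 x] chi_nonzero[of x 0]
  by simp_all

lemma chi_diff: "\<chi> (a - b) c = \<chi> a c / \<chi> b c" "\<chi> c (a - b) = \<chi> c a / \<chi> c b"
  using chi_add_left[of "a - b" b c] chi_add_right[of c "a - b" b] chi_nonzero by (simp_all add: field_simps)

lemma tc_diff: "tc (a - b) c = tc a c / tc b c" "tc c (a - b) = tc c a / tc c b"
  by (simp_all add: tc_def chi_diff)

lemma tc_zero [simp]: "tc 0 c = 1" "tc c 0 = 1"
  by (simp_all add: tc_def)

lemma tc_commute: "tc a b = tc b a"
  by (simp add: tc_def)

lemma tc_simple_less:
  assumes "1 \<le> i" "i < j" "j \<le> N"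
  shows "tc (\<alpha>\<^sub>s i) (\<alpha>\<^sub>s j) = qh powi (2 * form (\<alpha>\<^sub>s i) (\<alpha>\<^sub>s j))"
proof -
  consider "j = i + 1" "j < N" | "i = N - 1" "j = N" | "i = N - 2" "j = N"
    | "j \<noteq> i + 1" "j < N" | "j = N" "i + 2 < N"
    using assms by linarith
  then show ?thesis
  proof cases
    case 1
    then show ?thesis
      using assms q_next[of i] by (auto simp: tc_def form_simple crd_simple_root sgn_e_def)
  next
    case 2
    then show ?thesis
      using assms N_ge n_ge q_ends by (auto simp: tc_def form_simple crd_simple_root_last sgn_e_def)
  next
    case 3
    then show ?thesis
      using assms N_ge n_ge q_fork by (auto simp: tc_def form_simple crd_simple_root_last sgn_e_def)
  next
    case 4
    then show ?thesis
      using assms q_far[of i j] by (auto simp: tc_def form_simple crd_simple_root)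
  next
    case 5
    then show ?thesis
      using assms q_far[of i j] by (auto simp: tc_def form_simple crd_simple_root_last)
  qed
qed

lemma q_simple: "i \<in> {1..N} \<Longrightarrow> \<chi> (\<alpha>\<^sub>s i) (\<alpha>\<^sub>s i) =
    (-1) powi (Poly_Mapping.lookup (\<alpha>\<^sub>s i) n) * qh powi (form (\<alpha>\<^sub>s i) (\<alpha>\<^sub>s i))"
proof -
  assume i: "i \<in> {1..N}"
  consider "i < n" | "i = n" | "n < i" "i < N" | "i = N" using i by fastforce
  then show ?thesis
    by cases (use i N_ge n_ge q_low[of i] q_odd q_high[of i] in
      \<open>auto simp: form_simple form_last crd_simple_root crd_simple_root_last lookup_simple_root sgn_e_def\<close>)
qed

lemma tc_simple:
  assumes "i \<in> {1..N}" "j \<in> {1..N}"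
  shows "tc (\<alpha>\<^sub>s i) (\<alpha>\<^sub>s j) = qh powi (2 * form (\<alpha>\<^sub>s i) (\<alpha>\<^sub>s j))"
proof (cases i j rule: linorder_cases)
  case less
  then show ?thesis using tc_simple_less[of i j] assms by simp
next
  case equal
  let ?s = "(- 1 :: 'k) powi (Poly_Mapping.lookup (\<alpha>\<^sub>s i) n)" and ?f = "form (\<alpha>\<^sub>s i) (\<alpha>\<^sub>s i)"
  have "tc (\<alpha>\<^sub>s i) (\<alpha>\<^sub>s i) = (?s * ?s) * (qh powi ?f * qh powi ?f)"
    unfolding tc_def q_simple[OF assms(1)] by (simp only: mult_ac)
  also have "?s * ?s = 1"
    by (simp add: power_int_mult_distrib[symmetric])
  also have "qh powi ?f * qh powi ?f = qh powi (2 * ?f)"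
    by (simp only: mult_2 power_int_add[OF disjI1[OF qh_nonzero]])
  finally show ?thesis using equal by simp
next
  case greater
  then show ?thesis
    using tc_simple_less[of j i] assms by (simp add: tc_commute form_commute)
qed

lemma tc_eq:
  assumes "a \<in> root_lattice N" "b \<in> root_lattice N"
  shows "tc a b = qh powi (2 * form a b)"
  using assms(1)
proof (induction rule: root_lattice_induct)
  case zero
  then show ?case by (simp add: form_simps)
next
  case (simple i)
  show ?case
    using assms(2)
  proof (induction rule: root_lattice_induct)
    case zero
    then show ?case by (simp add: form_simps)
  next
    case (simple j)
    then show ?case using tc_simple \<open>i \<in> {1..N}\<close> by blast
  next
    case (diff a b)
    then show ?case by (simp add: tc_diff form_simps right_diff_distrib power_int_diff)
  qed
next
  case (diff a b)
  then show ?case by (simp add: tc_diff form_simps right_diff_distrib power_int_diff)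
qed

text \<open>The sign is the parity, that is, the number of odd simple roots in \<open>a\<close>. The
  formula extends from the simple roots because \<open>\<chi>\<close> on a difference and the
  quadratic form polarize in the same way, through \<open>tc\<close> and twice the form.\<close>

lemma q_eq:
  assumes "a \<in> root_lattice N"
  shows "\<chi> a a = (-1) powi (Poly_Mapping.lookup a n) * qh powi (form a a)"
  using assms
proof (induction rule: root_lattice_induct)
  case zero
  then show ?case by (simp add: form_simps)
next
  case (simple i)
  then show ?case by (rule q_simple)
next
  case (diff a b)
  have "\<chi> (a - b) (a - b) = \<chi> a a * \<chi> b b / tc a b"
    by (simp add: chi_diff tc_def)
  also have "\<dots> = (-1) powi (Poly_Mapping.lookup (a - b) n) * qh powi (form (a - b) (a - b))"
  proof -
    have "form (a - b) (a - b) = form a a + form b b - 2 * form a b"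
      by (simp add: form_simps form_commute)
    moreover have "(-1 :: 'k) powi (Poly_Mapping.lookup (a - b) n) =
        (-1) powi (Poly_Mapping.lookup a n) * (-1) powi (Poly_Mapping.lookup b n)"
      by (simp add: lookup_minus power_int_diff power_int_minus_left)
    ultimately show ?thesis
      unfolding diff.IH tc_eq[OF diff.hyps] by (simp add: power_int_diff power_int_add)
  qed
  finally show ?case .
qed

section \<open>Simple roots along the chain, their closed form and their heights\<close>

text \<open>
  In coordinates, \<open>R k l\<close> is \<open>\<epsilon>\<^sub>k - \<epsilon>\<^sub>l\<close>.
\<close>

definition R :: "nat \<Rightarrow> nat \<Rightarrow> weight"
  where "R k l = (\<Sum>i=k..<l. \<alpha>\<^sub>s i)"

lemma R_same [simp]: "R k k = 0"
  by (simp add: R_def)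

lemma R_Suc: "k \<le> l \<Longrightarrow> R k (Suc l) = R k l + \<alpha>\<^sub>s l"
  by (simp add: R_def)

lemma R_in:
  assumes "k \<le> l" "1 \<le> k" "l \<le> Suc N"
  shows "R k l \<in> root_lattice N"
  using assms
proof (induction l rule: dec_induct)
  case (step l)
  then show ?case by (simp add: R_Suc root_lattice_add simple_root_in)
qed simp

lemma lookup_R:
  assumes "k \<le> l"
  shows "Poly_Mapping.lookup (R k l) x = (if k \<le> x \<and> x < l then 1 else 0)"
  using assms by (induction l rule: dec_induct) (auto simp: R_Suc lookup_add lookup_simple_root)

lemma crd_R:
  assumes "k \<le> l" "1 \<le> k" "l \<le> N" "x \<in> {1..N}"
  shows "crd N (R k l) x = (if x = k then 1 else 0) - (if x = l then 1 else 0)"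
  using assms by (induction l rule: dec_induct) (auto simp: R_Suc crd_add crd_simple_root)

lemma form_R:
  assumes "n < l" "l \<le> N"
  shows "form (R n l) y = - crd N y n - crd N y l"
proof -
  have "form (R n l) y = (if l = n then 0 else - crd N y n - crd N y l)" if "n \<le> l" "l \<le> N" for l
    using that
    by (induction l rule: dec_induct)
      (use n_ge in \<open>auto simp: R_Suc form_simps form_simple sgn_e_def\<close>)
  with assms show ?thesis by auto
qed

text \<open>
  The simple roots after \<open>t\<close> odd reflections, in closed form.
\<close>

definition closed_root :: "nat \<Rightarrow> nat \<Rightarrow> weight"
  where "closed_root t i =
    (if t = 0 then \<alpha>\<^sub>s i
     else if i + 1 = n then \<alpha>\<^sub>s i + \<alpha>\<^sub>s n
     else if n \<le> i \<and> i + 1 < n + t then \<alpha>\<^sub>s (i + 1)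
     else if i + 1 = n + t then - R n (n + t)
     else if i = n + t \<and> i < N then R n (n + t + 1)
     else if i = N \<and> m \<le> t + 1 then \<alpha>\<^sub>s N + R n (N - 1) + (if t = m then R n N else 0)
     else \<alpha>\<^sub>s i)"

lemma rt_in:
  assumes "t \<le> m" "i \<in> {1..N}"
  shows "closed_root t i \<in> root_lattice N"
proof -
  have "n + t \<le> N" using assms(1) N_eq by simp
  then show ?thesis
    using assms N_ge n_ge
    by (simp add: closed_root_def root_lattice_add root_lattice_minus R_in simple_root_in)
qed

lemma rt_odd: "t < m \<Longrightarrow> closed_root t (n + t) = R n (n + t + 1)"
  using N_eq[THEN arg_cong, of "\<lambda>k. n + t < k"] by (auto simp: closed_root_def R_Suc)

text \<open>The reflected root is eps_n - eps_(n+t+1). As qh is not a root of unity,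
  \<open>tc\<close> equals 1 exactly when the form vanishes, so a root is left alone exactly if its
  coordinates at \<open>n\<close> and \<open>n + t + 1\<close> cancel. What remains is a check of
  each position in the diagram.\<close>

lemma reflect_rt:
  assumes t: "t < m" and i: "i \<in> {1..N}"
  shows "reflect_root \<chi> (n + t) (closed_root t) i = closed_root (Suc t) i"
proof -
  have tN: "n + t + 1 \<le> N" using t N_eq by simp
  have Nm: "n + t + 1 = N \<longleftrightarrow> t + 1 = m" "n + t + 2 = N \<longleftrightarrow> t + 2 = m" "N = n + Suc t \<longleftrightarrow> t + 1 = m"
    using N_eq by auto
  have adj: "\<chi> (closed_root t (n + t)) (closed_root t i) * \<chi> (closed_root t i) (closed_root t (n + t)) = 1 \<longleftrightarrow>
      crd N (closed_root t i) n + crd N (closed_root t i) (n + t + 1) = 0"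
  proof -
    have "\<chi> (closed_root t (n + t)) (closed_root t i) * \<chi> (closed_root t i) (closed_root t (n + t)) = tc (R n (n + t + 1)) (closed_root t i)"
      by (simp add: tc_def rt_odd[OF t])
    also have "\<dots> = qh powi (2 * form (R n (n + t + 1)) (closed_root t i))"
      by (rule tc_eq) (use rt_in[of t i] t i tN n_ge in \<open>auto intro: R_in\<close>)
    finally show ?thesis
      using form_R[of "n + t + 1" "closed_root t i"] tN by (auto simp: qh_powi_eq_1)
  qed
  note defs = reflect_root_def adj rt_odd[OF t]
  note crds = crd_add crd_minus crd_R crd_simple_root crd_simple_root_last
  consider "i = n + t" | "i = n + t + 1" "i < N" | "i = N" "t + 2 = m" | "i = N" "t + 1 = m" | "i = N" "t + 2 < m"
    | "i + 1 = n" "t = 0" | "i + 1 = n" "t > 0" | "n \<le> i" "i + 1 < n + t" | "i + 1 = n + t" "t > 0"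
    | "i + 1 < n" | "n + t + 1 < i" "i < N"
    using i t tN by (smt (verit) Suc_leI add.commute add_Suc_right add_diff_inverse_nat atLeastAtMost_iff le_neq_implies_less less_or_eq_imp_le linorder_neqE_nat nat_add_left_cancel_less not_less_eq plus_1_eq_Suc zero_less_Suc not_gr_zero Suc_1 add_2_eq_Suc')
  then show ?thesis
  proof cases
    case 1
    then show ?thesis using t tN by (simp add: defs) (simp add: closed_root_def)
  next
    case 2
    then have "closed_root t i = \<alpha>\<^sub>s i" "closed_root (Suc t) i = R n (n + t + 1) + \<alpha>\<^sub>s i"
      by (auto simp: closed_root_def R_Suc)
    then show ?thesis unfolding reflect_root_def adj unfolding rt_odd[OF t] using 2 n_ge by (simp add: crds)
  next
    case 3
    then have "closed_root t i = \<alpha>\<^sub>s i" "closed_root (Suc t) i = \<alpha>\<^sub>s i + R n (n + t + 1)" "N - 1 = n + t + 1"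
      using Nm by (auto simp: closed_root_def)
    then show ?thesis unfolding reflect_root_def adj unfolding rt_odd[OF t] using 3 n_ge tN N_ge Nm by (simp add: crds)
  next
    \<comment> \<open>The fork root eps_(N-1) + eps_N became eps_n + eps_N one step earlier (case
      3); adding eps_n - eps_N now gives 2 eps_n.\<close>
    case 4
    then have "closed_root t i = \<alpha>\<^sub>s N + R n (N - 1)" "closed_root (Suc t) i = \<alpha>\<^sub>s N + R n (N - 1) + R n N"
      "Suc (n + t) = N" "n + t = N - 1" "N \<noteq> N - Suc 0"
      using Nm m_ge by (auto simp: closed_root_def)
    then show ?thesis unfolding reflect_root_def adj unfolding rt_odd[OF t] using 4 n_ge N_ge m_ge by (simp add: crds)
  next
    case 5
    then have tN': "n + t + 1 + 1 < N" using N_eq by simp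
    then have "closed_root t i = \<alpha>\<^sub>s N" "closed_root (Suc t) i = \<alpha>\<^sub>s N"
      using 5 by (auto simp: closed_root_def)
    then show ?thesis unfolding reflect_root_def adj unfolding rt_odd[OF t] using tN' 5 n_ge N_ge by (simp add: crds)
  next
    case 6
    then have "closed_root t i = \<alpha>\<^sub>s i" "closed_root (Suc t) i = \<alpha>\<^sub>s i + R n (n + t + 1)"
      by (auto simp: closed_root_def R_Suc)
    then show ?thesis unfolding reflect_root_def adj unfolding rt_odd[OF t] using 6 i N_ge by (simp add: crds)
  next
    case 7
    then have "closed_root t i = \<alpha>\<^sub>s i + \<alpha>\<^sub>s n" "closed_root (Suc t) i = \<alpha>\<^sub>s i + \<alpha>\<^sub>s n"
      by (auto simp: closed_root_def)
    then show ?thesis unfolding reflect_root_def adj unfolding rt_odd[OF t] using 7 i N_ge tN by (simp add: crds)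
  next
    case 8
    then have "closed_root t i = \<alpha>\<^sub>s (i + 1)" "closed_root (Suc t) i = \<alpha>\<^sub>s (i + 1)"
      by (auto simp: closed_root_def)
    then show ?thesis unfolding reflect_root_def adj unfolding rt_odd[OF t] using 8 i N_ge tN n_ge by (simp add: crds)
  next
    case 9
    then have "closed_root t i = - R n (n + t)" "closed_root (Suc t) i = \<alpha>\<^sub>s (n + t)"
      by (auto simp: closed_root_def)
    then show ?thesis unfolding reflect_root_def adj unfolding rt_odd[OF t] using 9 i N_ge tN n_ge by (simp add: crds R_Suc)
  next
    case 10
    then have "closed_root t i = \<alpha>\<^sub>s i" "closed_root (Suc t) i = \<alpha>\<^sub>s i"
      using N_ge by (auto simp: closed_root_def)
    then show ?thesis unfolding reflect_root_def adj unfolding rt_odd[OF t] using 10 i N_ge tN n_ge by (simp add: crds)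
  next
    case 11
    then have "closed_root t i = \<alpha>\<^sub>s i" "closed_root (Suc t) i = \<alpha>\<^sub>s i"
      using N_ge by (auto simp: closed_root_def)
    then show ?thesis unfolding reflect_root_def adj unfolding rt_odd[OF t] using 11 i N_ge tN n_ge by (simp add: crds)
  qed
qed

text \<open>After t steps eps_n stands between eps_(n+t) and eps_(n+t+1). The other coordinates get
  even decreasing weights, and the odd value at \<open>n\<close> fits exactly into this gap; for t =
  m it is 1, so 2 eps_n stays positive.\<close>

definition wt :: "nat \<Rightarrow> nat \<Rightarrow> int"
  where "wt t k = (if k = n then 2 * (int N - int n - int t) + 1 else 2 * (int N - int k) + 2)"

definition ht :: "nat \<Rightarrow> weight \<Rightarrow> int"
  where "ht t a = (\<Sum>k=1..N. wt t k * crd N a k)"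

lemma ht_add: "ht t (a + b) = ht t a + ht t b"
  and ht_minus: "ht t (- a) = - ht t a"
  by (simp_all add: ht_def crd_add crd_minus algebra_simps sum.distrib sum_negf)

lemma ht_zero [simp]: "ht t 0 = 0"
  by (simp add: ht_def)

lemma ht_simple: "\<lbrakk>1 \<le> i; i < N\<rbrakk> \<Longrightarrow> ht t (\<alpha>\<^sub>s i) = wt t i - wt t (i + 1)"
proof -
  assume i: "1 \<le> i" "i < N"
  have "ht t (\<alpha>\<^sub>s i) = (\<Sum>k=1..N. (if k = i then wt t i else 0) + (if k = i + 1 then - wt t (i + 1) else 0))"
    unfolding ht_def by (rule sum.cong) (use i in \<open>auto simp: crd_simple_root\<close>)
  with i show ?thesis by (simp add: sum.distrib)
qed

lemma ht_last: "ht t (\<alpha>\<^sub>s N) = wt t (N - 1) + wt t N"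
proof -
  have "ht t (\<alpha>\<^sub>s N) = (\<Sum>k=1..N. (if k = N - 1 then wt t (N - 1) else 0) + (if k = N then wt t N else 0))"
    unfolding ht_def by (rule sum.cong) (use N_ge in \<open>auto simp: crd_simple_root_last\<close>)
  with N_ge n_ge show ?thesis by (simp add: sum.distrib)
qed

lemma ht_R:
  assumes "k \<le> l" "1 \<le> k" "l \<le> N"
  shows "ht t (R k l) = wt t k - wt t l"
  using assms by (induction l rule: dec_induct) (auto simp: R_Suc ht_add ht_simple)

lemma ht_pos:
  assumes t: "t \<le> m" and i: "i \<in> {1..N}"
  shows "ht t (closed_root t i) > 0"
proof -
  have tN: "n + t \<le> N" "N = n + t \<longleftrightarrow> t = m" "N = n + t + 1 \<longleftrightarrow> t + 1 = m" using t N_eq by auto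
  have mN: "int m = int N - int n" using N_eq by simp
  consider "i = N" | "i < N" using i by fastforce
  then show ?thesis
    by cases (use t i tN mN N_ge n_ge m_ge in \<open>auto simp: closed_root_def ht_add ht_minus ht_simple ht_last ht_R wt_def\<close>)
qed

end

section \<open>The chain of odd reflections\<close>

text \<open>
  The coordinates \<open>1..n\<close> are bounded above because the first is; the sign change at \<open>n\<close> then bounds them below, the
  partial sum up to \<open>n + 1\<close> bounds the coordinate \<open>n + 1\<close> above, and \<open>swap_neg\<close> bounds the remaining ones below.
\<close>

lemma bounded_by_reflections:
  fixes W :: "(nat \<Rightarrow> int) set"
  assumes n: "1 \<le> n" "n + 2 \<le> N"
    and partial_sums: "\<And>x k. \<lbrakk>x \<in> W; 1 \<le> k; k \<le> n + 1\<rbrakk> \<Longrightarrow> (\<Sum>l=1..k. x l) \<le> 0"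
    and swap: "\<And>i. \<lbrakk>1 \<le> i; i < N; i \<noteq> n\<rbrakk> \<Longrightarrow> \<exists>c. \<forall>x\<in>W. \<exists>y\<in>W. y i = x (i + 1) + c \<and> y (i + 1) = x i - c"
    and swap_neg: "\<exists>c. \<forall>x\<in>W. \<exists>y\<in>W. y (N - 1) = - x N + c"
    and neg: "\<exists>c. \<forall>x\<in>W. \<exists>y\<in>W. y n = - x n + c"
  shows "\<exists>B. \<forall>x\<in>W. \<forall>k\<in>{1..N}. \<bar>x k\<bar> \<le> B"
proof -
  define ub where "ub k \<longleftrightarrow> (\<exists>C. \<forall>x\<in>W. x k \<le> C)" for k
  define lb where "lb k \<longleftrightarrow> (\<exists>C. \<forall>x\<in>W. C \<le> x k)" for k
  have ub_up: "ub (i + 1)" if "ub i" "1 \<le> i" "i < N" "i \<noteq> n" for i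
  proof -
    from swap[OF that(2-)] obtain c where c: "\<forall>x\<in>W. \<exists>y\<in>W. y i = x (i + 1) + c" by blast
    from that(1) obtain C where C: "\<forall>x\<in>W. x i \<le> C" by (auto simp: ub_def)
    have "\<forall>x\<in>W. x (i + 1) \<le> C - c" using c C by (metis add_le_imp_le_diff)
    then show ?thesis by (auto simp: ub_def)
  qed
  have lb_down: "lb i" if "lb (i + 1)" "1 \<le> i" "i < N" "i \<noteq> n" for i
  proof -
    from swap[OF that(2-)] obtain c where c: "\<forall>x\<in>W. \<exists>y\<in>W. y (i + 1) = x i - c" by blast
    from that(1) obtain C where C: "\<forall>x\<in>W. C \<le> x (i + 1)" by (auto simp: lb_def)
    have "\<forall>x\<in>W. C + c \<le> x i" using c C by (metis le_diff_eq)
    then show ?thesis by (auto simp: lb_def)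
  qed
  have ub_le: "ub k" if "ub j" "j \<le> k" "1 \<le> j" "k \<le> N" "k \<le> n \<or> n < j" for j k
    using that(2,1,3-) by (induction k rule: dec_induct) (auto intro: ub_up[simplified])
  have lb_le: "lb j" if "lb k" "j \<le> k" "1 \<le> j" "k \<le> N" "k \<le> n \<or> n < j" for j k
    using that(2,1,3-) by (induction j rule: inc_induct) (auto intro: lb_down[simplified])
  have "ub 1" using partial_sums[of _ 1] by (auto simp: ub_def)
  then have ub1: "ub k" if "1 \<le> k" "k \<le> n" for k using ub_le[of 1 k] that n by simp
  have "lb n"
  proof -
    from neg obtain c where c: "\<forall>x\<in>W. \<exists>y\<in>W. y n = - x n + c" by blast
    from ub1[of n] n obtain C where C: "\<forall>x\<in>W. x n \<le> C" by (auto simp: ub_def)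
    have "\<forall>x\<in>W. c - C \<le> x n" using c C by force
    then show ?thesis by (auto simp: lb_def)
  qed
  then have lb1: "lb k" if "1 \<le> k" "k \<le> n" for k using lb_le[of n k] that n by simp
  have "ub (n + 1)"
  proof -
    have "\<forall>k. \<exists>C. k \<in> {1..n} \<longrightarrow> (\<forall>x\<in>W. C \<le> x k)" using lb1 by (auto simp: lb_def)
    then obtain C where C: "\<And>k x. \<lbrakk>k \<in> {1..n}; x \<in> W\<rbrakk> \<Longrightarrow> C k \<le> x k" by metis
    have "x (n + 1) \<le> - (\<Sum>k=1..n. C k)" if "x \<in> W" for x
    proof -
      have "(\<Sum>l=1..n. C l) \<le> (\<Sum>l=1..n. x l)" using C that by (intro sum_mono) auto
      then show ?thesis using partial_sums[OF that, of "n + 1"] by simp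
    qed
    then show ?thesis by (auto simp: ub_def)
  qed
  then have ub2: "ub k" if "n < k" "k \<le> N" for k using ub_le[of "n + 1" k] that by simp
  have "lb N"
  proof -
    from swap_neg obtain c where c: "\<forall>x\<in>W. \<exists>y\<in>W. y (N - 1) = - x N + c" by blast
    have "ub (N - 1)" using ub2[of "N - 1"] n by linarith
    then obtain C where C: "\<forall>x\<in>W. x (N - 1) \<le> C" by (auto simp: ub_def)
    have "\<forall>x\<in>W. c - C \<le> x N" using c C by force
    then show ?thesis by (auto simp: lb_def)
  qed
  then have lb2: "lb k" if "n < k" "k \<le> N" for k using lb_le[of N k] that by simp
  have "\<exists>B. \<forall>x\<in>W. \<bar>x k\<bar> \<le> B" if "k \<in> {1..N}" for k
  proof -
    have "ub k" "lb k" using that ub1 ub2 lb1 lb2 by (cases "k \<le> n"; simp)+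
    then obtain C D where CD: "\<forall>x\<in>W. x k \<le> C" "\<forall>x\<in>W. D \<le> x k" by (auto simp: ub_def lb_def)
    then have "\<forall>x\<in>W. \<bar>x k\<bar> \<le> max \<bar>C\<bar> \<bar>D\<bar>" by fastforce
    then show ?thesis by blast
  qed
  then have "\<forall>k. \<exists>B. k \<in> {1..N} \<longrightarrow> (\<forall>x\<in>W. \<bar>x k\<bar> \<le> B)" by blast
  then obtain B where B: "\<And>k x. \<lbrakk>k \<in> {1..N}; x \<in> W\<rbrakk> \<Longrightarrow> \<bar>x k\<bar> \<le> B k" by metis
  have "\<bar>x k\<bar> \<le> (\<Sum>l=1..N. \<bar>B l\<bar>)" if "k \<in> {1..N}" "x \<in> W" for x k
  proof -
    have "\<bar>x k\<bar> \<le> \<bar>B k\<bar>" using B[OF that] by simp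
    also have "\<dots> \<le> (\<Sum>l=1..N. \<bar>B l\<bar>)" using that by (intro member_le_sum) auto
    finally show ?thesis .
  qed
  then show ?thesis by blast
qed

lemma finite_bounded_crd:
  assumes "N \<ge> 2"
  shows "finite {a \<in> root_lattice N. \<forall>k\<in>{1..N}. \<bar>crd N a k\<bar> \<le> B}"
proof (rule finite_imageD)
  let ?f = "\<lambda>a. \<lambda>k\<in>{1..N}. crd N a k"
  show "inj_on ?f {a \<in> root_lattice N. \<forall>k\<in>{1..N}. \<bar>crd N a k\<bar> \<le> B}"
  proof (rule inj_onI)
    fix a b assume a: "a \<in> {a \<in> root_lattice N. \<forall>k\<in>{1..N}. \<bar>crd N a k\<bar> \<le> B}"
      and b: "b \<in> {a \<in> root_lattice N. \<forall>k\<in>{1..N}. \<bar>crd N a k\<bar> \<le> B}" and eq: "?f a = ?f b"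
    have "a - b = 0"
    proof (rule crd_zero_imp[OF assms])
      show "a - b \<in> root_lattice N" using a b by (auto intro: root_lattice_diff)
      show "crd N (a - b) k = 0" if "k \<in> {1..N}" for k
        using fun_cong[OF eq, of k] that by (simp add: crd_diff)
    qed
    then show "a = b" by simp
  qed
  have "?f ` {a \<in> root_lattice N. \<forall>k\<in>{1..N}. \<bar>crd N a k\<bar> \<le> B} \<subseteq> ({1..N} \<rightarrow>\<^sub>E {-B..B})"
    by (auto simp: abs_le_iff)
  then show "finite (?f ` {a \<in> root_lattice N. \<forall>k\<in>{1..N}. \<bar>crd N a k\<bar> \<le> B})"
    by (rule finite_subset) (intro finite_PiE; simp)
qed

lemma crd_partial_sum: "k + 1 < N \<Longrightarrow> (\<Sum>l=1..k. crd N a l) = Poly_Mapping.lookup a k - Poly_Mapping.lookup a 0"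
  by (induction k) (simp_all add: crd_def)

lemma crd_partial_sum_fork:
  assumes "N \<ge> 2"
  shows "(\<Sum>l=1..N-1. crd N a l) =
    Poly_Mapping.lookup a (N - 1) + Poly_Mapping.lookup a N - Poly_Mapping.lookup a 0"
proof -
  obtain k where k: "N = Suc (Suc k)" using assms by (metis Suc_le_D numeral_2_eq_2 Suc_le_mono)
  have "(\<Sum>l=1..Suc k. crd N a l) = (\<Sum>l=1..k. crd N a l) + crd N a (Suc k)" by simp
  also have "\<dots> = Poly_Mapping.lookup a (Suc k) + Poly_Mapping.lookup a N - Poly_Mapping.lookup a 0"
    using crd_partial_sum[of k N a] k by (simp add: crd_def)
  finally show ?thesis by (simp add: k)
qed

context qsys
begin

text \<open>\<open>h\<close> is the Cartan integer of the weight at \<open>i\<close>. The reflection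
  subtracts h times the root, which means going up the string if \<open>h\<close> is
  negative.\<close>

lemma weight_reflection:
  assumes "i \<in> I" "\<And>n. \<chi> (\<alpha> i) (\<alpha> i) ^ Suc n \<noteq> 1" "\<kappa> i \<mu>\<^sub>0 = \<chi> (\<alpha> i) (\<alpha> i) ^ r"
    "\<And>j. \<lbrakk>j \<in> I; j \<noteq> i\<rbrakk> \<Longrightarrow> \<chi> (\<alpha> i) (\<alpha> j) * \<chi> (\<alpha> j) (\<alpha> i) = 1 \<or>
      \<chi> (\<alpha> i) (\<alpha> i) * (\<chi> (\<alpha> i) (\<alpha> j) * \<chi> (\<alpha> j) (\<alpha> i)) = 1"
    "L \<mu> \<noteq> {0}" "\<kappa> i \<mu> = \<chi> (\<alpha> i) (\<alpha> i) powi h"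
  shows "L (if 0 \<le> h then \<mu> - rep (nat h) (\<alpha> i) else \<mu> + rep (nat (- h)) (\<alpha> i)) \<noteq> {0}"
proof -
  obtain x where x: "x \<in> L \<mu>" "x \<noteq> 0" using assms(5) zero_in by blast
  show ?thesis
  proof (cases "0 \<le> h")
    case True
    then show ?thesis
      using reflection_weight_down[OF assms(1,2) x, of "nat h"] assms(6) by (simp add: power_int_def)
  next
    case False
    then have "\<kappa> i \<mu> * \<chi> (\<alpha> i) (\<alpha> i) ^ nat (- h) = 1"
      using assms(6) chi_nonzero by (simp add: power_int_def field_simps)
    then show ?thesis
      using reflection_weight_up[OF assms(1,2,3,4) x] False by simp
  qed
qed

end

context type_D
begin

lemma not_root: "s \<noteq> 0 \<Longrightarrow> (qh powi s) ^ Suc k \<noteq> 1"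
  using qh_powi_eq_1[of "s * int (Suc k)"] by (simp add: power_int_mult power_int_of_nat del: power_Suc of_nat_Suc)

lemma qh_powi_power: "(qh powi s) ^ k = qh powi (s * int k)"
  by (simp add: power_int_mult)

text \<open>The multiplicative extension of \<open>lam\<close> to the root lattice, corresponding to
  the value of the character on K_a L_(-a).\<close>

definition lamw :: "(nat \<Rightarrow> 'k) \<Rightarrow> weight \<Rightarrow> 'k"
  where "lamw lam a = (\<Prod>i=1..N. lam i powi (Poly_Mapping.lookup a i))"

lemma lamw_zero [simp]: "lamw lam 0 = 1"
  by (simp add: lamw_def)

lemma lamw_simple: "i \<in> {1..N} \<Longrightarrow> lamw lam (\<alpha>\<^sub>s i) = lam i"
proof -
  assume i: "i \<in> {1..N}"
  have "lamw lam (\<alpha>\<^sub>s i) = (\<Prod>j=1..N. if j = i then lam i else 1)"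
    unfolding lamw_def by (rule prod.cong) (auto simp: lookup_simple_root)
  with i show ?thesis by simp
qed

text \<open>
  The simple roots, the values of \<open>\<Lambda>\<close> on them and the highest weight after odd reflections at \<open>n, \<dots>, n + t - 1\<close>.
  The \<open>\<epsilon>\<^sub>n\<close>-coordinate of that weight is \<open>- z lam t\<close>: only the steps at which the highest weight moves count.
\<close>

primrec chain_root :: "nat \<Rightarrow> nat \<Rightarrow> weight"
  where "chain_root 0 = \<alpha>\<^sub>s" | "chain_root (Suc t) = reflect_root \<chi> (n + t) (chain_root t)"

primrec chain_character :: "(nat \<Rightarrow> 'k) \<Rightarrow> nat \<Rightarrow> nat \<Rightarrow> 'k"
  where "chain_character lam 0 = lam" | "chain_character lam (Suc t) = reflect_lam \<chi> (n + t) (chain_root t) (chain_character lam t)"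

primrec chain_weight :: "(nat \<Rightarrow> 'k) \<Rightarrow> nat \<Rightarrow> weight"
  where "chain_weight lam 0 = 0"
  | "chain_weight lam (Suc t) = (if lamw lam (R n (n + t + 1)) * tc (R n (n + t + 1)) (chain_weight lam t) = 1 then chain_weight lam t
      else chain_weight lam t - R n (n + t + 1))"

primrec z :: "(nat \<Rightarrow> 'k) \<Rightarrow> nat \<Rightarrow> int"
  where "z lam 0 = 0"
  | "z lam (Suc t) = z lam t + (if lamw lam (R n (n + t + 1)) * qh powi (2 * z lam t) = 1 then 0 else 1)"

context
  fixes lam :: "nat \<Rightarrow> 'k"
  assumes all_nonzero: "\<forall>i\<in>{1..N}. lam i \<noteq> 0"
begin

lemma lam_nonzero: "i \<in> {1..N} \<Longrightarrow> lam i \<noteq> 0"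
  using all_nonzero by blast

lemma lamw_add: "lamw lam (a + b) = lamw lam a * lamw lam b"
  unfolding lamw_def prod.distrib[symmetric]
  by (rule prod.cong) (use lam_nonzero in \<open>auto simp: lookup_add power_int_add\<close>)

lemma lamw_minus: "lamw lam (- a) = inverse (lamw lam a)"
  unfolding lamw_def prod_inversef[symmetric]
  by (simp add: power_int_minus)

lemma lamw_R:
  assumes "k \<le> l" "1 \<le> k" "l \<le> Suc N"
  shows "lamw lam (R k l) = (\<Prod>i=k..<l. lam i)"
  using assms
proof (induction l rule: dec_induct)
  case (step l)
  then have "l \<in> {1..N}" by auto
  then show ?case using step by (simp add: R_Suc lamw_add lamw_simple prod.atLeastLessThan_Suc)
qed simp

lemma odd_index: "t < m \<Longrightarrow> n + t \<in> {1..N}"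
  using n_ge N_eq by simp

lemma rc_eq: "\<lbrakk>t \<le> m; i \<in> {1..N}\<rbrakk> \<Longrightarrow> chain_root t i = closed_root t i"
proof (induction t arbitrary: i)
  case (Suc t)
  then have t: "t < m" by simp
  have "reflect_root \<chi> (n + t) (chain_root t) i = reflect_root \<chi> (n + t) (closed_root t) i"
    using Suc.IH[of i] Suc.IH[OF _ odd_index[OF t]] t Suc.prems(2) by (simp add: reflect_root_def)
  then show ?case using reflect_rt[OF t Suc.prems(2)] by simp
qed (simp add: closed_root_def)

lemma lc_eq: "\<lbrakk>t \<le> m; i \<in> {1..N}\<rbrakk> \<Longrightarrow> chain_character lam t i = lamw lam (chain_root t i)"
proof (induction t arbitrary: i)
  case (Suc t)
  then have t: "t < m" by simp
  show ?case
    using Suc.IH[of i] Suc.IH[OF _ odd_index[OF t]] t Suc.prems(2)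
    by (simp add: reflect_lam_def reflect_root_def lamw_add lamw_minus)
qed (simp add: lamw_simple)

text \<open>Pairing with eps_n - eps_(n+t+1) sees only the coordinates \<open>n\<close> and
  \<open>n + t + 1\<close>, and the steps so far have not touched the latter. So the tests in
  \<open>chain_weight\<close> and in \<open>z\<close> agree, which is why the third clause is
  carried along.\<close>

lemma chain_weight_props:
  "t \<le> m \<Longrightarrow> chain_weight lam t \<in> root_lattice N \<and> crd N (chain_weight lam t) n = - z lam t \<and> (\<forall>k. n + t < k \<and> k \<le> N \<longrightarrow> crd N (chain_weight lam t) k = 0)"
proof (induction t)
  case (Suc t)
  then have t: "t < m" and tN: "n + t + 1 \<le> N" using N_eq by auto
  have R: "R n (n + t + 1) \<in> root_lattice N" by (rule R_in) (use n_ge tN in auto)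
  from Suc t have IH: "chain_weight lam t \<in> root_lattice N" "crd N (chain_weight lam t) n = - z lam t" "\<And>k. \<lbrakk>n + t < k; k \<le> N\<rbrakk> \<Longrightarrow> crd N (chain_weight lam t) k = 0"
    by auto
  have "tc (R n (n + t + 1)) (chain_weight lam t) = qh powi (2 * z lam t)"
    using tc_eq[OF R IH(1)] form_R[of "n + t + 1" "chain_weight lam t"] tN IH(2) IH(3)[of "n + t + 1"] by simp
  then show ?case
    using IH R n_ge tN by (auto simp: crd_diff crd_R root_lattice_diff)
qed simp

lemma chain:
  assumes "qsys scale \<chi> {1..N} \<alpha>\<^sub>s lam b E F L 0 v" "t \<le> m"
  shows "\<exists>b E F v. qsys scale \<chi> {1..N} (chain_root t) (chain_character lam t) b E F L (chain_weight lam t) v"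
  using assms(2)
proof (induction t)
  case 0
  then show ?case using assms(1) by auto
next
  case (Suc t)
  then have t: "t < m" and tN: "n + t + 1 \<le> N" using N_eq by auto
  from Suc t obtain b E F v where q: "qsys scale \<chi> {1..N} (chain_root t) (chain_character lam t) b E F L (chain_weight lam t) v" by auto
  note p = odd_index[OF t]
  have root: "chain_root t (n + t) = R n (n + t + 1)" using rc_eq[OF _ p, of t] rt_odd[OF t] t by simp
  have R: "R n (n + t + 1) \<in> root_lattice N" by (rule R_in) (use n_ge tN in auto)
  \<comment> \<open>The root eps_n - eps_(n+t+1) is isotropic and contains the odd simple root once,
    so \<open>q_eq\<close> gives -1.\<close>
  have pp: "\<chi> (chain_root t (n + t)) (chain_root t (n + t)) = - 1"
    unfolding root q_eq[OF R] using n_ge tN by (simp add: form_R crd_R lookup_R)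
  have ht: "\<exists>h::weight \<Rightarrow> int. (\<forall>x y. h (x + y) = h x + h y) \<and>
      (\<forall>i\<in>{1..N}. h (reflect_root \<chi> (n + t) (chain_root t) i) > 0)"
    using ht_add ht_pos[of "Suc t"] rc_eq[of "Suc t"] t by (intro exI[of _ "ht (Suc t)"]) simp
  have "qsys.\<kappa> \<chi> (chain_root t) (chain_character lam t) (n + t) (chain_weight lam t) = lamw lam (R n (n + t + 1)) * tc (R n (n + t + 1)) (chain_weight lam t)"
    using lc_eq[of t "n + t"] p t by (simp add: qsys.\<kappa>_def[OF q] tc_def root mult.assoc)
  then have eq: "(if qsys.\<kappa> \<chi> (chain_root t) (chain_character lam t) (n + t) (chain_weight lam t) = 1 then chain_weight lam t else chain_weight lam t - chain_root t (n + t)) = chain_weight lam (Suc t)"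
    by (simp add: root)
  show ?case
    using qsys.odd_reflection[OF q p pp ht] unfolding eq chain_root.simps chain_character.simps .
qed

text \<open>
  After \<open>m\<close> steps the last simple root is \<open>2 \<epsilon>\<^sub>n\<close>, an even root that is not simple in the original system.
\<close>

lemma final_root:
  "chain_root m N = \<alpha>\<^sub>s N + R n (N - 1) + R n N" "chain_root m N \<in> root_lattice N"
  "y \<in> root_lattice N \<Longrightarrow> tc (chain_root m N) y = qh powi (- 4 * crd N y n)"
  "\<chi> (chain_root m N) (chain_root m N) = qh powi (- 4)"
  "lamw lam (chain_root m N) = (\<Prod>i=n..N-2. lam i) ^ 2 * lam (N - 1) * lam N"
proof -
  have NI: "N \<in> {1..N}" using N_ge by simp
  show root: "chain_root m N = \<alpha>\<^sub>s N + R n (N - 1) + R n N"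
    unfolding rc_eq[OF order_refl NI] using N_ge m_ge N_eq[symmetric] by (simp add: closed_root_def)
  show lattice: "chain_root m N \<in> root_lattice N"
    using rt_in[OF order_refl NI] rc_eq[OF order_refl NI] by simp
  have form: "form (chain_root m N) y = - 2 * crd N y n" for y
    unfolding root using N_ge by (simp add: form_simps form_last form_R)
  show "tc (chain_root m N) y = qh powi (- 4 * crd N y n)" if "y \<in> root_lattice N"
    using tc_eq[OF lattice that] form by simp
  have "crd N (chain_root m N) n = 2"
    unfolding root using N_ge n_ge by (simp add: crd_add crd_simple_root_last crd_R)
  moreover have "Poly_Mapping.lookup (chain_root m N) n = 2"
    unfolding root using N_ge by (simp add: lookup_add lookup_R lookup_simple_root)
  ultimately show "\<chi> (chain_root m N) (chain_root m N) = qh powi (- 4)"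
    using q_eq[OF lattice] form by simp
  have "lamw lam (R n N) = lamw lam (R n (N - 1)) * lam (N - 1)"
    using R_Suc[of n "N - 1"] N_ge by (simp add: lamw_add lamw_simple)
  moreover have "lamw lam (R n (N - 1)) = (\<Prod>i=n..N-2. lam i)"
  proof -
    have "{n..<N - 1} = {n..N - 2}" using N_ge by auto
    then show ?thesis using lamw_R[of n "N - 1"] N_ge n_ge by simp
  qed
  ultimately show "lamw lam (chain_root m N) = (\<Prod>i=n..N-2. lam i) ^ 2 * lam (N - 1) * lam N"
    unfolding root lamw_add using NI by (simp add: lamw_simple power2_eq_square)
qed

end

section \<open>Conditions (ii), (iii), (iv) and the number of moves along the chain\<close>

definition conditions :: "(nat \<Rightarrow> 'k) \<Rightarrow> 'k \<Rightarrow> bool"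
  where "conditions lam g \<longleftrightarrow>
    (\<exists>x::nat. g = qh powi (- 4 * int x)) \<and>
    (\<forall>y::nat. y \<le> m - 2 \<and> g = qh powi (- 4 * int y) \<longrightarrow>
       (\<Prod>i = n..n + y. lam i) = qh powi (- 2 * int y) \<and>
       (\<forall>j. n + y + 1 \<le> j \<and> j \<le> N \<longrightarrow> lam j = 1)) \<and>
    (g = qh powi (- 4 * (int m - 1)) \<longrightarrow>
       (\<Prod>i = n..N - 1. lam i) = qh powi (- 2 * (int m - 1)))"

context
  fixes lam :: "nat \<Rightarrow> 'k" and r :: "nat \<Rightarrow> nat"
  assumes all_nonzero: "\<forall>i\<in>{1..N}. lam i \<noteq> 0"
    and all_high: "\<forall>j. n < j \<and> j \<le> N \<longrightarrow> lam j = qh powi (2 * int (r j))"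
begin

lemma lam_high: "\<lbrakk>n < j; j \<le> N\<rbrakk> \<Longrightarrow> lam j = qh powi (2 * int (r j))"
  using all_high by blast

text \<open>The scalar of the original character at eps_n - eps_(n+t+1), the root of step t: the
  vector stays there exactly if \<open>A t\<close> is
  \<open>qh powi (- 2 * z lam t)\<close>.\<close>

definition A :: "nat \<Rightarrow> 'k"
  where "A t = (\<Prod>i=n..n+t. lam i)"

lemma A_Suc: "A (Suc t) = A t * lam (n + Suc t)"
  by (simp add: A_def)

lemma z_Suc: "t < m \<Longrightarrow> z lam (Suc t) = z lam t + (if A t = qh powi (- 2 * z lam t) then 0 else 1)"
proof -
  assume "t < m"
  then have "lamw lam (R n (n + t + 1)) = A t"
    using lamw_R[OF all_nonzero, where k = n and l = "n + t + 1"] n_ge N_eq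
    by (simp add: A_def atLeastLessThanSuc_atLeastAtMost)
  moreover have "A t * qh powi (2 * z lam t) = 1 \<longleftrightarrow> A t = qh powi (- 2 * z lam t)"
    by (simp add: power_int_minus field_simps)
  ultimately show ?thesis by simp
qed

lemma z_typical: "\<lbrakk>t \<le> m; \<And>s. s < t \<Longrightarrow> A s \<noteq> qh powi (- 2 * int s)\<rbrakk> \<Longrightarrow> z lam t = int t"
  by (induction t) (auto simp: z_Suc simp del: z.simps(2))

lemma z_mono: "s \<le> t \<Longrightarrow> t \<le> m \<Longrightarrow> z lam s \<le> z lam t"
  by (induction t rule: dec_induct) (auto simp: z_Suc simp del: z.simps(2))

lemma A_later:
  assumes "s \<le> t" "t < m"
  shows "A t = A s * qh powi (2 * (\<Sum>j=n+s+1..n+t. int (r j)))"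
  using assms
proof (induction t rule: dec_induct)
  case (step t)
  have "lam (n + Suc t) = qh powi (2 * int (r (n + Suc t)))"
    using lam_high[of "n + Suc t"] step.prems N_eq by simp
  moreover have "{n+s+1..n+Suc t} = insert (n + Suc t) {n+s+1..n+t}" using step.hyps by auto
  ultimately show ?case
    using step by (simp add: A_Suc power_int_add distrib_left mult_ac)
qed simp

text \<open>Once the vector has stayed at step s, vanishing exponents keep \<open>A\<close> constant
  while \<open>z\<close> does not grow, so the same equality holds at every later step.\<close>

lemma z_constant:
  assumes "A s = qh powi (- 2 * int s)" "z lam s = int s" "\<And>j. \<lbrakk>n + s < j; j < N\<rbrakk> \<Longrightarrow> r j = 0"
    and "s \<le> t" "t \<le> m"
  shows "z lam t = int s"
  using assms(4,5)
proof (induction t rule: dec_induct)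
  case (step t)
  have "(\<Sum>j=n+s+1..n+t. int (r j)) = 0"
    using assms(3) step.prems N_eq by (intro sum.neutral) auto
  then have "A t = qh powi (- 2 * int s)"
    using A_later[of s t] assms(1) step by simp
  then show ?case using step by (simp add: z_Suc del: z.simps(2))
qed (use assms(2) in simp)

text \<open>The proof distinguishes where the first standstill occurs, at the least \<open>s\<close>
  with \<open>A s = qh powi (- 2 * int s)\<close>: nowhere, at the last step m - 1, or
  earlier.\<close>

lemma conditions_iff:
  assumes g: "g = (\<Prod>i=n..N-2. lam i) ^ 2 * lam (N - 1) * lam N"
  shows "conditions lam g \<longleftrightarrow> (\<exists>k. g * qh powi (4 * z lam m) = (qh powi (-4)) ^ k)"
    (is "_ \<longleftrightarrow> ?C")
proof -
  have N1: "N - 2 = n + (m - 2)" "N - 1 = n + (m - 1)" "Suc (m - 2) = m - 1" "Suc (m - 1) = m"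
    using m_ge N_eq by auto
  have g_A: "g = A (m - 2) ^ 2 * lam (N - 1) * lam N"
    unfolding g by (simp add: A_def N1(1))
  have A_last: "A (m - 1) = A (m - 2) * lam (N - 1)"
    using A_Suc[of "m - 2"] N1 by simp
  have prod_last: "(\<Prod>i=n..N-1. lam i) = A (m - 1)"
    unfolding A_def N1(2) ..
  have conds: "conditions lam g \<longleftrightarrow> (\<exists>x::nat. g = qh powi (- 4 * int x)) \<and>
    (\<forall>y::nat. y \<le> m - 2 \<and> g = qh powi (- 4 * int y) \<longrightarrow> A y = qh powi (- 2 * int y) \<and>
       (\<forall>j. n + y + 1 \<le> j \<and> j \<le> N \<longrightarrow> lam j = 1)) \<and>
    (g = qh powi (- 4 * int (m - 1)) \<longrightarrow> A (m - 1) = qh powi (- 2 * int (m - 1)))"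
    unfolding conditions_def prod_last using m_ge by (simp add: A_def[symmetric] of_nat_diff)
  have C: "?C \<longleftrightarrow> (\<exists>k::nat. g = qh powi (- 4 * (int k + z lam m)))"
  proof -
    have "g * qh powi (4 * z lam m) = (qh powi (-4)) ^ k \<longleftrightarrow> g = qh powi (- 4 * (int k + z lam m))" for k
    proof -
      have "g = qh powi (- 4 * (int k + z lam m)) \<longleftrightarrow>
          g * qh powi (4 * z lam m) = qh powi (- 4 * (int k + z lam m)) * qh powi (4 * z lam m)"
        by simp
      also have "qh powi (- 4 * (int k + z lam m)) * qh powi (4 * z lam m) = qh powi (- 4 * int k)"
        by (subst power_int_add[symmetric]) simp_all
      finally show ?thesis by (simp add: qh_powi_power)
    qed
    then show ?thesis by simp
  qed
  show ?thesis
  proof (cases "\<exists>s<m. A s = qh powi (- 2 * int s)")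
    \<comment> \<open>Every step moves, so z = m. An exponent x < m in (ii) would, by (iii) or (iv),
      make \<open>A x\<close> a standstill; hence x is at least m, and conversely (iii) and (iv)
      then have false premises.\<close>
    case False
    then have z: "z lam m = int m" using z_typical[of m] by auto
    show ?thesis
    proof
      assume "conditions lam g"
      then obtain x :: nat where x: "g = qh powi (- 4 * int x)" unfolding conds by blast
      have "m \<le> x"
      proof (rule ccontr)
        assume "\<not> m \<le> x"
        then consider "x \<le> m - 2" | "x = m - 1" by linarith
        then have "A x = qh powi (- 2 * int x)"
          using \<open>conditions lam g\<close> x unfolding conds by cases auto
        then show False using False \<open>\<not> m \<le> x\<close> by auto
      qed
      then show ?C unfolding C using x z by (intro exI[of _ "x - m"]) (simp add: of_nat_diff)
    next
      assume ?C
      then obtain k :: nat where k: "g = qh powi (- 4 * (int k + int m))"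
        unfolding C unfolding z by blast
      have "g = qh powi (- 4 * int y) \<longleftrightarrow> y = k + m" for y :: nat
        unfolding k qh_powi_inject by auto
      moreover from this[of "m - 1"] have "g \<noteq> qh powi (- 4 * int (m - 1))" using m_ge by simp
      ultimately show "conditions lam g" unfolding conds using m_ge by auto
    qed
  next
    case True
    then obtain s where s: "s < m" "A s = qh powi (- 2 * int s)"
      and least: "\<And>s'. s' < s \<Longrightarrow> A s' \<noteq> qh powi (- 2 * int s')"
      using exists_least_iff[of "\<lambda>s. s < m \<and> A s = qh powi (- 2 * int s)"] by (metis order_less_trans)
    have z_s: "z lam s = int s" using z_typical[of s] least s(1) by simp
    have z_ge: "z lam m \<ge> int s" using z_mono[of s m] z_s s(1) by simp
    show ?thesis
    proof (cases "s = m - 1")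
      \<comment> \<open>Only the last step can stand still, so z = m - 1. An exponent below m - 1
        would contradict minimality of s through (iii); the conclusion of (iv) is the choice of
        s.\<close>
      case True
      have z: "z lam m = int (m - 1)"
        using z_constant[OF s(2) z_s, of m] True N1 s(1) N_eq by simp
      show ?thesis
      proof
        assume "conditions lam g"
        then obtain x :: nat where x: "g = qh powi (- 4 * int x)" unfolding conds by blast
        have "m - 1 \<le> x"
        proof (rule ccontr)
          assume "\<not> m - 1 \<le> x"
          then have "x \<le> m - 2" "x < s" using True by linarith+
          then show False
            using \<open>conditions lam g\<close> x least unfolding conds by blast
        qed
        then show ?C unfolding C using x z by (intro exI[of _ "x - (m - 1)"]) (simp add: of_nat_diff)
      next
        assume ?C
        then obtain k :: nat where k: "g = qh powi (- 4 * (int k + int (m - 1)))"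
          unfolding C unfolding z by blast
        have "g = qh powi (- 4 * int y) \<longleftrightarrow> y = k + (m - 1)" for y :: nat
          unfolding k qh_powi_inject by auto
        then show "conditions lam g" unfolding conds using m_ge s(2) True by auto
      qed
    next
      case False
      then have s2: "s \<le> m - 2" using s(1) by simp
      \<comment> \<open>The exponents gathered between the standstill and the fork. Below,
        \<open>g_eq\<close> writes g as \<open>qh powi (- 4 * int s)\<close> times a power whose
        exponent is a sum of nonnegative terms.\<close>
      define S where "S = (\<Sum>j=n+s+1..n+(m-2). int (r j))"
      have S_nonneg: "S \<ge> 0" by (simp add: S_def sum_nonneg)
      have A2: "A (m - 2) = qh powi (- 2 * int s + 2 * S)"
        using A_later[of s "m - 2"] s2 m_ge unfolding s(2) S_def
        by (simp only: power_int_add[OF disjI1[OF qh_nonzero]])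
      have g_eq: "g = qh powi (- 4 * int s + 4 * S + 2 * int (r (N - 1)) + 2 * int (r N))"
      proof -
        have "lam (N - 1) = qh powi (2 * int (r (N - 1)))" "lam N = qh powi (2 * int (r N))"
          using lam_high[of "N - 1"] lam_high[of N] N_ge by auto
        then show ?thesis
          unfolding g_A A2 by (simp add: power2_eq_square power_int_add[symmetric])
      qed
      have all_zero: "r j = 0" if "S = 0" "r (N - 1) = 0" "r N = 0" "n + s < j" and j_le: "j \<le> N" for j
      proof -
        consider "j \<le> n + (m - 2)" | "j = N - 1" | "j = N" using j_le N1 by linarith
        then show ?thesis
        proof cases
          case 1
          then have "int (r j) \<le> S" unfolding S_def using that(4) by (intro member_le_sum) auto
          then show ?thesis using that(1) by simp
        qed (use that in auto)
      qed
      show ?thesis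
      proof
        assume cond: "conditions lam g"
        then obtain x :: nat where x: "g = qh powi (- 4 * int x)" unfolding conds by blast
        then have x_eq: "- 4 * int x = - 4 * int s + 4 * S + 2 * int (r (N - 1)) + 2 * int (r N)"
          unfolding g_eq qh_powi_inject by simp
        \<comment> \<open>Since x is at most s and hence at most m - 2, (iii) applies at x and makes
          it a standstill; minimality of s then gives x = s.\<close>
        then have "x \<le> s" using S_nonneg by linarith
        with s2 have "x \<le> m - 2" by linarith
        with cond x have Ax: "A x = qh powi (- 2 * int x)"
          and all_ones: "\<forall>j. n + x + 1 \<le> j \<and> j \<le> N \<longrightarrow> lam j = 1"
          unfolding conds by blast+
        have ones: "\<And>j. \<lbrakk>n + x + 1 \<le> j; j \<le> N\<rbrakk> \<Longrightarrow> lam j = 1"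
          using all_ones by blast
        have "x = s" using least[of x] Ax \<open>x \<le> s\<close> by (cases "x = s") auto
        have "r j = 0" if "n + s < j" "j \<le> N" for j
          using ones[of j] lam_high[of j] that \<open>x = s\<close> by (simp add: qh_powi_eq_1)
        then have "z lam m = int s" using z_constant[OF s(2) z_s, of m] s(1) by simp
        then show ?C unfolding C using x \<open>x = s\<close> by (intro exI[of _ 0]) simp
      next
        assume ?C
        then obtain k :: nat where k: "g = qh powi (- 4 * (int k + z lam m))" unfolding C by blast
        then have k_eq: "- 4 * (int k + z lam m) = - 4 * int s + 4 * S + 2 * int (r (N - 1)) + 2 * int (r N)"
          unfolding g_eq qh_powi_inject by simp
        have nonneg: "0 \<le> int k" "0 \<le> int (r (N - 1))" "0 \<le> int (r N)" by simp_all
        \<comment> \<open>The exponent on the left is at most -4s because z is at least s; the one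
          on the right is at least -4s. So all nonnegative terms vanish.\<close>
        have "S = 0" "int (r (N - 1)) = 0" "int (r N) = 0"
          using k_eq z_ge S_nonneg nonneg unfolding distrib_left by linarith+
        then have zeros: "S = 0" "r (N - 1) = 0" "r N = 0" by simp_all
        then have g_s: "g = qh powi (- 4 * int s)" unfolding g_eq by simp
        have "lam j = 1" if "n + s + 1 \<le> j" "j \<le> N" for j
          using all_zero[OF zeros, of j] lam_high[of j] that by simp
        moreover have "g = qh powi (- 4 * int y) \<longleftrightarrow> y = s" for y :: nat
          unfolding g_s qh_powi_inject by auto
        ultimately show "conditions lam g" unfolding conds using s(2) False by auto
      qed
    qed
  qed
qed

end

section \<open>The criterion for finitely many weights\<close>

lemma negative_weight:
  assumes q: "qsys scale \<chi> {1..N} \<alpha>\<^sub>s lam b E F L 0 v" and "L \<mu> \<noteq> {0}"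
  shows "- \<mu> \<in> positive_cone N"
proof -
  interpret qsys scale \<chi> "{1..N}" \<alpha>\<^sub>s lam b E F L 0 v by (rule q)
  from assms(2) obtain x where x: "x \<in> L \<mu>" "x \<noteq> 0" using zero_in by blast
  have "generated 0 v \<mu> x" by (rule singular_generates[OF v_in v_nonzero E_v x(1)])
  then show ?thesis
    using x(2)
  proof induction
    case (add \<mu> x x')
    then show ?case by (cases "x = 0") auto
  next
    case (step \<mu> x i \<mu>')
    then have "x \<noteq> 0" by auto
    with step have "- \<mu> \<in> positive_cone N" by blast
    moreover from this have "Poly_Mapping.lookup \<mu> j \<le> 1" for j
      using order_trans[of "Poly_Mapping.lookup \<mu> j" 0 1] by (auto simp: positive_cone_def)
    moreover have "- \<mu>' = - \<mu> + \<alpha>\<^sub>s i" by (simp add: step.hyps)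
    ultimately show ?case
      using step.hyps root_lattice_add[of "- \<mu>" N "\<alpha>\<^sub>s i"] simple_root_in[of i N]
      by (auto simp: positive_cone_def lookup_add lookup_minus lookup_simple_root)
  qed (auto simp: positive_cone_def)
qed

text \<open>Supplies the Cartan hypothesis of the string lemmas: at an even simple root the norm is
  \<open>s\<close> (2 or -2), and the form with another simple root is 0 or -s/2.\<close>

lemma simple_even:
  assumes "i \<in> {1..N}" "i \<noteq> n"
  shows "\<exists>s. s \<noteq> 0 \<and> \<chi> (\<alpha>\<^sub>s i) (\<alpha>\<^sub>s i) = qh powi s \<and>
    (\<forall>j\<in>{1..N}. j \<noteq> i \<longrightarrow> tc (\<alpha>\<^sub>s i) (\<alpha>\<^sub>s j) = 1 \<or> qh powi s * tc (\<alpha>\<^sub>s i) (\<alpha>\<^sub>s j) = 1)"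
proof -
  define s :: int where "s = (if i < n then -2 else 2)"
  have "\<chi> (\<alpha>\<^sub>s i) (\<alpha>\<^sub>s i) = qh powi s"
    using q_low[of i] q_high[of i] assms by (auto simp: s_def)
  moreover have "tc (\<alpha>\<^sub>s i) (\<alpha>\<^sub>s j) = 1 \<or> qh powi s * tc (\<alpha>\<^sub>s i) (\<alpha>\<^sub>s j) = 1" if j: "j \<in> {1..N}" "j \<noteq> i" for j
  proof -
    have "form (\<alpha>\<^sub>s i) (\<alpha>\<^sub>s j) = 0 \<or> 2 * form (\<alpha>\<^sub>s i) (\<alpha>\<^sub>s j) = - s"
    proof -
      consider "i < N" "j < N" | "i = N" "j < N" | "i < N" "j = N" using assms(1) j by fastforce
      then show ?thesis
      proof cases
        case 1
        then show ?thesis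
          using assms j n_ge N_ge by (auto simp: form_simple crd_simple_root sgn_e_def s_def)
      next
        case 2
        then show ?thesis
          using assms j n_ge N_ge by (auto simp: form_last crd_simple_root s_def)
      next
        case 3
        then show ?thesis
          using assms j n_ge N_ge by (auto simp: form_simple crd_simple_root_last sgn_e_def s_def)
      qed
    qed
    then show ?thesis
      unfolding tc_simple[OF assms(1) j(1)] by (auto simp: power_int_add[symmetric])
  qed
  ultimately show ?thesis by (intro exI[of _ s]) (simp add: s_def)
qed

theorem finite_weights_iff:
  assumes q: "qsys scale \<chi> {1..N} \<alpha>\<^sub>s lam b E F L 0 v"
  shows "finite {\<mu>. L \<mu> \<noteq> {0}} \<longleftrightarrow>
    (\<forall>i\<in>{1..N} - {n}. \<exists>r::nat. lam i = \<chi> (\<alpha>\<^sub>s i) (\<alpha>\<^sub>s i) ^ r) \<and>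
    conditions lam ((\<Prod>i=n..N-2. lam i) ^ 2 * lam (N - 1) * lam N)"
    (is "?fin \<longleftrightarrow> ?pow \<and> ?cond")
proof -
  let ?g = "(\<Prod>i=n..N-2. lam i) ^ 2 * lam (N - 1) * lam N"
  interpret q: qsys scale \<chi> "{1..N}" \<alpha>\<^sub>s lam b E F L 0 v by (rule q)
  have all_nonzero: "\<forall>i\<in>{1..N}. lam i \<noteq> 0" using q.lam_nonzero by blast
  obtain b' E' F' v' where q': "qsys scale \<chi> {1..N} (chain_root m) (chain_character lam m) b' E' F' L (chain_weight lam m) v'"
    using chain[OF all_nonzero q, of m] by auto
  interpret q': qsys scale \<chi> "{1..N}" "chain_root m" "chain_character lam m" b' E' F' L "chain_weight lam m" v' by (rule q')
  have NI: "N \<in> {1..N}" using N_ge by simp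
  note final = final_root[OF all_nonzero]
  have lcN: "chain_character lam m N = ?g"
    using lc_eq[OF all_nonzero order_refl NI] final(5) by simp
  have chain_weight: "chain_weight lam m \<in> root_lattice N" "crd N (chain_weight lam m) n = - z lam m"
    using chain_weight_props[OF all_nonzero order_refl] by auto
  have \<kappa>N: "q'.\<kappa> N y = ?g * qh powi (- 4 * crd N y n)" if "y \<in> root_lattice N" for y
    using final(3)[OF that] by (simp add: q'.\<kappa>_def lcN tc_def mult.assoc)
  have \<kappa>0: "q.\<kappa> i y = lam i * qh powi (2 * form (\<alpha>\<^sub>s i) y)" if "i \<in> {1..N}" "y \<in> root_lattice N" for i y
    using tc_eq[OF simple_root_in[OF that(1)] that(2)] by (simp add: q.\<kappa>_def tc_def mult.assoc)
  have not_root_N: "\<chi> (chain_root m N) (chain_root m N) ^ Suc k \<noteq> 1" for k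
    unfolding final(4) by (rule not_root) simp
  have not_root_i: "\<chi> (\<alpha>\<^sub>s i) (\<alpha>\<^sub>s i) ^ Suc k \<noteq> 1" if "i \<in> {1..N}" "i \<noteq> n" for i k
    using simple_even[OF that] not_root by auto
  have cond_iff: "?cond \<longleftrightarrow> (\<exists>k. ?g * qh powi (4 * z lam m) = (qh powi (-4)) ^ k)" if ?pow
  proof -
    have "\<forall>i. \<exists>r. i \<in> {1..N} - {n} \<longrightarrow> lam i = \<chi> (\<alpha>\<^sub>s i) (\<alpha>\<^sub>s i) ^ r" using that by blast
    then obtain r where r: "\<And>i. i \<in> {1..N} - {n} \<Longrightarrow> lam i = \<chi> (\<alpha>\<^sub>s i) (\<alpha>\<^sub>s i) ^ r i" by metis
    have "\<forall>j. n < j \<and> j \<le> N \<longrightarrow> lam j = qh powi (2 * int (r j))"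
      using r q_high qh_powi_power[of 2] by simp
    from conditions_iff[OF all_nonzero this refl] show ?thesis by blast
  qed
  show ?thesis
  proof
    assume fin: ?fin
    have pow: ?pow
    proof
      fix i assume "i \<in> {1..N} - {n}"
      then have i: "i \<in> {1..N}" "i \<noteq> n" by auto
      show "\<exists>r::nat. lam i = \<chi> (\<alpha>\<^sub>s i) (\<alpha>\<^sub>s i) ^ r"
        using q.finite_weights_power[OF i(1) not_root_i[OF i] fin] by (simp add: q.\<kappa>_def)
    qed
    moreover have "\<exists>k. ?g * qh powi (4 * z lam m) = (qh powi (-4)) ^ k"
      using q'.finite_weights_power[OF NI not_root_N fin] \<kappa>N[OF chain_weight(1)] chain_weight(2) final(4) by simp
    ultimately show "?pow \<and> ?cond" using cond_iff by blast
  next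
    assume "?pow \<and> ?cond"
    then have pow: ?pow and C: "\<exists>k. ?g * qh powi (4 * z lam m) = (qh powi (-4)) ^ k" and "?cond"
      using cond_iff by blast+
    then obtain x0 :: nat where x0: "?g = qh powi (- 4 * int x0)" unfolding conditions_def by blast
    define S where "S = {\<mu>. L \<mu> \<noteq> {0}}"
    have S_lattice: "\<mu> \<in> root_lattice N" if "\<mu> \<in> S" for \<mu>
      using negative_weight[OF q, of \<mu>] root_lattice_minus[of "- \<mu>" N] that by (auto simp: S_def positive_cone_def)
    \<comment> \<open>In powers of qh the scalar \<open>\<kappa>\<close> has exponent
      \<open>s * int r + 2 * form\<close>, so \<open>h\<close> is the Cartan integer of the weight.
      Stating the reflection in coordinates hides its two directions.\<close>
    have even: "\<exists>s r. s \<noteq> 0 \<and> \<chi> (\<alpha>\<^sub>s i) (\<alpha>\<^sub>s i) = qh powi s \<and> (\<forall>\<mu>\<in>S. \<forall>h. s * h = s * int r + 2 * form (\<alpha>\<^sub>s i) \<mu> \<longrightarrow>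
        (\<exists>\<nu>\<in>S. \<forall>k. crd N \<nu> k = crd N \<mu> k - h * crd N (\<alpha>\<^sub>s i) k))"
      if i: "i \<in> {1..N}" "i \<noteq> n" for i
    proof -
      obtain s where s: "s \<noteq> 0" "\<chi> (\<alpha>\<^sub>s i) (\<alpha>\<^sub>s i) = qh powi s"
        and cartan: "\<And>j. \<lbrakk>j \<in> {1..N}; j \<noteq> i\<rbrakk> \<Longrightarrow> tc (\<alpha>\<^sub>s i) (\<alpha>\<^sub>s j) = 1 \<or> qh powi s * tc (\<alpha>\<^sub>s i) (\<alpha>\<^sub>s j) = 1"
        using simple_even[OF i] by blast
      obtain r :: nat where r: "lam i = \<chi> (\<alpha>\<^sub>s i) (\<alpha>\<^sub>s i) ^ r" using pow i by blast
      have "\<exists>\<nu>\<in>S. \<forall>k. crd N \<nu> k = crd N \<mu> k - h * crd N (\<alpha>\<^sub>s i) k"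
        if \<mu>: "\<mu> \<in> S" and h: "s * h = s * int r + 2 * form (\<alpha>\<^sub>s i) \<mu>" for \<mu> h
      proof -
        have "q.\<kappa> i \<mu> = \<chi> (\<alpha>\<^sub>s i) (\<alpha>\<^sub>s i) powi h"
          unfolding \<kappa>0[OF i(1) S_lattice[OF \<mu>]] r s(2)
          by (simp add: qh_powi_power power_int_mult[symmetric] h power_int_add)
        moreover have "q.\<kappa> i 0 = \<chi> (\<alpha>\<^sub>s i) (\<alpha>\<^sub>s i) ^ r" by (simp add: q.\<kappa>_def r)
        ultimately have "L (if 0 \<le> h then \<mu> - rep (nat h) (\<alpha>\<^sub>s i) else \<mu> + rep (nat (- h)) (\<alpha>\<^sub>s i)) \<noteq> {0}"
          using q.weight_reflection[OF i(1) not_root_i[OF i], of r \<mu> h] cartan \<mu>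
          unfolding S_def tc_def s(2) by blast
        moreover have "crd N (if 0 \<le> h then \<mu> - rep (nat h) (\<alpha>\<^sub>s i) else \<mu> + rep (nat (- h)) (\<alpha>\<^sub>s i)) k =
            crd N \<mu> k - h * crd N (\<alpha>\<^sub>s i) k" for k
          by (simp add: crd_diff crd_add crd_rep)
        ultimately show ?thesis unfolding S_def by blast
      qed
      with s show ?thesis by blast
    qed
    \<comment> \<open>The reflection at 2 eps_n, simple only at the end of the chain. By (ii) the
      Cartan integer there is x0 plus the coordinate at n, and subtracting twice it changes the sign
      of that coordinate up to the constant -2 x0.\<close>
    have final_refl: "\<exists>\<nu>\<in>S. crd N \<nu> n = - crd N \<mu> n - 2 * int x0" if \<mu>: "\<mu> \<in> S" for \<mu>
    proof -
      define h where "h = int x0 + crd N \<mu> n"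
      obtain k :: nat where k: "?g * qh powi (4 * z lam m) = (qh powi (-4)) ^ k" using C by blast
      have 1: "q'.\<kappa> N (chain_weight lam m) = \<chi> (chain_root m N) (chain_root m N) ^ k"
        using \<kappa>N[OF chain_weight(1)] chain_weight(2) final(4) k by simp
      have 2: "q'.\<kappa> N \<mu> = \<chi> (chain_root m N) (chain_root m N) powi h"
        unfolding \<kappa>N[OF S_lattice[OF \<mu>]] x0 final(4) h_def
        by (simp add: power_int_mult[symmetric] power_int_add[symmetric] distrib_left)
      \<comment> \<open>The other final simple roots contain eps_n with coefficient 0 or -1, so the
        Cartan integers at 2 eps_n are 0 or -1.\<close>
      have 3: "\<chi> (chain_root m N) (chain_root m j) * \<chi> (chain_root m j) (chain_root m N) = 1 \<or>
          \<chi> (chain_root m N) (chain_root m N) * (\<chi> (chain_root m N) (chain_root m j) * \<chi> (chain_root m j) (chain_root m N)) = 1" if j: "j \<in> {1..N}" "j \<noteq> N" for j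
      proof -
        have rcj: "chain_root m j = closed_root m j" using rc_eq[OF all_nonzero order_refl j(1)] .
        have lat: "closed_root m j \<in> root_lattice N" using rt_in[OF order_refl j(1)] .
        have "crd N (closed_root m j) n = 0 \<or> crd N (closed_root m j) n = -1"
          using j m_ge n_ge N_ge N_eq[symmetric]
          by (auto simp: closed_root_def crd_add crd_minus crd_R crd_simple_root)
        then show ?thesis
          using final(3)[OF lat] final(4) unfolding tc_def rcj by (auto simp: power_int_add[symmetric])
      qed
      have "L (if 0 \<le> h then \<mu> - rep (nat h) (chain_root m N) else \<mu> + rep (nat (- h)) (chain_root m N)) \<noteq> {0}"
        using q'.weight_reflection[OF NI not_root_N 1 3 _ 2] \<mu> by (simp add: S_def)
      moreover have "crd N (chain_root m N) n = 2"
        unfolding final(1) using N_ge n_ge by (simp add: crd_add crd_simple_root_last crd_R)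
      then have "crd N (if 0 \<le> h then \<mu> - rep (nat h) (chain_root m N) else \<mu> + rep (nat (- h)) (chain_root m N)) n =
          - crd N \<mu> n - 2 * int x0"
        by (simp add: crd_diff crd_add crd_rep h_def)
      ultimately show ?thesis unfolding S_def by blast
    qed
    have "\<exists>B. \<forall>x\<in>crd N ` S. \<forall>k\<in>{1..N}. \<bar>x k\<bar> \<le> B"
    proof (rule bounded_by_reflections[OF n_ge N_ge])
      fix x k assume "x \<in> crd N ` S" and k: "1 \<le> k" "k \<le> n + 1"
      then obtain \<mu> where \<mu>: "\<mu> \<in> S" "x = crd N \<mu>" by blast
      have le: "Poly_Mapping.lookup \<mu> j \<le> 0" and z: "Poly_Mapping.lookup \<mu> 0 = 0" for j
        using negative_weight[OF q, of \<mu>] \<mu> by (auto simp: S_def positive_cone_def root_lattice_def in_keys_iff)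
      \<comment> \<open>For m = 2 the index n + 1 is N - 1, where the partial sum also involves the
        coefficient of the last simple root.\<close>
      consider "k + 1 < N" | "k = N - 1" using k N_ge by linarith
      then show "(\<Sum>l=1..k. x l) \<le> 0"
      proof cases
        case 1
        then show ?thesis using crd_partial_sum[OF 1, of \<mu>] le[of k] z \<mu>(2) by simp
      next
        case 2
        then show ?thesis
          using crd_partial_sum_fork[of N \<mu>] le[of k] le[of N] z \<mu>(2) N_ge by simp
      qed
    next
      fix i assume i: "1 \<le> i" "i < N" "i \<noteq> n"
      then have iI: "i \<in> {1..N}" by simp
      obtain s r where s: "s \<noteq> 0" "\<chi> (\<alpha>\<^sub>s i) (\<alpha>\<^sub>s i) = qh powi s"
        and refl: "\<And>\<mu> h. \<lbrakk>\<mu> \<in> S; s * h = s * int r + 2 * form (\<alpha>\<^sub>s i) \<mu>\<rbrakk> \<Longrightarrow>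
          \<exists>\<nu>\<in>S. \<forall>k. crd N \<nu> k = crd N \<mu> k - h * crd N (\<alpha>\<^sub>s i) k"
        using even[OF iI i(3)] by blast
      have s_val: "s = 2 * sgn_e i" "sgn_e (i + 1) = sgn_e i"
      proof -
        have "qh powi s = qh powi (2 * sgn_e i)"
          using s(2) q_low[of i] q_high[of i] i by (auto simp: sgn_e_def)
        then show "s = 2 * sgn_e i" by (simp add: qh_powi_inject)
        show "sgn_e (i + 1) = sgn_e i" using i by (auto simp: sgn_e_def)
      qed
      have "\<exists>y\<in>crd N ` S. y i = x (i + 1) + (- int r) \<and> y (i + 1) = x i - (- int r)" if "x \<in> crd N ` S" for x
      proof -
        from that obtain \<mu> where \<mu>: "\<mu> \<in> S" "x = crd N \<mu>" by blast
        let ?h = "int r + crd N \<mu> i - crd N \<mu> (i + 1)"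
        have "s * ?h = s * int r + 2 * form (\<alpha>\<^sub>s i) \<mu>"
          unfolding form_simple[OF i(1,2)] s_val by (simp add: algebra_simps)
        from refl[OF \<mu>(1) this] obtain \<nu> where \<nu>: "\<nu> \<in> S" "\<And>k. crd N \<nu> k = crd N \<mu> k - ?h * crd N (\<alpha>\<^sub>s i) k"
          by blast
        show ?thesis
          using \<nu>(1) \<nu>(2)[of i] \<nu>(2)[of "i + 1"] i \<mu>(2)
          by (intro bexI[OF _ imageI[OF \<nu>(1)]]) (simp add: crd_simple_root)
      qed
      then show "\<exists>c. \<forall>x\<in>crd N ` S. \<exists>y\<in>crd N ` S. y i = x (i + 1) + c \<and> y (i + 1) = x i - c" by blast
    next
      obtain s r where s: "s \<noteq> 0" "\<chi> (\<alpha>\<^sub>s N) (\<alpha>\<^sub>s N) = qh powi s"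
        and refl: "\<And>\<mu> h. \<lbrakk>\<mu> \<in> S; s * h = s * int r + 2 * form (\<alpha>\<^sub>s N) \<mu>\<rbrakk> \<Longrightarrow>
          \<exists>\<nu>\<in>S. \<forall>k. crd N \<nu> k = crd N \<mu> k - h * crd N (\<alpha>\<^sub>s N) k"
        using even[OF NI] N_ge by (metis Suc_n_not_le_n add_2_eq_Suc' le_SucI)
      have s_val: "s = 2"
      proof -
        have "qh powi s = qh powi 2" using s(2) q_high[of N] N_ge by simp
        then show ?thesis unfolding qh_powi_inject .
      qed
      have "\<exists>y\<in>crd N ` S. y (N - 1) = - x N + (- int r)" if "x \<in> crd N ` S" for x
      proof -
        from that obtain \<mu> where \<mu>: "\<mu> \<in> S" "x = crd N \<mu>" by blast
        let ?h = "int r + crd N \<mu> (N - 1) + crd N \<mu> N"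
        have "s * ?h = s * int r + 2 * form (\<alpha>\<^sub>s N) \<mu>"
          unfolding form_last s_val by simp
        from refl[OF \<mu>(1) this] obtain \<nu> where \<nu>: "\<nu> \<in> S" "\<And>k. crd N \<nu> k = crd N \<mu> k - ?h * crd N (\<alpha>\<^sub>s N) k"
          by blast
        show ?thesis
          using \<nu>(2)[of "N - 1"] N_ge \<mu>(2)
          by (intro bexI[OF _ imageI[OF \<nu>(1)]]) (simp add: crd_simple_root_last)
      qed
      then show "\<exists>c. \<forall>x\<in>crd N ` S. \<exists>y\<in>crd N ` S. y (N - 1) = - x N + c" by blast
    next
      have "\<exists>y\<in>crd N ` S. y n = - x n + (- 2 * int x0)" if "x \<in> crd N ` S" for x
        using that final_refl by force
      then show "\<exists>c. \<forall>x\<in>crd N ` S. \<exists>y\<in>crd N ` S. y n = - x n + c" by blast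
    qed
    then obtain B where "\<forall>x\<in>crd N ` S. \<forall>k\<in>{1..N}. \<bar>x k\<bar> \<le> B" by blast
    then have "S \<subseteq> {a \<in> root_lattice N. \<forall>k\<in>{1..N}. \<bar>crd N a k\<bar> \<le> B}"
      using S_lattice by blast
    then show ?fin
      unfolding S_def using finite_bounded_crd[of N B] N_ge by (auto intro: finite_subset)
  qed
qed

text \<open>The last two simple roots force the last two coordinates to vanish; the others carry
  this down, since neighbouring coordinates agree up to sign.\<close>

lemma form_nondegenerate:
  assumes "a \<in> root_lattice N" "\<And>i. i \<in> {1..N} \<Longrightarrow> form (\<alpha>\<^sub>s i) a = 0"
  shows "a = 0"
proof (rule crd_zero_imp[OF _ assms(1)])
  show "2 \<le> N" using N_ge by simp
  have step: "sgn_e i * crd N a i = sgn_e (i + 1) * crd N a (i + 1)" if "1 \<le> i" "i < N" for i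
    using form_simple[OF that, of a] assms(2)[of i] that by simp
  have "1 \<le> N - 1" "N - 1 < N" "\<not> N - 1 \<le> n" using N_ge n_ge by auto
  with step[of "N - 1"] have "crd N a (N - 1) = crd N a N" by (simp add: sgn_e_def)
  moreover have "crd N a (N - 1) + crd N a N = 0" using form_last[of a] assms(2)[of N] N_ge by simp
  ultimately have last: "crd N a N = 0" by linarith
  have "crd N a (N - j) = 0" if "j < N" for j
    using that
  proof (induction j)
    case 0
    then show ?case using last by simp
  next
    case (Suc j)
    then have "crd N a (N - Suc j + 1) = 0" by (simp add: Suc_diff_Suc)
    moreover have "1 \<le> N - Suc j" "N - Suc j < N" using Suc.prems by auto
    ultimately have "sgn_e (N - Suc j) * crd N a (N - Suc j) = 0" using step by simp
    then show ?case by (simp add: sgn_e_def split: if_splits)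
  qed
  note below = this
  show "crd N a k = 0" if "k \<in> {1..N}" for k
    using below[of "N - k"] that by simp
qed

text \<open>The two conditions are the eigenvalues of the \<open>K\<close> and \<open>L\<close>
  generators on a weight. Together they determine \<open>tc\<close> against all simple roots, hence
  the form, hence the weight; this allows projections onto weight spaces by torus elements.\<close>

lemma chi_separates:
  assumes "a \<in> root_lattice N" "b \<in> root_lattice N"
    and "\<And>i. i \<in> {1..N} \<Longrightarrow> \<chi> (\<alpha>\<^sub>s i) (- a) = \<chi> (\<alpha>\<^sub>s i) (- b) \<and> \<chi> a (\<alpha>\<^sub>s i) = \<chi> b (\<alpha>\<^sub>s i)"
  shows "a = b"
proof -
  have "form (\<alpha>\<^sub>s i) (a - b) = 0" if i: "i \<in> {1..N}" for i
  proof -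
    have inv: "\<chi> (\<alpha>\<^sub>s i) c * \<chi> (\<alpha>\<^sub>s i) (- c) = 1" for c
      using chi_add_right[of "\<alpha>\<^sub>s i" c "- c"] by simp
    have "\<chi> (\<alpha>\<^sub>s i) a = \<chi> (\<alpha>\<^sub>s i) b"
      using inv[of a] inv[of b] assms(3)[OF i] chi_nonzero[of "\<alpha>\<^sub>s i" "- b"] by (metis mult_right_cancel)
    then have "tc (\<alpha>\<^sub>s i) a = tc (\<alpha>\<^sub>s i) b" using assms(3)[OF i] by (simp add: tc_def)
    then have "tc (\<alpha>\<^sub>s i) (a - b) = 1" using chi_nonzero unfolding tc_diff by (simp add: tc_def)
    then have "qh powi (2 * form (\<alpha>\<^sub>s i) (a - b)) = 1"
      using tc_eq[OF simple_root_in[OF i] root_lattice_diff[OF assms(1,2)]] by simp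
    then show ?thesis unfolding qh_powi_eq_1 by simp
  qed
  then show ?thesis using form_nondegenerate[OF root_lattice_diff[OF assms(1,2)]] by simp
qed

end

section \<open>The word model of the irreducible module\<close>

definition fscale :: "'k::field \<Rightarrow> ('w \<Rightarrow> 'k) \<Rightarrow> 'w \<Rightarrow> 'k"
  where "fscale a f w = a * f w"

interpretation fs: vector_space fscale
  by standard (auto simp: fscale_def algebra_simps fun_eq_iff)

text \<open>
  A vector \<open>x\<close> of the irreducible module is determined by the function sending a word \<open>i\<^sub>1 \<dots> i\<^sub>k\<close> to the
  coefficient of the highest weight vector in \<open>E\<^bsub>i\<^sub>k\<^esub> \<dots> E\<^bsub>i\<^sub>1\<^esub> x\<close>.  On such functions \<open>E i\<close> is a shift,
  and the commutation relation determines \<open>F j\<close>.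
\<close>

locale word_model =
  fixes \<chi> :: "'g::ab_group_add \<Rightarrow> 'g \<Rightarrow> 'k::field"
    and I :: "'i set" and \<alpha> :: "'i \<Rightarrow> 'g" and lam b :: "'i \<Rightarrow> 'k"
  assumes chi_add_left: "\<chi> (r + s) t = \<chi> r t * \<chi> s t"
    and chi_add_right: "\<chi> r (s + t) = \<chi> r s * \<chi> r t"
    and chi_nonzero: "\<chi> r s \<noteq> 0"
    and height_ex: "\<exists>h::'g \<Rightarrow> int. (\<forall>x y. h (x + y) = h x + h y) \<and> (\<forall>i\<in>I. h (\<alpha> i) > 0)"
    and lam_nonzero: "i \<in> I \<Longrightarrow> lam i \<noteq> 0"
    and b_nonzero: "i \<in> I \<Longrightarrow> b i \<noteq> 0"
begin

definition c :: "'i \<Rightarrow> 'g \<Rightarrow> 'k"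
  where "c i \<mu> = b i * (inverse (\<chi> \<mu> (\<alpha> i)) - lam i * \<chi> (\<alpha> i) \<mu>)"

definition content :: "'i list \<Rightarrow> 'g"
  where "content w = sum_list (map \<alpha> w)"

lemma content_simps [simp]: "content [] = 0" "content (i # w) = \<alpha> i + content w"
  "content (u @ w) = content u + content w"
  by (simp_all add: content_def)

definition mE :: "'i \<Rightarrow> ('i list \<Rightarrow> 'k) \<Rightarrow> 'i list \<Rightarrow> 'k"
  where "mE i f w = f (i # w)"

text \<open>The value at \<open>i # w\<close> is that of E_i F_j f at \<open>w\<close>, rewritten by
  the commutation relation. The weight of f is not an argument but is read off from the word: where
  f is nonzero at \<open>w\<close>, its weight is minus the content of \<open>w\<close>. The value
  at the empty word is zero because a lowered vector has no highest weight component.\<close>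

fun mF :: "'i \<Rightarrow> ('i list \<Rightarrow> 'k) \<Rightarrow> 'i list \<Rightarrow> 'k"
  where "mF j f [] = 0"
  | "mF j f (i # w) = mF j (mE i f) w + (if i = j then c i (- content w) * f w else 0)"

definition \<delta> :: "'i list \<Rightarrow> 'k"
  where "\<delta> w = (if w = [] then 1 else 0)"

definition fword :: "'i list \<Rightarrow> 'i list \<Rightarrow> 'k"
  where "fword u = foldr mF u \<delta>"

lemma fword_simps [simp]: "fword [] = \<delta>" "fword (j # u) = mF j (fword u)"
  by (simp_all add: fword_def)

lemma mE_add: "mE i (f + g) = mE i f + mE i g"
  and mE_scale: "mE i (fscale a f) = fscale a (mE i f)"
  by (auto simp: mE_def fun_eq_iff fscale_def)

lemma mF_add: "mF j (f + g) = mF j f + mF j g"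
proof
  show "mF j (f + g) w = (mF j f + mF j g) w" for w
    by (induction w arbitrary: f g) (auto simp: mE_add algebra_simps)
qed

lemma mF_scale: "mF j (fscale a f) = fscale a (mF j f)"
proof
  show "mF j (fscale a f) w = fscale a (mF j f) w" for w
    by (induction w arbitrary: f) (auto simp: mE_scale fscale_def algebra_simps)
qed

lemma mF_zero [simp]: "mF j 0 = 0"
  using mF_add[of j 0 0] by simp

lemma mE_zero [simp]: "mE j 0 = 0"
  using mE_add[of j 0 0] by simp

lemma mE_\<delta> [simp]: "mE j \<delta> = 0"
  by (auto simp: mE_def \<delta>_def fun_eq_iff)

definition supported :: "'g \<Rightarrow> ('i list \<Rightarrow> 'k) \<Rightarrow> bool"
  where "supported \<mu> f \<longleftrightarrow> (\<forall>w. f w \<noteq> 0 \<longrightarrow> content w = - \<mu> \<and> set w \<subseteq> I)"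

lemma supported_mF:
  assumes "supported \<mu> f" "j \<in> I"
  shows "supported (\<mu> - \<alpha> j) (mF j f)"
proof -
  have "mF j f w \<noteq> 0 \<Longrightarrow> content w = \<alpha> j - \<mu> \<and> set w \<subseteq> I" for w
    using assms(1)
  proof (induction w arbitrary: f \<mu>)
    case (Cons i w)
    show ?case
    proof (cases "mF j (mE i f) w = 0")
      case True
      then show ?thesis using Cons.prems assms(2) by (auto simp: supported_def split: if_splits)
    next
      case False
      have "supported (\<mu> + \<alpha> i) (mE i f)" "i \<in> I"
      proof -
        show "supported (\<mu> + \<alpha> i) (mE i f)"
          unfolding supported_def mE_def
        proof (intro allI impI)
          fix w assume "f (i # w) \<noteq> 0"
          then have "\<alpha> i + content w = - \<mu>" "set (i # w) \<subseteq> I"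
            using Cons.prems(2) unfolding supported_def by (metis content_simps(2))+
          moreover have "content w = (\<alpha> i + content w) - \<alpha> i" by simp
          ultimately show "content w = - (\<mu> + \<alpha> i) \<and> set w \<subseteq> I" by simp
        qed
        have "mE i f \<noteq> 0" using False mF_zero by fastforce
        then obtain w where "f (i # w) \<noteq> 0" by (auto simp: mE_def fun_eq_iff)
        then show "i \<in> I" using Cons.prems(2) by (auto simp: supported_def)
      qed
      with Cons.IH[OF False this(1)] show ?thesis by (auto simp: algebra_simps)
    qed
  qed simp
  then show ?thesis by (auto simp: supported_def)
qed

lemma mE_mF:
  assumes "supported \<mu> f"
  shows "mE i (mF j f) = mF j (mE i f) + (if i = j then fscale (c i \<mu>) f else 0)"
proof
  fix w
  have "c i (- content w) * f w = c i \<mu> * f w"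
    using assms by (cases "f w = 0") (auto simp: supported_def)
  then show "mE i (mF j f) w = (mF j (mE i f) + (if i = j then fscale (c i \<mu>) f else 0)) w"
    by (auto simp: mE_def[of _ "mF j f"] fscale_def)
qed

inductive member :: "'g \<Rightarrow> ('i list \<Rightarrow> 'k) \<Rightarrow> bool" where
    base: "member 0 \<delta>"
  | zero: "member \<mu> 0"
  | add: "\<lbrakk>member \<mu> f; member \<mu> g\<rbrakk> \<Longrightarrow> member \<mu> (f + g)"
  | scale: "member \<mu> f \<Longrightarrow> member \<mu> (fscale a f)"
  | step: "\<lbrakk>member \<mu> f; j \<in> I; \<mu>' = \<mu> - \<alpha> j\<rbrakk> \<Longrightarrow> member \<mu>' (mF j f)"

definition Lm :: "'g \<Rightarrow> ('i list \<Rightarrow> 'k) set"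
  where "Lm \<mu> = {f. member \<mu> f}"

lemma member_supported: "member \<mu> f \<Longrightarrow> supported \<mu> f"
proof (induction rule: member.induct)
  case base
  then show ?case by (auto simp: supported_def \<delta>_def split: if_splits)
next
  case (add \<mu> f g)
  then show ?case unfolding supported_def by (metis add.left_neutral plus_fun_def)
next
  case (step \<mu> f j \<mu>')
  then show ?case using supported_mF by simp
qed (auto simp: supported_def fscale_def)

lemma member_mE: "\<lbrakk>member \<mu> f; i \<in> I\<rbrakk> \<Longrightarrow> member (\<mu> + \<alpha> i) (mE i f)"
proof (induction rule: member.induct)
  case (step \<mu> f j \<mu>')
  have "member (\<mu>' + \<alpha> i) (mF j (mE i f))"
    by (rule member.step[OF step.IH[OF step.prems] step.hyps(2)]) (simp add: step.hyps)
  moreover have "member (\<mu>' + \<alpha> i) (if i = j then fscale (c i \<mu>) f else 0)"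
    using step.hyps by (auto intro: member.scale member.zero)
  ultimately show ?case
    unfolding mE_mF[OF member_supported[OF step.hyps(1)]] by (rule member.add)
qed (simp_all add: mE_add mE_scale member.zero member.add member.scale)

lemma append_shift_closed:
  assumes "\<And>i \<mu> x. \<lbrakk>i \<in> I; x \<in> S \<mu>\<rbrakk> \<Longrightarrow> mE i x \<in> S (\<mu> + \<alpha> i)" "f \<in> S \<mu>" "set w \<subseteq> I"
  shows "(\<lambda>u. f (w @ u)) \<in> S (\<mu> + content w)"
  using assms(2,3)
proof (induction w arbitrary: f \<mu>)
  case (Cons i w)
  have "mE i f \<in> S (\<mu> + \<alpha> i)" using Cons.prems assms(1) by simp
  from Cons.IH[OF this] Cons.prems show ?case by (simp add: mE_def add.assoc)
qed simp

text \<open>Let \<open>w\<close> be a longest word with y w nonzero; it exists because the height of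
  the weight bounds the length. Raising \<open>y\<close> along \<open>w\<close> leaves a function
  supported on the empty word, so \<open>S\<close> contains \<open>\<delta>\<close>, which generates
  everything.\<close>

lemma irreducible_Lm:
  assumes S: "\<And>\<mu>. fs.subspace (S \<mu>)"
    and SE: "\<And>i \<mu> x. \<lbrakk>i \<in> I; x \<in> S \<mu>\<rbrakk> \<Longrightarrow> mE i x \<in> S (\<mu> + \<alpha> i)"
    and SF: "\<And>i \<mu> x. \<lbrakk>i \<in> I; x \<in> S \<mu>\<rbrakk> \<Longrightarrow> mF i x \<in> S (\<mu> - \<alpha> i)"
    and y: "y \<in> S \<nu>" "y \<noteq> 0" "y \<in> Lm \<nu>"
  shows "Lm \<mu> \<subseteq> S \<mu>"
proof -
  obtain h :: "'g \<Rightarrow> int" where h: "\<And>x y. h (x + y) = h x + h y" "\<And>i. i \<in> I \<Longrightarrow> h (\<alpha> i) > 0"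
    using height_ex by blast
  have supp: "content w = - \<nu>" "set w \<subseteq> I" if "y w \<noteq> 0" for w
    using member_supported y(3) that by (auto simp: Lm_def supported_def)
  have len: "int (length w) \<le> h (content w)" if "set w \<subseteq> I" for w
    using that
  proof (induction w)
    case Nil
    then show ?case using h(1)[of 0 0] by simp
  next
    case (Cons i w)
    then show ?case using h(2)[of i] by (simp add: h(1))
  qed
  have bounded: "length w \<le> nat (h (- \<nu>))" if "y w \<noteq> 0" for w
    using len[OF supp(2)[OF that]] unfolding supp(1)[OF that] by simp
  obtain w where w: "y w \<noteq> 0" and w_max: "\<And>w'. y w' \<noteq> 0 \<Longrightarrow> length w' \<le> length w"
  proof -
    have "\<exists>w. y w \<noteq> 0" using y(2) by (auto simp: fun_eq_iff)
    then obtain w where "y w \<noteq> 0" by blast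
    from ex_has_greatest_nat[of "\<lambda>w. y w \<noteq> 0" w length "Suc (nat (h (- \<nu>)))", OF this] bounded
    show ?thesis using that by (auto simp: less_Suc_eq_le)
  qed
  have "(\<lambda>u. y (w @ u)) \<in> S (\<nu> + content w)"
    by (rule append_shift_closed[OF SE y(1) supp(2)[OF w]])
  also have "\<nu> + content w = 0" using supp(1)[OF w] by simp
  also have "(\<lambda>u. y (w @ u)) = fscale (y w) \<delta>"
  proof
    fix u show "y (w @ u) = fscale (y w) \<delta> u"
      using w_max[of "w @ u"] by (auto simp: fscale_def \<delta>_def)
  qed
  finally have "fscale (inverse (y w)) (fscale (y w) \<delta>) \<in> S 0"
    using S by (blast intro: fs.subspace_scale)
  then have \<delta>: "\<delta> \<in> S 0" using w by simp
  have "f \<in> S \<mu>" if "member \<mu> f" for \<mu> f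
    using that
  proof induction
    case (step \<mu> f j \<mu>')
    then show ?case using SF by blast
  qed (rule \<delta> fs.subspace_add[OF S] fs.subspace_scale[OF S] fs.subspace_0[OF S]; assumption?)+
  then show ?thesis by (auto simp: Lm_def)
qed

theorem qsys_model: "qsys fscale \<chi> I \<alpha> lam b (\<lambda>i \<mu>. mE i) (\<lambda>i \<mu>. mF i) Lm 0 \<delta>"
proof unfold_locales
  show "fs.subspace (Lm \<mu>)" for \<mu>
    by (auto simp: fs.subspace_def Lm_def intro: member.intros)
  show "\<delta> \<noteq> 0" by (auto simp: \<delta>_def fun_eq_iff)
  show "mE i (mF j x) = mF j (mE i x) +
      (if i = j then fscale (b i * (inverse (\<chi> \<mu> (\<alpha> i)) - lam i * \<chi> (\<alpha> i) \<mu>)) x else 0)"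
    if "x \<in> Lm \<mu>" for i j \<mu> x
    using mE_mF[OF member_supported, of \<mu> x i j] that by (auto simp: Lm_def c_def)
  show "Lm \<mu> \<subseteq> S \<mu>"
    if "\<And>\<mu>. fs.subspace (S \<mu>) \<and> S \<mu> \<subseteq> Lm \<mu>"
      and "\<And>i \<mu> x. \<lbrakk>i \<in> I; x \<in> S \<mu>\<rbrakk> \<Longrightarrow> mE i x \<in> S (\<mu> + \<alpha> i)"
      and "\<And>i \<mu> x. \<lbrakk>i \<in> I; x \<in> S \<mu>\<rbrakk> \<Longrightarrow> mF i x \<in> S (\<mu> - \<alpha> i)"
      and "y \<in> S \<nu>" "y \<noteq> 0" for S y \<nu> \<mu>
    using irreducible_Lm[of S y \<nu> \<mu>] that by blast
qed (use height_ex in \<open>auto simp: chi_add_left chi_add_right chi_nonzero lam_nonzero b_nonzero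
    mE_add mE_scale mF_add mF_scale Lm_def member_mE intro: member.intros\<close>)

lemma fword_in_Lm: "set u \<subseteq> I \<Longrightarrow> fword u \<in> Lm (- content u)"
  unfolding Lm_def
  by (induction u) (auto intro!: member.base member.step simp: algebra_simps)

lemma Lm_span: "f \<in> Lm \<mu> \<Longrightarrow> f \<in> fs.span (fword ` {u. set u \<subseteq> I \<and> content u = - \<mu>})"
  unfolding Lm_def mem_Collect_eq
proof (induction rule: member.induct)
  case base
  show ?case by (rule fs.span_base) (auto intro!: image_eqI[of _ _ "[]"])
next
  case (step \<mu> f j \<mu>')
  let ?B = "fs.span (fword ` {u. set u \<subseteq> I \<and> content u = - \<mu>'})"
  have "fs.span (fword ` {u. set u \<subseteq> I \<and> content u = - \<mu>}) \<subseteq> {f. mF j f \<in> ?B}"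
  proof (rule fs.span_minimal)
    show "fword ` {u. set u \<subseteq> I \<and> content u = - \<mu>} \<subseteq> {f. mF j f \<in> ?B}"
    proof clarsimp
      fix u assume "set u \<subseteq> I" "content u = - \<mu>"
      then have "fword (j # u) \<in> ?B" using step.hyps by (intro fs.span_base imageI) auto
      then show "mF j (fword u) \<in> ?B" by simp
    qed
    show "fs.subspace {f. mF j f \<in> ?B}"
      unfolding fs.subspace_def by (auto simp: mF_add mF_scale fs.span_zero fs.span_add fs.span_scale)
  qed
  with step.IH show ?case by blast
qed (rule fs.span_zero fs.span_add fs.span_scale; assumption?)+

text \<open>Turns a question about weights into one about words with nonzero function, which is the
  form in which the Verma module can be compared.\<close>

lemma Lm_nonzero_iff: "Lm \<mu> \<noteq> {0} \<longleftrightarrow> (\<exists>u. set u \<subseteq> I \<and> content u = - \<mu> \<and> fword u \<noteq> 0)"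
proof
  assume "Lm \<mu> \<noteq> {0}"
  moreover have "0 \<in> Lm \<mu>" by (simp add: Lm_def member.zero)
  ultimately obtain f where f: "f \<in> Lm \<mu>" "f \<noteq> 0" by blast
  show "\<exists>u. set u \<subseteq> I \<and> content u = - \<mu> \<and> fword u \<noteq> 0"
  proof (rule ccontr)
    assume "\<not> ?thesis"
    then have "fword ` {u. set u \<subseteq> I \<and> content u = - \<mu>} \<subseteq> {0}" by blast
    then have "fs.span (fword ` {u. set u \<subseteq> I \<and> content u = - \<mu>}) \<subseteq> {0}"
      by (rule fs.span_minimal) (rule fs.subspace_single_0)
    with Lm_span[OF f(1)] f(2) show False by blast
  qed
qed (use fword_in_Lm in fastforce)

end

section \<open>Words in the generators\<close>

lemma poly_mapping_sum_single: "(\<Sum>w\<in>Poly_Mapping.keys p. Poly_Mapping.single w (Poly_Mapping.lookup p w)) = p"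
proof (rule poly_mapping_eqI)
  fix k
  show "Poly_Mapping.lookup (\<Sum>w\<in>Poly_Mapping.keys p. Poly_Mapping.single w (Poly_Mapping.lookup p w)) k
      = Poly_Mapping.lookup p k"
    by (simp add: lookup_sum lookup_single when_def in_keys_iff)
qed

lemma const_monomial: "const c * monomial u = Poly_Mapping.single (FWord u) c"
  by (simp add: const_def monomial_def mult_single)

lemma monomial_mult: "monomial u * monomial w = monomial (u @ w)"
  by (simp add: monomial_def mult_single plus_fword_def)

lemma const_monomial_mult: "(const c * monomial u) * (const d * monomial w) = const (c * d) * monomial (u @ w)"
  by (simp add: const_monomial mult_single plus_fword_def)

lemma monomial_Nil: "monomial [] = 1"
  by (simp add: monomial_def single_one[symmetric] zero_fword_def del: single_one)

lemma const_one [simp]: "const 1 = 1"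
  by (simp add: const_def)

lemma const_zero [simp]: "const 0 = 0"
  by (simp add: const_def)

lemma const_mult: "const (c * d) = const c * const d"
  by (simp add: const_def mult_single)

lemma const_add: "const (c + d) = const c + const d"
  by (simp add: const_def single_add)

lemma const_uminus: "const (- c) = - const c"
  by (simp add: const_def single_uminus)

definition FA :: "nat \<Rightarrow> ('k::field, 'k free) module"
  where "FA N = free_algebra (generators N)"

lemma FA_simps [simp]:
  "monoid.mult (FA N) = (*)" "one (FA N) = 1" "zero (FA N) = 0" "add (FA N) = (+)"
  "module.smult (FA N) = (\<lambda>c p. const c * p)"
  by (simp_all add: FA_def free_algebra_def const_def fun_eq_iff)

lemma FA_carrier: "p \<in> carrier (FA N) \<longleftrightarrow> (\<forall>w\<in>Poly_Mapping.keys p. set (letters w) \<subseteq> generators N)"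
  by (simp add: FA_def free_algebra_def)

lemma ring_FA: "ring (FA N)"
  unfolding FA_def by (rule ring_free_algebra)

lemma FA_add: "\<lbrakk>p \<in> carrier (FA N); q \<in> carrier (FA N)\<rbrakk> \<Longrightarrow> p + q \<in> carrier (FA N)"
  and FA_mult: "\<lbrakk>p \<in> carrier (FA N); q \<in> carrier (FA N)\<rbrakk> \<Longrightarrow> p * q \<in> carrier (FA N)"
  and FA_zero [simp]: "0 \<in> carrier (FA N)"
  and FA_one [simp]: "1 \<in> carrier (FA N)"
  using ring.ring_simprules(1)[OF ring_FA[of N], of p q] ring.ring_simprules(5)[OF ring_FA[of N], of p q]
    ring.ring_simprules(2)[OF ring_FA[of N]] ring.ring_simprules(6)[OF ring_FA[of N]] by simp_all

lemma FA_monomial: "set u \<subseteq> generators N \<Longrightarrow> monomial u \<in> carrier (FA N)"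
  by (simp add: FA_carrier monomial_def)

lemma FA_const [simp]: "const c \<in> carrier (FA N)"
  by (simp add: FA_carrier const_def zero_fword_def)

lemma FA_uminus: "p \<in> carrier (FA N) \<Longrightarrow> - p \<in> carrier (FA N)"
  by (simp add: FA_carrier keys_def)

lemma FA_diff: "\<lbrakk>p \<in> carrier (FA N); q \<in> carrier (FA N)\<rbrakk> \<Longrightarrow> p - q \<in> carrier (FA N)"
  using FA_add[of p N "- q"] FA_uminus[of q N] by simp

lemma FA_a_inv: "p \<in> carrier (FA N) \<Longrightarrow> \<ominus>\<^bsub>FA N\<^esub> p = - p"
  by (rule abelian_group.minus_equality[OF ring.is_abelian_group[OF ring_FA]]) (simp_all add: FA_uminus)

lemma FA_induct [consumes 1, case_names zero add monomial]:
  assumes "p \<in> carrier (FA N)" "P 0"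
    and "\<And>p q. \<lbrakk>p \<in> carrier (FA N); q \<in> carrier (FA N); P p; P q\<rbrakk> \<Longrightarrow> P (p + q)"
    and "\<And>c u. set u \<subseteq> generators N \<Longrightarrow> P (const c * monomial u)"
  shows "P p"
proof -
  let ?f = "\<lambda>w. Poly_Mapping.single w (Poly_Mapping.lookup p w)"
  have "finite W \<Longrightarrow> W \<subseteq> Poly_Mapping.keys p \<Longrightarrow> sum ?f W \<in> carrier (FA N) \<and> P (sum ?f W)" for W
  proof (induction W rule: finite_induct)
    case (insert w W)
    have u: "set (letters w) \<subseteq> generators N"
      using assms(1) insert.prems by (auto simp: FA_carrier)
    have eq: "?f w = const (Poly_Mapping.lookup p w) * monomial (letters w)"
      by (simp add: const_monomial)
    have "?f w \<in> carrier (FA N)" unfolding eq using u by (intro FA_mult FA_const FA_monomial)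
    moreover have "P (?f w)" unfolding eq by (rule assms(4)[OF u])
    ultimately show ?case
      using insert assms(3) by (auto intro: FA_add)
  qed (simp add: assms(2))
  from this[OF _ order_refl] show ?thesis by (simp add: poly_mapping_sum_single)
qed

lemma free_induct [case_names zero add monomial]:
  fixes p :: "'k::field free"
  assumes "P 0" "\<And>p q. \<lbrakk>P p; P q\<rbrakk> \<Longrightarrow> P (p + q)" "\<And>c u. P (const c * monomial u)"
  shows "P p"
proof -
  let ?f = "\<lambda>w. Poly_Mapping.single w (Poly_Mapping.lookup p w)"
  have "P (sum ?f W)" for W
  proof (induction W rule: infinite_finite_induct)
    case (insert w W)
    have "?f w = const (Poly_Mapping.lookup p w) * monomial (letters w)"
      by (simp add: const_monomial)
    then show ?case using insert assms(2,3) by simp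
  qed (simp_all add: assms(1))
  from this[of "Poly_Mapping.keys p"] show ?thesis by (simp add: poly_mapping_sum_single)
qed

lemma const_commute: "p * const c = const c * p"
proof (induction p rule: free_induct)
  case (monomial d u)
  then show ?case by (simp add: const_monomial) (simp add: const_def mult_single mult.commute)
qed (simp_all add: distrib_left distrib_right)

lemma const_left_commute: "p * (const c * q) = const c * (p * q)"
  by (metis const_commute mult.assoc)

text \<open>An endomorphism of the free algebra sending generators to words. This suffices for the
  automorphism Omega, whose values on generators are single words.\<close>

definition subst :: "(generator \<Rightarrow> generator list) \<Rightarrow> 'k::field free \<Rightarrow> 'k free"
  where "subst \<omega> p = (\<Sum>w\<in>Poly_Mapping.keys p. const (Poly_Mapping.lookup p w) * monomial (concat (map \<omega> (letters w))))"

lemma subst_superset: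
  assumes "finite W" "Poly_Mapping.keys p \<subseteq> W"
  shows "subst \<omega> p = (\<Sum>w\<in>W. const (Poly_Mapping.lookup p w) * monomial (concat (map \<omega> (letters w))))"
  unfolding subst_def
  by (rule sum.mono_neutral_left) (use assms in \<open>auto simp: in_keys_iff const_def\<close>)

lemma subst_add: "subst \<omega> (p + q) = subst \<omega> p + subst \<omega> q"
proof -
  let ?W = "Poly_Mapping.keys p \<union> Poly_Mapping.keys q"
  have "Poly_Mapping.keys (p + q) \<subseteq> ?W" by (rule keys_add)
  then show ?thesis
    by (simp add: subst_superset[of ?W] lookup_add const_add distrib_right sum.distrib)
qed

lemma subst_zero [simp]: "subst \<omega> 0 = 0"
  by (simp add: subst_def)

lemma subst_single: "subst \<omega> (const c * monomial u) = const c * monomial (concat (map \<omega> u))"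
  by (cases "c = 0") (simp_all add: const_monomial subst_def)

lemma subst_monomial: "subst \<omega> (monomial u) = monomial (concat (map \<omega> u))"
  using subst_single[of \<omega> 1 u] by simp

lemma subst_const_mult: "subst \<omega> (const c * p) = const c * subst \<omega> p"
proof (induction p rule: free_induct)
  case (monomial d u)
  show ?case
    unfolding mult.assoc[symmetric] const_mult[symmetric] subst_single ..
qed (simp_all add: distrib_left subst_add)

lemma subst_mult: "subst \<omega> (p * q) = subst \<omega> p * subst \<omega> q"
proof (induction p rule: free_induct)
  case (monomial c u)
  show ?case
  proof (induction q rule: free_induct)
    case (monomial d w)
    show ?case
      unfolding subst_single const_monomial_mult by simp
  qed (simp_all add: distrib_left subst_add)
qed (simp_all add: distrib_right subst_add)

lemma subst_one [simp]: "subst \<omega> 1 = 1"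
  using subst_monomial[of \<omega> "[]"] by (simp add: monomial_Nil)

lemma subst_uminus: "subst \<omega> (- p) = - subst \<omega> p"
  using subst_add[of \<omega> p "- p"] by (simp add: add_eq_0_iff)

lemma subst_diff: "subst \<omega> (p - q) = subst \<omega> p - subst \<omega> q"
  using subst_add[of \<omega> p "- q"] by (simp add: subst_uminus)

lemma subst_in:
  assumes "\<And>g. g \<in> generators N \<Longrightarrow> set (\<omega> g) \<subseteq> generators N" "p \<in> carrier (FA N)"
  shows "subst \<omega> p \<in> carrier (FA N)"
  using assms(2)
proof (induction rule: FA_induct)
  case (monomial c u)
  have "set (concat (map \<omega> u)) \<subseteq> generators N" using monomial assms(1) by fastforce
  then show ?case unfolding subst_single by (intro FA_mult FA_const FA_monomial)
qed (simp_all add: subst_add FA_add)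

lemma quotient_simps:
  "carrier (A //\<^sub>m I) = (\<lambda>x. I +>\<^bsub>A\<^esub> x) ` carrier A"
  "monoid.mult (A //\<^sub>m I) = rcoset_mult A I" "one (A //\<^sub>m I) = I +>\<^bsub>A\<^esub> \<one>\<^bsub>A\<^esub>"
  "zero (A //\<^sub>m I) = I" "add (A //\<^sub>m I) = set_add A"
  "module.smult (A //\<^sub>m I) = (\<lambda>c C. \<Union>x\<in>C. I +>\<^bsub>A\<^esub> (c \<odot>\<^bsub>A\<^esub> x))"
  by (auto simp: quotient_def FactRing_def A_RCOSETS_def' image_def)

lemma ring_cong:
  assumes "ring R" "carrier S = carrier R" "monoid.mult S = monoid.mult R" "one S = one R"
    "zero S = zero R" "add S = add R"
  shows "ring S"
proof -
  interpret R: ring R by fact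
  show ?thesis
  proof (intro ringI abelian_groupI monoidI)
    show "\<exists>y\<in>carrier S. y \<oplus>\<^bsub>S\<^esub> x = \<zero>\<^bsub>S\<^esub>" if "x \<in> carrier S" for x
      using that R.l_neg[of x] R.a_inv_closed[of x] unfolding assms(2-) by blast
  qed (unfold assms(2-), simp_all add: R.a_ac R.m_assoc R.l_distr R.r_distr)
qed

lemma ring_quotient: "ideal I A \<Longrightarrow> ring (A //\<^sub>m I)"
  by (rule ring_cong[OF ideal.quotient_is_ring]) (simp_all add: quotient_def)

context abelian_subgroup
begin

lemma coset_eq_iff:
  assumes "x \<in> carrier G" "y \<in> carrier G"
  shows "H +> x = H +> y \<longleftrightarrow> x \<ominus> y \<in> H"
proof
  assume "H +> x = H +> y"
  then have "x \<in> H +> y" using a_rcos_self[OF assms(1)] by simp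
  then show "x \<ominus> y \<in> H" using a_rcos_module[OF assms(2,1)] by (simp add: a_minus_def)
next
  assume "x \<ominus> y \<in> H"
  then have "x \<in> H +> y" using a_rcos_module[OF assms(2,1)] by (simp add: a_minus_def)
  then show "H +> x = H +> y" using a_repr_independence'[OF _ assms(2)] by simp
qed

lemma coset_zero: "H +> \<zero> = H"
  using a_rcos_const[of \<zero>] by simp

lemma coset_mem: "\<lbrakk>x \<in> carrier G; y \<in> H +> x\<rbrakk> \<Longrightarrow> y \<in> carrier G \<and> y \<ominus> x \<in> H"
  using a_rcos_module[of x y] a_elemrcos_carrier[of x y] by (simp add: a_minus_def)

end

text \<open>The scalar multiplication of a \<open>quotient\<close> is a union over all
  representatives; it is a single coset as soon as the map respects congruence modulo
  \<open>H\<close>.\<close>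

lemma (in abelian_subgroup) coset_smult:
  assumes "x \<in> carrier G" "\<And>y. y \<in> carrier G \<Longrightarrow> f y \<in> carrier G"
    and "\<And>y. \<lbrakk>y \<in> carrier G; y \<ominus> x \<in> H\<rbrakk> \<Longrightarrow> f y \<ominus> f x \<in> H"
  shows "(\<Union>y\<in>H +> x. H +> f y) = H +> f x"
proof -
  have "H +> f y = H +> f x" if "y \<in> H +> x" for y
    using coset_mem[OF assms(1) that] assms by (simp add: coset_eq_iff)
  then show ?thesis using a_rcos_self[OF assms(1)] by blast
qed

lemma generators_iff [simp]:
  "GenK a \<in> generators N \<longleftrightarrow> a \<in> root_lattice N" "GenL a \<in> generators N \<longleftrightarrow> a \<in> root_lattice N"
  "GenE i \<in> generators N \<longleftrightarrow> i \<in> {1..N}" "GenF i \<in> generators N \<longleftrightarrow> i \<in> {1..N}"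
  by (auto simp: generators_def)

section \<open>Words modulo the defining relations\<close>

locale bihom =
  fixes N :: nat and \<chi> :: "weight \<Rightarrow> weight \<Rightarrow> 'k::field"
  assumes bihom: "bihomomorphism N \<chi>"
begin

abbreviation \<A> :: "('k, 'k free) module" where "\<A> \<equiv> FA N"
abbreviation \<R> :: "'k free set" where "\<R> \<equiv> relation_ideal N \<chi>"
abbreviation Lt :: "weight set" where "Lt \<equiv> root_lattice N"

lemma Lt_simps [simp]: "0 \<in> Lt" "a \<in> Lt \<Longrightarrow> - a \<in> Lt" "\<lbrakk>a \<in> Lt; b \<in> Lt\<rbrakk> \<Longrightarrow> a + b \<in> Lt"
    "\<lbrakk>a \<in> Lt; b \<in> Lt\<rbrakk> \<Longrightarrow> a - b \<in> Lt" "i \<in> {1..N} \<Longrightarrow> \<alpha>\<^sub>s i \<in> Lt"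
  using keys_add[of a b] keys_diff[of a b] by (auto simp: root_lattice_def simple_root_def)

lemma chi_nz [simp]: "\<lbrakk>a \<in> Lt; b \<in> Lt\<rbrakk> \<Longrightarrow> \<chi> a b \<noteq> 0"
  and chi_add: "\<lbrakk>a \<in> Lt; b \<in> Lt; c \<in> Lt\<rbrakk> \<Longrightarrow> \<chi> a (b + c) = \<chi> a b * \<chi> a c"
    "\<lbrakk>a \<in> Lt; b \<in> Lt; c \<in> Lt\<rbrakk> \<Longrightarrow> \<chi> (a + b) c = \<chi> a c * \<chi> b c"
  using bihom unfolding bihomomorphism_def by auto

lemma chi_zero [simp]: "a \<in> Lt \<Longrightarrow> \<chi> a 0 = 1" "a \<in> Lt \<Longrightarrow> \<chi> 0 a = 1"
  using chi_add(1)[of a 0 0] chi_add(2)[of 0 0 a] chi_nz[of a 0] chi_nz[of 0 a] by simp_all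

lemma chi_minus: "\<lbrakk>a \<in> Lt; b \<in> Lt\<rbrakk> \<Longrightarrow> \<chi> a (- b) = inverse (\<chi> a b)"
    "\<lbrakk>a \<in> Lt; b \<in> Lt\<rbrakk> \<Longrightarrow> \<chi> (- a) b = inverse (\<chi> a b)"
  using chi_add(1)[of a b "- b"] chi_add(2)[of a "- a" b] by (simp_all add: field_simps)

text \<open>
  All relators except those for \<open>[E\<^sub>i, F\<^sub>j]\<close> have the form \<open>u - c w\<close> with words \<open>u\<close>, \<open>w\<close> and a scalar \<open>c\<close>.
\<close>

inductive binomial_relator :: "'k \<Rightarrow> generator list \<Rightarrow> generator list \<Rightarrow> bool" where
  "binomial_relator 1 [GenK 0] []"
| "binomial_relator 1 [GenL 0] []"
| "\<lbrakk>a \<in> Lt; b \<in> Lt\<rbrakk> \<Longrightarrow> binomial_relator 1 [GenK a, GenK b] [GenK (a + b)]"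
| "\<lbrakk>a \<in> Lt; b \<in> Lt\<rbrakk> \<Longrightarrow> binomial_relator 1 [GenL a, GenL b] [GenL (a + b)]"
| "\<lbrakk>a \<in> Lt; b \<in> Lt\<rbrakk> \<Longrightarrow> binomial_relator 1 [GenK a, GenL b] [GenL b, GenK a]"
| "\<lbrakk>a \<in> Lt; i \<in> {1..N}\<rbrakk> \<Longrightarrow> binomial_relator (\<chi> a (\<alpha>\<^sub>s i)) [GenK a, GenE i] [GenE i, GenK a]"
| "\<lbrakk>a \<in> Lt; i \<in> {1..N}\<rbrakk> \<Longrightarrow> binomial_relator (\<chi> (- \<alpha>\<^sub>s i) a) [GenL a, GenE i] [GenE i, GenL a]"
| "\<lbrakk>a \<in> Lt; i \<in> {1..N}\<rbrakk> \<Longrightarrow> binomial_relator (\<chi> a (- \<alpha>\<^sub>s i)) [GenK a, GenF i] [GenF i, GenK a]"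
| "\<lbrakk>a \<in> Lt; i \<in> {1..N}\<rbrakk> \<Longrightarrow> binomial_relator (\<chi> (\<alpha>\<^sub>s i) a) [GenL a, GenF i] [GenF i, GenL a]"

definition commutator_relator :: "nat \<Rightarrow> nat \<Rightarrow> 'k free"
  where "commutator_relator i j = monomial [GenE i, GenF j] - monomial [GenF j, GenE i] -
    (if i = j then - monomial [GenK (\<alpha>\<^sub>s i)] + monomial [GenL (\<alpha>\<^sub>s i)] else 0)"

lemma relators_eq: "relators N \<chi> = {monomial u - const c * monomial w | c u w. binomial_relator c u w}
    \<union> {commutator_relator i j | i j. i \<in> {1..N} \<and> j \<in> {1..N}}" (is "_ = ?B \<union> ?E")
proof
  show "relators N \<chi> \<subseteq> ?B \<union> ?E"
  proof
    fix p :: "'k free"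
    have B: "p \<in> ?B \<union> ?E" if "binomial_relator c u w" "p = monomial u - const c * monomial w" for c u w
      using that by blast
    have B1: "p \<in> ?B \<union> ?E" if "binomial_relator 1 u w" "p = monomial u - monomial w" for u w
      using B[of 1 u w] that by simp
    have B0: "p \<in> ?B \<union> ?E" if "binomial_relator 1 u []" "p = monomial u - 1" for u
      using B1[of u "[]"] that by (simp add: monomial_Nil)
    assume "p \<in> relators N \<chi>"
    then show "p \<in> ?B \<union> ?E"
      unfolding relators_def Let_def mult.assoc monomial_mult append.simps
    proof (elim UnE CollectE exE conjE insertE emptyE)
      fix i j assume "p = monomial [GenE i, GenF j] - monomial [GenF j, GenE i] -
        (if i = j then - monomial [GenK (\<alpha>\<^sub>s i)] + monomial [GenL (\<alpha>\<^sub>s i)] else 0)" "i \<in> {1..N}" "j \<in> {1..N}"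
      then show ?thesis unfolding commutator_relator_def by blast
    qed (erule B0[rotated] B1[rotated] B[rotated]; (rule binomial_relator.intros; assumption?))+
  qed
  show "?B \<union> ?E \<subseteq> relators N \<chi>"
  proof
    fix p assume "p \<in> ?B \<union> ?E"
    then consider c u w where "binomial_relator c u w" "p = monomial u - const c * monomial w"
      | i j where "i \<in> {1..N}" "j \<in> {1..N}" "p = commutator_relator i j" by blast
    then show "p \<in> relators N \<chi>"
    proof cases
      case 1
      from 1(1) show ?thesis
        unfolding 1(2) relators_def Let_def mult.assoc monomial_mult append.simps
        by cases (simp only: const_one mult_1 monomial_Nil Un_iff mem_Collect_eq insert_iff, blast)+
    next
      case 2
      then show ?thesis
        unfolding relators_def Let_def mult.assoc monomial_mult append.simps commutator_relator_def by blast
    qed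
  qed
qed

lemma brel_words: "binomial_relator c u w \<Longrightarrow> set u \<subseteq> generators N \<and> set w \<subseteq> generators N"
  by (induction rule: binomial_relator.induct) (auto simp del: atLeastAtMost_iff)

lemma erel_in: "\<lbrakk>i \<in> {1..N}; j \<in> {1..N}\<rbrakk> \<Longrightarrow> commutator_relator i j \<in> carrier \<A>"
  unfolding commutator_relator_def by (auto intro!: FA_diff FA_add FA_uminus FA_monomial)

lemma relators_in: "relators N \<chi> \<subseteq> carrier \<A>"
  unfolding relators_eq
proof (intro Un_least subsetI)
  fix p assume "p \<in> {monomial u - const c * monomial w | c u w. binomial_relator c u w}"
  then obtain c u w where "binomial_relator c u w" "p = monomial u - const c * monomial w" by blast
  with brel_words[of c u w] show "p \<in> carrier \<A>"
    by (simp add: FA_diff FA_mult FA_monomial)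
qed (use erel_in in blast)

lemma relation_ideal_eq: "\<R> = Idl\<^bsub>\<A>\<^esub> (relators N \<chi>)"
  by (simp add: relation_ideal_def FA_def)

lemma ideal_R: "ideal \<R> \<A>"
  unfolding relation_ideal_eq by (rule ring.genideal_ideal[OF ring_FA relators_in])

lemma R_zero [simp]: "0 \<in> \<R>"
  using additive_subgroup.zero_closed[OF ideal.axioms(1)[OF ideal_R]] by simp

lemma R_add: "\<lbrakk>p \<in> \<R>; q \<in> \<R>\<rbrakk> \<Longrightarrow> p + q \<in> \<R>"
  using additive_subgroup.a_closed[OF ideal.axioms(1)[OF ideal_R], of p q] by simp

lemma R_lmult: "\<lbrakk>a \<in> carrier \<A>; p \<in> \<R>\<rbrakk> \<Longrightarrow> a * p \<in> \<R>"
  and R_rmult: "\<lbrakk>a \<in> carrier \<A>; p \<in> \<R>\<rbrakk> \<Longrightarrow> p * a \<in> \<R>"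
  using ideal.I_l_closed[OF ideal_R, of p a] ideal.I_r_closed[OF ideal_R, of p a] by simp_all

lemma R_uminus: "p \<in> \<R> \<Longrightarrow> - p \<in> \<R>"
  using R_lmult[OF FA_const, of p "- 1"] by (simp add: const_uminus)

lemma R_diff: "\<lbrakk>p \<in> \<R>; q \<in> \<R>\<rbrakk> \<Longrightarrow> p - q \<in> \<R>"
  using R_add[of p "- q"] R_uminus[of q] by simp

lemma R_relator: "p \<in> relators N \<chi> \<Longrightarrow> p \<in> \<R>"
  unfolding relation_ideal_eq using ring.genideal_self[OF ring_FA relators_in] by blast

text \<open>Congruence carries a scalar because torus generators commute with words only up to a
  scalar; transitivity multiplies the scalars.\<close>

definition wcong :: "'k \<Rightarrow> generator list \<Rightarrow> generator list \<Rightarrow> bool"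
  where "wcong c u w \<longleftrightarrow> monomial u - const c * monomial w \<in> \<R>"

lemma wcong_brel: "binomial_relator c u w \<Longrightarrow> wcong c u w"
  unfolding wcong_def by (rule R_relator) (unfold relators_eq, blast)

lemma wcong_refl: "wcong 1 u u"
  by (simp add: wcong_def)

lemma wcong_trans [trans]: "\<lbrakk>wcong c u v; wcong d v w\<rbrakk> \<Longrightarrow> wcong (c * d) u w"
  unfolding wcong_def
  using R_add[of "monomial u - const c * monomial v" "const c * (monomial v - const d * monomial w)"]
    R_lmult[OF FA_const, of "monomial v - const d * monomial w" c]
  by (simp add: algebra_simps const_mult)

lemma wcong_context:
  assumes "set a \<subseteq> generators N" "set b \<subseteq> generators N" "wcong c u w"
  shows "wcong c (a @ u @ b) (a @ w @ b)"
proof -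
  have "monomial a * (monomial u - const c * monomial w) * monomial b \<in> \<R>"
    using assms unfolding wcong_def by (intro R_lmult R_rmult FA_monomial)
  also have "monomial a * (monomial u - const c * monomial w) * monomial b =
      monomial (a @ u @ b) - const c * monomial (a @ w @ b)"
    by (simp add: right_diff_distrib left_diff_distrib const_left_commute[of "monomial a"] mult.assoc
        monomial_mult[symmetric])
  finally show ?thesis unfolding wcong_def .
qed

lemma wcong_sym: "\<lbrakk>wcong c u w; c \<noteq> 0\<rbrakk> \<Longrightarrow> wcong (inverse c) w u"
  unfolding wcong_def
  using R_uminus[OF R_lmult[OF FA_const, of "monomial u - const c * monomial w" "inverse c"]]
  by (simp add: right_diff_distrib mult.assoc[symmetric] const_mult[symmetric])

text \<open>The factor picked up when a torus generator passes an element of degree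
  \<open>b\<close>; the value 1 at the other generators is a default.\<close>

definition tau :: "generator \<Rightarrow> weight \<Rightarrow> 'k"
  where "tau g b = (case g of GenK a \<Rightarrow> \<chi> a b | GenL a \<Rightarrow> \<chi> (- b) a | _ \<Rightarrow> 1)"

lemma tau_simps [simp]: "tau (GenK a) b = \<chi> a b" "tau (GenL a) b = \<chi> (- b) a"
  by (simp_all add: tau_def)

definition torus :: "generator \<Rightarrow> bool"
  where "torus g \<longleftrightarrow> (\<exists>a\<in>Lt. g = GenK a \<or> g = GenL a)"

lemma torus_generator: "torus g \<Longrightarrow> g \<in> generators N"
  by (auto simp: torus_def)

lemma degree_in: "g \<in> generators N \<Longrightarrow> generator_degree g \<in> Lt"
  by (cases g) auto

lemma degree_list_in: "set w \<subseteq> generators N \<Longrightarrow> sum_list (map generator_degree w) \<in> Lt"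
  by (induction w) (simp_all add: degree_in)

lemma tau_add: "\<lbrakk>torus g; a \<in> Lt; b \<in> Lt\<rbrakk> \<Longrightarrow> tau g (a + b) = tau g a * tau g b"
  using chi_add(2)[of "- a" "- b"] by (auto simp: torus_def chi_add)

lemma tau_zero: "torus g \<Longrightarrow> tau g 0 = 1"
  by (auto simp: torus_def)

lemma torus_commute1: "\<lbrakk>torus g; x \<in> generators N\<rbrakk> \<Longrightarrow> wcong (tau g (generator_degree x)) [g, x] [x, g]"
proof -
  assume g: "torus g" and x: "x \<in> generators N"
  have KK: "wcong 1 [GenK a, GenK b] [GenK b, GenK a]" and LL: "wcong 1 [GenL a, GenL b] [GenL b, GenL a]"
    and KL: "wcong 1 [GenK a, GenL b] [GenL b, GenK a]" and LK: "wcong 1 [GenL a, GenK b] [GenK b, GenL a]"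
    if "a \<in> Lt" "b \<in> Lt" for a b
  proof -
    have "wcong 1 [GenK b, GenK a] [GenK (a + b)]" "wcong 1 [GenL b, GenL a] [GenL (a + b)]"
      using binomial_relator.intros(3,4)[of b a] that by (auto intro: wcong_brel simp: add.commute)
    from this[THEN wcong_sym] have "wcong 1 [GenK (a + b)] [GenK b, GenK a]" "wcong 1 [GenL (a + b)] [GenL b, GenL a]"
      by simp_all
    from this[THEN wcong_trans[rotated]] show "wcong 1 [GenK a, GenK b] [GenK b, GenK a]" "wcong 1 [GenL a, GenL b] [GenL b, GenL a]"
      using binomial_relator.intros(3,4)[of a b, THEN wcong_brel] that by fastforce+
    show "wcong 1 [GenK a, GenL b] [GenL b, GenK a]" using binomial_relator.intros(5) that by (blast intro: wcong_brel)
    have "wcong 1 [GenK b, GenL a] [GenL a, GenK b]" using binomial_relator.intros(5) that by (blast intro: wcong_brel)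
    from wcong_sym[OF this] show "wcong 1 [GenL a, GenK b] [GenK b, GenL a]" by simp
  qed
  from g obtain a where a: "a \<in> Lt" "g = GenK a \<or> g = GenL a" by (auto simp: torus_def)
  from a(2) show ?thesis
  proof
    assume "g = GenK a"
    then show ?thesis
      using x a(1) KK KL binomial_relator.intros(6,8)[THEN wcong_brel] by (cases x) (auto simp del: atLeastAtMost_iff)
  next
    assume "g = GenL a"
    then show ?thesis
      using x a(1) LL LK binomial_relator.intros(7,9)[THEN wcong_brel] by (cases x) (auto simp del: atLeastAtMost_iff)
  qed
qed

lemma torus_commute:
  assumes "torus g" "set w \<subseteq> generators N"
  shows "wcong (tau g (sum_list (map generator_degree w))) (g # w) (w @ [g])"
  using assms(2)
proof (induction w)
  case Nil
  then show ?case using wcong_refl assms(1) by (simp add: tau_zero)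
next
  case (Cons x w)
  then have x: "x \<in> generators N" and w: "set w \<subseteq> generators N" by auto
  have "wcong (tau g (generator_degree x)) (g # x # w) (x # g # w)"
    using wcong_context[OF _ w torus_commute1[OF assms(1) x], of "[]"] by simp
  also have "wcong (tau g (sum_list (map generator_degree w))) (x # g # w) (x # w @ [g])"
    using wcong_context[OF _ _ Cons.IH[OF w], of "[x]" "[]"] x by simp
  finally show ?case
    using tau_add[OF assms(1) degree_in[OF x] degree_list_in[OF w]] by simp
qed

definition cls :: "'k free \<Rightarrow> 'k tilde"
  where "cls p = \<R> +>\<^bsub>\<A>\<^esub> p"

lemma subgroup_R: "abelian_subgroup \<R> \<A>"
  by (rule abelian_subgroupI3[OF ideal.axioms(1)[OF ideal_R] ring.is_abelian_group[OF ring_FA]])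

lemma Utilde_eq: "Utilde N \<chi> = \<A> //\<^sub>m \<R>"
  by (simp add: Utilde_def FA_def)

lemma ring_Utilde: "ring (Utilde N \<chi>)"
  unfolding Utilde_eq by (rule ring_quotient[OF ideal_R])

lemma tilde_class_eq: "tilde_class N \<chi> u = cls (monomial u)"
  by (simp add: tilde_class_def cls_def FA_def)

lemma a_minus_FA: "\<lbrakk>p \<in> carrier \<A>; q \<in> carrier \<A>\<rbrakk> \<Longrightarrow> p \<ominus>\<^bsub>\<A>\<^esub> q = p - q"
  by (simp add: a_minus_def FA_a_inv)

lemma cls_eq_iff: "\<lbrakk>p \<in> carrier \<A>; q \<in> carrier \<A>\<rbrakk> \<Longrightarrow> cls p = cls q \<longleftrightarrow> p - q \<in> \<R>"
  unfolding cls_def using abelian_subgroup.coset_eq_iff[OF subgroup_R] a_minus_FA by simp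

lemma carrier_Utilde: "carrier (Utilde N \<chi>) = cls ` carrier \<A>"
  unfolding Utilde_eq quotient_simps cls_def ..

lemma cls_in: "p \<in> carrier \<A> \<Longrightarrow> cls p \<in> carrier (Utilde N \<chi>)"
  unfolding carrier_Utilde by blast

lemma cls_add: "\<lbrakk>p \<in> carrier \<A>; q \<in> carrier \<A>\<rbrakk> \<Longrightarrow> cls p \<oplus>\<^bsub>Utilde N \<chi>\<^esub> cls q = cls (p + q)"
  unfolding Utilde_eq quotient_simps cls_def using abelian_subgroup.a_rcos_sum[OF subgroup_R] by simp

lemma cls_mult: "\<lbrakk>p \<in> carrier \<A>; q \<in> carrier \<A>\<rbrakk> \<Longrightarrow> cls p \<otimes>\<^bsub>Utilde N \<chi>\<^esub> cls q = cls (p * q)"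
  unfolding Utilde_eq quotient_simps cls_def using ideal.rcoset_mult_add[OF ideal_R] by simp

lemma cls_one: "\<one>\<^bsub>Utilde N \<chi>\<^esub> = cls 1"
  unfolding Utilde_eq quotient_simps cls_def by simp

lemma cls_zero: "\<zero>\<^bsub>Utilde N \<chi>\<^esub> = cls 0"
  unfolding Utilde_eq quotient_simps cls_def using abelian_subgroup.coset_zero[OF subgroup_R] by simp

lemma cls_smult: "p \<in> carrier \<A> \<Longrightarrow> c \<odot>\<^bsub>Utilde N \<chi>\<^esub> cls p = cls (const c * p)"
proof -
  assume p: "p \<in> carrier \<A>"
  have "const c * q \<ominus>\<^bsub>\<A>\<^esub> const c * p \<in> \<R>" if "q \<in> carrier \<A>" "q \<ominus>\<^bsub>\<A>\<^esub> p \<in> \<R>" for q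
    using R_lmult[OF FA_const, of "q - p" c] that p by (simp add: a_minus_FA FA_mult right_diff_distrib)
  then show ?thesis
    unfolding Utilde_eq quotient_simps cls_def
    using abelian_subgroup.coset_smult[OF subgroup_R p, of "\<lambda>p. const c * p"] by (simp add: FA_mult)
qed

lemma wcong_append: "\<lbrakk>wcong c u u'; wcong d w w'; set w \<subseteq> generators N; set u' \<subseteq> generators N\<rbrakk> \<Longrightarrow>
    wcong (c * d) (u @ w) (u' @ w')"
  using wcong_trans[of c "u @ w" "u' @ w" d "u' @ w'"] wcong_context[of "[]" w c u u'] wcong_context[of u' "[]" d w w']
  by simp

section \<open>The automorphism Omega as a substitution of words\<close>

definition om :: "generator \<Rightarrow> generator list"
  where "om g = (case g of GenK a \<Rightarrow> [GenK (- a)] | GenL a \<Rightarrow> [GenL (- a)]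
    | GenE i \<Rightarrow> [GenF i, GenL (- \<alpha>\<^sub>s i)] | GenF i \<Rightarrow> [GenK (- \<alpha>\<^sub>s i), GenE i])"

text \<open>Inverse to \<open>om\<close> modulo the relations, for instance since K_a K_(-a) = 1; it
  provides bijectivity.\<close>

definition om' :: "generator \<Rightarrow> generator list"
  where "om' g = (case g of GenK a \<Rightarrow> [GenK (- a)] | GenL a \<Rightarrow> [GenL (- a)]
    | GenE i \<Rightarrow> [GenK (- \<alpha>\<^sub>s i), GenF i] | GenF i \<Rightarrow> [GenE i, GenL (- \<alpha>\<^sub>s i)])"

lemma om_simps [simp]: "om (GenK a) = [GenK (- a)]" "om (GenL a) = [GenL (- a)]"
    "om (GenE i) = [GenF i, GenL (- \<alpha>\<^sub>s i)]" "om (GenF i) = [GenK (- \<alpha>\<^sub>s i), GenE i]"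
  by (simp_all add: om_def)

lemma om'_simps [simp]: "om' (GenK a) = [GenK (- a)]" "om' (GenL a) = [GenL (- a)]"
    "om' (GenE i) = [GenK (- \<alpha>\<^sub>s i), GenF i]" "om' (GenF i) = [GenE i, GenL (- \<alpha>\<^sub>s i)]"
  by (simp_all add: om'_def)

lemma om_generators: "g \<in> generators N \<Longrightarrow> set (om g) \<subseteq> generators N"
  and om'_generators: "g \<in> generators N \<Longrightarrow> set (om' g) \<subseteq> generators N"
  by (cases g; simp del: atLeastAtMost_iff)+

text \<open>Both substitutions negate degrees and torus indices, so the scalar of each relation
  stays the same: \<chi> takes equal values at (-a, -b) and (a, b).\<close>

lemma brel_subst:
  assumes "binomial_relator c u w"
    and \<omega>: "\<And>a. \<omega> (GenK a) = [GenK (- a)]" "\<And>a. \<omega> (GenL a) = [GenL (- a)]"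
      "\<And>i. sum_list (map generator_degree (\<omega> (GenE i))) = - \<alpha>\<^sub>s i"
      "\<And>i. sum_list (map generator_degree (\<omega> (GenF i))) = \<alpha>\<^sub>s i"
      "\<And>g. g \<in> generators N \<Longrightarrow> set (\<omega> g) \<subseteq> generators N"
  shows "wcong c (concat (map \<omega> u)) (concat (map \<omega> w))"
  using assms(1)
proof cases
  case 1
  then show ?thesis using binomial_relator.intros(1) by (auto simp: \<omega> intro: wcong_brel)
next
  case 2
  then show ?thesis using binomial_relator.intros(2) by (auto simp: \<omega> intro: wcong_brel)
next
  case (3 a b)
  then show ?thesis using binomial_relator.intros(3)[of "- a" "- b"] by (auto simp: \<omega> intro: wcong_brel)
next
  case (4 a b)
  then show ?thesis using binomial_relator.intros(4)[of "- a" "- b"] by (auto simp: \<omega> intro: wcong_brel)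
next
  case (5 a b)
  then show ?thesis using binomial_relator.intros(5)[of "- a" "- b"] by (auto simp: \<omega> intro: wcong_brel)
next
  case (6 a i)
  then show ?thesis
    using torus_commute[of "GenK (- a)" "\<omega> (GenE i)"] \<omega>(5)[of "GenE i"]
    by (auto simp: \<omega>(1-4) torus_def chi_minus simp del: atLeastAtMost_iff)
next
  case (7 a i)
  then show ?thesis
    using torus_commute[of "GenL (- a)" "\<omega> (GenE i)"] \<omega>(5)[of "GenE i"]
    by (auto simp: \<omega>(1-4) torus_def chi_minus simp del: atLeastAtMost_iff)
next
  case (8 a i)
  then show ?thesis
    using torus_commute[of "GenK (- a)" "\<omega> (GenF i)"] \<omega>(5)[of "GenF i"]
    by (auto simp: \<omega>(1-4) torus_def chi_minus simp del: atLeastAtMost_iff)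
next
  case (9 a i)
  then show ?thesis
    using torus_commute[of "GenL (- a)" "\<omega> (GenF i)"] \<omega>(5)[of "GenF i"]
    by (auto simp: \<omega>(1-4) torus_def chi_minus simp del: atLeastAtMost_iff)
qed

lemma subst_R:
  assumes "\<And>g. g \<in> generators N \<Longrightarrow> set (\<omega> g) \<subseteq> generators N"
    and "\<And>c u w. binomial_relator c u w \<Longrightarrow> wcong c (concat (map \<omega> u)) (concat (map \<omega> w))"
    and "\<And>i j. \<lbrakk>i \<in> {1..N}; j \<in> {1..N}\<rbrakk> \<Longrightarrow> subst \<omega> (commutator_relator i j) \<in> \<R>"
    and "p \<in> \<R>"
  shows "subst \<omega> p \<in> \<R>"
proof -
  let ?I = "{p \<in> carrier \<A>. subst \<omega> p \<in> \<R>}"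
  have "ideal ?I \<A>"
  proof (rule idealI[OF ring_FA])
    show "subgroup ?I (add_monoid \<A>)"
    proof
      show "inv\<^bsub>add_monoid \<A>\<^esub> x \<in> ?I" if "x \<in> ?I" for x
        using that FA_a_inv[of x N] by (simp add: a_inv_def FA_uminus subst_uminus R_uminus)
    qed (auto simp: FA_add subst_add R_add)
  qed (auto simp: FA_mult subst_mult intro: R_lmult R_rmult subst_in[OF assms(1)])
  moreover have "relators N \<chi> \<subseteq> ?I"
  proof
    fix p assume p: "p \<in> relators N \<chi>"
    then consider c u w where "binomial_relator c u w" "p = monomial u - const c * monomial w"
      | i j where "i \<in> {1..N}" "j \<in> {1..N}" "p = commutator_relator i j" unfolding relators_eq by blast
    then have "subst \<omega> p \<in> \<R>"
    proof cases
      case 1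
      then show ?thesis using assms(2)[OF 1(1)]
        by (simp add: wcong_def subst_diff subst_monomial subst_single)
    qed (use assms(3) in blast)
    then show "p \<in> ?I" using p relators_in by blast
  qed
  ultimately have "\<R> \<subseteq> ?I"
    unfolding relation_ideal_eq by (rule ring.genideal_minimal[OF ring_FA])
  with assms(4) show ?thesis by blast
qed

text \<open>Up to sign the image of the relator for (i, j) is the relator for (j, i) between a
  \<open>K\<close> and an \<open>L\<close> of negative index. The scalars from moving torus elements
  cancel in pairs, and the right-hand side fits because K^(-1) (L - K) L^(-1) = K^(-1) -
  L^(-1).\<close>

lemma om_erel:
  assumes i: "i \<in> {1..N}" and j: "j \<in> {1..N}"
  shows "subst om (commutator_relator i j) \<in> \<R>" and "subst om' (commutator_relator i j) \<in> \<R>"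
proof -
  let ?K = "\<lambda>i. GenK (- \<alpha>\<^sub>s i)" and ?L = "\<lambda>i. GenL (- \<alpha>\<^sub>s i)"
  have gens: "?K k \<in> generators N" "?L k \<in> generators N" "GenE k \<in> generators N" "GenF k \<in> generators N"
    if "k \<in> {1..N}" for k using that by (simp_all del: atLeastAtMost_iff)
  have torus: "torus (?K k)" "torus (?L k)" if "k \<in> {1..N}" for k using that by (auto simp: torus_def simp del: atLeastAtMost_iff)
  have KKL: "wcong 1 [?K k, GenK (\<alpha>\<^sub>s k), ?L k] [?L k]" and KLL: "wcong 1 [?K k, GenL (\<alpha>\<^sub>s k), ?L k] [?K k]"
    if k: "k \<in> {1..N}" for k
  proof -
    have "wcong 1 [?K k, GenK (\<alpha>\<^sub>s k)] [GenK 0]" "wcong 1 [GenL (\<alpha>\<^sub>s k), ?L k] [GenL 0]"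
      using binomial_relator.intros(3)[of "- \<alpha>\<^sub>s k" "\<alpha>\<^sub>s k"] binomial_relator.intros(4)[of "\<alpha>\<^sub>s k" "- \<alpha>\<^sub>s k"] k
      by (auto intro: wcong_brel simp del: atLeastAtMost_iff)
    then have 1: "wcong 1 [?K k, GenK (\<alpha>\<^sub>s k)] []" "wcong 1 [GenL (\<alpha>\<^sub>s k), ?L k] []"
      using wcong_trans wcong_brel[OF binomial_relator.intros(1)] wcong_brel[OF binomial_relator.intros(2)] by fastforce+
    show "wcong 1 [?K k, GenK (\<alpha>\<^sub>s k), ?L k] [?L k]" "wcong 1 [?K k, GenL (\<alpha>\<^sub>s k), ?L k] [?K k]"
      using wcong_context[OF _ _ 1(1), of "[]" "[?L k]"] wcong_context[OF _ _ 1(2), of "[?K k]" "[]"] gens[OF k] by simp_all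
  qed
  define D where "D k = (- monomial [GenK (\<alpha>\<^sub>s k)] + monomial [GenL (\<alpha>\<^sub>s k)] :: 'k free)" for k
  define D' where "D' k = (- monomial [?K k] + monomial [?L k] :: 'k free)" for k
  have DD': "monomial [?K k] * D k * monomial [?L k] + D' k \<in> \<R>" if k: "k \<in> {1..N}" for k
  proof -
    have "(monomial [?K k, GenL (\<alpha>\<^sub>s k), ?L k] - monomial [?K k]) - (monomial [?K k, GenK (\<alpha>\<^sub>s k), ?L k] - monomial [?L k]) \<in> \<R>"
      using KKL[OF k] KLL[OF k] unfolding wcong_def by - (rule R_diff, simp_all)
    then show ?thesis
      by (simp add: D_def D'_def distrib_left distrib_right monomial_mult algebra_simps)
  qed
  have sandwich: "monomial [?K k] * commutator_relator a b * monomial [?L l] \<in> \<R>" if "k \<in> {1..N}" "l \<in> {1..N}" "a \<in> {1..N}" "b \<in> {1..N}" for k l a b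
  proof -
    have "commutator_relator a b \<in> relators N \<chi>" unfolding relators_eq using that by blast
    then show ?thesis
      using gens that by (intro R_rmult[OF FA_monomial R_lmult[OF FA_monomial R_relator]]) simp_all
  qed
  show "subst om (commutator_relator i j) \<in> \<R>"
  proof -
    have 1: "wcong (\<chi> (\<alpha>\<^sub>s j) (\<alpha>\<^sub>s i)) [GenF i, ?L i, ?K j, GenE j] [GenF i, ?K j, GenE j, ?L i]"
      using wcong_context[OF _ _ torus_commute[OF torus(2)[OF i], of "[?K j, GenE j]"], of "[GenF i]" "[]"] gens i j
      by (simp add: chi_minus del: atLeastAtMost_iff)
    have "wcong (\<chi> (\<alpha>\<^sub>s j) (\<alpha>\<^sub>s i)) [?K j, GenF i] [GenF i, ?K j]"
      using torus_commute[OF torus(1)[OF j], of "[GenF i]"] gens i j by (simp add: chi_minus del: atLeastAtMost_iff)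
    from wcong_sym[OF this] have "wcong (inverse (\<chi> (\<alpha>\<^sub>s j) (\<alpha>\<^sub>s i))) [GenF i, ?K j] [?K j, GenF i]"
      using i j by (simp del: atLeastAtMost_iff)
    from wcong_context[OF _ _ this, of "[]" "[GenE j, ?L i]"]
    have 2: "wcong (inverse (\<chi> (\<alpha>\<^sub>s j) (\<alpha>\<^sub>s i))) [GenF i, ?K j, GenE j, ?L i] [?K j, GenF i, GenE j, ?L i]"
      using gens i j by (simp del: atLeastAtMost_iff)
    have 3: "monomial [GenF i, ?L i, ?K j, GenE j] - monomial [?K j, GenF i, GenE j, ?L i] \<in> \<R>"
      using wcong_trans[OF 1 2] i j unfolding wcong_def by (simp del: atLeastAtMost_iff)
    have 4: "monomial [?K j] * commutator_relator j i * monomial [?L i] \<in> \<R>" using sandwich i j by blast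
    have 5: "(if i = j then monomial [?K i] * D i * monomial [?L i] + D' i else 0) \<in> \<R>" by (simp only: DD'[OF i] R_zero split: if_split) simp
    have "subst om (commutator_relator i j) = monomial [GenF i, ?L i, ?K j, GenE j] - monomial [?K j, GenE j, GenF i, ?L i]
        - (if i = j then D' i else 0)"
      by (simp add: commutator_relator_def subst_diff subst_add subst_uminus subst_monomial D'_def)
    also have "\<dots> = (monomial [GenF i, ?L i, ?K j, GenE j] - monomial [?K j, GenF i, GenE j, ?L i])
        - monomial [?K j] * commutator_relator j i * monomial [?L i]
        - (if i = j then monomial [?K i] * D i * monomial [?L i] + D' i else 0)"
      by (auto simp: commutator_relator_def D_def left_diff_distrib right_diff_distrib monomial_mult)
    also have "\<dots> \<in> \<R>" by (rule R_diff[OF R_diff[OF 3 4] 5])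
    finally show ?thesis .
  qed
  show "subst om' (commutator_relator i j) \<in> \<R>"
  proof -
    have 1: "wcong (inverse (\<chi> (\<alpha>\<^sub>s i) (\<alpha>\<^sub>s j))) [GenE j, ?L j, ?K i, GenF i] [GenE j, ?K i, GenF i, ?L j]"
      using wcong_context[OF _ _ torus_commute[OF torus(2)[OF j], of "[?K i, GenF i]"], of "[GenE j]" "[]"] gens i j
      by (simp add: chi_minus del: atLeastAtMost_iff)
    have "wcong (inverse (\<chi> (\<alpha>\<^sub>s i) (\<alpha>\<^sub>s j))) [?K i, GenE j] [GenE j, ?K i]"
      using torus_commute[OF torus(1)[OF i], of "[GenE j]"] gens i j by (simp add: chi_minus del: atLeastAtMost_iff)
    from wcong_sym[OF this] have "wcong (\<chi> (\<alpha>\<^sub>s i) (\<alpha>\<^sub>s j)) [GenE j, ?K i] [?K i, GenE j]"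
      using i j by (simp del: atLeastAtMost_iff)
    from wcong_context[OF _ _ this, of "[]" "[GenF i, ?L j]"]
    have 2: "wcong (\<chi> (\<alpha>\<^sub>s i) (\<alpha>\<^sub>s j)) [GenE j, ?K i, GenF i, ?L j] [?K i, GenE j, GenF i, ?L j]"
      using gens i j by (simp del: atLeastAtMost_iff)
    have 3: "monomial [GenE j, ?L j, ?K i, GenF i] - monomial [?K i, GenE j, GenF i, ?L j] \<in> \<R>"
      using wcong_trans[OF 1 2] i j unfolding wcong_def by (simp del: atLeastAtMost_iff)
    have 4: "monomial [?K i] * commutator_relator j i * monomial [?L j] \<in> \<R>" using sandwich i j by blast
    have 5: "(if i = j then monomial [?K i] * D i * monomial [?L i] + D' i else 0) \<in> \<R>" by (simp only: DD'[OF i] R_zero split: if_split) simp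
    have "subst om' (commutator_relator i j) = monomial [?K i, GenF i, GenE j, ?L j] - monomial [GenE j, ?L j, ?K i, GenF i]
        - (if i = j then D' i else 0)"
      by (simp add: commutator_relator_def subst_diff subst_add subst_uminus subst_monomial D'_def)
    also have "\<dots> = - (monomial [GenE j, ?L j, ?K i, GenF i] - monomial [?K i, GenE j, GenF i, ?L j])
        - monomial [?K i] * commutator_relator j i * monomial [?L j]
        - (if i = j then monomial [?K i] * D i * monomial [?L i] + D' i else 0)"
      by (auto simp: commutator_relator_def D_def left_diff_distrib right_diff_distrib monomial_mult)
    also have "\<dots> \<in> \<R>" by (rule R_diff[OF R_diff[OF R_uminus[OF 3] 4] 5])
    finally show ?thesis .
  qed
qed

lemma subst_om_R: "p \<in> \<R> \<Longrightarrow> subst om p \<in> \<R>"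
  by (rule subst_R[OF om_generators brel_subst om_erel(1)]) (auto simp: om_generators dest: om_generators)

lemma subst_om'_R: "p \<in> \<R> \<Longrightarrow> subst om' p \<in> \<R>"
  by (rule subst_R[OF om'_generators brel_subst om_erel(2)]) (auto simp: om'_generators dest: om'_generators)

end

section \<open>Submodules, spans and ideals\<close>

lemma scalars_simps [simp]: "carrier scalars = UNIV" "monoid.mult scalars = (*)" "one scalars = 1"
  "zero scalars = 0" "add scalars = (+)"
  by (simp_all add: ring_of_type_algebra_def)

lemma submodule_scalarsI:
  fixes V :: "('k::field, 'a) module"
  assumes "abelian_group V" "W \<subseteq> carrier V" "\<zero>\<^bsub>V\<^esub> \<in> W"
    and "\<And>x y. \<lbrakk>x \<in> W; y \<in> W\<rbrakk> \<Longrightarrow> x \<oplus>\<^bsub>V\<^esub> y \<in> W"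
    and "\<And>c x. x \<in> W \<Longrightarrow> c \<odot>\<^bsub>V\<^esub> x \<in> W"
    and "\<And>x. x \<in> W \<Longrightarrow> \<ominus>\<^bsub>V\<^esub> x \<in> W"
  shows "submodule W scalars V"
  by (intro submodule.intro subgroup.intro submodule_axioms.intro) (use assms in \<open>auto simp: a_inv_def\<close>)

lemma submodule_subset: "submodule W R V \<Longrightarrow> W \<subseteq> carrier V"
  using subgroup.subset[OF submodule.axioms(1)] by force

lemma submodule_add: "\<lbrakk>submodule W R V; x \<in> W; y \<in> W\<rbrakk> \<Longrightarrow> x \<oplus>\<^bsub>V\<^esub> y \<in> W"
  using subgroup.m_closed[OF submodule.axioms(1)] by force

lemma submodule_zero: "submodule W R V \<Longrightarrow> \<zero>\<^bsub>V\<^esub> \<in> W"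
  using subgroup.one_closed[OF submodule.axioms(1)] by force

lemma submodule_uminus: "\<lbrakk>submodule W R V; x \<in> W\<rbrakk> \<Longrightarrow> \<ominus>\<^bsub>V\<^esub> x \<in> W"
  using subgroup.m_inv_closed[OF submodule.axioms(1)] by (force simp: a_inv_def)

lemma submodule_smult: "\<lbrakk>submodule W R V; a \<in> carrier R; x \<in> W\<rbrakk> \<Longrightarrow> a \<odot>\<^bsub>V\<^esub> x \<in> W"
  by (rule submodule.smult_closed)

lemma linear_span_submodule:
  fixes V :: "('k::field, 'a) module"
  assumes "abelian_group V" "submodule (carrier V) scalars V" "S \<subseteq> carrier V"
  shows "submodule (linear_span V S) scalars V"
proof (rule submodule_scalarsI[OF assms(1)])
  show "linear_span V S \<subseteq> carrier V"
    unfolding linear_span_def by (rule hull_minimal) (rule assms)+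
qed (unfold linear_span_def hull_def,
    auto intro: submodule_zero submodule_add submodule_uminus submodule_smult)

lemma linear_span_superset: "S \<subseteq> linear_span V S"
  unfolding linear_span_def by (rule hull_subset)

lemma linear_span_minimal: "\<lbrakk>submodule W scalars V; S \<subseteq> W\<rbrakk> \<Longrightarrow> linear_span V S \<subseteq> W"
  unfolding linear_span_def by (rule hull_minimal)

text \<open>
  Applied to \<^const>\<open>J_total\<close>: the ring axioms for \<open>U(\<chi>)\<close> are part of the definition of a module over it, hence the
  ideal property need not be derived from the triangular decomposition.
\<close>

lemma ideal_of_quotient_ring:
  assumes A: "ring A" and J: "additive_subgroup J A" and Q: "ring (A //\<^sub>m J)"
  shows "ideal J A"
proof -
  interpret A: ring A by fact
  interpret Q: ring "A //\<^sub>m J" by fact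
  interpret J: abelian_subgroup J A by (rule abelian_subgroupI3[OF J A.is_abelian_group])
  have key: "a \<otimes>\<^bsub>A\<^esub> b \<in> J" if ab: "a \<in> carrier A" "b \<in> carrier A" "a \<in> J \<or> b \<in> J" for a b
  proof -
    let ?P = "rcoset_mult A J (J +>\<^bsub>A\<^esub> a) (J +>\<^bsub>A\<^esub> b)"
    have "?P \<in> carrier (A //\<^sub>m J)"
      using Q.m_closed[of "J +>\<^bsub>A\<^esub> a" "J +>\<^bsub>A\<^esub> b"] ab unfolding quotient_simps by blast
    then obtain x where x: "x \<in> carrier A" "?P = J +>\<^bsub>A\<^esub> x" unfolding quotient_simps by blast
    have in_P: "a' \<otimes>\<^bsub>A\<^esub> b' \<in> ?P" if "a' \<in> J +>\<^bsub>A\<^esub> a" "b' \<in> J +>\<^bsub>A\<^esub> b" for a' b'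
    proof -
      have "a' \<in> carrier A" "b' \<in> carrier A" using that ab J.a_elemrcos_carrier by blast+
      then have "a' \<otimes>\<^bsub>A\<^esub> b' \<in> J +>\<^bsub>A\<^esub> (a' \<otimes>\<^bsub>A\<^esub> b')" by (intro J.a_rcos_self) simp
      then show ?thesis unfolding rcoset_mult_def using that by blast
    qed
    have self: "a \<in> J +>\<^bsub>A\<^esub> a" "b \<in> J +>\<^bsub>A\<^esub> b" using ab J.a_rcos_self by blast+
    \<comment> \<open>A product of cosets is a coset because the quotient is a ring; if it contains
      zero, it is \<open>J\<close> itself.\<close>
    have "\<zero>\<^bsub>A\<^esub> \<in> ?P"
    proof (cases "a \<in> J")
      case True
      then have "\<zero>\<^bsub>A\<^esub> \<in> J +>\<^bsub>A\<^esub> a" using J.a_rcos_const by simp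
      from in_P[OF this self(2)] show ?thesis using ab by simp
    next
      case False
      then have "\<zero>\<^bsub>A\<^esub> \<in> J +>\<^bsub>A\<^esub> b" using J.a_rcos_const ab by simp
      from in_P[OF self(1) this] show ?thesis using ab by simp
    qed
    then have "?P = J" using J.a_repr_independence'[of "\<zero>\<^bsub>A\<^esub>" x] x J.coset_zero by simp
    then show ?thesis using in_P[OF self] by simp
  qed
  show ?thesis
    by (rule idealI[OF A J.a_subgroup]) (auto intro: key)
qed

lemma additive_subgroup_image:
  assumes "ring A" "ring B" "h \<in> ring_hom A B" "additive_subgroup J A"
  shows "additive_subgroup (h ` J) B"
proof -
  interpret h: ring_hom_ring A B h by (rule ring_hom_ringI2[OF assms(1-3)])
  interpret J: additive_subgroup J A by fact
  show ?thesis
  proof (rule additive_subgroupI, rule subgroup.intro)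
    show "x \<otimes>\<^bsub>add_monoid B\<^esub> y \<in> h ` J" if xy: "x \<in> h ` J" "y \<in> h ` J" for x y
    proof -
      obtain a b where "a \<in> J" "b \<in> J" "x = h a" "y = h b" using xy by blast
      then have "x \<otimes>\<^bsub>add_monoid B\<^esub> y = h (a \<oplus>\<^bsub>A\<^esub> b)" by simp
      with \<open>a \<in> J\<close> \<open>b \<in> J\<close> show ?thesis by blast
    qed
    show "inv\<^bsub>add_monoid B\<^esub> x \<in> h ` J" if x: "x \<in> h ` J" for x
    proof -
      obtain a where "x = h a" "a \<in> J" using x by blast
      then have "inv\<^bsub>add_monoid B\<^esub> x = h (\<ominus>\<^bsub>A\<^esub> a)"
        using h.hom_a_inv[OF J.a_Hcarr, of a] unfolding a_inv_def by (simp only:)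
      with \<open>a \<in> J\<close> show ?thesis by blast
    qed
    show "\<one>\<^bsub>add_monoid B\<^esub> \<in> h ` J"
      using h.hom_zero J.zero_closed by (metis imageI monoid.simps(2))
  qed auto
qed

section \<open>Existence of Omega and additivity of the defining ideal\<close>

context bihom
begin

abbreviation Ut :: "('k, 'k tilde) module" where "Ut \<equiv> Utilde N \<chi>"

lemma om_om':
  assumes "g \<in> generators N"
  shows "wcong 1 (concat (map om' (om g))) [g]" "wcong 1 (concat (map om (om' g))) [g]"
proof -
  have KK: "wcong 1 [GenK a, GenK (- a)] []" and LL: "wcong 1 [GenL (- a), GenL a] []" if a: "a \<in> Lt" for a
  proof -
    have "wcong 1 [GenK a, GenK (- a)] [GenK 0]" "wcong 1 [GenL (- a), GenL a] [GenL 0]"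
      using binomial_relator.intros(3)[of a "- a"] binomial_relator.intros(4)[of "- a" a] a by (auto intro: wcong_brel)
    then show "wcong 1 [GenK a, GenK (- a)] []" "wcong 1 [GenL (- a), GenL a] []"
      using wcong_trans wcong_brel[OF binomial_relator.intros(1)] wcong_brel[OF binomial_relator.intros(2)] by fastforce+
  qed
  have "wcong 1 (concat (map om' (om g))) [g] \<and> wcong 1 (concat (map om (om' g))) [g]"
  proof (cases g)
    case (GenE i)
    then have i: "i \<in> {1..N}" using assms by simp
    from KK[of "\<alpha>\<^sub>s i"] LL[of "\<alpha>\<^sub>s i"] i have "wcong 1 [GenK (\<alpha>\<^sub>s i), GenK (- \<alpha>\<^sub>s i)] []" "wcong 1 [GenL (- \<alpha>\<^sub>s i), GenL (\<alpha>\<^sub>s i)] []"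
      by (simp_all del: atLeastAtMost_iff)
    from wcong_context[OF _ _ this(1), of "[]" "[GenE i]"] wcong_context[OF _ _ this(2), of "[GenE i]" "[]"]
    show ?thesis using GenE i by simp
  next
    case (GenF i)
    then have i: "i \<in> {1..N}" using assms by simp
    from KK[of "\<alpha>\<^sub>s i"] LL[of "\<alpha>\<^sub>s i"] i have "wcong 1 [GenK (\<alpha>\<^sub>s i), GenK (- \<alpha>\<^sub>s i)] []" "wcong 1 [GenL (- \<alpha>\<^sub>s i), GenL (\<alpha>\<^sub>s i)] []"
      by (simp_all del: atLeastAtMost_iff)
    from wcong_context[OF _ _ this(1), of "[]" "[GenF i]"] wcong_context[OF _ _ this(2), of "[GenF i]" "[]"]
    show ?thesis using GenF i by simp
  qed (simp_all add: wcong_refl)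
  then show "wcong 1 (concat (map om' (om g))) [g]" "wcong 1 (concat (map om (om' g))) [g]" by blast+
qed

lemma subst_inverse:
  assumes "\<And>g. g \<in> generators N \<Longrightarrow> wcong 1 (concat (map \<omega>' (\<omega> g))) [g]" "p \<in> carrier \<A>"
    and gens: "\<And>g. g \<in> generators N \<Longrightarrow> set (\<omega> g) \<subseteq> generators N"
      "\<And>g. g \<in> generators N \<Longrightarrow> set (\<omega>' g) \<subseteq> generators N"
  shows "subst \<omega>' (subst \<omega> p) - p \<in> \<R>"
  using assms(2)
proof (induction rule: FA_induct)
  case (add p q)
  then show ?case using R_add[of "subst \<omega>' (subst \<omega> p) - p" "subst \<omega>' (subst \<omega> q) - q"]
    by (simp add: subst_add algebra_simps)
next
  case (monomial c u)
  have "wcong 1 (concat (map \<omega>' (concat (map \<omega> u)))) u"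
    using monomial
  proof (induction u)
    case (Cons g u)
    have closed: "set (concat (map \<phi> w)) \<subseteq> generators N"
      if "\<And>g. g \<in> generators N \<Longrightarrow> set (\<phi> g) \<subseteq> generators N" "set w \<subseteq> generators N" for \<phi> w
      using that(2) by (induction w) (use that(1) in auto)
    have "set (concat (map \<omega>' (concat (map \<omega> u)))) \<subseteq> generators N"
      using Cons.prems by (intro closed gens) auto
    then have "wcong (1 * 1) (concat (map \<omega>' (\<omega> g)) @ concat (map \<omega>' (concat (map \<omega> u)))) ([g] @ u)"
      using Cons assms(1)[of g] by (intro wcong_append) auto
    then show ?case by simp
  qed (simp add: wcong_refl)
  then show ?case
    using R_lmult[OF FA_const[of c], of "monomial (concat (map \<omega>' (concat (map \<omega> u)))) - monomial u"]
    by (simp add: wcong_def subst_single right_diff_distrib)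
qed simp

text \<open>
  The choice in \<^const>\<open>Omega_tilde\<close> is meaningless unless the automorphism exists.
\<close>

definition Om :: "'k tilde \<Rightarrow> 'k tilde"
  where "Om C = cls (subst om (SOME p. p \<in> carrier \<A> \<and> cls p = C))"

lemma subst_om_in: "p \<in> carrier \<A> \<Longrightarrow> subst om p \<in> carrier \<A>"
  and subst_om'_in: "p \<in> carrier \<A> \<Longrightarrow> subst om' p \<in> carrier \<A>"
  using subst_in om_generators om'_generators by blast+

lemma Om_cls:
  assumes "p \<in> carrier \<A>"
  shows "Om (cls p) = cls (subst om p)"
proof -
  define p' where "p' = (SOME p'. p' \<in> carrier \<A> \<and> cls p' = cls p)"
  have "p' \<in> carrier \<A> \<and> cls p' = cls p"
    unfolding p'_def by (rule someI[of _ p]) (use assms in simp)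
  then have "p' \<in> carrier \<A>" "p' - p \<in> \<R>" using assms cls_eq_iff by auto
  moreover from this subst_om_R[of "p' - p"] have "subst om p' - subst om p \<in> \<R>" by (simp add: subst_diff)
  ultimately have "cls (subst om p') = cls (subst om p)"
    using assms by (simp add: cls_eq_iff subst_om_in)
  then show ?thesis by (simp add: Om_def p'_def)
qed

lemma Om_iso: "Om \<in> ring_iso Ut Ut"
proof -
  have "Om \<in> ring_hom Ut Ut"
    by (rule ring_hom_memI)
      (auto simp: carrier_Utilde Om_cls cls_add cls_mult cls_one FA_add FA_mult subst_om_in subst_add subst_mult)
  moreover have "bij_betw Om (carrier Ut) (carrier Ut)"
  proof (rule bij_betw_imageI)
    show "inj_on Om (carrier Ut)"
    proof (rule inj_onI, unfold carrier_Utilde, clarify)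
      fix p q assume p: "p \<in> carrier \<A>" and q: "q \<in> carrier \<A>" and eq: "Om (cls p) = Om (cls q)"
      have "subst om p - subst om q \<in> \<R>" using eq p q by (simp add: Om_cls cls_eq_iff subst_om_in)
      from subst_om'_R[OF this] have 1: "subst om' (subst om p) - subst om' (subst om q) \<in> \<R>" by (simp add: subst_diff)
      have 2: "subst om' (subst om r) - r \<in> \<R>" if "r \<in> carrier \<A>" for r
        by (rule subst_inverse[OF om_om'(1) that om_generators om'_generators])
      have "p - q = (subst om' (subst om p) - subst om' (subst om q)) - (subst om' (subst om p) - p)
          + (subst om' (subst om q) - q)" by simp
      also have "\<dots> \<in> \<R>" using 1 2[OF p] 2[OF q] by (intro R_add[OF R_diff])
      finally show "cls p = cls q" using p q by (simp add: cls_eq_iff)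
    qed
    show "Om ` carrier Ut = carrier Ut"
    proof
      show "Om ` carrier Ut \<subseteq> carrier Ut" by (auto simp: carrier_Utilde Om_cls subst_om_in)
      show "carrier Ut \<subseteq> Om ` carrier Ut"
      proof (unfold carrier_Utilde, clarify)
        fix p assume p: "p \<in> carrier \<A>"
        have "subst om (subst om' p) - p \<in> \<R>"
          by (rule subst_inverse[OF om_om'(2) p om'_generators om_generators])
        then have "Om (cls (subst om' p)) = cls p" using p by (simp add: Om_cls cls_eq_iff subst_om_in subst_om'_in)
        then show "cls p \<in> Om ` cls ` carrier \<A>" using subst_om'_in[OF p] by (metis imageI)
      qed
    qed
  qed
  ultimately show ?thesis by (simp add: ring_iso_def)
qed

lemma Omega_hom: "Omega_tilde N \<chi> \<in> ring_hom Ut Ut"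
proof -
  have mem: "[g] \<in> {u. set u \<subseteq> generators N}" if "g \<in> generators N" for g using that by simp
  have "\<exists>h. h \<in> ring_iso Ut Ut \<and> (\<forall>c. \<forall>x \<in> carrier Ut. h (c \<odot>\<^bsub>Ut\<^esub> x) = c \<odot>\<^bsub>Ut\<^esub> h x) \<and>
    (\<forall>a \<in> Lt. h (tK N \<chi> a) = tK N \<chi> (- a) \<and> h (tL N \<chi> a) = tL N \<chi> (- a)) \<and>
    (\<forall>i \<in> {1..N}. h (tE N \<chi> i) = tF N \<chi> i \<otimes>\<^bsub>Ut\<^esub> tL N \<chi> (- \<alpha>\<^sub>s i) \<and>
                  h (tF N \<chi> i) = tK N \<chi> (- \<alpha>\<^sub>s i) \<otimes>\<^bsub>Ut\<^esub> tE N \<chi> i)"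
  proof (intro exI[of _ Om] conjI allI ballI)
    show "Om (c \<odot>\<^bsub>Ut\<^esub> x) = c \<odot>\<^bsub>Ut\<^esub> Om x" if "x \<in> carrier Ut" for c x
      using that by (auto simp: carrier_Utilde cls_smult Om_cls FA_mult subst_om_in subst_const_mult)
  qed (simp_all add: Om_iso tK_def tL_def tE_def tF_def tilde_class_eq Om_cls FA_monomial subst_monomial
        cls_mult monomial_mult del: atLeastAtMost_iff)
  from someI_ex[OF this] show ?thesis
    unfolding Omega_tilde_def ring_iso_def by blast
qed

lemma Ut_abelian: "abelian_group Ut"
  by (rule ring.is_abelian_group[OF ring_Utilde])

lemma Ut_carrier_submodule: "submodule (carrier Ut) scalars Ut"
proof -
  interpret ring Ut by (rule ring_Utilde)
  show ?thesis
  proof (rule submodule_scalarsI[OF Ut_abelian])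
    show "c \<odot>\<^bsub>Ut\<^esub> x \<in> carrier Ut" if "x \<in> carrier Ut" for c x
      using that by (auto simp: carrier_Utilde cls_smult FA_mult)
  qed simp_all
qed

lemma generated_subalgebra_subset: "S \<subseteq> carrier Ut \<Longrightarrow> generated_subalgebra Ut S \<subseteq> carrier Ut"
  unfolding generated_subalgebra_def
  by (rule hull_minimal) (use Ut_carrier_submodule ring.carrier_is_subring[OF ring_Utilde] in auto)

lemma tclass_in: "set u \<subseteq> generators N \<Longrightarrow> tilde_class N \<chi> u \<in> carrier Ut"
  unfolding tilde_class_eq by (intro cls_in FA_monomial)

lemma subalgebras_subset: "Utilde_minus N \<chi> \<subseteq> carrier Ut" "Utilde_plus N \<chi> \<subseteq> carrier Ut"
  "Utilde_zero N \<chi> \<subseteq> carrier Ut"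
  unfolding Utilde_minus_def Utilde_plus_def Utilde_zero_def tK_def tL_def tE_def tF_def
  by (rule generated_subalgebra_subset; auto intro!: tclass_in)+

lemma J_minus_subgroup: "additive_subgroup (J_minus N \<chi>) Ut"
proof -
  interpret ring Ut by (rule ring_Utilde)
  have I_in: "Y \<in> carrier Ut" if "I_minus N \<chi> a Y" for a Y
    using that by cases (use subalgebras_subset in auto)
  have "submodule (I_minus_sum N \<chi>) scalars Ut"
    unfolding I_minus_sum_def using I_in by (intro linear_span_submodule[OF Ut_abelian Ut_carrier_submodule]) auto
  then have "I_minus_sum N \<chi> \<subseteq> carrier Ut" by (rule submodule_subset)
  then have "submodule (J_minus N \<chi>) scalars Ut"
    unfolding J_minus_def using subalgebras_subset
    by (intro linear_span_submodule[OF Ut_abelian Ut_carrier_submodule]) blast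
  then show ?thesis
    using submodule.axioms(1) by (intro additive_subgroup.intro) auto
qed

lemma J_total_subgroup: "additive_subgroup (J_total N \<chi>) Ut"
  unfolding J_total_def
  by (rule abelian_group.add_additive_subgroups[OF Ut_abelian J_minus_subgroup
        additive_subgroup_image[OF ring_Utilde ring_Utilde Omega_hom J_minus_subgroup]])

lemma J_total_ideal: "ring (U N \<chi>) \<Longrightarrow> ideal (J_total N \<chi>) Ut"
  unfolding U_def by (rule ideal_of_quotient_ring[OF ring_Utilde J_total_subgroup])

end

section \<open>Verma modules and their irreducible quotients\<close>

text \<open>
  Bihomomorphisms are specified on the root lattice only; truncating the arguments extends them to all weights.
\<close>

definition restr :: "nat \<Rightarrow> weight \<Rightarrow> weight"
  where "restr N a = (\<Sum>i=1..N. Poly_Mapping.single i (Poly_Mapping.lookup a i))"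

lemma lookup_restr: "Poly_Mapping.lookup (restr N a) k = (if k \<in> {1..N} then Poly_Mapping.lookup a k else 0)"
  unfolding restr_def lookup_sum lookup_single when_def by simp

lemma restr_add: "restr N (a + b) = restr N a + restr N b"
  by (simp add: restr_def lookup_add single_add sum.distrib)

lemma restr_in: "restr N a \<in> root_lattice N"
  by (auto simp: root_lattice_def in_keys_iff lookup_restr split: if_splits)

lemma restr_id: "a \<in> root_lattice N \<Longrightarrow> restr N a = a"
  by (rule poly_mapping_eqI) (auto simp: lookup_restr root_lattice_def in_keys_iff)

locale verma = bihom N \<chi> for N and \<chi> :: "weight \<Rightarrow> weight \<Rightarrow> 'k::field" +
  fixes \<Lambda> :: "'k qgroup \<Rightarrow> 'k" and M :: "('k qgroup, 'm) module" and v :: 'm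
  assumes character: "\<Lambda> \<in> Ch_U_zero N \<chi>" and verma: "verma_module N \<chi> \<Lambda> M v"
begin

abbreviation Uq :: "('k, 'k qgroup) module" where "Uq \<equiv> U N \<chi>"
abbreviation J :: "'k tilde set" where "J \<equiv> J_total N \<chi>"

lemma left_module: "left_module Uq M"
  using verma by (simp add: verma_module_def)

sublocale LM: left_module Uq M
  by (rule left_module)

lemma M_abelian: "abelian_group M"
  using left_module by (simp add: left_module_def)

lemma ring_U: "ring Uq"
  using left_module by (simp add: left_module_def)

lemma ideal_J: "ideal J Ut"
  by (rule J_total_ideal[OF ring_U])

lemma subgroup_J: "abelian_subgroup J Ut"
  by (rule abelian_subgroupI3[OF ideal.axioms(1)[OF ideal_J] Ut_abelian])

section \<open>The free algebra acting on the Verma module\<close>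

definition rho :: "'k free \<Rightarrow> 'k qgroup"
  where "rho p = proj N \<chi> (cls p)"

lemma carrier_U: "carrier Uq = rho ` carrier \<A>"
  unfolding U_def quotient_simps carrier_Utilde image_image rho_def proj_def ..

lemma rho_in: "p \<in> carrier \<A> \<Longrightarrow> rho p \<in> carrier Uq"
  unfolding carrier_U by blast

lemma rho_add: "\<lbrakk>p \<in> carrier \<A>; q \<in> carrier \<A>\<rbrakk> \<Longrightarrow> rho p \<oplus>\<^bsub>Uq\<^esub> rho q = rho (p + q)"
  unfolding U_def quotient_simps rho_def proj_def
  using abelian_subgroup.a_rcos_sum[OF subgroup_J] by (simp add: cls_in cls_add)

lemma rho_mult: "\<lbrakk>p \<in> carrier \<A>; q \<in> carrier \<A>\<rbrakk> \<Longrightarrow> rho p \<otimes>\<^bsub>Uq\<^esub> rho q = rho (p * q)"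
  unfolding U_def quotient_simps rho_def proj_def
  using ideal.rcoset_mult_add[OF ideal_J] by (simp add: cls_in cls_mult)

lemma rho_one: "\<one>\<^bsub>Uq\<^esub> = rho 1"
  unfolding U_def quotient_simps rho_def proj_def cls_one ..

lemma rho_cong: "\<lbrakk>p \<in> carrier \<A>; q \<in> carrier \<A>; p - q \<in> \<R>\<rbrakk> \<Longrightarrow> rho p = rho q"
  unfolding rho_def by (simp add: cls_eq_iff[symmetric])

lemma rho_smult: "p \<in> carrier \<A> \<Longrightarrow> c \<odot>\<^bsub>Uq\<^esub> rho p = rho (const c * p)"
proof -
  interpret J: abelian_subgroup J Ut by (rule subgroup_J)
  interpret R: ring Ut by (rule ring_Utilde)
  assume p: "p \<in> carrier \<A>"
  have smult_eq: "c \<odot>\<^bsub>Ut\<^esub> x = cls (const c) \<otimes>\<^bsub>Ut\<^esub> x" if "x \<in> carrier Ut" for x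
    using that by (auto simp: carrier_Utilde cls_smult cls_mult)
  have "c \<odot>\<^bsub>Ut\<^esub> y \<ominus>\<^bsub>Ut\<^esub> c \<odot>\<^bsub>Ut\<^esub> cls p \<in> J" if y: "y \<in> carrier Ut" "y \<ominus>\<^bsub>Ut\<^esub> cls p \<in> J" for y
  proof -
    have "cls (const c) \<otimes>\<^bsub>Ut\<^esub> (y \<ominus>\<^bsub>Ut\<^esub> cls p) \<in> J"
      by (rule ideal.I_l_closed[OF ideal_J y(2) cls_in[OF FA_const]])
    moreover have "cls (const c) \<otimes>\<^bsub>Ut\<^esub> (y \<ominus>\<^bsub>Ut\<^esub> cls p) = cls (const c) \<otimes>\<^bsub>Ut\<^esub> y \<ominus>\<^bsub>Ut\<^esub> cls (const c) \<otimes>\<^bsub>Ut\<^esub> cls p"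
      using y(1) cls_in[OF p] cls_in[OF FA_const, of c] by (simp add: a_minus_def R.r_distr R.r_minus)
    ultimately show ?thesis using smult_eq y(1) cls_in[OF p] by simp
  qed
  from J.coset_smult[OF cls_in[OF p], of "\<lambda>x. c \<odot>\<^bsub>Ut\<^esub> x", OF _ this]
  have "(\<Union>y\<in>J +>\<^bsub>Ut\<^esub> cls p. J +>\<^bsub>Ut\<^esub> c \<odot>\<^bsub>Ut\<^esub> y) = J +>\<^bsub>Ut\<^esub> c \<odot>\<^bsub>Ut\<^esub> cls p"
    using smult_eq cls_in[OF FA_const] by simp
  then show ?thesis
    unfolding U_def quotient_simps rho_def proj_def by (simp add: cls_smult p)
qed

definition act :: "'k free \<Rightarrow> 'm \<Rightarrow> 'm"
  where "act p x = rho p \<odot>\<^bsub>M\<^esub> x"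

abbreviation sc :: "'k \<Rightarrow> 'm \<Rightarrow> 'm"
  where "sc c \<equiv> act (const c)"

lemma act_in [simp]: "\<lbrakk>p \<in> carrier \<A>; x \<in> carrier M\<rbrakk> \<Longrightarrow> act p x \<in> carrier M"
  unfolding act_def by (intro LM.smult_closed rho_in)

lemma act_add: "\<lbrakk>p \<in> carrier \<A>; q \<in> carrier \<A>; x \<in> carrier M\<rbrakk> \<Longrightarrow> act (p + q) x = act p x \<oplus>\<^bsub>M\<^esub> act q x"
  unfolding act_def rho_add[symmetric] by (intro LM.smult_l_distr rho_in)

lemma act_distrib: "\<lbrakk>p \<in> carrier \<A>; x \<in> carrier M; y \<in> carrier M\<rbrakk> \<Longrightarrow> act p (x \<oplus>\<^bsub>M\<^esub> y) = act p x \<oplus>\<^bsub>M\<^esub> act p y"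
  unfolding act_def by (intro LM.smult_r_distr rho_in)

lemma act_mult: "\<lbrakk>p \<in> carrier \<A>; q \<in> carrier \<A>; x \<in> carrier M\<rbrakk> \<Longrightarrow> act (p * q) x = act p (act q x)"
  unfolding act_def rho_mult[symmetric] by (intro LM.smult_assoc rho_in)

lemma act_one [simp]: "x \<in> carrier M \<Longrightarrow> act 1 x = x"
  unfolding act_def rho_one[symmetric] by (rule LM.smult_one)

lemma act_cong: "\<lbrakk>p \<in> carrier \<A>; q \<in> carrier \<A>; p - q \<in> \<R>\<rbrakk> \<Longrightarrow> act p x = act q x"
  unfolding act_def by (simp only: rho_cong)

lemma act_commute: "\<lbrakk>p \<in> carrier \<A>; x \<in> carrier M\<rbrakk> \<Longrightarrow> act p (sc c x) = sc c (act p x)"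
  by (simp add: act_mult[symmetric] const_commute)

lemma sc_sc: "x \<in> carrier M \<Longrightarrow> sc c (sc d x) = sc (c * d) x"
  by (simp add: act_mult[symmetric] const_mult)

lemma sc_add: "x \<in> carrier M \<Longrightarrow> sc (c + d) x = sc c x \<oplus>\<^bsub>M\<^esub> sc d x"
  by (simp add: act_add const_add)

lemma act_zero [simp]: "p \<in> carrier \<A> \<Longrightarrow> act p \<zero>\<^bsub>M\<^esub> = \<zero>\<^bsub>M\<^esub>"
  using act_distrib[of p "\<zero>\<^bsub>M\<^esub>" "\<zero>\<^bsub>M\<^esub>"] LM.M.add.l_cancel_one[of "act p \<zero>\<^bsub>M\<^esub>" "act p \<zero>\<^bsub>M\<^esub>"] by simp

lemma zero_act [simp]: "x \<in> carrier M \<Longrightarrow> act 0 x = \<zero>\<^bsub>M\<^esub>"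
  using act_add[of 0 0 x] LM.M.add.l_cancel_one[of "act 0 x" "act 0 x"] by simp

lemma sc_uminus: "x \<in> carrier M \<Longrightarrow> sc (- 1) x = \<ominus>\<^bsub>M\<^esub> x"
  using sc_add[of x "- 1" 1] LM.M.minus_equality[of "sc (- 1) x" x] by simp

lemma restrict_smult: "c \<odot>\<^bsub>restrict_scalars Uq M'\<^esub> x = rho (const c) \<odot>\<^bsub>M'\<^esub> x"
  using rho_smult[of 1 c] by (simp add: restrict_scalars_def rho_one)

lemma v_in: "v \<in> carrier M" and v_nz: "v \<noteq> \<zero>\<^bsub>M\<^esub>"
  and carrier_M: "carrier M = (\<lambda>p. act p v) ` carrier \<A>"
  using verma unfolding verma_module_def carrier_U image_image act_def by auto

abbreviation actw :: "generator list \<Rightarrow> 'm \<Rightarrow> 'm"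
  where "actw u \<equiv> act (monomial u)"

lemma actw_append: "\<lbrakk>set u \<subseteq> generators N; set w \<subseteq> generators N; x \<in> carrier M\<rbrakk> \<Longrightarrow> actw (u @ w) x = actw u (actw w x)"
  by (simp add: monomial_mult[symmetric] act_mult FA_monomial)

lemma actw_Nil [simp]: "x \<in> carrier M \<Longrightarrow> actw [] x = x"
  by (simp add: monomial_Nil)

lemma actw_wcong:
  assumes "wcong c u w" "set u \<subseteq> generators N" "set w \<subseteq> generators N" "x \<in> carrier M"
  shows "actw u x = sc c (actw w x)"
  using act_cong[of "monomial u" "const c * monomial w" x] assms
  by (simp add: wcong_def FA_monomial FA_mult act_mult)

definition ev :: "generator \<Rightarrow> 'k"
  where "ev g = \<Lambda> (rho (monomial [g]))"

lemma rho_torus: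
  assumes "torus g"
  shows "rho (monomial [g]) \<in> U_zero N \<chi>"
proof -
  have "cls (monomial [g]) \<in> tK N \<chi> ` Lt \<union> tL N \<chi> ` Lt"
    using assms by (auto simp: torus_def tK_def tL_def tilde_class_eq)
  then have "cls (monomial [g]) \<in> Utilde_zero N \<chi>"
    unfolding Utilde_zero_def generated_subalgebra_def by (rule hull_inc)
  then show ?thesis by (simp add: U_zero_def rho_def)
qed

lemma torus_v: "torus g \<Longrightarrow> actw [g] v = sc (ev g) v"
  using verma rho_torus[of g]
  unfolding verma_module_def restrict_smult act_def ev_def by blast

lemma E_v: "i \<in> {1..N} \<Longrightarrow> actw [GenE i] v = \<zero>\<^bsub>M\<^esub>"
  using verma unfolding verma_module_def UE_def tE_def tilde_class_eq act_def rho_def by blast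

lemma character_hom: "\<lbrakk>x \<in> U_zero N \<chi>; y \<in> U_zero N \<chi>\<rbrakk> \<Longrightarrow> \<Lambda> (x \<otimes>\<^bsub>Uq\<^esub> y) = \<Lambda> x * \<Lambda> y"
  using ring_hom_mult[of \<Lambda> "Uq\<lparr>carrier := U_zero N \<chi>\<rparr>" scalars x y] character
  by (simp add: Ch_U_zero_def)

lemma character_one: "\<Lambda> \<one>\<^bsub>Uq\<^esub> = 1"
  using ring_hom_one[of \<Lambda> "Uq\<lparr>carrier := U_zero N \<chi>\<rparr>" scalars] character
  by (simp add: Ch_U_zero_def)

lemma ev_inverse: "a \<in> Lt \<Longrightarrow> ev (GenK a) * ev (GenK (- a)) = 1 \<and> ev (GenL a) * ev (GenL (- a)) = 1"
proof -
  assume a: "a \<in> Lt"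
  have wc: "wcong 1 [GenK a, GenK (- a)] []" "wcong 1 [GenL a, GenL (- a)] []"
    using binomial_relator.intros(3,4)[of a "- a", THEN wcong_brel] a
      wcong_trans[of 1 _ "[GenK 0]" 1 "[]"] wcong_trans[of 1 _ "[GenL 0]" 1 "[]"] binomial_relator.intros(1,2)[THEN wcong_brel]
    by simp_all
  have "rho (monomial [GenK a, GenK (- a)]) = rho 1"
    using wc(1) a by (intro rho_cong FA_monomial) (simp_all add: wcong_def monomial_Nil)
  moreover have "rho (monomial [GenL a, GenL (- a)]) = rho 1"
    using wc(2) a by (intro rho_cong FA_monomial) (simp_all add: wcong_def monomial_Nil)
  ultimately have eq: "rho (monomial [GenK a]) \<otimes>\<^bsub>Uq\<^esub> rho (monomial [GenK (- a)]) = \<one>\<^bsub>Uq\<^esub>"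
    "rho (monomial [GenL a]) \<otimes>\<^bsub>Uq\<^esub> rho (monomial [GenL (- a)]) = \<one>\<^bsub>Uq\<^esub>"
    using a by (simp_all add: rho_mult rho_one monomial_mult FA_monomial)
  have torus: "torus (GenK a)" "torus (GenK (- a))" "torus (GenL a)" "torus (GenL (- a))"
    using a by (auto simp: torus_def)
  show ?thesis
    unfolding ev_def
    using character_hom[OF rho_torus[OF torus(1)] rho_torus[OF torus(2)]]
      character_hom[OF rho_torus[OF torus(3)] rho_torus[OF torus(4)]] eq character_one by simp
qed

lemma ev_nonzero: "a \<in> Lt \<Longrightarrow> ev (GenK a) \<noteq> 0" "a \<in> Lt \<Longrightarrow> ev (GenL a) \<noteq> 0"
  using ev_inverse[of a] by auto

lemma lam_eq: "i \<in> {1..N} \<Longrightarrow> \<Lambda> (UK N \<chi> (\<alpha>\<^sub>s i) \<otimes>\<^bsub>Uq\<^esub> UL N \<chi> (- \<alpha>\<^sub>s i)) = ev (GenK (\<alpha>\<^sub>s i)) / ev (GenL (\<alpha>\<^sub>s i))"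
proof -
  assume i: "i \<in> {1..N}"
  have "torus (GenK (\<alpha>\<^sub>s i))" "torus (GenL (- \<alpha>\<^sub>s i))" using i by (auto simp: torus_def simp del: atLeastAtMost_iff)
  from character_hom[OF this[THEN rho_torus]]
  have "\<Lambda> (UK N \<chi> (\<alpha>\<^sub>s i) \<otimes>\<^bsub>Uq\<^esub> UL N \<chi> (- \<alpha>\<^sub>s i)) = ev (GenK (\<alpha>\<^sub>s i)) * ev (GenL (- \<alpha>\<^sub>s i))"
    by (simp add: UK_def UL_def tK_def tL_def tilde_class_eq rho_def ev_def)
  also have "ev (GenL (- \<alpha>\<^sub>s i)) = inverse (ev (GenL (\<alpha>\<^sub>s i)))"
    using ev_inverse[of "\<alpha>\<^sub>s i"] i by (metis Lt_simps(5) inverse_unique)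
  finally show ?thesis by (simp add: field_simps)
qed

definition fM :: "nat list \<Rightarrow> 'm"
  where "fM u = actw (map GenF u) v"

abbreviation cont :: "nat list \<Rightarrow> weight"
  where "cont u \<equiv> sum_list (map \<alpha>\<^sub>s u)"

lemma Fword_generators [simp]: "set u \<subseteq> {1..N} \<Longrightarrow> GenF ` set u \<subseteq> generators N"
  by auto

lemma fM_in [simp]: "set u \<subseteq> {1..N} \<Longrightarrow> fM u \<in> carrier M"
  unfolding fM_def by (intro act_in FA_monomial v_in) simp

lemma fM_Nil [simp]: "fM [] = v"
  by (simp add: fM_def v_in)

lemma fM_Cons: "set (j # u) \<subseteq> {1..N} \<Longrightarrow> fM (j # u) = actw [GenF j] (fM u)"
  using actw_append[of "[GenF j]" "map GenF u" v] by (simp add: fM_def v_in)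

lemma cont_in: "set u \<subseteq> {1..N} \<Longrightarrow> cont u \<in> Lt"
  by (induction u) simp_all

lemma degree_Fword: "sum_list (map generator_degree (map GenF u)) = - cont u"
  by (induction u) simp_all

lemma torus_fM:
  assumes "torus g" "set u \<subseteq> {1..N}"
  shows "actw [g] (fM u) = sc (ev g * tau g (- cont u)) (fM u)"
proof -
  have g: "set [g] \<subseteq> generators N" using torus_generator[OF assms(1)] by simp
  have w: "set (map GenF u) \<subseteq> generators N" using assms(2) by simp
  have "actw [g] (fM u) = actw (g # map GenF u) v"
    using actw_append[OF g w v_in] by (simp add: fM_def)
  also have "\<dots> = sc (tau g (- cont u)) (actw (map GenF u @ [g]) v)"
    using torus_commute[OF assms(1) w] g w v_in unfolding degree_Fword by (intro actw_wcong) auto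
  also have "actw (map GenF u @ [g]) v = actw (map GenF u) (sc (ev g) v)"
    using actw_append[OF w g v_in] torus_v[OF assms(1)] by simp
  also have "\<dots> = sc (ev g) (fM u)"
    unfolding fM_def by (rule act_commute[OF FA_monomial[OF w] v_in])
  finally show ?thesis using assms(2) by (simp add: sc_sc mult.commute)
qed

definition cc :: "nat \<Rightarrow> weight \<Rightarrow> 'k"
  where "cc i b = ev (GenL (\<alpha>\<^sub>s i)) * \<chi> b (\<alpha>\<^sub>s i) - ev (GenK (\<alpha>\<^sub>s i)) * \<chi> (\<alpha>\<^sub>s i) (- b)"

lemma E_fM:
  assumes i: "i \<in> {1..N}" and ju: "set (j # u) \<subseteq> {1..N}"
  shows "actw [GenE i] (fM (j # u)) = actw [GenF j] (actw [GenE i] (fM u)) \<oplus>\<^bsub>M\<^esub>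
    (if i = j then sc (cc i (cont u)) (fM u) else \<zero>\<^bsub>M\<^esub>)"
proof -
  let ?K = "monomial [GenK (\<alpha>\<^sub>s i)] :: 'k free" and ?L = "monomial [GenL (\<alpha>\<^sub>s i)] :: 'k free"
  let ?D = "if i = j then const (- 1) * ?K + ?L else 0"
  have j: "j \<in> {1..N}" and u: "set u \<subseteq> {1..N}" using ju by auto
  have gens: "set [GenE i] \<subseteq> generators N" "set [GenF j] \<subseteq> generators N" "set [GenK (\<alpha>\<^sub>s i)] \<subseteq> generators N" "set [GenL (\<alpha>\<^sub>s i)] \<subseteq> generators N"
    using i j by (simp_all del: atLeastAtMost_iff)
  have EF: "set [GenE i, GenF j] \<subseteq> generators N" "set [GenF j, GenE i] \<subseteq> generators N" using gens by auto
  have D: "?D \<in> carrier \<A>" using gens by (auto intro!: FA_add FA_mult FA_monomial simp del: atLeastAtMost_iff)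
  have "commutator_relator i j \<in> \<R>" using i j by (intro R_relator) (unfold relators_eq, blast)
  moreover have "commutator_relator i j = monomial [GenE i, GenF j] - (monomial [GenF j, GenE i] + ?D)"
    by (simp add: commutator_relator_def const_uminus)
  ultimately have "act (monomial [GenE i, GenF j]) (fM u) = act (monomial [GenF j, GenE i] + ?D) (fM u)"
    using EF D by (intro act_cong FA_add FA_monomial) simp_all
  also have "\<dots> = actw [GenF j, GenE i] (fM u) \<oplus>\<^bsub>M\<^esub> act ?D (fM u)"
    using EF D u by (intro act_add FA_monomial fM_in)
  also have "act ?D (fM u) = (if i = j then sc (cc i (cont u)) (fM u) else \<zero>\<^bsub>M\<^esub>)"
  proof (cases "i = j")
    case True
    have torus: "torus (GenK (\<alpha>\<^sub>s i))" "torus (GenL (\<alpha>\<^sub>s i))" using i by (auto simp: torus_def simp del: atLeastAtMost_iff)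
    have "act (const (- 1) * ?K + ?L) (fM u) = sc (- 1) (act ?K (fM u)) \<oplus>\<^bsub>M\<^esub> act ?L (fM u)"
      using gens u by (simp add: act_add act_mult FA_mult FA_monomial)
    also have "\<dots> = sc (cc i (cont u)) (fM u)"
      unfolding torus_fM[OF torus(1) u] torus_fM[OF torus(2) u] cc_def
      using u by (simp add: sc_sc sc_add[symmetric])
    finally show ?thesis using True by simp
  qed (use u in simp)
  finally show ?thesis
    using actw_append[OF gens(1,2), of "fM u"] actw_append[OF gens(2,1), of "fM u"] u fM_Cons[OF ju] by simp
qed

end

section \<open>Comparison of the Verma module with the word model\<close>

locale separated_verma = verma N \<chi> \<Lambda> M v for N and \<chi> :: "weight \<Rightarrow> weight \<Rightarrow> 'k::field" and \<Lambda>
    and M :: "('k qgroup, 'm) module" and v +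
  assumes separated: "\<lbrakk>\<beta> \<in> root_lattice N; \<gamma> \<in> root_lattice N; \<beta> \<noteq> \<gamma>\<rbrakk> \<Longrightarrow>
    \<exists>i\<in>{1..N}. \<chi> (\<alpha>\<^sub>s i) (- \<beta>) \<noteq> \<chi> (\<alpha>\<^sub>s i) (- \<gamma>) \<or> \<chi> \<beta> (\<alpha>\<^sub>s i) \<noteq> \<chi> \<gamma> (\<alpha>\<^sub>s i)"
begin

definition lamv :: "nat \<Rightarrow> 'k"
  where "lamv i = ev (GenK (\<alpha>\<^sub>s i)) / ev (GenL (\<alpha>\<^sub>s i))"

definition bv :: "nat \<Rightarrow> 'k"
  where "bv i = ev (GenL (\<alpha>\<^sub>s i))"

definition chir :: "weight \<Rightarrow> weight \<Rightarrow> 'k"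
  where "chir a b = \<chi> (restr N a) (restr N b)"

sublocale W: word_model chir "{1..N}" \<alpha>\<^sub>s lamv bv
proof
  show "chir (r + s) t = chir r t * chir s t" "chir r (s + t) = chir r s * chir r t" "chir r s \<noteq> 0" for r s t
    by (simp_all add: chir_def restr_add restr_in chi_add)
  show "\<exists>h::weight \<Rightarrow> int. (\<forall>x y. h (x + y) = h x + h y) \<and> (\<forall>i\<in>{1..N}. 0 < h (\<alpha>\<^sub>s i))"
  proof (intro exI[of _ "\<lambda>a. \<Sum>k=1..N. Poly_Mapping.lookup a k"] conjI allI ballI)
    show "0 < (\<Sum>k=1..N. Poly_Mapping.lookup (\<alpha>\<^sub>s i) k)" if "i \<in> {1..N}" for i
      using that by (simp add: simple_root_def lookup_single when_def)
  qed (simp add: lookup_add sum.distrib)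
  show "lamv i \<noteq> 0" "bv i \<noteq> 0" if "i \<in> {1..N}" for i
    using that ev_nonzero[of "\<alpha>\<^sub>s i"] by (simp_all add: lamv_def bv_def del: atLeastAtMost_iff)
qed

lemma W_content: "W.content u = cont u"
  by (simp add: W.content_def)

lemma cc_eq: "\<lbrakk>i \<in> {1..N}; set u \<subseteq> {1..N}\<rbrakk> \<Longrightarrow> W.c i (- cont u) = cc i (cont u)"
proof -
  assume i: "i \<in> {1..N}" and u: "set u \<subseteq> {1..N}"
  have "ev (GenL (\<alpha>\<^sub>s i)) \<noteq> 0" "\<chi> (cont u) (\<alpha>\<^sub>s i) \<noteq> 0"
    using i ev_nonzero cont_in[OF u] by (simp_all del: atLeastAtMost_iff)
  then show ?thesis
    using i cont_in[OF u]
    by (simp add: W.c_def cc_def bv_def lamv_def chir_def restr_id chi_minus field_simps del: atLeastAtMost_iff)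
qed

text \<open>
  A formal combination of words, evaluated by \<open>lcM\<close> in the Verma module and by \<open>lcV\<close> in the word model.
\<close>

type_synonym 'a combination = "('a \<times> nat list) list"

definition ok :: "'k combination \<Rightarrow> bool"
  where "ok xs \<longleftrightarrow> (\<forall>p\<in>set xs. set (snd p) \<subseteq> {1..N})"

definition smul :: "'k \<Rightarrow> 'k combination \<Rightarrow> 'k combination"
  where "smul c xs = map (\<lambda>(a, u). (c * a, u)) xs"

definition ext :: "(nat list \<Rightarrow> 'k combination) \<Rightarrow> 'k combination \<Rightarrow> 'k combination"
  where "ext t xs = concat (map (\<lambda>(a, u). smul a (t u)) xs)"

primrec lcM :: "'k combination \<Rightarrow> 'm"
  where "lcM [] = \<zero>\<^bsub>M\<^esub>" | "lcM (p # xs) = sc (fst p) (fM (snd p)) \<oplus>\<^bsub>M\<^esub> lcM xs"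

primrec lcV :: "'k combination \<Rightarrow> nat list \<Rightarrow> 'k"
  where "lcV [] = (\<lambda>_. 0)" | "lcV (p # xs) = (\<lambda>w. fst p * W.fword (snd p) w + lcV xs w)"

lemma ok_simps [simp]: "ok []" "ok (p # xs) \<longleftrightarrow> set (snd p) \<subseteq> {1..N} \<and> ok xs"
  "ok (xs @ ys) \<longleftrightarrow> ok xs \<and> ok ys"
  by (auto simp: ok_def)

lemma ok_smul [simp]: "ok (smul c xs) \<longleftrightarrow> ok xs"
  by (induction xs) (auto simp: smul_def)

lemma ok_filter: "ok xs \<Longrightarrow> ok (filter P xs)"
  by (auto simp: ok_def)

lemma ok_ext: "\<lbrakk>\<And>u. set u \<subseteq> {1..N} \<Longrightarrow> ok (t u); ok xs\<rbrakk> \<Longrightarrow> ok (ext t xs)"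
  by (induction xs) (auto simp: ext_def)

lemma lcM_in [simp]: "ok xs \<Longrightarrow> lcM xs \<in> carrier M"
  by (induction xs) simp_all

lemma lcM_append: "\<lbrakk>ok xs; ok ys\<rbrakk> \<Longrightarrow> lcM (xs @ ys) = lcM xs \<oplus>\<^bsub>M\<^esub> lcM ys"
  by (induction xs) (simp_all add: LM.M.a_assoc)

lemma lcM_smul: "ok xs \<Longrightarrow> lcM (smul c xs) = sc c (lcM xs)"
  by (induction xs) (auto simp: smul_def act_distrib sc_sc)

lemma lcM_ext:
  assumes "p \<in> carrier \<A>" "\<And>u. set u \<subseteq> {1..N} \<Longrightarrow> act p (fM u) = lcM (t u) \<and> ok (t u)" "ok xs"
  shows "act p (lcM xs) = lcM (ext t xs)"
  using assms(3)
proof (induction xs)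
  case (Cons x xs)
  obtain a u where x: "x = (a, u)" by force
  have u: "set u \<subseteq> {1..N}" using Cons.prems x by simp
  have "ok (smul a (t u))" "ok (ext t xs)" using assms(2)[OF u] ok_ext[of t xs] assms(2) Cons.prems by auto
  then have "lcM (ext t (x # xs)) = sc a (act p (fM u)) \<oplus>\<^bsub>M\<^esub> act p (lcM xs)"
    using Cons assms(2)[OF u] by (simp add: x ext_def lcM_append lcM_smul)
  then show ?case
    using Cons.prems u assms(1) by (simp add: x act_distrib act_commute)
qed (use assms(1) in \<open>simp add: ext_def\<close>)

lemma lcV_append: "lcV (xs @ ys) = (\<lambda>w. lcV xs w + lcV ys w)"
  by (induction xs) (simp_all add: add.assoc)

lemma lcV_smul: "lcV (smul c xs) = fscale c (lcV xs)"
  by (induction xs) (auto simp: smul_def fscale_def algebra_simps)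

lemma lcV_ext:
  assumes "\<And>f g. T (\<lambda>w. f w + g w) = (\<lambda>w. T f w + T g w)" "\<And>a f. T (fscale a f) = fscale a (T f)"
    and "\<And>u. set u \<subseteq> {1..N} \<Longrightarrow> T (W.fword u) = lcV (t u)" and "ok xs"
  shows "T (lcV xs) = lcV (ext t xs)"
  using assms(4)
proof (induction xs)
  case Nil
  have "T (fscale 0 f) = fscale 0 (T f)" for f by (rule assms(2))
  from this[of 0] show ?case by (simp add: ext_def zero_fun_def)
next
  case (Cons x xs)
  obtain a u where x: "x = (a, u)" by force
  have "T (lcV (x # xs)) = (\<lambda>w. T (fscale a (W.fword u)) w + T (lcV xs) w)"
    using assms(1)[of "fscale a (W.fword u)" "lcV xs"] by (simp add: x fscale_def)
  also have "\<dots> = lcV (ext t (x # xs))"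
    using Cons assms(3)[of u] by (simp add: x ext_def assms(2) lcV_append lcV_smul)
  finally show ?case .
qed

text \<open>
  \<open>tg g u\<close> is the action of the generator \<open>g\<close> on the word \<open>u\<close>, and \<open>TV g\<close> its action on functions.
\<close>

primrec dE :: "nat \<Rightarrow> nat list \<Rightarrow> 'k combination"
  where "dE i [] = []"
  | "dE i (j # u) = map (\<lambda>(a, w). (a, j # w)) (dE i u) @ (if i = j then [(cc i (cont u), u)] else [])"

fun tg :: "generator \<Rightarrow> nat list \<Rightarrow> 'k combination"
  where "tg (GenF j) u = [(1, j # u)]"
  | "tg (GenE i) u = dE i u"
  | "tg g u = [(ev g * tau g (- cont u), u)]"

fun TV :: "generator \<Rightarrow> (nat list \<Rightarrow> 'k) \<Rightarrow> nat list \<Rightarrow> 'k"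
  where "TV (GenF j) f = W.mF j f"
  | "TV (GenE i) f = W.mE i f"
  | "TV g f = (\<lambda>w. ev g * tau g (- cont w) * f w)"

lemma ok_map_Cons: "j \<in> {1..N} \<Longrightarrow> ok (map (\<lambda>(a, w). (a, j # w)) xs) \<longleftrightarrow> ok xs"
  by (induction xs) (auto simp: ok_def)

lemma ok_dE: "set u \<subseteq> {1..N} \<Longrightarrow> ok (dE i u)"
  by (induction u) (auto simp: ok_map_Cons simp del: atLeastAtMost_iff)

lemma actF_lcM: "\<lbrakk>j \<in> {1..N}; ok xs\<rbrakk> \<Longrightarrow> actw [GenF j] (lcM xs) = lcM (map (\<lambda>(a, w). (a, j # w)) xs)"
  by (induction xs)
    (auto simp: act_distrib act_commute fM_Cons FA_monomial simp del: atLeastAtMost_iff)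

lemma actE_fM: "\<lbrakk>i \<in> {1..N}; set u \<subseteq> {1..N}\<rbrakk> \<Longrightarrow> actw [GenE i] (fM u) = lcM (dE i u)"
proof (induction u)
  case Nil
  then show ?case using E_v[of i] by simp
next
  case (Cons j u)
  then have j: "j \<in> {1..N}" and u: "set u \<subseteq> {1..N}" by auto
  have "actw [GenE i] (fM (j # u)) = lcM (map (\<lambda>(a, w). (a, j # w)) (dE i u)) \<oplus>\<^bsub>M\<^esub>
      (if i = j then sc (cc i (cont u)) (fM u) else \<zero>\<^bsub>M\<^esub>)"
    unfolding E_fM[OF Cons.prems] Cons.IH[OF Cons.prems(1) u] actF_lcM[OF j ok_dE[OF u]] ..
  then show ?case
    using u ok_dE[OF u] ok_map_Cons[OF j, of "dE i u"] by (auto simp: lcM_append)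
qed

lemma tg_M: "\<lbrakk>g \<in> generators N; set u \<subseteq> {1..N}\<rbrakk> \<Longrightarrow> actw [g] (fM u) = lcM (tg g u) \<and> ok (tg g u)"
proof (cases g)
  case (GenF j)
  assume "g \<in> generators N" "set u \<subseteq> {1..N}"
  then show ?thesis using GenF fM_Cons[of j u] fM_in[of "j # u"] by (simp del: fM_in)
next
  case (GenE i)
  assume "g \<in> generators N" "set u \<subseteq> {1..N}"
  then show ?thesis using GenE actE_fM ok_dE by simp
next
  case (GenK a)
  assume "g \<in> generators N" "set u \<subseteq> {1..N}"
  then show ?thesis using GenK torus_fM[of g u] by (simp add: torus_def)
next
  case (GenL a)
  assume "g \<in> generators N" "set u \<subseteq> {1..N}"
  then show ?thesis using GenL torus_fM[of g u] by (simp add: torus_def)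
qed

lemma fword_supp: "\<lbrakk>set u \<subseteq> {1..N}; W.fword u w \<noteq> 0\<rbrakk> \<Longrightarrow> cont w = cont u \<and> set w \<subseteq> {1..N}"
  using W.member_supported W.fword_in_Lm[of u] unfolding W.Lm_def W.supported_def W_content by fastforce

lemma mF_lcV: "W.mF j (lcV xs) = lcV (map (\<lambda>(a, w). (a, j # w)) xs)"
proof (induction xs)
  case Nil
  show ?case using W.mF_zero[of j] by (simp add: zero_fun_def)
next
  case (Cons x xs)
  obtain a u where x: "x = (a, u)" by force
  have "lcV (x # xs) = fscale a (W.fword u) + lcV xs" by (simp add: x fscale_def plus_fun_def)
  then have "W.mF j (lcV (x # xs)) = fscale a (W.fword (j # u)) + W.mF j (lcV xs)"
    by (simp only: W.mF_add W.mF_scale W.fword_simps)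
  then show ?case unfolding Cons by (simp add: x fscale_def plus_fun_def)
qed

lemma dE_V: "\<lbrakk>i \<in> {1..N}; set u \<subseteq> {1..N}\<rbrakk> \<Longrightarrow> W.mE i (W.fword u) = lcV (dE i u)"
proof (induction u)
  case Nil
  show ?case using W.mE_\<delta>[of i] by (simp add: zero_fun_def)
next
  case (Cons j u)
  then have j: "j \<in> {1..N}" and u: "set u \<subseteq> {1..N}" by auto
  have "W.supported (- cont u) (W.fword u)"
    using W.member_supported W.fword_in_Lm[OF u] unfolding W.Lm_def W_content by blast
  from W.mE_mF[OF this, of i j]
  have "W.mE i (W.fword (j # u)) = W.mF j (lcV (dE i u)) + (if i = j then fscale (cc i (cont u)) (W.fword u) else 0)"
    unfolding W.fword_simps Cons.IH[OF Cons.prems(1) u] cc_eq[OF Cons.prems(1) u] .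
  then show ?case
    unfolding mF_lcV by (auto simp: lcV_append fscale_def plus_fun_def zero_fun_def)
qed

lemma TV_linear: "TV g (\<lambda>w. f w + h w) = (\<lambda>w. TV g f w + TV g h w)" "TV g (fscale a f) = fscale a (TV g f)"
proof -
  show "TV g (\<lambda>w. f w + h w) = (\<lambda>w. TV g f w + TV g h w)"
    using W.mF_add[of _ f h] W.mE_add[of _ f h] by (cases g) (auto simp: plus_fun_def algebra_simps)
  show "TV g (fscale a f) = fscale a (TV g f)"
    by (cases g) (auto simp: W.mF_scale W.mE_scale, auto simp: fscale_def)
qed

lemma tg_V: "\<lbrakk>g \<in> generators N; set u \<subseteq> {1..N}\<rbrakk> \<Longrightarrow> TV g (W.fword u) = lcV (tg g u)"
proof (cases g)
  case (GenK a)
  assume "g \<in> generators N" "set u \<subseteq> {1..N}"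
  then show ?thesis using GenK fword_supp[of u] by (fastforce simp: fun_eq_iff)
next
  case (GenL a)
  assume "g \<in> generators N" "set u \<subseteq> {1..N}"
  then show ?thesis using GenL fword_supp[of u] by (fastforce simp: fun_eq_iff)
qed (simp_all add: dE_V)

lemma TV_zero: "TV g (\<lambda>_. 0) = (\<lambda>_. 0)"
  using TV_linear(2)[of g 0 "\<lambda>_. 0"] by (simp add: zero_fun_def)

text \<open>Generators act on words by the same coefficients in the Verma module and on functions,
  up to the torus, which acts on functions through \<open>TV\<close>. A combination with zero
  function is therefore mapped to one with zero function; this will make the radical a
  submodule.\<close>

lemma act_combination:
  assumes "p \<in> carrier \<A>" "ok xs"
  shows "\<exists>ys. ok ys \<and> act p (lcM xs) = lcM ys \<and> (lcV xs = (\<lambda>_. 0) \<longrightarrow> lcV ys = (\<lambda>_. 0))"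
  using assms(1)
proof (induction rule: FA_induct)
  case zero
  then show ?case using assms(2) by (intro exI[of _ "[]"]) simp
next
  case (add p q)
  then obtain ys zs where "ok ys \<and> act p (lcM xs) = lcM ys \<and> (lcV xs = (\<lambda>_. 0) \<longrightarrow> lcV ys = (\<lambda>_. 0))"
    "ok zs \<and> act q (lcM xs) = lcM zs \<and> (lcV xs = (\<lambda>_. 0) \<longrightarrow> lcV zs = (\<lambda>_. 0))" by blast
  then show ?case
    using add assms(2) by (intro exI[of _ "ys @ zs"]) (simp add: act_add lcM_append lcV_append)
next
  case (monomial c u)
  have "\<exists>ys. ok ys \<and> actw u (lcM xs) = lcM ys \<and> (lcV xs = (\<lambda>_. 0) \<longrightarrow> lcV ys = (\<lambda>_. 0))"
    using monomial
  proof (induction u)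
    case Nil
    then show ?case using assms(2) by (intro exI[of _ xs]) simp
  next
    case (Cons g u)
    then obtain ys where ys: "ok ys" "actw u (lcM xs) = lcM ys" "lcV xs = (\<lambda>_. 0) \<longrightarrow> lcV ys = (\<lambda>_. 0)" by auto
    have g: "g \<in> generators N" using Cons.prems by simp
    have "actw (g # u) (lcM xs) = actw [g] (lcM ys)"
      using actw_append[of "[g]" u "lcM xs"] Cons.prems assms(2) ys(2) by simp
    also have "\<dots> = lcM (ext (tg g) ys)"
      using g ys(1) tg_M[OF g] by (intro lcM_ext FA_monomial) auto
    finally have "actw (g # u) (lcM xs) = lcM (ext (tg g) ys)" .
    moreover have "ok (ext (tg g) ys)" using tg_M[OF g] ys(1) by (intro ok_ext) auto
    moreover have "lcV (ext (tg g) ys) = TV g (lcV ys)"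
      using lcV_ext[of "TV g" "tg g" ys] TV_linear tg_V[OF g] ys(1) by simp
    ultimately show ?case using ys(3) TV_zero by (intro exI[of _ "ext (tg g) ys"]) auto
  qed
  then obtain ys where "ok ys" "actw u (lcM xs) = lcM ys" "lcV xs = (\<lambda>_. 0) \<longrightarrow> lcV ys = (\<lambda>_. 0)" by blast
  then show ?case
    using monomial assms(2)
    by (intro exI[of _ "smul c ys"]) (simp add: act_mult FA_monomial lcM_smul lcV_smul fscale_def)
qed

lemma carrier_M_combination: "x \<in> carrier M \<Longrightarrow> \<exists>xs. ok xs \<and> x = lcM xs"
proof -
  assume "x \<in> carrier M"
  then obtain p where "p \<in> carrier \<A>" "x = act p v" unfolding carrier_M by blast
  moreover have "lcM [(1, [])] = v" using v_in by simp
  ultimately show ?thesis using act_combination[of p "[(1, [])]"] by auto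
qed

lemma submodule_act: "\<lbrakk>submodule S Uq M; p \<in> carrier \<A>; x \<in> S\<rbrakk> \<Longrightarrow> act p x \<in> S"
  unfolding act_def by (rule submodule_smult[OF _ rho_in])

lemma torus_separates:
  assumes "\<beta> \<in> Lt" "\<gamma> \<in> Lt" "\<beta> \<noteq> \<gamma>"
  shows "\<exists>g. torus g \<and> ev g * tau g (- \<beta>) \<noteq> ev g * tau g (- \<gamma>)"
proof -
  obtain i where i: "i \<in> {1..N}" "\<chi> (\<alpha>\<^sub>s i) (- \<beta>) \<noteq> \<chi> (\<alpha>\<^sub>s i) (- \<gamma>) \<or> \<chi> \<beta> (\<alpha>\<^sub>s i) \<noteq> \<chi> \<gamma> (\<alpha>\<^sub>s i)"
    using separated[OF assms] by blast
  have torus: "torus (GenK (\<alpha>\<^sub>s i))" "torus (GenL (\<alpha>\<^sub>s i))"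
    using i(1) by (auto simp: torus_def simp del: atLeastAtMost_iff)
  have ev: "ev (GenK (\<alpha>\<^sub>s i)) \<noteq> 0" "ev (GenL (\<alpha>\<^sub>s i)) \<noteq> 0"
    using i(1) ev_nonzero[of "\<alpha>\<^sub>s i"] by (simp_all del: atLeastAtMost_iff)
  from i(2) show ?thesis
  proof
    assume "\<chi> (\<alpha>\<^sub>s i) (- \<beta>) \<noteq> \<chi> (\<alpha>\<^sub>s i) (- \<gamma>)"
    then show ?thesis using torus(1) ev(1) by (intro exI[of _ "GenK (\<alpha>\<^sub>s i)"]) simp
  next
    assume "\<chi> \<beta> (\<alpha>\<^sub>s i) \<noteq> \<chi> \<gamma> (\<alpha>\<^sub>s i)"
    then show ?thesis using torus(2) ev(2) by (intro exI[of _ "GenL (\<alpha>\<^sub>s i)"]) simp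
  qed
qed

text \<open>Lagrange interpolation in the torus: for each weight in \<open>D\<close> choose a
  generator g that separates it from \<beta>, and multiply the factors (g - e \<gamma>) / (e \<beta>
  - e \<gamma>).\<close>

lemma weight_projection:
  assumes "finite D" "D \<subseteq> Lt" "\<beta> \<in> Lt" "\<beta> \<notin> D"
  shows "\<exists>p\<in>carrier \<A>. \<forall>u. set u \<subseteq> {1..N} \<longrightarrow>
    (cont u \<in> D \<longrightarrow> act p (fM u) = \<zero>\<^bsub>M\<^esub>) \<and> (cont u = \<beta> \<longrightarrow> act p (fM u) = fM u)"
  using assms
proof (induction D rule: finite_induct)
  case empty
  show ?case by (intro bexI[of _ 1]) auto
next
  case (insert \<gamma> D)
  then obtain p where p: "p \<in> carrier \<A>" "\<And>u. \<lbrakk>set u \<subseteq> {1..N}; cont u \<in> D\<rbrakk> \<Longrightarrow> act p (fM u) = \<zero>\<^bsub>M\<^esub>"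
    "\<And>u. \<lbrakk>set u \<subseteq> {1..N}; cont u = \<beta>\<rbrakk> \<Longrightarrow> act p (fM u) = fM u" by auto
  have "\<gamma> \<in> Lt" "\<beta> \<noteq> \<gamma>" using insert.prems by auto
  from torus_separates[OF \<open>\<beta> \<in> Lt\<close> this]
  obtain g where g: "torus g" "ev g * tau g (- \<beta>) \<noteq> ev g * tau g (- \<gamma>)" by blast
  define e where "e b = ev g * tau g (- b)" for b
  define q where "q = const (inverse (e \<beta> - e \<gamma>)) * (monomial [g] + const (- e \<gamma>))"
  have mg: "monomial [g] \<in> carrier \<A>" using torus_generator[OF g(1)] by (intro FA_monomial) simp
  have q_in: "q \<in> carrier \<A>" unfolding q_def by (intro FA_mult FA_add FA_const mg)
  have q: "act q (fM u) = sc ((e (cont u) - e \<gamma>) / (e \<beta> - e \<gamma>)) (fM u)" if u: "set u \<subseteq> {1..N}" for u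
  proof -
    have "act (monomial [g] + const (- e \<gamma>)) (fM u) = sc (e (cont u)) (fM u) \<oplus>\<^bsub>M\<^esub> sc (- e \<gamma>) (fM u)"
      using act_add[OF mg FA_const fM_in[OF u]] torus_fM[OF g(1) u] by (simp add: e_def)
    also have "\<dots> = sc (e (cont u) - e \<gamma>) (fM u)"
      using sc_add[of "fM u" "e (cont u)" "- e \<gamma>"] u by simp
    finally have "act q (fM u) = sc (inverse (e \<beta> - e \<gamma>)) (sc (e (cont u) - e \<gamma>) (fM u))"
      unfolding q_def using act_mult[OF FA_const FA_add[OF mg FA_const] fM_in[OF u]] by simp
    then show ?thesis using u by (simp add: sc_sc field_simps)
  qed
  have e_ne: "e \<beta> \<noteq> e \<gamma>" using g(2) by (simp add: e_def)
  have pq: "act (p * q) (fM u) = sc ((e (cont u) - e \<gamma>) / (e \<beta> - e \<gamma>)) (act p (fM u))" if u: "set u \<subseteq> {1..N}" for u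
    using act_mult[OF p(1) q_in fM_in[OF u]] q[OF u] act_commute[OF p(1) fM_in[OF u]] by simp
  show ?case
  proof (intro bexI[of _ "p * q"] allI impI conjI FA_mult p(1) q_in)
    fix u assume u: "set u \<subseteq> {1..N}"
    show "act (p * q) (fM u) = \<zero>\<^bsub>M\<^esub>" if c: "cont u \<in> insert \<gamma> D"
    proof (cases "cont u = \<gamma>")
      case True
      then show ?thesis unfolding pq[OF u] using p(1) u by simp
    next
      case False
      then show ?thesis unfolding pq[OF u] using c p(2)[OF u] FA_const by simp
    qed
    show "act (p * q) (fM u) = fM u" if c: "cont u = \<beta>"
      unfolding pq[OF u] p(3)[OF u c] using c e_ne u by simp
  qed
qed

text \<open>The projection onto a weight is the action of an element of the algebra, so submodules
  contain the homogeneous parts of their elements.\<close>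

lemma submodule_homogeneous:
  assumes S: "submodule S Uq M" and xs: "ok xs" "lcM xs \<in> S" and \<beta>: "\<beta> \<in> Lt"
  shows "lcM (filter (\<lambda>p. cont (snd p) = \<beta>) xs) \<in> S"
proof -
  let ?D = "(\<lambda>p. cont (snd p)) ` set xs - {\<beta>}"
  have "?D \<subseteq> Lt" using xs(1) cont_in by (auto simp: ok_def)
  then obtain p where p: "p \<in> carrier \<A>" "\<And>u. \<lbrakk>set u \<subseteq> {1..N}; cont u \<in> ?D\<rbrakk> \<Longrightarrow> act p (fM u) = \<zero>\<^bsub>M\<^esub>"
    "\<And>u. \<lbrakk>set u \<subseteq> {1..N}; cont u = \<beta>\<rbrakk> \<Longrightarrow> act p (fM u) = fM u"
    using weight_projection[of ?D \<beta>] \<beta> by auto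
  have "act p (lcM ys) = lcM (filter (\<lambda>p. cont (snd p) = \<beta>) ys)" if "ok ys" "set ys \<subseteq> set xs" for ys
    using that
  proof (induction ys)
    case Nil
    then show ?case using p(1) by simp
  next
    case (Cons y ys)
    obtain a u where y: "y = (a, u)" by force
    have u: "set u \<subseteq> {1..N}" and ys: "ok ys" using Cons.prems y by auto
    have "act p (lcM (y # ys)) = sc a (act p (fM u)) \<oplus>\<^bsub>M\<^esub> act p (lcM ys)"
      using p(1) u ys by (simp add: y act_distrib act_commute)
    moreover have "cont u \<noteq> \<beta> \<Longrightarrow> cont u \<in> ?D" using Cons.prems(2) y by force
    ultimately show ?case
      using Cons p(2,3)[OF u] ys u by (cases "cont u = \<beta>") (auto simp: y ok_filter)
  qed
  from this[of xs] submodule_act[OF S p(1) xs(2)] xs(1) show ?thesis by simp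
qed

lemma lcV_support: "\<lbrakk>ok xs; lcV xs w \<noteq> 0\<rbrakk> \<Longrightarrow> set w \<subseteq> {1..N} \<and> (\<exists>p\<in>set xs. cont (snd p) = cont w)"
proof (induction xs)
  case (Cons x xs)
  then show ?case using fword_supp[of "snd x" w] by (cases "W.fword (snd x) w = 0") auto
qed simp

lemma lcV_filter: "ok xs \<Longrightarrow> lcV (filter (\<lambda>p. cont (snd p) = \<beta>) xs) w = (if cont w = \<beta> then lcV xs w else 0)"
proof (induction xs)
  case (Cons x xs)
  then show ?case using fword_supp[of "snd x" w] by (cases "W.fword (snd x) w = 0") auto
qed simp

lemma cont_dE: "p \<in> set (dE i u) \<Longrightarrow> cont (snd p) = cont u - \<alpha>\<^sub>s i"
proof (induction u arbitrary: p)
  case (Cons j u)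
  show ?case
  proof (cases "p \<in> (\<lambda>(a, w). (a, j # w)) ` set (dE i u)")
    case True
    then obtain a w where "p = (a, j # w)" "(a, w) \<in> set (dE i u)" by auto
    then show ?thesis using Cons.IH[of "(a, w)"] by (simp add: algebra_simps)
  next
    case False
    then show ?thesis using Cons.prems by (auto split: if_splits)
  qed
qed simp

lemma cont_ext: "\<lbrakk>\<forall>p\<in>set xs. cont (snd p) = \<beta>; p \<in> set (ext (dE i) xs)\<rbrakk> \<Longrightarrow> cont (snd p) = \<beta> - \<alpha>\<^sub>s i"
proof -
  assume xs: "\<forall>p\<in>set xs. cont (snd p) = \<beta>" and p: "p \<in> set (ext (dE i) xs)"
  then obtain x y where x: "x \<in> set xs" "y \<in> set (dE i (snd x))" "snd p = snd y"
    by (force simp: ext_def smul_def)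
  then show ?thesis using cont_dE[of y i "snd x"] xs by simp
qed

lemma cont_eq_0: "set u \<subseteq> {1..N} \<Longrightarrow> cont u = 0 \<Longrightarrow> u = []"
proof (rule ccontr)
  assume u: "set u \<subseteq> {1..N}" "cont u = 0" "u \<noteq> []"
  then obtain i w where iw: "u = i # w" by (cases u) auto
  have nn: "0 \<le> Poly_Mapping.lookup (cont w) i" for w
    by (induction w) (auto simp: lookup_add simple_root_def lookup_single when_def)
  have "Poly_Mapping.lookup (cont u) i = 1 + Poly_Mapping.lookup (cont w) i"
    by (simp add: iw lookup_add simple_root_def)
  then show False using u(2) nn[of w] by simp
qed

text \<open>
  For a word \<open>w\<close> of the same content, the product of the \<open>E\<^sub>i\<close> along \<open>w\<close> maps the combination to the multiple
  \<open>lcV xs w\<close> of \<open>v\<close>.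
\<close>

lemma homogeneous_pairing:
  assumes S: "submodule S Uq M" and v: "v \<notin> S"
  shows "\<lbrakk>set w \<subseteq> {1..N}; ok xs; \<forall>p\<in>set xs. cont (snd p) = cont w; lcM xs \<in> S\<rbrakk> \<Longrightarrow> lcV xs w = 0"
proof (induction w arbitrary: xs)
  case Nil
  have "\<exists>s. lcM ys = sc s v \<and> lcV ys [] = s" if "ok ys" "\<forall>p\<in>set ys. cont (snd p) = 0" for ys
    using that
  proof (induction ys)
    case Nil
    show ?case using v_in by (intro exI[of _ 0]) simp
  next
    case (Cons y ys)
    then obtain s where s: "lcM ys = sc s v" "lcV ys [] = s" by auto
    have "snd y = []" using cont_eq_0[of "snd y"] Cons.prems by simp
    then show ?case
      using s v_in by (intro exI[of _ "fst y + s"]) (simp add: sc_add W.\<delta>_def)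
  qed
  from this[of xs] Nil obtain s where s: "lcM xs = sc s v" "lcV xs [] = s" by auto
  show ?case
  proof (rule ccontr)
    assume "lcV xs [] \<noteq> 0"
    then have "sc (inverse s) (lcM xs) = v" using s v_in by (simp add: sc_sc)
    then show False using submodule_act[OF S FA_const Nil(4)] v by metis
  qed
next
  case (Cons i w)
  have i: "i \<in> {1..N}" and w: "set w \<subseteq> {1..N}" using Cons.prems(1) by auto
  let ?ys = "ext (dE i) xs"
  have ok: "ok ?ys" using ok_ext[of "dE i" xs] ok_dE Cons.prems(2) by blast
  have "lcM ?ys = actw [GenE i] (lcM xs)"
    using lcM_ext[of "monomial [GenE i]" "dE i" xs] actE_fM[OF i] ok_dE Cons.prems(2) i
    by (simp add: FA_monomial del: atLeastAtMost_iff)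
  then have "lcM ?ys \<in> S"
    using submodule_act[OF S _ Cons.prems(4), of "monomial [GenE i]"] i by (simp add: FA_monomial del: atLeastAtMost_iff)
  moreover have "\<forall>p\<in>set ?ys. cont (snd p) = cont w"
    using cont_ext[OF Cons.prems(3)] by fastforce
  ultimately have "lcV ?ys w = 0" by (intro Cons.IH w ok)
  moreover have "lcV ?ys = W.mE i (lcV xs)"
    using lcV_ext[of "W.mE i" "dE i" xs] dE_V[OF i] Cons.prems(2) W.mE_scale W.mE_add
    by (simp add: plus_fun_def)
  ultimately show ?case by (simp add: W.mE_def)
qed

text \<open>The pairing is available for homogeneous combinations; a nonzero value at
  \<open>w\<close> is already seen by the part having the content of \<open>w\<close>, and that part
  stays in \<open>S\<close>. Applied to the zero submodule, this also shows that equal vectors have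
  equal functions.\<close>

lemma proper_submodule_lcV:
  assumes S: "submodule S Uq M" and v: "v \<notin> S" and xs: "ok xs" "lcM xs \<in> S"
  shows "lcV xs = (\<lambda>_. 0)"
proof (rule ext, rule ccontr)
  fix w assume nz: "lcV xs w \<noteq> 0"
  from lcV_support[OF xs(1) this] have w: "set w \<subseteq> {1..N}" by simp
  let ?ys = "filter (\<lambda>p. cont (snd p) = cont w) xs"
  have "lcV ?ys w = 0"
    by (rule homogeneous_pairing[OF S v w ok_filter[OF xs(1)] _ submodule_homogeneous[OF S xs cont_in[OF w]]]) simp
  then show False using lcV_filter[OF xs(1)] nz by simp
qed

end

lemma generated_subalgebra_mult:
  "\<lbrakk>x \<in> generated_subalgebra A S; y \<in> generated_subalgebra A S\<rbrakk> \<Longrightarrow> x \<otimes>\<^bsub>A\<^esub> y \<in> generated_subalgebra A S"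
  unfolding generated_subalgebra_def hull_def
  by (auto intro: submonoid.m_closed[OF subring.axioms(2)])

lemma generated_subalgebra_one: "\<one>\<^bsub>A\<^esub> \<in> generated_subalgebra A S"
  unfolding generated_subalgebra_def hull_def
  by (auto intro: submonoid.one_closed[OF subring.axioms(2)])

lemma generated_subalgebra_zero: "\<zero>\<^bsub>A\<^esub> \<in> generated_subalgebra A S"
  unfolding generated_subalgebra_def hull_def by (auto intro: submodule_zero)

lemma generated_subalgebra_combination:
  fixes A :: "('k::field, 'a) module"
  assumes "x \<in> generated_subalgebra A S" "y \<in> generated_subalgebra A S"
  shows "a \<odot>\<^bsub>A\<^esub> x \<oplus>\<^bsub>A\<^esub> y \<in> generated_subalgebra A S"
  using assms unfolding generated_subalgebra_def hull_def
  by (auto intro!: submodule_add submodule_smult[of _ scalars])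

lemma linear_span_combination:
  fixes A :: "('k::field, 'a) module"
  assumes "x \<in> linear_span A S" "y \<in> linear_span A S"
  shows "a \<odot>\<^bsub>A\<^esub> x \<oplus>\<^bsub>A\<^esub> y \<in> linear_span A S"
  using assms unfolding linear_span_def hull_def
  by (auto intro!: submodule_add submodule_smult[of _ scalars])

section \<open>The radical of the pairing as maximal graded submodule\<close>

context separated_verma
begin

text \<open>The kernel of the passage from the Verma module to functions on words.\<close>

definition radical :: "'m set"
  where "radical = {lcM xs | xs. ok xs \<and> lcV xs = (\<lambda>_. 0)}"

lemma radical_subset: "radical \<subseteq> carrier M"
  unfolding radical_def by auto

lemma radical_add: "\<lbrakk>x \<in> radical; y \<in> radical\<rbrakk> \<Longrightarrow> x \<oplus>\<^bsub>M\<^esub> y \<in> radical"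
proof -
  assume "x \<in> radical" "y \<in> radical"
  then obtain xs ys where "ok xs" "lcV xs = (\<lambda>_. 0)" "x = lcM xs" "ok ys" "lcV ys = (\<lambda>_. 0)" "y = lcM ys"
    unfolding radical_def by blast
  then have "x \<oplus>\<^bsub>M\<^esub> y = lcM (xs @ ys)" "ok (xs @ ys)" "lcV (xs @ ys) = (\<lambda>_. 0)"
    by (simp_all add: lcM_append lcV_append)
  then show ?thesis unfolding radical_def by blast
qed

lemma radical_act: "\<lbrakk>p \<in> carrier \<A>; x \<in> radical\<rbrakk> \<Longrightarrow> act p x \<in> radical"
  unfolding radical_def using act_combination by blast

lemma radical_uminus: "x \<in> radical \<Longrightarrow> \<ominus>\<^bsub>M\<^esub> x \<in> radical"
  using radical_act[OF FA_const, of x "- 1"] radical_subset by (auto simp: sc_uminus)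

lemma radical_zero: "\<zero>\<^bsub>M\<^esub> \<in> radical"
  unfolding radical_def by (intro CollectI exI[of _ "[]"]) simp

lemma radical_submodule: "submodule radical Uq M"
  by (intro submodule.intro subgroup.intro submodule_axioms.intro)
    (use radical_subset radical_add radical_zero radical_uminus radical_act in
      \<open>auto simp: a_inv_def carrier_U act_def\<close>)

lemma zero_submodule: "submodule {\<zero>\<^bsub>M\<^esub>} Uq M"
proof (intro submodule.intro subgroup.intro submodule_axioms.intro)
  show "inv\<^bsub>add_monoid M\<^esub> x \<in> {\<zero>\<^bsub>M\<^esub>}" if "x \<in> {\<zero>\<^bsub>M\<^esub>}" for x
    using that LM.M.add.inv_one by simp
  show "u \<odot>\<^bsub>M\<^esub> x \<in> {\<zero>\<^bsub>M\<^esub>}" if "u \<in> carrier Uq" "x \<in> {\<zero>\<^bsub>M\<^esub>}" for u x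
    using that act_zero unfolding carrier_U act_def by auto
qed simp_all

text \<open>A combination equal to \<open>v\<close> with zero function would differ from the empty
  word by a representation of zero, whose function vanishes by \<open>proper_submodule_lcV\<close>
  for the zero submodule; but the empty word has function \<open>\<delta>\<close>.\<close>

lemma v_notin_radical: "v \<notin> radical"
proof
  assume "v \<in> radical"
  then obtain xs where xs: "ok xs" "lcV xs = (\<lambda>_. 0)" "v = lcM xs" unfolding radical_def by blast
  let ?ys = "(1, []) # smul (- 1) xs"
  have "lcM ?ys = v \<oplus>\<^bsub>M\<^esub> \<ominus>\<^bsub>M\<^esub> v"
    using xs v_in by (simp add: lcM_smul sc_uminus)
  then have "lcM ?ys \<in> {\<zero>\<^bsub>M\<^esub>}" using v_in LM.M.r_neg by simp
  moreover have "ok ?ys" using xs by simp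
  ultimately have "lcV ?ys = (\<lambda>_. 0)"
    using v_nz by (intro proper_submodule_lcV[OF zero_submodule]) simp_all
  then have "lcV ?ys [] = 0" by simp
  then show False using xs(2) by (simp add: lcV_smul fscale_def W.\<delta>_def)
qed

text \<open>The grading is defined through elements of the minus part of given degree, so the
  combination is lifted to one free element whose class lies in both subspaces.\<close>

lemma lcM_in_verma_degree:
  assumes "ok xs" "\<forall>p\<in>set xs. cont (snd p) = \<beta>"
  shows "lcM xs \<in> verma_degree N \<chi> M v (- \<beta>)"
proof -
  have "\<exists>p\<in>carrier \<A>. act p v = lcM xs \<and> cls p \<in> Utilde_minus N \<chi> \<inter> Utilde_degree N \<chi> (- \<beta>)"
    using assms
  proof (induction xs)
    case Nil
    have "cls 0 \<in> Utilde_minus N \<chi>"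
      using generated_subalgebra_zero unfolding Utilde_minus_def cls_zero[symmetric] .
    moreover have "cls 0 \<in> Utilde_degree N \<chi> (- \<beta>)"
      unfolding Utilde_degree_def linear_span_def hull_def cls_zero[symmetric] by (auto intro: submodule_zero)
    ultimately show ?case using v_in by (intro bexI[of _ 0]) simp_all
  next
    case (Cons x xs)
    obtain a u where x: "x = (a, u)" by force
    have u: "set u \<subseteq> {1..N}" "cont u = \<beta>" using Cons.prems x by auto
    obtain p where p: "p \<in> carrier \<A>" "act p v = lcM xs" "cls p \<in> Utilde_minus N \<chi>" "cls p \<in> Utilde_degree N \<chi> (- \<beta>)"
      using Cons by auto
    let ?m = "monomial (map GenF u) :: 'k free"
    have gens: "set (map GenF u) \<subseteq> generators N" using u(1) by auto
    have m: "?m \<in> carrier \<A>" by (rule FA_monomial[OF gens])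
    have cls_eq: "cls (const a * ?m + p) = a \<odot>\<^bsub>Ut\<^esub> cls ?m \<oplus>\<^bsub>Ut\<^esub> cls p"
      using m p(1) by (simp add: cls_smult cls_add FA_mult)
    have word: "cls (monomial (map GenF u)) \<in> Utilde_minus N \<chi>" if "set u \<subseteq> {1..N}" for u
      using that
    proof (induction u)
      case Nil
      show ?case
        using generated_subalgebra_one unfolding Utilde_minus_def by (simp add: monomial_Nil cls_one[symmetric])
    next
      case (Cons j u)
      have j: "GenF j \<in> generators N" and u: "set (map GenF u) \<subseteq> generators N" using Cons.prems by auto
      have "cls (monomial [GenF j]) \<in> Utilde_minus N \<chi>"
        unfolding Utilde_minus_def generated_subalgebra_def
        by (rule hull_inc) (use Cons.prems in \<open>auto simp: tF_def tilde_class_eq\<close>)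
      moreover have "cls (monomial (map GenF (j # u))) = cls (monomial [GenF j]) \<otimes>\<^bsub>Ut\<^esub> cls (monomial (map GenF u))"
        using cls_mult[OF FA_monomial[of "[GenF j]"] FA_monomial[OF u]] j by (simp add: monomial_mult)
      moreover have "cls (monomial (map GenF u)) \<in> Utilde_minus N \<chi>" using Cons by simp
      ultimately show ?case
        unfolding Utilde_minus_def by (simp only: generated_subalgebra_mult)
    qed
    have "cls ?m \<in> Utilde_degree N \<chi> (- \<beta>)"
      unfolding Utilde_degree_def tilde_class_eq[symmetric]
      by (rule subsetD[OF linear_span_superset]) (use gens degree_Fword[of u] u(2) in \<open>auto intro!: exI[of _ "map GenF u"]\<close>)
    with word[OF u(1)] p(3,4) have "a \<odot>\<^bsub>Ut\<^esub> cls ?m \<oplus>\<^bsub>Ut\<^esub> cls p \<in> Utilde_minus N \<chi> \<inter> Utilde_degree N \<chi> (- \<beta>)"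
      unfolding Utilde_minus_def Utilde_degree_def
      by (intro IntI generated_subalgebra_combination linear_span_combination)
    moreover have "act (const a * ?m + p) v = lcM (x # xs)"
      using m p v_in by (simp add: x act_add act_mult FA_mult fM_def)
    ultimately show ?case
      unfolding cls_eq[symmetric] using m p(1) by (intro bexI[of _ "const a * ?m + p"]) (simp_all add: FA_add FA_mult)
  qed
  then obtain p where p: "act p v = lcM xs" "cls p \<in> Utilde_minus N \<chi>" "cls p \<in> Utilde_degree N \<chi> (- \<beta>)" by blast
  then have "rho p \<in> U_minus N \<chi> \<inter> U_degree N \<chi> (- \<beta>)" by (simp add: rho_def U_minus_def U_degree_def)
  then show ?thesis unfolding verma_degree_def p(1)[symmetric] act_def by (rule imageI)
qed

lemma radical_graded: "graded_submodule N \<chi> M v radical"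
  unfolding graded_submodule_def
proof (intro conjI radical_submodule equalityI)
  let ?V = "restrict_scalars Uq M"
  let ?G = "\<Union>a\<in>Lt. radical \<inter> verma_degree N \<chi> M v a"
  have V: "abelian_group ?V"
  proof (rule abelian_groupI)
    show "\<exists>y\<in>carrier ?V. y \<oplus>\<^bsub>?V\<^esub> x = \<zero>\<^bsub>?V\<^esub>" if "x \<in> carrier ?V" for x
      using that LM.M.l_neg[of x] LM.M.a_inv_closed[of x] by (auto simp: restrict_scalars_def)
  qed (simp_all add: restrict_scalars_def LM.M.a_ac)
  have "submodule radical scalars ?V"
  proof (rule submodule_scalarsI[OF V])
    show "c \<odot>\<^bsub>?V\<^esub> x \<in> radical" if "x \<in> radical" for c x
      using radical_act[OF FA_const that] unfolding restrict_smult act_def .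
    show "\<ominus>\<^bsub>?V\<^esub> x \<in> radical" if "x \<in> radical" for x
    proof -
      have "x \<in> carrier M" using that radical_subset by blast
      then have "\<ominus>\<^bsub>?V\<^esub> x = \<ominus>\<^bsub>M\<^esub> x"
        using LM.M.l_neg[of x] by (intro abelian_group.minus_equality[OF V]) (simp_all add: restrict_scalars_def)
      then show ?thesis using radical_uminus[OF that] by simp
    qed
  qed (use radical_subset radical_zero radical_add in \<open>auto simp: restrict_scalars_def\<close>)
  then show "linear_span ?V ?G \<subseteq> radical" by (rule linear_span_minimal) blast
  show "radical \<subseteq> linear_span ?V ?G"
    unfolding linear_span_def hull_def
  proof (rule Inter_greatest, clarify)
    fix W x assume W: "submodule W scalars ?V" "?G \<subseteq> W" and "x \<in> radical"
    then obtain xs where xs: "ok xs" "lcV xs = (\<lambda>_. 0)" "x = lcM xs" unfolding radical_def by blast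
    \<comment> \<open>The words with the content of the first one are split off. Their function is
      the restriction of the zero function to one content, hence zero, and the remaining combination
      is shorter.\<close>
    have "\<lbrakk>ok ys; lcV ys = (\<lambda>_. 0)\<rbrakk> \<Longrightarrow> lcM ys \<in> W" for ys
    proof (induction "length ys" arbitrary: ys rule: less_induct)
      case less
      show ?case
      proof (cases ys)
        case Nil
        then show ?thesis using submodule_zero[OF W(1)] by (simp add: restrict_scalars_def)
      next
        case (Cons y zs)
        let ?P = "\<lambda>p. cont (snd p) = cont (snd y)"
        have lt: "length (filter (\<lambda>p. \<not> ?P p) ys) < length ys"
          using length_filter_le[of "\<lambda>p. \<not> ?P p" zs] by (simp add: Cons del: length_filter_le)
        have z: "lcV (filter ?P ys) = (\<lambda>_. 0)"
          using lcV_filter[OF less.prems(1), of "cont (snd y)"] less.prems(2) by auto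
        have part: "lcM us = lcM (filter ?P us) \<oplus>\<^bsub>M\<^esub> lcM (filter (\<lambda>p. \<not> ?P p) us) \<and>
            lcV us w = lcV (filter ?P us) w + lcV (filter (\<lambda>p. \<not> ?P p) us) w" if "ok us" for us w
          using that by (induction us) (auto simp: LM.M.a_ac ok_filter)
        have "lcV (filter (\<lambda>p. \<not> ?P p) ys) = (\<lambda>_. 0)"
          using part[OF less.prems(1)] z less.prems(2) by auto
        then have rest: "lcM (filter (\<lambda>p. \<not> ?P p) ys) \<in> W"
          by (rule less.hyps[OF lt ok_filter[OF less.prems(1)]])
        have "lcM (filter ?P ys) \<in> radical"
          using z ok_filter[OF less.prems(1)] unfolding radical_def by blast
        moreover have "lcM (filter ?P ys) \<in> verma_degree N \<chi> M v (- cont (snd y))"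
          by (rule lcM_in_verma_degree) (use ok_filter[OF less.prems(1)] in auto)
        moreover have "- cont (snd y) \<in> Lt"
          using less.prems(1) cont_in[of "snd y"] Cons by simp
        ultimately have "lcM (filter ?P ys) \<in> W" using W(2) by blast
        from submodule_add[OF W(1) this rest] part[OF less.prems(1)]
        show ?thesis by (simp add: restrict_scalars_def)
      qed
    qed
    then show "x \<in> W" using xs by blast
  qed
qed

text \<open>A submodule other than the whole module misses the generator \<open>v\<close>, so all
  its elements have zero function.\<close>

lemma maximal_graded_submodule_eq: "maximal_graded_submodule N \<chi> M v = radical"
  unfolding maximal_graded_submodule_def
proof (rule Greatest_equality)
  show "graded_submodule N \<chi> M v radical \<and> radical \<noteq> carrier M"
    using radical_graded v_notin_radical v_in by blast
next
  fix S assume S: "graded_submodule N \<chi> M v S \<and> S \<noteq> carrier M"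
  then have sub: "submodule S Uq M" by (simp add: graded_submodule_def)
  have "v \<notin> S"
  proof
    assume "v \<in> S"
    then have "carrier M \<subseteq> S" unfolding carrier_M using submodule_act[OF sub] by blast
    then show False using S submodule_subset[OF sub] by blast
  qed
  show "S \<subseteq> radical"
  proof
    fix x assume x: "x \<in> S"
    then obtain xs where xs: "ok xs" "x = lcM xs"
      using carrier_M_combination submodule_subset[OF sub] by blast
    with proper_submodule_lcV[OF sub \<open>v \<notin> S\<close>] x show "x \<in> radical"
      unfolding radical_def by blast
  qed
qed

section \<open>Dimension of the irreducible quotient\<close>

abbreviation Lq :: "('k, 'm set) module"
  where "Lq \<equiv> restrict_scalars Uq (simple_quotient N \<chi> M v)"

abbreviation coset :: "'m \<Rightarrow> 'm set"
  where "coset x \<equiv> radical +>\<^bsub>M\<^esub> x"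

lemma radical_subgroup: "abelian_subgroup radical M"
proof -
  have "subgroup radical (add_monoid M)" using submodule.axioms(1)[OF radical_submodule] .
  then have "additive_subgroup radical M" by (intro additive_subgroup.intro)
  then show ?thesis by (rule abelian_subgroupI3[OF _ M_abelian])
qed

sublocale rad: abelian_subgroup radical M
  by (rule radical_subgroup)

lemma Lq_carrier: "carrier Lq = coset ` carrier M"
  by (simp add: restrict_scalars_def simple_quotient_def maximal_graded_submodule_eq quotient_simps)

lemma Lq_zero: "\<zero>\<^bsub>Lq\<^esub> = coset \<zero>\<^bsub>M\<^esub>"
  by (simp add: restrict_scalars_def simple_quotient_def maximal_graded_submodule_eq quotient_simps rad.coset_zero)

lemma Lq_add: "\<lbrakk>x \<in> carrier M; y \<in> carrier M\<rbrakk> \<Longrightarrow> coset x \<oplus>\<^bsub>Lq\<^esub> coset y = coset (x \<oplus>\<^bsub>M\<^esub> y)"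
  by (simp add: restrict_scalars_def simple_quotient_def maximal_graded_submodule_eq quotient_simps rad.a_rcos_sum)

lemma Lq_smult:
  assumes x: "x \<in> carrier M"
  shows "c \<odot>\<^bsub>Lq\<^esub> coset x = coset (sc c x)"
proof -
  have "c \<odot>\<^bsub>Lq\<^esub> coset x = (\<Union>y\<in>coset x. coset (sc c y))"
    unfolding restrict_smult simple_quotient_def maximal_graded_submodule_eq quotient_simps act_def ..
  also have "\<dots> = coset (sc c x)"
  proof (rule rad.coset_smult[OF x])
    fix y assume y: "y \<in> carrier M" "y \<ominus>\<^bsub>M\<^esub> x \<in> radical"
    have "sc c y \<ominus>\<^bsub>M\<^esub> sc c x = sc c y \<oplus>\<^bsub>M\<^esub> sc (- 1) (sc c x)"
      using x by (simp add: a_minus_def sc_uminus)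
    also have "\<dots> = sc c (y \<oplus>\<^bsub>M\<^esub> sc (- 1) x)"
      using x y by (simp add: act_distrib sc_sc)
    also have "\<dots> = sc c (y \<ominus>\<^bsub>M\<^esub> x)"
      using x by (simp add: a_minus_def sc_uminus)
    finally show "sc c y \<ominus>\<^bsub>M\<^esub> sc c x \<in> radical"
      using radical_act[OF FA_const y(2)] by simp
  qed simp
  finally show ?thesis .
qed

lemma Lq_abelian: "abelian_group Lq"
proof (rule abelian_groupI)
  show "\<exists>D\<in>carrier Lq. D \<oplus>\<^bsub>Lq\<^esub> C = \<zero>\<^bsub>Lq\<^esub>" if C: "C \<in> carrier Lq" for C
  proof -
    obtain x where x: "x \<in> carrier M" "C = coset x" using C unfolding Lq_carrier by blast
    then have "coset (\<ominus>\<^bsub>M\<^esub> x) \<oplus>\<^bsub>Lq\<^esub> C = \<zero>\<^bsub>Lq\<^esub>"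
      using LM.M.l_neg[of x] by (simp add: Lq_add Lq_zero)
    then show ?thesis using x(1) unfolding Lq_carrier by blast
  qed
  show "\<zero>\<^bsub>Lq\<^esub> \<in> carrier Lq" unfolding Lq_carrier Lq_zero by simp
  show "C \<oplus>\<^bsub>Lq\<^esub> D \<in> carrier Lq" if "C \<in> carrier Lq" "D \<in> carrier Lq" for C D
    using that unfolding Lq_carrier by (auto simp: Lq_add)
  show "C \<oplus>\<^bsub>Lq\<^esub> D \<oplus>\<^bsub>Lq\<^esub> E = C \<oplus>\<^bsub>Lq\<^esub> (D \<oplus>\<^bsub>Lq\<^esub> E)"
    if "C \<in> carrier Lq" "D \<in> carrier Lq" "E \<in> carrier Lq" for C D E
    using that unfolding Lq_carrier by (auto simp: Lq_add LM.M.a_assoc)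
  show "C \<oplus>\<^bsub>Lq\<^esub> D = D \<oplus>\<^bsub>Lq\<^esub> C" if "C \<in> carrier Lq" "D \<in> carrier Lq" for C D
    using that unfolding Lq_carrier by (auto simp: Lq_add LM.M.a_comm)
  show "\<zero>\<^bsub>Lq\<^esub> \<oplus>\<^bsub>Lq\<^esub> C = C" if "C \<in> carrier Lq" for C
    using that unfolding Lq_carrier Lq_zero by (auto simp: Lq_add)
qed

lemma Lq_submoduleI:
  assumes "W \<subseteq> carrier M" "\<zero>\<^bsub>M\<^esub> \<in> W" "\<And>x y. \<lbrakk>x \<in> W; y \<in> W\<rbrakk> \<Longrightarrow> x \<oplus>\<^bsub>M\<^esub> y \<in> W"
    and "\<And>c x. x \<in> W \<Longrightarrow> sc c x \<in> W"
  shows "submodule (coset ` W) scalars Lq"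
proof (rule submodule_scalarsI[OF Lq_abelian])
  note W = subsetD[OF assms(1)]
  show "coset ` W \<subseteq> carrier Lq" using assms(1) unfolding Lq_carrier by blast
  show "\<zero>\<^bsub>Lq\<^esub> \<in> coset ` W" using assms(2) unfolding Lq_zero by blast
  show "C \<oplus>\<^bsub>Lq\<^esub> D \<in> coset ` W" if "C \<in> coset ` W" "D \<in> coset ` W" for C D
    using that assms(3) W by (auto simp: Lq_add)
  show "c \<odot>\<^bsub>Lq\<^esub> C \<in> coset ` W" if "C \<in> coset ` W" for c C
    using that assms(4) W by (auto simp: Lq_smult)
  show "\<ominus>\<^bsub>Lq\<^esub> C \<in> coset ` W" if C: "C \<in> coset ` W" for C
  proof -
    obtain x where x: "x \<in> W" "C = coset x" using C by blast
    have "sc (- 1) x \<oplus>\<^bsub>M\<^esub> x = \<zero>\<^bsub>M\<^esub>" using W[OF x(1)] LM.M.l_neg by (simp add: sc_uminus)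
    then have "\<ominus>\<^bsub>Lq\<^esub> C = coset (sc (- 1) x)"
      using W[OF x(1)] W[OF assms(4)[OF x(1)]] x(2)
      by (intro abelian_group.minus_equality[OF Lq_abelian]) (auto simp: Lq_add Lq_zero Lq_carrier)
    then show ?thesis using assms(4)[OF x(1)] by blast
  qed
qed

text \<open>The length of a word is the height of its content, so finitely many weights leave
  finitely many words with nonzero function. Their cosets span, as the other words lie in the
  radical.\<close>

lemma finite_dimensional_if:
  assumes fin: "finite {\<mu>. W.Lm \<mu> \<noteq> {0}}"
  shows "finite_dimensional Lq"
proof -
  let ?W = "{u. set u \<subseteq> {1..N} \<and> W.fword u \<noteq> 0}"
  let ?h = "\<lambda>a. nat (\<Sum>k=1..N. Poly_Mapping.lookup a k)"
  have len: "length u = ?h (cont u)" if u: "set u \<subseteq> {1..N}" for u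
  proof -
    have "(\<Sum>k=1..N. Poly_Mapping.lookup (cont u) k) = int (length u)"
      using u
    proof (induction u)
      case (Cons i u)
      have "(\<Sum>k=1..N. Poly_Mapping.lookup (\<alpha>\<^sub>s i) k) = 1"
        using Cons.prems by (simp add: simple_root_def lookup_single when_def)
      then show ?case using Cons by (simp add: lookup_add sum.distrib)
    qed simp
    then show ?thesis by simp
  qed
  have "finite ?W"
  proof (rule finite_subset)
    let ?D = "?h ` uminus ` {\<mu>. W.Lm \<mu> \<noteq> {0}}"
    have mem: "length u \<in> ?D" if "u \<in> ?W" for u
    proof -
      have "W.Lm (- cont u) \<noteq> {0}" using that unfolding W.Lm_nonzero_iff W_content by auto
      then have "- (- cont u) \<in> uminus ` {\<mu>. W.Lm \<mu> \<noteq> {0}}" by blast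
      then have "?h (- (- cont u)) \<in> ?D" by (rule imageI)
      then show ?thesis using len[of u] that by simp
    qed
    have "finite ?D" using fin by simp
    then have "length u \<le> Max ?D" if "u \<in> ?W" for u
      using mem[OF that] by (rule Max_ge)
    then show "?W \<subseteq> {u. set u \<subseteq> {1..N} \<and> length u \<le> Max ?D}" by blast
    show "finite {u. set u \<subseteq> {1..N} \<and> length u \<le> Max ?D}"
      by (rule finite_lists_length_le) simp
  qed
  let ?B = "(\<lambda>u. coset (fM u)) ` ?W"
  have B: "?B \<subseteq> carrier Lq" unfolding Lq_carrier by auto
  have carrier_sub: "submodule (carrier Lq) scalars Lq"
    unfolding Lq_carrier by (rule Lq_submoduleI) auto
  note span = linear_span_submodule[OF Lq_abelian carrier_sub B]
  have word: "coset (fM u) \<in> linear_span Lq ?B" if u: "set u \<subseteq> {1..N}" for u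
  proof (cases "W.fword u = 0")
    case True
    have "lcM [(1, u)] \<in> radical"
      unfolding radical_def using True u by (intro CollectI exI[of _ "[(1, u)]"]) (simp add: zero_fun_def)
    then have "fM u \<in> radical" using u by simp
    then have "coset (fM u) = \<zero>\<^bsub>Lq\<^esub>"
      using u unfolding Lq_zero by (simp add: rad.coset_eq_iff a_minus_def LM.M.add.inv_one)
    then show ?thesis using submodule_zero[OF span] by (simp only:)
  next
    case False
    then show ?thesis using u by (intro subsetD[OF linear_span_superset]) blast
  qed
  have comb: "coset (lcM xs) \<in> linear_span Lq ?B" if "ok xs" for xs
    using that
  proof (induction xs)
    case Nil
    show ?case unfolding lcM.simps Lq_zero[symmetric] by (rule submodule_zero[OF span])
  next
    case (Cons x xs)
    then have "set (snd x) \<subseteq> {1..N}" "ok xs" by simp_all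
    then have "coset (lcM (x # xs)) = fst x \<odot>\<^bsub>Lq\<^esub> coset (fM (snd x)) \<oplus>\<^bsub>Lq\<^esub> coset (lcM xs)"
      by (simp add: Lq_smult Lq_add)
    then show ?case
      using Cons.IH[OF \<open>ok xs\<close>] word[OF \<open>set (snd x) \<subseteq> {1..N}\<close>] by (simp only: linear_span_combination)
  qed
  have "carrier Lq \<subseteq> linear_span Lq ?B"
  proof
    fix C assume "C \<in> carrier Lq"
    then obtain x where x: "x \<in> carrier M" "C = coset x" unfolding Lq_carrier by blast
    from carrier_M_combination[OF x(1)] obtain xs where "ok xs" "x = lcM xs" by blast
    then show "C \<in> linear_span Lq ?B" using comb[of xs] x(2) by simp
  qed
  with submodule_subset[OF span] have "linear_span Lq ?B = carrier Lq" by blast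
  then show ?thesis
    unfolding finite_dimensional_def using \<open>finite ?W\<close> B by blast
qed

text \<open>A finite spanning set involves a finite set \<open>D\<close> of contents, so every
  vector is congruent to a combination of words with content in \<open>D\<close>. A word with
  nonzero function must then have its content in \<open>D\<close>, as functions of different content
  have disjoint supports.\<close>

lemma finite_dimensional_only_if:
  assumes "finite_dimensional Lq"
  shows "finite {\<mu>. W.Lm \<mu> \<noteq> {0}}"
proof -
  obtain B where B: "finite B" "B \<subseteq> carrier Lq" "linear_span Lq B = carrier Lq"
    using assms unfolding finite_dimensional_def by blast
  have "\<forall>C\<in>B. \<exists>xs. ok xs \<and> C = coset (lcM xs)"
  proof
    fix C assume "C \<in> B"
    then obtain x where x: "x \<in> carrier M" "C = coset x" using B(2) unfolding Lq_carrier by blast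
    from carrier_M_combination[OF x(1)] obtain xs where "ok xs" "x = lcM xs" by blast
    then show "\<exists>xs. ok xs \<and> C = coset (lcM xs)" using x(2) by blast
  qed
  then obtain f where f: "\<forall>C\<in>B. ok (f C) \<and> C = coset (lcM (f C))" by (rule bchoice[THEN exE])
  define D where "D = (\<Union>C\<in>B. (\<lambda>p. cont (snd p)) ` set (f C))"
  have finD: "finite D" unfolding D_def using B(1) by simp
  define T where "T = {lcM xs | xs. ok xs \<and> (\<forall>p\<in>set xs. cont (snd p) \<in> D)}"
  have "submodule (coset ` T) scalars Lq"
  proof (rule Lq_submoduleI)
    show "T \<subseteq> carrier M" unfolding T_def by auto
    show "\<zero>\<^bsub>M\<^esub> \<in> T" unfolding T_def by (intro CollectI exI[of _ "[]"]) simp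
    show "x \<oplus>\<^bsub>M\<^esub> y \<in> T" if xy: "x \<in> T" "y \<in> T" for x y
    proof -
      obtain xs ys where "x = lcM xs" "ok xs" "\<forall>p\<in>set xs. cont (snd p) \<in> D"
        "y = lcM ys" "ok ys" "\<forall>p\<in>set ys. cont (snd p) \<in> D" using xy unfolding T_def by blast
      then show ?thesis
        unfolding T_def by (intro CollectI exI[of _ "xs @ ys"]) (auto simp: lcM_append)
    qed
    show "sc c x \<in> T" if x: "x \<in> T" for c x
    proof -
      obtain xs where "x = lcM xs" "ok xs" "\<forall>p\<in>set xs. cont (snd p) \<in> D" using x unfolding T_def by blast
      then show ?thesis
        using lcM_smul[of xs c] ok_smul[of c xs]
        unfolding T_def by (intro CollectI exI[of _ "smul c xs"]) (auto simp: smul_def[of c xs])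
    qed
  qed
  moreover have "B \<subseteq> coset ` T"
  proof
    fix C assume C: "C \<in> B"
    then have "lcM (f C) \<in> T" using f unfolding T_def D_def by blast
    then show "C \<in> coset ` T" using f C by blast
  qed
  ultimately have carrier: "carrier Lq \<subseteq> coset ` T"
    using linear_span_minimal[of "coset ` T" Lq B] unfolding B(3) by simp
  have content: "cont u \<in> D" if u: "set u \<subseteq> {1..N}" "W.fword u \<noteq> 0" for u
  proof -
    have "coset (fM u) \<in> coset ` T" using carrier u(1) unfolding Lq_carrier by auto
    then obtain xs where xs: "ok xs" "\<forall>p\<in>set xs. cont (snd p) \<in> D" "coset (fM u) = coset (lcM xs)"
      unfolding T_def by auto
    then have "fM u \<ominus>\<^bsub>M\<^esub> lcM xs \<in> radical" using u(1) by (simp add: rad.coset_eq_iff)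
    moreover have "lcM ((1, u) # smul (- 1) xs) = fM u \<ominus>\<^bsub>M\<^esub> lcM xs"
      using xs(1) u(1) by (simp add: lcM_smul sc_uminus a_minus_def)
    \<comment> \<open>The radical is itself a submodule that avoids \<open>v\<close>, so a
      difference lying in it forces equality of the functions.\<close>
    ultimately have z: "lcV ((1, u) # smul (- 1) xs) = (\<lambda>_. 0)"
      using xs(1) u(1) by (intro proper_submodule_lcV[OF radical_submodule v_notin_radical]) simp_all
    obtain w where w: "W.fword u w \<noteq> 0" using u(2) by (auto simp: fun_eq_iff)
    have "W.fword u w = lcV xs w" using fun_cong[OF z, of w] by (simp add: lcV_smul fscale_def)
    with w have "lcV xs w \<noteq> 0" by simp
    from lcV_support[OF xs(1) this] xs(2) fword_supp[OF u(1) w] show ?thesis by auto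
  qed
  have "{\<mu>. W.Lm \<mu> \<noteq> {0}} \<subseteq> uminus ` D"
  proof clarify
    fix \<mu> assume "W.Lm \<mu> \<noteq> {0}"
    then obtain u where u: "set u \<subseteq> {1..N}" "cont u = - \<mu>" "W.fword u \<noteq> 0"
      unfolding W.Lm_nonzero_iff W_content by blast
    then have "- \<mu> \<in> D" using content[OF u(1,3)] by simp
    then show "\<mu> \<in> uminus ` D" by (metis image_eqI minus_minus)
  qed
  then show ?thesis using finD finite_surj by blast
qed

end

theorem theorem7p6:
  fixes N m :: nat
    and \<chi> :: "weight \<Rightarrow> weight \<Rightarrow> 'k::field_char_0"
    and q :: "nat \<Rightarrow> nat \<Rightarrow> 'k" and qh :: 'k
    and \<Lambda> :: "'k qgroup \<Rightarrow> 'k"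
    and M :: "('k qgroup, 'm) module" and v :: 'm
    and lam :: "nat \<Rightarrow> 'k" and g :: 'k
  assumes "N \<ge> 3" and "2 \<le> m" and "m \<le> N - 1"
    and "bihomomorphism N \<chi>"
    and q_def: "\<And>i j. q i j = \<chi> (\<alpha>\<^sub>s i) (\<alpha>\<^sub>s j)"
    and "qh \<in> K_times_infty" and "qh ^ 2 = q N N"
    and "\<forall>i. 1 \<le> i \<and> i < N - m \<longrightarrow> q i i = qh powi (-2)"
    and "q (N - m) (N - m) = -1"
    and "\<forall>i. N - m < i \<and> i \<le> N \<longrightarrow> q i i = qh ^ 2"
    and "\<forall>i. 1 \<le> i \<and> i \<le> N - 2 \<longrightarrow>
           q i (i + 1) * q (i + 1) i = (if i + 1 \<le> N - m then qh ^ 2 else qh powi (-2))"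
    and "q (N - 2) N * q N (N - 2) = qh powi (-2)"
    and "q (N - 1) N * q N (N - 1) = 1"
    and "\<forall>i j. 1 \<le> i \<and> i < j \<and> j \<le> N \<and> j \<noteq> i + 1 \<and> (i, j) \<noteq> (N - 2, N) \<longrightarrow> q i j * q j i = 1"
    and "\<Lambda> \<in> Ch_U_zero N \<chi>"
    and lam_def: "\<And>i. lam i = \<Lambda> (UK N \<chi> (\<alpha>\<^sub>s i) \<otimes>\<^bsub>U N \<chi>\<^esub> UL N \<chi> (- \<alpha>\<^sub>s i))"
    and g_def: "g = (\<Prod>i = N - m..N - 2. lam i) ^ 2 * lam (N - 1) * lam N"
    and "verma_module N \<chi> \<Lambda> M v"
  shows "finite_dimensional (restrict_scalars (U N \<chi>) (simple_quotient N \<chi> M v)) \<longleftrightarrow>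
    (\<forall>i \<in> {1..N} - {N - m}. \<exists>r::nat. lam i = q i i ^ r) \<and>
    (\<exists>x::nat. g = qh powi (- 4 * int x)) \<and>
    (\<forall>y::nat. y \<le> m - 2 \<and> g = qh powi (- 4 * int y) \<longrightarrow>
       (\<Prod>i = N - m..N - m + y. lam i) = qh powi (- 2 * int y) \<and>
       (\<forall>j. N - m + y + 1 \<le> j \<and> j \<le> N \<longrightarrow> lam j = 1)) \<and>
    (g = qh powi (- 4 * (int m - 1)) \<longrightarrow>
       (\<Prod>i = N - m..N - 1. lam i) = qh powi (- 2 * (int m - 1)))"
proof -
  define \<chi>' where "\<chi>' a b = \<chi> (restr N a) (restr N b)" for a b
  interpret V: verma N \<chi> \<Lambda> M v
    by unfold_locales (rule assms(4) assms(15) assms(18))+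
  have simple: "\<chi>' (\<alpha>\<^sub>s i) (\<alpha>\<^sub>s j) = q i j" if "i \<in> {1..N}" "j \<in> {1..N}" for i j
    unfolding \<chi>'_def q_def restr_id[OF simple_root_in[OF that(1)]] restr_id[OF simple_root_in[OF that(2)]] ..
  interpret D: type_D N m "N - m" \<chi>' qh
  proof
    show "2 \<le> m" "1 \<le> N - m" "N = N - m + m" using assms(1-3) by linarith+
    show "qh \<in> K_times_infty" by (rule assms(6))
    show "\<chi>' (r + s) t = \<chi>' r t * \<chi>' s t" "\<chi>' r (s + t) = \<chi>' r s * \<chi>' r t" "\<chi>' r s \<noteq> 0" for r s t
      by (simp_all add: \<chi>'_def restr_add restr_in V.chi_add)
    show "\<chi>' (\<alpha>\<^sub>s i) (\<alpha>\<^sub>s i) = qh powi - 2" if "1 \<le> i" "i < N - m" for i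
      using that assms(8) simple[of i i] by simp
    show "\<chi>' (\<alpha>\<^sub>s (N - m)) (\<alpha>\<^sub>s (N - m)) = - 1"
      using assms(1-3,9) simple[of "N - m" "N - m"] by simp
    show "\<chi>' (\<alpha>\<^sub>s i) (\<alpha>\<^sub>s i) = qh ^ 2" if "N - m < i" "i \<le> N" for i
      using that assms(10) simple[of i i] by simp
    show "\<chi>' (\<alpha>\<^sub>s i) (\<alpha>\<^sub>s (i + 1)) * \<chi>' (\<alpha>\<^sub>s (i + 1)) (\<alpha>\<^sub>s i) = (if i + 1 \<le> N - m then qh ^ 2 else qh powi - 2)"
      if "1 \<le> i" "i \<le> N - 2" for i
    proof -
      have "i \<in> {1..N}" "i + 1 \<in> {1..N}" using that by auto
      then show ?thesis using assms(11)[rule_format, of i] that simple by metis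
    qed
    have ends: "N \<in> {1..N}" "N - 1 \<in> {1..N}" "N - 2 \<in> {1..N}" using assms(1) by auto
    show "\<chi>' (\<alpha>\<^sub>s (N - 2)) (\<alpha>\<^sub>s N) * \<chi>' (\<alpha>\<^sub>s N) (\<alpha>\<^sub>s (N - 2)) = qh powi - 2"
      "\<chi>' (\<alpha>\<^sub>s (N - 1)) (\<alpha>\<^sub>s N) * \<chi>' (\<alpha>\<^sub>s N) (\<alpha>\<^sub>s (N - 1)) = 1"
      using assms(12,13) unfolding simple[OF ends(1) ends(2)] simple[OF ends(2) ends(1)]
        simple[OF ends(1) ends(3)] simple[OF ends(3) ends(1)] by blast+
    show "\<chi>' (\<alpha>\<^sub>s i) (\<alpha>\<^sub>s j) * \<chi>' (\<alpha>\<^sub>s j) (\<alpha>\<^sub>s i) = 1"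
      if "1 \<le> i" "i < j" "j \<le> N" "j \<noteq> i + 1" "(i, j) \<noteq> (N - 2, N)" for i j
    proof -
      have "i \<in> {1..N}" "j \<in> {1..N}" using that by auto
      then have "\<chi>' (\<alpha>\<^sub>s i) (\<alpha>\<^sub>s j) * \<chi>' (\<alpha>\<^sub>s j) (\<alpha>\<^sub>s i) = q i j * q j i" by (simp only: simple)
      also have "\<dots> = 1" by (rule assms(14)[rule_format]) (intro conjI that)
      finally show ?thesis .
    qed
  qed
  \<comment> \<open>Weights are separated because the form is nondegenerate on the root lattice and
    qh is not a root of unity.\<close>
  interpret S: separated_verma N \<chi> \<Lambda> M v
  proof
    fix \<beta> \<gamma> assume in_lattice: "\<beta> \<in> root_lattice N" "\<gamma> \<in> root_lattice N" and "\<beta> \<noteq> \<gamma>"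
    have ext: "\<chi>' (\<alpha>\<^sub>s i) (- a) = \<chi> (\<alpha>\<^sub>s i) (- a)" "\<chi>' a (\<alpha>\<^sub>s i) = \<chi> a (\<alpha>\<^sub>s i)"
      if "i \<in> {1..N}" "a \<in> root_lattice N" for i a
      using that simple_root_in[OF that(1)] by (simp_all add: \<chi>'_def restr_id root_lattice_minus)
    have "\<exists>i\<in>{1..N}. \<not> (\<chi>' (\<alpha>\<^sub>s i) (- \<beta>) = \<chi>' (\<alpha>\<^sub>s i) (- \<gamma>) \<and> \<chi>' \<beta> (\<alpha>\<^sub>s i) = \<chi>' \<gamma> (\<alpha>\<^sub>s i))"
      using D.chi_separates[OF in_lattice] \<open>\<beta> \<noteq> \<gamma>\<close> by blast
    then obtain i where i: "i \<in> {1..N}" "\<not> (\<chi>' (\<alpha>\<^sub>s i) (- \<beta>) = \<chi>' (\<alpha>\<^sub>s i) (- \<gamma>) \<and> \<chi>' \<beta> (\<alpha>\<^sub>s i) = \<chi>' \<gamma> (\<alpha>\<^sub>s i))"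
      by blast
    from i(2) show "\<exists>i\<in>{1..N}. \<chi> (\<alpha>\<^sub>s i) (- \<beta>) \<noteq> \<chi> (\<alpha>\<^sub>s i) (- \<gamma>) \<or> \<chi> \<beta> (\<alpha>\<^sub>s i) \<noteq> \<chi> \<gamma> (\<alpha>\<^sub>s i)"
      unfolding ext[OF i(1) in_lattice(1)] ext[OF i(1) in_lattice(2)] using i(1) by blast
  qed
  have chir: "S.chir = \<chi>'" by (intro ext) (simp add: S.chir_def \<chi>'_def)
  have lam: "S.lamv i = lam i" if "i \<in> {1..N}" for i
    unfolding S.lamv_def lam_def V.lam_eq[OF that] ..
  have n: "1 \<le> N - m" "N - m \<le> N" using assms(1-3) by linarith+
  have q: "\<chi>' (\<alpha>\<^sub>s i) (\<alpha>\<^sub>s i) = q i i" if "i \<in> {1..N}" for i by (rule simple[OF that that])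
  have prod: "(\<Prod>i = N - m..k. S.lamv i) = (\<Prod>i = N - m..k. lam i)" if "k \<le> N" for k
    by (rule prod.cong) (use that n(1) lam in auto)
  have "finite_dimensional S.Lq \<longleftrightarrow> finite {\<mu>. S.W.Lm \<mu> \<noteq> {0}}"
    using S.finite_dimensional_if S.finite_dimensional_only_if by blast
  also have "\<dots> \<longleftrightarrow> (\<forall>i \<in> {1..N} - {N - m}. \<exists>r::nat. S.lamv i = \<chi>' (\<alpha>\<^sub>s i) (\<alpha>\<^sub>s i) ^ r) \<and>
      D.conditions S.lamv ((\<Prod>i = N - m..N - 2. S.lamv i) ^ 2 * S.lamv (N - 1) * S.lamv N)"
    using D.finite_weights_iff[OF S.W.qsys_model[unfolded chir]] unfolding chir .
  also have "(\<Prod>i = N - m..N - 2. S.lamv i) ^ 2 * S.lamv (N - 1) * S.lamv N = g"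
    unfolding g_def using prod[of "N - 2"] lam[of "N - 1"] lam[of N] assms(1) by simp
  also have "(\<forall>i \<in> {1..N} - {N - m}. \<exists>r::nat. S.lamv i = \<chi>' (\<alpha>\<^sub>s i) (\<alpha>\<^sub>s i) ^ r) \<longleftrightarrow>
      (\<forall>i \<in> {1..N} - {N - m}. \<exists>r::nat. lam i = q i i ^ r)"
    by (rule ball_cong) (use lam q in auto)
  \<comment> \<open>The two families are known to agree only on the indices 1, ..., N, so every
    product and every index in the conditions has to be kept in this range.\<close>
  also have "D.conditions S.lamv g = D.conditions lam g"
  proof -
    have 1: "(\<Prod>i = N - m..N - m + y. S.lamv i) = (\<Prod>i = N - m..N - m + y. lam i)" if "y \<le> m - 2" for y
      by (rule prod) (use that assms(1-3) in linarith)
    have 2: "(\<Prod>i = N - m..N - 1. S.lamv i) = (\<Prod>i = N - m..N - 1. lam i)"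
      by (rule prod) simp
    have 3: "S.lamv j = lam j" if "N - m + y + 1 \<le> j \<and> j \<le> N" for j y
      using that by (intro lam) simp
    show ?thesis
      unfolding D.conditions_def 2
    proof (intro arg_cong2[of _ _ _ _ "(\<and>)"] refl all_cong1)
      fix y
      show "(y \<le> m - 2 \<and> g = qh powi (- 4 * int y) \<longrightarrow>
          (\<Prod>i = N - m..N - m + y. S.lamv i) = qh powi (- 2 * int y) \<and>
          (\<forall>j. N - m + y + 1 \<le> j \<and> j \<le> N \<longrightarrow> S.lamv j = 1)) \<longleftrightarrow>
        (y \<le> m - 2 \<and> g = qh powi (- 4 * int y) \<longrightarrow>
          (\<Prod>i = N - m..N - m + y. lam i) = qh powi (- 2 * int y) \<and>
          (\<forall>j. N - m + y + 1 \<le> j \<and> j \<le> N \<longrightarrow> lam j = 1))"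
        using 1[of y] 3[of y] by (cases "y \<le> m - 2") (simp_all only: simp_thms, metis)
    qed
  qed
  finally show ?thesis unfolding D.conditions_def .
qed

end
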